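(* Let $K$ be a commutative ring and let $A$ be a $K$-algebra which is projective as a $K$-module. Let $M$ be a projective $A$-module, assumed finitely generated unless $K$ is semisimple, let $B=(\mathrm{End}_AM)^o$ (so that $M$ is an $A\otimes B^o$-module), and let $m\geq 1$ be an integer. Then there is a split short exact sequence of graded $K$-modules $$0\longrightarrow(HH^{*-1}B)^{m^2-1}\longrightarrow HH^*\begin{pmatrix}A&M^m\\0&B\end{pmatrix}\xrightarrow{\ r^*\ }HH^*A\longrightarrow 0$$ in which $r^*$ is a morphism of algebras.
   Context: $\otimes=\otimes_K$; algebras are associative unital $K$-algebras, modules are unital left modules, $T^o$ is the opposite algebra of $T$. For an $A\otimes B^o$-module $N$, $\begin{pmatrix}A&N\\0&B\end{pmatrix}$ is the triangular matrix algebra with product $\begin{pmatrix}a&n\\0&b\end{pmatrix}\begin{pmatrix}a'&n'\\0&b'\end{pmatrix}=\begin{pmatrix}aa'&an'+nb'\\0&bb'\end{pmatrix}$. $HH^*T=H^*(T,T)$ is the Hochschild cohomology of $T$ over $K$, a graded algebra for the cup (Yoneda) product, and $HH^{-1}=0$. *)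

theory Defs
  imports "HOL-Algebra.Module" "HOL-Algebra.Ideal"
begin

section \<open>Modules and algebras\<close>

text \<open>The library locales \<^locale>\<open>module\<close> and \<^locale>\<open>algebra\<close> require commutative
  scalars, respectively a commutative algebra, so the non-commutative versions are given here.
  As in the library, a module is a record of type \<^typ>\<open>('r, 'm) module\<close> whose fields
  \<^const>\<open>mult\<close> and \<^const>\<open>one\<close> carry no meaning.\<close>

locale left_module = R?: ring R + M?: abelian_group M
  for R :: "('r, 'c) ring_scheme" (structure) and M :: "('r, 'm, 'd) module_scheme" (structure) +
  assumes smult_closed:
      "\<lbrakk>a \<in> carrier R; x \<in> carrier M\<rbrakk> \<Longrightarrow> a \<odot>\<^bsub>M\<^esub> x \<in> carrier M"
    and smult_l_distr:
      "\<lbrakk>a \<in> carrier R; b \<in> carrier R; x \<in> carrier M\<rbrakk> \<Longrightarrow>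
        (a \<oplus> b) \<odot>\<^bsub>M\<^esub> x = a \<odot>\<^bsub>M\<^esub> x \<oplus>\<^bsub>M\<^esub> b \<odot>\<^bsub>M\<^esub> x"
    and smult_r_distr:
      "\<lbrakk>a \<in> carrier R; x \<in> carrier M; y \<in> carrier M\<rbrakk> \<Longrightarrow>
        a \<odot>\<^bsub>M\<^esub> (x \<oplus>\<^bsub>M\<^esub> y) = a \<odot>\<^bsub>M\<^esub> x \<oplus>\<^bsub>M\<^esub> a \<odot>\<^bsub>M\<^esub> y"
    and smult_assoc1:
      "\<lbrakk>a \<in> carrier R; b \<in> carrier R; x \<in> carrier M\<rbrakk> \<Longrightarrow>
        (a \<otimes> b) \<odot>\<^bsub>M\<^esub> x = a \<odot>\<^bsub>M\<^esub> (b \<odot>\<^bsub>M\<^esub> x)"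
    and smult_one: "x \<in> carrier M \<Longrightarrow> \<one> \<odot>\<^bsub>M\<^esub> x = x"

locale assoc_algebra = module K A + A?: ring A
  for K :: "('k, 'c) ring_scheme" (structure) and A :: "('k, 'a, 'd) module_scheme" (structure) +
  assumes smult_mult_left:
      "\<lbrakk>k \<in> carrier K; x \<in> carrier A; y \<in> carrier A\<rbrakk> \<Longrightarrow>
        (k \<odot>\<^bsub>A\<^esub> x) \<otimes>\<^bsub>A\<^esub> y = k \<odot>\<^bsub>A\<^esub> (x \<otimes>\<^bsub>A\<^esub> y)"
    and smult_mult_right:
      "\<lbrakk>k \<in> carrier K; x \<in> carrier A; y \<in> carrier A\<rbrakk> \<Longrightarrow>
        x \<otimes>\<^bsub>A\<^esub> (k \<odot>\<^bsub>A\<^esub> y) = k \<odot>\<^bsub>A\<^esub> (x \<otimes>\<^bsub>A\<^esub> y)"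

definition linear_maps ::
    "('r, 'c) ring_scheme \<Rightarrow> ('r, 'm, 'd) module_scheme \<Rightarrow> ('r, 'n, 'e) module_scheme \<Rightarrow>
      ('m \<Rightarrow> 'n) set" where
  "linear_maps R M N =
    {f \<in> carrier M \<rightarrow> carrier N.
      (\<forall>x\<in>carrier M. \<forall>y\<in>carrier M. f (x \<oplus>\<^bsub>M\<^esub> y) = f x \<oplus>\<^bsub>N\<^esub> f y) \<and>
      (\<forall>a\<in>carrier R. \<forall>x\<in>carrier M. f (a \<odot>\<^bsub>M\<^esub> x) = a \<odot>\<^bsub>N\<^esub> f x)}"

definition free_module :: "('r, 'c) ring_scheme \<Rightarrow> 'i set \<Rightarrow> ('r, 'i \<Rightarrow> 'r) module" where
  "free_module R I =
    \<lparr>carrier = {f \<in> I \<rightarrow>\<^sub>E carrier R. finite {i \<in> I. f i \<noteq> \<zero>\<^bsub>R\<^esub>}},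
     mult = undefined, one = undefined,
     zero = (\<lambda>i\<in>I. \<zero>\<^bsub>R\<^esub>), add = (\<lambda>f g. \<lambda>i\<in>I. f i \<oplus>\<^bsub>R\<^esub> g i),
     smult = (\<lambda>a f. \<lambda>i\<in>I. a \<otimes>\<^bsub>R\<^esub> f i)\<rparr>"

text \<open>Projective means: direct summand of a free module. It is enough to consider index sets
  inside the type of the module, because a projective module is a direct summand of the free
  module on its own carrier.\<close>

definition projective_module ::
    "('r, 'c) ring_scheme \<Rightarrow> ('r, 'm, 'd) module_scheme \<Rightarrow> bool" where
  "projective_module R P \<longleftrightarrow> left_module R P \<and>
    (\<exists>I :: 'm set. \<exists>u \<in> linear_maps R P (free_module R I).
      \<exists>v \<in> linear_maps R (free_module R I) P. \<forall>x\<in>carrier P. v (u x) = x)"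

definition finitely_generated_module ::
    "('r, 'c) ring_scheme \<Rightarrow> ('r, 'm, 'd) module_scheme \<Rightarrow> bool" where
  "finitely_generated_module R M \<longleftrightarrow>
    (\<exists>S \<subseteq> carrier M. finite S \<and>
      (\<forall>x\<in>carrier M. \<exists>c \<in> S \<rightarrow> carrier R. x = (\<Oplus>\<^bsub>M\<^esub>s\<in>S. c s \<odot>\<^bsub>M\<^esub> s)))"

text \<open>A commutative ring is semisimple if it is a semisimple module over itself, that is, if
  every ideal is a direct summand.\<close>

definition semisimple_cring :: "('k, 'c) ring_scheme \<Rightarrow> bool" where
  "semisimple_cring K \<longleftrightarrow> cring K \<and>
    (\<forall>I. ideal I K \<longrightarrow>
      (\<exists>J. ideal J K \<and> I \<inter> J = {\<zero>\<^bsub>K\<^esub>} \<and> I <+>\<^bsub>K\<^esub> J = carrier K))"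

definition module_power :: "nat \<Rightarrow> ('r, 'm, 'd) module_scheme \<Rightarrow> ('r, nat \<Rightarrow> 'm) module" where
  "module_power n M =
    \<lparr>carrier = {..<n} \<rightarrow>\<^sub>E carrier M, mult = undefined, one = undefined,
     zero = (\<lambda>i\<in>{..<n}. \<zero>\<^bsub>M\<^esub>), add = (\<lambda>x y. \<lambda>i\<in>{..<n}. x i \<oplus>\<^bsub>M\<^esub> y i),
     smult = (\<lambda>a x. \<lambda>i\<in>{..<n}. a \<odot>\<^bsub>M\<^esub> x i)\<rparr>"

definition zero_module :: "('r, 'm) module" where
  "zero_module =
    \<lparr>carrier = {undefined}, mult = undefined, one = undefined,
     zero = undefined, add = (\<lambda>_ _. undefined), smult = (\<lambda>_ _. undefined)\<rparr>"

text \<open>The quotient by a submodule \<open>S\<close>; its elements are the cosets of \<open>S\<close>.\<close>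

definition quotient_module ::
    "('r, 'm, 'd) module_scheme \<Rightarrow> 'm set \<Rightarrow> ('r, 'm set) module" where
  "quotient_module M S =
    \<lparr>carrier = a_rcosets\<^bsub>M\<^esub> S, mult = undefined, one = undefined,
     zero = S, add = set_add M,
     smult = (\<lambda>a X. \<Union>x\<in>X. S +>\<^bsub>M\<^esub> (a \<odot>\<^bsub>M\<^esub> x))\<rparr>"

definition opposite_algebra :: "('k, 'a) module \<Rightarrow> ('k, 'a) module" where
  "opposite_algebra A = A\<lparr>mult := (\<lambda>x y. y \<otimes>\<^bsub>A\<^esub> x)\<rparr>"

text \<open>\<open>End\<^sub>A M\<close> as an algebra over \<open>K\<close>; its elements are extensional functions on the carrier of
  \<open>M\<close>, and \<open>K\<close> acts on an \<open>A\<close>-module through \<open>k \<mapsto> k \<cdot> 1\<^sub>A\<close>.\<close>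

definition endomorphism_algebra ::
    "('k, 'a) module \<Rightarrow> ('a, 'm) module \<Rightarrow> ('k, 'm \<Rightarrow> 'm) module" where
  "endomorphism_algebra A M =
    \<lparr>carrier = linear_maps A M M \<inter> extensional (carrier M),
     mult = (\<lambda>f g. compose (carrier M) f g), one = (\<lambda>x\<in>carrier M. x),
     zero = (\<lambda>x\<in>carrier M. \<zero>\<^bsub>M\<^esub>), add = (\<lambda>f g. \<lambda>x\<in>carrier M. f x \<oplus>\<^bsub>M\<^esub> g x),
     smult = (\<lambda>k f. \<lambda>x\<in>carrier M. (k \<odot>\<^bsub>A\<^esub> \<one>\<^bsub>A\<^esub>) \<odot>\<^bsub>M\<^esub> f x)\<rparr>"


section \<open>Bimodules and triangular matrix algebras\<close>

text \<open>A left module over the tensor product of \<open>A\<close> with the opposite of \<open>B\<close> is encoded as a left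
  \<open>A\<close>-module with an additional commuting right action of \<open>B\<close>.\<close>

record ('a, 'n, 'b) bimodule = "('a, 'n) module" +
  ract :: "'n \<Rightarrow> 'b \<Rightarrow> 'n"

text \<open>\<open>M\<close> as a bimodule over \<open>A\<close> and \<open>B = (End\<^sub>A M)\<^sup>o\<close>, with right action \<open>x \<cdot> f = f x\<close>.\<close>

definition endo_bimodule :: "('a, 'm) module \<Rightarrow> ('a, 'm, 'm \<Rightarrow> 'm) bimodule" where
  "endo_bimodule M = module.extend M \<lparr>ract = (\<lambda>x f. f x)\<rparr>"

definition bimodule_power :: "nat \<Rightarrow> ('a, 'm, 'b) bimodule \<Rightarrow> ('a, nat \<Rightarrow> 'm, 'b) bimodule" where
  "bimodule_power n M =
    module.extend (module_power n M) \<lparr>ract = (\<lambda>x b. \<lambda>i\<in>{..<n}. ract M (x i) b)\<rparr>"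

text \<open>The triple \<open>(a, n, b)\<close> stands for the matrix with rows \<open>(a n)\<close> and \<open>(0 b)\<close>.\<close>

definition triangular_algebra ::
    "('k, 'a) module \<Rightarrow> ('a, 'n, 'b) bimodule \<Rightarrow> ('k, 'b) module \<Rightarrow>
      ('k, 'a \<times> 'n \<times> 'b) module" where
  "triangular_algebra A N B =
    \<lparr>carrier = carrier A \<times> carrier N \<times> carrier B,
     mult = (\<lambda>(a, n, b) (a', n', b').
       (a \<otimes>\<^bsub>A\<^esub> a', (a \<odot>\<^bsub>N\<^esub> n') \<oplus>\<^bsub>N\<^esub> ract N n b', b \<otimes>\<^bsub>B\<^esub> b')),
     one = (\<one>\<^bsub>A\<^esub>, \<zero>\<^bsub>N\<^esub>, \<one>\<^bsub>B\<^esub>),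
     zero = (\<zero>\<^bsub>A\<^esub>, \<zero>\<^bsub>N\<^esub>, \<zero>\<^bsub>B\<^esub>),
     add = (\<lambda>(a, n, b) (a', n', b'). (a \<oplus>\<^bsub>A\<^esub> a', n \<oplus>\<^bsub>N\<^esub> n', b \<oplus>\<^bsub>B\<^esub> b')),
     smult = (\<lambda>k (a, n, b). (k \<odot>\<^bsub>A\<^esub> a, (k \<odot>\<^bsub>A\<^esub> \<one>\<^bsub>A\<^esub>) \<odot>\<^bsub>N\<^esub> n, k \<odot>\<^bsub>B\<^esub> b))\<rparr>"


section \<open>Hochschild cohomology\<close>

definition tuples :: "('k, 't) module \<Rightarrow> nat \<Rightarrow> 't list set" where
  "tuples T n = {xs. length xs = n \<and> set xs \<subseteq> carrier T}"

text \<open>Cochains of degree \<open>n\<close>: the \<open>K\<close>-multilinear maps in \<open>n\<close> variables from \<open>T\<close> to \<open>T\<close>, that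
  is, the \<open>K\<close>-linear maps from the \<open>n\<close>-th tensor power of \<open>T\<close> to \<open>T\<close>.\<close>

definition cochains :: "('k, 'c) ring_scheme \<Rightarrow> ('k, 't) module \<Rightarrow> nat \<Rightarrow> ('t list \<Rightarrow> 't) set" where
  "cochains K T n =
    {f \<in> tuples T n \<rightarrow>\<^sub>E carrier T.
      \<forall>xs\<in>tuples T n. \<forall>i<n.
        (\<forall>x\<in>carrier T. \<forall>y\<in>carrier T.
          f (xs[i := x \<oplus>\<^bsub>T\<^esub> y]) = f (xs[i := x]) \<oplus>\<^bsub>T\<^esub> f (xs[i := y])) \<and>
        (\<forall>k\<in>carrier K. \<forall>x\<in>carrier T.
          f (xs[i := k \<odot>\<^bsub>T\<^esub> x]) = k \<odot>\<^bsub>T\<^esub> f (xs[i := x]))}"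

definition cochain_module ::
    "('k, 'c) ring_scheme \<Rightarrow> ('k, 't) module \<Rightarrow> nat \<Rightarrow> ('k, 't list \<Rightarrow> 't) module" where
  "cochain_module K T n =
    \<lparr>carrier = cochains K T n, mult = undefined, one = undefined,
     zero = (\<lambda>xs\<in>tuples T n. \<zero>\<^bsub>T\<^esub>),
     add = (\<lambda>f g. \<lambda>xs\<in>tuples T n. f xs \<oplus>\<^bsub>T\<^esub> g xs),
     smult = (\<lambda>k f. \<lambda>xs\<in>tuples T n. k \<odot>\<^bsub>T\<^esub> f xs)\<rparr>"

definition alt_sign :: "('k, 't) module \<Rightarrow> nat \<Rightarrow> 't \<Rightarrow> 't" where
  "alt_sign T j x = (if even j then x else \<ominus>\<^bsub>T\<^esub> x)"

text \<open>Multiply the adjacent entries at positions \<open>i\<close> and \<open>i + 1\<close> (counted from zero).\<close>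

definition contract :: "('k, 't) module \<Rightarrow> nat \<Rightarrow> 't list \<Rightarrow> 't list" where
  "contract T i xs = take i xs @ (xs ! i \<otimes>\<^bsub>T\<^esub> xs ! Suc i) # drop (Suc (Suc i)) xs"

text \<open>\<open>(\<delta> f)(x\<^sub>0, \<dots>, x\<^sub>n) = x\<^sub>0 f(x\<^sub>1, \<dots>, x\<^sub>n)
    + (\<Sum>i<n. (-1)\<^bsup>i+1\<^esup> f(\<dots>, x\<^sub>i x\<^bsub>i+1\<^esub>, \<dots>)) + (-1)\<^bsup>n+1\<^esup> f(x\<^sub>0, \<dots>, x\<^bsub>n-1\<^esub>) x\<^sub>n\<close>\<close>

definition hochschild_d :: "('k, 't) module \<Rightarrow> nat \<Rightarrow> ('t list \<Rightarrow> 't) \<Rightarrow> 't list \<Rightarrow> 't" where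
  "hochschild_d T n f =
    (\<lambda>xs\<in>tuples T (Suc n).
      hd xs \<otimes>\<^bsub>T\<^esub> f (tl xs)
      \<oplus>\<^bsub>T\<^esub> (\<Oplus>\<^bsub>T\<^esub>i\<in>{..<n}. alt_sign T (Suc i) (f (contract T i xs)))
      \<oplus>\<^bsub>T\<^esub> alt_sign T (Suc n) (f (butlast xs) \<otimes>\<^bsub>T\<^esub> last xs))"

definition cocycle_module ::
    "('k, 'c) ring_scheme \<Rightarrow> ('k, 't) module \<Rightarrow> nat \<Rightarrow> ('k, 't list \<Rightarrow> 't) module" where
  "cocycle_module K T n = (cochain_module K T n)
    \<lparr>carrier :=
      {f \<in> cochains K T n. hochschild_d T n f = \<zero>\<^bsub>cochain_module K T (Suc n)\<^esub>}\<rparr>"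

definition coboundaries ::
    "('k, 'c) ring_scheme \<Rightarrow> ('k, 't) module \<Rightarrow> nat \<Rightarrow> ('t list \<Rightarrow> 't) set" where
  "coboundaries K T n =
    (case n of 0 \<Rightarrow> {\<zero>\<^bsub>cochain_module K T 0\<^esub>}
     | Suc p \<Rightarrow> hochschild_d T p ` cochains K T p)"

text \<open>The graded module \<open>HH\<^sup>*T = H\<^sup>*(T, T)\<close> is the family \<open>n \<mapsto> HH K T n\<close>.\<close>

definition HH ::
    "('k, 'c) ring_scheme \<Rightarrow> ('k, 't) module \<Rightarrow> nat \<Rightarrow> ('k, ('t list \<Rightarrow> 't) set) module" where
  "HH K T n = quotient_module (cocycle_module K T n) (coboundaries K T n)"

definition cochain_cup ::
    "('k, 't) module \<Rightarrow> nat \<Rightarrow> nat \<Rightarrow> ('t list \<Rightarrow> 't) \<Rightarrow> ('t list \<Rightarrow> 't) \<Rightarrow> 't list \<Rightarrow> 't" where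
  "cochain_cup T p q f g =
    (\<lambda>xs\<in>tuples T (p + q). f (take p xs) \<otimes>\<^bsub>T\<^esub> g (drop p xs))"

definition HH_cup ::
    "('k, 'c) ring_scheme \<Rightarrow> ('k, 't) module \<Rightarrow> nat \<Rightarrow> nat \<Rightarrow>
      ('t list \<Rightarrow> 't) set \<Rightarrow> ('t list \<Rightarrow> 't) set \<Rightarrow> ('t list \<Rightarrow> 't) set" where
  "HH_cup K T p q X Y =
    (\<Union>f\<in>X. \<Union>g\<in>Y.
      coboundaries K T (p + q) +>\<^bsub>cocycle_module K T (p + q)\<^esub> cochain_cup T p q f g)"

definition HH_one :: "('k, 'c) ring_scheme \<Rightarrow> ('k, 't) module \<Rightarrow> ('t list \<Rightarrow> 't) set" where
  "HH_one K T =
    coboundaries K T 0 +>\<^bsub>cocycle_module K T 0\<^esub> (\<lambda>xs\<in>tuples T 0. \<one>\<^bsub>T\<^esub>)"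


section \<open>Graded modules and their morphisms\<close>

text \<open>A graded module is a family of modules indexed by the degree \<open>n \<ge> 0\<close>. The shift turns
  \<open>X\<^sup>*\<close> into \<open>X\<^bsup>*-1\<^esup>\<close>, with \<open>X\<^bsup>-1\<^esup> = 0\<close>.\<close>

definition degree_shift :: "(nat \<Rightarrow> ('k, 'x) module) \<Rightarrow> nat \<Rightarrow> ('k, 'x) module" where
  "degree_shift X n = (case n of 0 \<Rightarrow> zero_module | Suc p \<Rightarrow> X p)"

text \<open>\<open>0 \<rightarrow> X \<rightarrow> Y \<rightarrow> Z \<rightarrow> 0\<close> with maps \<open>i\<close> and \<open>r\<close> of degree zero.\<close>

definition graded_split_short_exact ::
    "('k, 'c) ring_scheme \<Rightarrow> (nat \<Rightarrow> ('k, 'x) module) \<Rightarrow> (nat \<Rightarrow> ('k, 'y) module) \<Rightarrow>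
      (nat \<Rightarrow> ('k, 'z) module) \<Rightarrow> (nat \<Rightarrow> 'x \<Rightarrow> 'y) \<Rightarrow> (nat \<Rightarrow> 'y \<Rightarrow> 'z) \<Rightarrow> bool" where
  "graded_split_short_exact K X Y Z i r \<longleftrightarrow>
    (\<forall>n. i n \<in> linear_maps K (X n) (Y n) \<and> r n \<in> linear_maps K (Y n) (Z n) \<and>
      inj_on (i n) (carrier (X n)) \<and>
      i n ` carrier (X n) = a_kernel (Y n) (Z n) (r n) \<and>
      r n ` carrier (Y n) = carrier (Z n) \<and>
      (\<exists>s \<in> linear_maps K (Z n) (Y n). \<forall>z\<in>carrier (Z n). r n (s z) = z))"

definition HH_algebra_morphism ::
    "('k, 'c) ring_scheme \<Rightarrow> ('k, 's) module \<Rightarrow> ('k, 't) module \<Rightarrow>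
      (nat \<Rightarrow> ('s list \<Rightarrow> 's) set \<Rightarrow> ('t list \<Rightarrow> 't) set) \<Rightarrow> bool" where
  "HH_algebra_morphism K S T r \<longleftrightarrow>
    (\<forall>n. r n \<in> linear_maps K (HH K S n) (HH K T n)) \<and>
    r 0 (HH_one K S) = HH_one K T \<and>
    (\<forall>p q. \<forall>x\<in>carrier (HH K S p). \<forall>y\<in>carrier (HH K S q).
      r (p + q) (HH_cup K S p q x y) = HH_cup K T p q (r p x) (r q y))"

end

theory Submission
  imports Defs
begin

text \<open>Let \<open>e\<^sub>1\<close>, \<open>e\<^sub>2\<close> be the diagonal idempotents of the triangular algebra \<open>T\<close> and \<open>N = e\<^sub>1Te\<^sub>2 = M\<^sup>m\<close>.
 Inserting \<open>1 = e\<^sub>1 + e\<^sub>2\<close> between all entries shows that a cochain of \<open>T\<close> is homotopic to its restriction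
 to the sequences of entries that run from \<open>A\<close> through at most one element of \<open>N\<close> to \<open>B\<close>. As \<open>M\<close> has a
 dual basis over \<open>A\<close>, the entries from \<open>A\<close> before the crossing can be contracted, so that the crossing
 part becomes a complex of cochains of \<open>B\<close> with values in the endomorphisms of the \<open>A\<close>-module \<open>N\<close>, that
 is, in the \<open>m \<times> m\<close> matrices over \<open>B\<close>, with degree shifted by one. The component in \<open>B\<close> of a cochain
 enters its differential through the scalar matrices. The entry at \<open>(0, 0)\<close> is a retraction \<open>\<kappa>\<close> onto
 the scalar matrices, and it cancels the cochains of \<open>B\<close> against them. There remain the cochains of
 \<open>A\<close> and those of \<open>B\<close> with values in the other \<open>m\<^sup>2 - 1\<close> entries. The section of the restriction to \<open>A\<close>
 transports a cochain of \<open>A\<close> along the dual basis, its component in \<open>B\<close> being read off by \<open>\<kappa>\<close>.\<close>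

section \<open>The inner bar differential\<close>

text \<open>Every comparison is an explicit cochain homotopy, collected in one formula \<open>f = Qc
  f + Dc f + \<delta> (Hc f + Kc f) + (Hc + Kc) (\<delta> f)\<close>; the linear section comes from
  \<open>Qc\<close>, the description of the kernel from \<open>Dc\<close>. Two devices carry it.
  Bordered as \<open>y f(xs) z\<close>, a cochain has a differential made of products of neighbours
  only, without outer terms. And one homotopy, built from coordinates that respect the left action
  alone, serves twice: with the coordinates \<open>t e1\<close>, \<open>t e2\<close> it inserts the
  idempotents, with a dual basis it contracts the entries from \<open>A\<close>. The obstacle is
  that a cochain assembled from a crossing part and the value of \<open>\<kappa>\<close> on it has a
  differential with an extra term, the deviation of the crossing part from a scalar matrix. For
  \<open>Qc\<close> the deviation is zero, because the expansion along the dual basis commutes with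
  the matrix units of \<open>M^m\<close>; so \<open>Qc\<close> commutes with
  \<open>\<delta>\<close>, and it depends only on the restriction to \<open>A\<close>. For the
  homotopy \<open>Kc\<close> it is in general not zero, and it is exactly \<open>Dc\<close>. Its
  \<open>m^2 - 1\<close> components are the matrix entries that \<open>\<kappa>\<close> does not
  read.\<close>

text \<open>The alternating sum over the contractions of two neighbouring entries. The Hochschild differential
 of \<open>f\<close> is obtained from it by bordering the list of arguments with units, see \<open>sandwich\<close>.\<close>

fun bar :: "('s, 'c) ring_scheme => ('g, 'd) ring_scheme => ('s list => 'g) => 's list => 'g" where
  "bar S G H (x # y # zs) =
   H ((x \<otimes>\<^bsub>S\<^esub> y) # zs) \<ominus>\<^bsub>G\<^esub> bar S G (\<lambda>l. H (x # l)) (y # zs)"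
| "bar S G H [x] = \<zero>\<^bsub>G\<^esub>"
| "bar S G H [] = \<zero>\<^bsub>G\<^esub>"

lemma tuples_0 [simp]: "tuples S 0 = {[]}"
  by (auto simp: tuples_def)

lemma Cons_in_tuples [simp]: "x # l \<in> tuples S (Suc n) \<longleftrightarrow> x \<in> carrier S \<and> l \<in> tuples S n"
  by (auto simp: tuples_def)

lemma in_tuples_Suc: "l \<in> tuples S (Suc n) \<longleftrightarrow> (\<exists>x xs. l = x # xs \<and> x \<in> carrier S \<and> xs \<in> tuples S n)"
  by (cases l) (auto simp: tuples_def)

lemma tuples_appendI: "l \<in> tuples S p ==> l' \<in> tuples S q ==> l @ l' \<in> tuples S (p + q)"
  by (auto simp: tuples_def)

lemma tuples_snocI: "l \<in> tuples S n ==> z \<in> carrier S ==> l @ [z] \<in> tuples S (Suc n)"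
  by (auto simp: tuples_def)

lemma in_tuples_Suc_Suc:
  "l \<in> tuples S (Suc (Suc n)) \<longleftrightarrow>
   (\<exists>x xs z. l = x # xs @ [z] \<and> x \<in> carrier S \<and> z \<in> carrier S \<and> xs \<in> tuples S n)"
proof
  assume l: "l \<in> tuples S (Suc (Suc n))"
  then obtain x ys where l': "l = x # ys" "x \<in> carrier S" "ys \<in> tuples S (Suc n)"
   by (auto simp: in_tuples_Suc)
  then have "ys = butlast ys @ [last ys]"
   by (cases ys rule: rev_cases) (auto simp: tuples_def)
  moreover have "butlast ys \<in> tuples S n" "last ys \<in> carrier S"
   using l'(3) by (cases ys rule: rev_cases; auto simp: tuples_def)+
  ultimately show "\<exists>x xs z. l = x # xs @ [z] \<and> x \<in> carrier S \<and> z \<in> carrier S \<and> xs \<in> tuples S n"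
   using l' by blast
qed (auto intro: tuples_snocI)

text \<open>Only products of neighbours enter \<open>bar\<close>, so a multiplicative map on the
  entries, unital or not, passes through it. It is applied to the corner projections of
  \<open>T\<close> and to the maps between \<open>T\<close>, \<open>A\<close> and
  \<open>B\<close>.\<close>

lemma bar_map:
  assumes "\<And>x y. x \<in> carrier S ==> y \<in> carrier S ==>
    \<alpha> (x \<otimes>\<^bsub>S\<^esub> y) = \<alpha> x \<otimes>\<^bsub>S'\<^esub> \<alpha> y"
   and "l \<in> tuples S n"
  shows "bar S' G H (map \<alpha> l) = bar S G (\<lambda>l. H (map \<alpha> l)) l"
  using assms(2)
proof (induction l arbitrary: H n)
  case (Cons x l)
  show ?case
  proof (cases l)
   case (Cons y zs)
   have "x \<in> carrier S" "y \<in> carrier S" "l \<in> tuples S (length l)"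
    using Cons.prems Cons by (auto simp: tuples_def)
   then show ?thesis
    using Cons.IH[of "length l" "\<lambda>l. H (\<alpha> x # l)"] assms(1) by (simp add: Cons)
  qed simp
qed simp

lemma (in abelian_group) a_inv_zero [simp]: "\<ominus> \<zero> = \<zero>"
  by (metis minus_equality l_zero zero_closed)

locale bar_context = S?: ring S + G: abelian_group G
  for S :: "('k, 's) module" (structure) and G :: "('g, 'd) ring_scheme" (structure)
begin

lemma abelian_group_G: "abelian_group G"
  by unfold_locales


lemma bar_closed:
  assumes "H \<in> tuples S n \<rightarrow> carrier G" "l \<in> tuples S (Suc n)"
  shows "bar S G H l \<in> carrier G"
  using assms
proof (induction l arbitrary: n H)
  case (Cons x l)
  show ?case
  proof (cases l)
   case (Cons y zs)
   then obtain n' where n': "n = Suc n'" using Cons.prems by (cases n) auto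
   have "bar S G (\<lambda>l. H (x # l)) l \<in> carrier G"
    using Cons.prems n' by (intro Cons.IH[of _ n']) (auto simp: Pi_def)
   then show ?thesis
    using Cons.prems n' by (simp add: Cons Pi_def)
  qed simp
qed simp

lemma bar_cong:
  assumes "\<And>l. l \<in> tuples S n ==> H l = \<psi> l" "l \<in> tuples S (Suc n)"
  shows "bar S G H l = bar S G \<psi> l"
  using assms
proof (induction l arbitrary: n H \<psi>)
  case (Cons x l)
  show ?case
  proof (cases l)
   case (Cons y zs)
   then obtain n' where n': "n = Suc n'" using Cons.prems by (cases n) auto
   have "bar S G (\<lambda>l. H (x # l)) l = bar S G (\<lambda>l. \<psi> (x # l)) l"
    using Cons.prems n' by (intro Cons.IH[of n']) auto
   then show ?thesis
    using Cons.prems n' by (simp add: Cons)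
  qed simp
qed simp

lemma bar_add:
  assumes "H \<in> tuples S n \<rightarrow> carrier G" "\<psi> \<in> tuples S n \<rightarrow> carrier G" "l \<in> tuples S (Suc n)"
  shows "bar S G (\<lambda>l. H l \<oplus>\<^bsub>G\<^esub> \<psi> l) l = bar S G H l \<oplus>\<^bsub>G\<^esub> bar S G \<psi> l"
  using assms
proof (induction l arbitrary: n H \<psi>)
  case (Cons x l)
  show ?case
  proof (cases l)
   case (Cons y zs)
   then obtain n' where n': "n = Suc n'" using Cons.prems by (cases n) auto
   have "bar S G (\<lambda>l. H (x # l) \<oplus>\<^bsub>G\<^esub> \<psi> (x # l)) l =
     bar S G (\<lambda>l. H (x # l)) l \<oplus>\<^bsub>G\<^esub> bar S G (\<lambda>l. \<psi> (x # l)) l"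
    using Cons.prems n' by (intro Cons.IH[of _ n']) (auto simp: Pi_def)
   moreover have "bar S G (\<lambda>l. H (x # l)) l \<in> carrier G" "bar S G (\<lambda>l. \<psi> (x # l)) l \<in> carrier G"
    using Cons.prems n' by (intro bar_closed[of _ n']; auto simp: Pi_def)+
   ultimately show ?thesis
    using Cons.prems n' by (simp add: Cons Pi_def G.minus_eq G.minus_add G.a_ac)
  qed simp
qed simp

lemma bar_hom:
  assumes h: "h \<in> carrier G \<rightarrow> carrier G'" "\<And>x y. x \<in> carrier G ==> y \<in> carrier G ==>
    h (x \<oplus>\<^bsub>G\<^esub> y) = h x \<oplus>\<^bsub>G'\<^esub> h y"
   and G': "abelian_group G'"
   and "H \<in> tuples S n \<rightarrow> carrier G" "l \<in> tuples S (Suc n)"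
  shows "bar S G' (\<lambda>l. h (H l)) l = h (bar S G H l)"
proof -
  interpret G': abelian_group G' by (rule G')
  interpret h: abelian_group_hom G G' h
   by (intro abelian_group_homI group_hom.intro group_hom_axioms.intro)
    (use h in \<open>auto simp: hom_def G.a_group G'.a_group G' abelian_group_G\<close>)
  show ?thesis
   using assms(4,5)
  proof (induction l arbitrary: n H)
   case (Cons x l)
   show ?case
   proof (cases l)
    case (Cons y zs)
    then obtain n' where n': "n = Suc n'" using Cons.prems by (cases n) auto
    have "bar S G' (\<lambda>l. h (H (x # l))) l = h (bar S G (\<lambda>l. H (x # l)) l)"
     using Cons.prems n' by (intro Cons.IH[of _ n']) (auto simp: Pi_def)
    moreover have "bar S G (\<lambda>l. H (x # l)) l \<in> carrier G"
     using Cons.prems n' by (intro bar_closed[of _ n']; auto simp: Pi_def)+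
    ultimately show ?thesis
     using Cons.prems n' by (simp add: Cons Pi_def G.minus_eq G'.minus_eq)
   qed simp
  qed simp
qed

lemma bar_minus:
  assumes "H \<in> tuples S n \<rightarrow> carrier G" "\<psi> \<in> tuples S n \<rightarrow> carrier G" "l \<in> tuples S (Suc n)"
  shows "bar S G (\<lambda>l. H l \<ominus>\<^bsub>G\<^esub> \<psi> l) l = bar S G H l \<ominus>\<^bsub>G\<^esub> bar S G \<psi> l"
proof -
  have "bar S G (\<lambda>l. H l \<ominus>\<^bsub>G\<^esub> \<psi> l) l = bar S G H l \<oplus>\<^bsub>G\<^esub> bar S G (\<lambda>l. \<ominus>\<^bsub>G\<^esub> \<psi> l) l"
   unfolding G.minus_eq using assms by (intro bar_add[of _ n]) (auto simp: Pi_def)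
  also have "bar S G (\<lambda>l. \<ominus>\<^bsub>G\<^esub> \<psi> l) l = \<ominus>\<^bsub>G\<^esub> bar S G \<psi> l"
   using assms abelian_group_G by (intro bar_hom[of _ _ _ n]) (auto simp: G.minus_add)
  finally show ?thesis by (simp add: G.minus_eq)
qed

lemma bar_zero [simp]: "bar S G (\<lambda>l. \<zero>\<^bsub>G\<^esub>) l = \<zero>\<^bsub>G\<^esub>"
  by (induction l rule: induct_list012) (auto simp: G.minus_eq)

text \<open>The leading entry is only ever multiplied on its right, so by associativity a left
  factor stays where it is.\<close>

lemma bar_scale_hd:
  assumes "v \<in> carrier S" "x # xs \<in> tuples S n"
  shows "bar S G (\<lambda>l. \<psi> ((v \<otimes> hd l) # tl l)) (x # xs) = bar S G \<psi> ((v \<otimes> x) # xs)"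
  using assms by (cases xs) (auto simp: tuples_def S.m_assoc)

text \<open>Induction on the list. The part of the inner \<open>bar\<close> that multiplies the
  first two entries cancels against the same term of the outer \<open>bar\<close>, because a left
  factor on the leading entry commutes with \<open>bar\<close>; the rest is the induction hypothesis
  for \<open>H (x # _)\<close>.\<close>

lemma bar_bar:
  assumes "H \<in> tuples S n \<rightarrow> carrier G" "l \<in> tuples S (Suc (Suc n))"
  shows "bar S G (bar S G H) l = \<zero>\<^bsub>G\<^esub>"
  using assms
proof (induction l arbitrary: n H)
  case (Cons x l)
  then obtain y zs where l: "l = y # zs" by (auto simp: in_tuples_Suc)
  have c: "x \<in> carrier S" "y \<in> carrier S" "zs \<in> tuples S n"
   using Cons.prems(2) l by auto
  show ?case
  proof (cases n)
   case 0
   then show ?thesis using c l by (simp add: G.minus_eq)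
  next
   case (Suc n')
   have "bar S G (\<lambda>l. bar S G H (x # l)) l =
     bar S G (\<lambda>l. H ((x \<otimes> hd l) # tl l) \<ominus>\<^bsub>G\<^esub> bar S G (\<lambda>l. H (x # l)) l) l"
    using Cons.prems by (intro bar_cong[of n]) (auto simp: Suc in_tuples_Suc)
   also have "\<dots> = bar S G (\<lambda>l. H ((x \<otimes> hd l) # tl l)) l \<ominus>\<^bsub>G\<^esub> bar S G (bar S G (\<lambda>l. H (x # l))) l"
   proof (rule bar_minus[of _ n])
    show "(\<lambda>l. H ((x \<otimes> hd l) # tl l)) \<in> tuples S n \<rightarrow> carrier G"
     using Cons.prems c by (auto simp: Suc in_tuples_Suc Pi_def)
    show "bar S G (\<lambda>l. H (x # l)) \<in> tuples S n \<rightarrow> carrier G"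
     using Cons.prems c by (auto simp: Suc Pi_def intro!: bar_closed[of _ n'])
   qed (use c l in auto)
   also have "bar S G (bar S G (\<lambda>l. H (x # l))) l = \<zero>\<^bsub>G\<^esub>"
    using Cons.prems c l Suc by (intro Cons.IH[of _ n']) (auto simp: Pi_def)
   also have "bar S G (\<lambda>l. H ((x \<otimes> hd l) # tl l)) l = bar S G H ((x \<otimes> y) # zs)"
    unfolding l using c by (intro bar_scale_hd[where n="Suc n"]) auto
   finally show ?thesis
    using bar_closed[of H n "(x \<otimes> y) # zs"] Cons.prems c by (simp add: l G.minus_eq G.r_neg)
  qed
qed simp

definition alt :: "nat => 'g => 'g" where
  "alt j x = (if even j then x else \<ominus>\<^bsub>G\<^esub> x)"

lemma alt_closed [simp]: "x \<in> carrier G ==> alt j x \<in> carrier G"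
  by (simp add: alt_def)

lemma alt_0 [simp]: "alt 0 x = x"
  by (simp add: alt_def)

lemma alt_Suc [simp]: "x \<in> carrier G ==> alt (Suc j) x = \<ominus>\<^bsub>G\<^esub> alt j x"
  by (simp add: alt_def)

text \<open>The products of neighbours fall into those up to \<open>x\<close>, the product of
  \<open>x\<close> and \<open>y\<close>, and those from \<open>y\<close> on; the signs count the
  \<open>p\<close> entries of \<open>us\<close>. This is the source of the Leibniz rule.\<close>

lemma bar_append:
  assumes "us \<in> tuples S p" "vs \<in> tuples S q" "x \<in> carrier S" "y \<in> carrier S"
   and "H \<in> tuples S (Suc (p + q)) \<rightarrow> carrier G"
  shows "bar S G H (us @ x # y # vs) =
   bar S G (\<lambda>l. H (l @ y # vs)) (us @ [x]) \<oplus>\<^bsub>G\<^esub> alt p (H (us @ (x \<otimes> y) # vs)) \<ominus>\<^bsub>G\<^esub>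
   alt p (bar S G (\<lambda>l. H (us @ x # l)) (y # vs))"
  using assms(1,5)
proof (induction us arbitrary: p H)
  case Nil
  have "H ((x \<otimes> y) # vs) \<in> carrier G"
   using Nil assms by (auto simp: Pi_def tuples_def)
  then show ?case using Nil by (simp add: tuples_def)
next
  case (Cons u us)
  then obtain p' where p: "p = Suc p'" by (cases p) auto
  then have u: "u \<in> carrier S" "us \<in> tuples S p'" using Cons.prems by auto
  \<comment> \<open>The neighbour of \<open>u\<close> is the head of \<open>us\<close>, or
    \<open>x\<close> if \<open>us\<close> is empty; \<open>w\<close> covers both cases.\<close>
  obtain w ws where w: "us @ [x] = w # ws" by (cases us) auto
  have w': "us @ x # y # vs = w # ws @ y # vs"
   using w by (metis append_Cons append_assoc append_Nil)
  have wc: "w \<in> carrier S" "ws \<in> tuples S p'"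
   using arg_cong[OF w, of set] arg_cong[OF w, of length] u assms by (auto simp: tuples_def)
  have uw: "(u \<otimes> w) # ws @ y # vs \<in> tuples S (Suc (p + q))"
   using wc u assms by (auto simp: tuples_def p)
  let ?a = "H ((u \<otimes> w) # ws @ y # vs)"
  let ?b = "bar S G (\<lambda>l. H (u # l @ y # vs)) (us @ [x])"
  let ?c = "alt p' (H (u # us @ (x \<otimes> y) # vs))"
  let ?d = "alt p' (bar S G (\<lambda>l. H (u # us @ x # l)) (y # vs))"
  have IH: "bar S G (\<lambda>l. H (u # l)) (us @ x # y # vs) = ?b \<oplus>\<^bsub>G\<^esub> ?c \<ominus>\<^bsub>G\<^esub> ?d"
   by (rule Cons.IH[OF u(2)]) (use Cons.prems u in \<open>auto simp: Pi_def p\<close>)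
  have "?a \<in> carrier G" using Cons.prems(2) uw by auto
  moreover have "?b \<in> carrier G"
   by (rule bar_closed[of _ p']) (use Cons.prems u assms in \<open>auto simp: Pi_def p tuples_def\<close>)
  moreover have c: "H (u # us @ (x \<otimes> y) # vs) \<in> carrier G"
   using Cons.prems u assms by (auto simp: Pi_def p tuples_def)
  moreover have d: "bar S G (\<lambda>l. H (u # us @ x # l)) (y # vs) \<in> carrier G"
   by (rule bar_closed[of _ q]) (use Cons.prems u assms in \<open>auto simp: Pi_def p tuples_def\<close>)
  ultimately have "?a \<ominus>\<^bsub>G\<^esub> (?b \<oplus>\<^bsub>G\<^esub> ?c \<ominus>\<^bsub>G\<^esub> ?d) =
    (?a \<ominus>\<^bsub>G\<^esub> ?b) \<oplus>\<^bsub>G\<^esub> (\<ominus>\<^bsub>G\<^esub> ?c) \<ominus>\<^bsub>G\<^esub> (\<ominus>\<^bsub>G\<^esub> ?d)"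
   by (simp add: G.minus_eq G.minus_add G.a_ac)
  then show ?case
   using IH c d by (simp add: w w' p flip: IH)
qed

end

section \<open>Multilinear maps\<close>

text \<open>Recursive in the number of arguments, so that multilinearity can be proved along the
  recursions of \<open>bar\<close> and of the homotopies, which also peel off the first entry.
  \<open>multilinear_iff\<close> connects it with the condition imposed on cochains.\<close>

primrec multilinear ::
   "('k, 'c) ring_scheme => ('k, 's) module => ('k, 'g) module => nat => ('s list => 'g) => bool" where
  "multilinear K S G 0 = (\<lambda>H. H [] \<in> carrier G)"
| "multilinear K S G (Suc n) = (\<lambda>H.
   (\<forall>x\<in>carrier S. multilinear K S G n (\<lambda>l. H (x # l))) \<and>
   (\<forall>l\<in>tuples S n. (\<lambda>x. H (x # l)) \<in> linear_maps K S G))"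

lemma linear_mapsI:
  assumes "\<And>x. x \<in> carrier M ==> f x \<in> carrier N"
   and "\<And>x y. x \<in> carrier M ==> y \<in> carrier M ==> f (x \<oplus>\<^bsub>M\<^esub> y) = f x \<oplus>\<^bsub>N\<^esub> f y"
   and "\<And>a x. a \<in> carrier R ==> x \<in> carrier M ==> f (a \<odot>\<^bsub>M\<^esub> x) = a \<odot>\<^bsub>N\<^esub> f x"
  shows "f \<in> linear_maps R M N"
  using assms by (auto simp: linear_maps_def)

lemma linear_mapsD:
  assumes "f \<in> linear_maps R M N"
  shows "x \<in> carrier M ==> f x \<in> carrier N"
   and "x \<in> carrier M ==> y \<in> carrier M ==> f (x \<oplus>\<^bsub>M\<^esub> y) = f x \<oplus>\<^bsub>N\<^esub> f y"
   and "a \<in> carrier R ==> x \<in> carrier M ==> f (a \<odot>\<^bsub>M\<^esub> x) = a \<odot>\<^bsub>N\<^esub> f x"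
  using assms by (auto simp: linear_maps_def)

lemma abelian_group_hom_of_additive:
  assumes "abelian_group M" "abelian_group N"
   and "\<And>x. x \<in> carrier M ==> f x \<in> carrier N"
   and "\<And>x y. x \<in> carrier M ==> y \<in> carrier M ==> f (x \<oplus>\<^bsub>M\<^esub> y) = f x \<oplus>\<^bsub>N\<^esub> f y"
  shows "abelian_group_hom M N f"
proof -
  interpret M: abelian_group M by fact
  interpret N: abelian_group N by fact
  show ?thesis
   by (intro abelian_group_homI group_hom.intro group_hom_axioms.intro)
    (use assms in \<open>auto simp: hom_def M.a_group N.a_group\<close>)
qed

lemma linear_maps_hom:
  assumes "f \<in> linear_maps R M N" "abelian_group M" "abelian_group N"
  shows "abelian_group_hom M N f"
  using assms by (intro abelian_group_hom_of_additive) (auto dest: linear_mapsD)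

lemma (in abelian_group_hom) hom_minus [simp]:
  "x \<in> carrier G ==> y \<in> carrier G ==> h (x \<ominus>\<^bsub>G\<^esub> y) = h x \<ominus>\<^bsub>H\<^esub> h y"
  by (simp add: G.minus_eq H.minus_eq)

lemma (in abelian_group_hom) hom_finsum:
  assumes "f \<in> I \<rightarrow> carrier G"
  shows "h (\<Oplus>\<^bsub>G\<^esub>i\<in>I. f i) = (\<Oplus>\<^bsub>H\<^esub>i\<in>I. h (f i))"
  using assms
proof (induction I rule: infinite_finite_induct)
  case (insert i I)
  then show ?case by (simp add: Pi_def)
qed (simp_all)

locale linear_context = S: module K S + G: module K G
  for K :: "'k ring" and S :: "('k, 's) module" and G :: "('k, 'g) module"
begin

lemma add_linear_maps:
  assumes "f \<in> linear_maps K S G" "g \<in> linear_maps K S G"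
  shows "(\<lambda>x. f x \<oplus>\<^bsub>G\<^esub> g x) \<in> linear_maps K S G"
  using linear_mapsD[OF assms(1)] linear_mapsD[OF assms(2)]
  by (auto intro!: linear_mapsI simp: G.a_ac G.smult_r_distr)

lemma zero_linear_map: "(\<lambda>x. \<zero>\<^bsub>G\<^esub>) \<in> linear_maps K S G"
  by (auto intro!: linear_mapsI)

lemma smult_linear_maps:
  assumes "f \<in> linear_maps K S G" "k \<in> carrier K"
  shows "(\<lambda>x. k \<odot>\<^bsub>G\<^esub> f x) \<in> linear_maps K S G"
  using linear_mapsD[OF assms(1)] assms(2)
  by (auto intro!: linear_mapsI simp: G.smult_r_distr S.R.m_comm G.smult_assoc1[symmetric])

lemma minus_linear_maps:
  assumes "f \<in> linear_maps K S G" "g \<in> linear_maps K S G"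
  shows "(\<lambda>x. f x \<ominus>\<^bsub>G\<^esub> g x) \<in> linear_maps K S G"
  using linear_mapsD[OF assms(1)] linear_mapsD[OF assms(2)]
  by (auto intro!: linear_mapsI simp: G.a_ac G.minus_eq G.minus_add G.smult_r_distr G.smult_r_minus)

lemma linear_cong:
  assumes "f \<in> linear_maps K S G" "\<And>x. x \<in> carrier S ==> f x = g x"
  shows "g \<in> linear_maps K S G"
  using assms by (auto simp: linear_maps_def Pi_def)

lemma multilinear_funcset: "multilinear K S G n H ==> H \<in> tuples S n \<rightarrow> carrier G"
proof (induction n arbitrary: H)
  case (Suc n)
  have "H (x # l) \<in> carrier G" if "x \<in> carrier S" "l \<in> tuples S n" for x l
   using Suc.prems that linear_mapsD(1)[of "\<lambda>x. H (x # l)" K S G] by auto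
  then show ?case by (auto simp: in_tuples_Suc)
qed simp

lemma multilinear_closed: "multilinear K S G n H ==> l \<in> tuples S n ==> H l \<in> carrier G"
  using multilinear_funcset by blast

lemma multilinear_cong:
  "multilinear K S G n H ==> (\<And>l. l \<in> tuples S n ==> H l = \<psi> l) ==> multilinear K S G n \<psi>"
proof (induction n arbitrary: H \<psi>)
  case (Suc n)
  show ?case
   unfolding multilinear.simps
  proof (intro conjI ballI)
   fix x assume x: "x \<in> carrier S"
   show "multilinear K S G n (\<lambda>l. \<psi> (x # l))"
    by (rule Suc.IH[of "\<lambda>l. H (x # l)"]) (use Suc.prems x in auto)
  next
   fix l assume l: "l \<in> tuples S n"
   show "(\<lambda>x. \<psi> (x # l)) \<in> linear_maps K S G"
    by (rule linear_cong[of "\<lambda>x. H (x # l)"]) (use Suc.prems l in auto)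
  qed
qed simp

lemma multilinear_zero: "multilinear K S G n (\<lambda>_. \<zero>\<^bsub>G\<^esub>)"
  by (induction n) (auto simp: zero_linear_map)

lemma multilinear_add:
  "multilinear K S G n H ==> multilinear K S G n \<psi> ==> multilinear K S G n (\<lambda>l. H l \<oplus>\<^bsub>G\<^esub> \<psi> l)"
  by (induction n arbitrary: H \<psi>) (auto simp: add_linear_maps)

lemma multilinear_minus:
  "multilinear K S G n H ==> multilinear K S G n \<psi> ==> multilinear K S G n (\<lambda>l. H l \<ominus>\<^bsub>G\<^esub> \<psi> l)"
  by (induction n arbitrary: H \<psi>) (auto simp: minus_linear_maps)

lemma multilinear_smult:
  "multilinear K S G n H ==> k \<in> carrier K ==> multilinear K S G n (\<lambda>l. k \<odot>\<^bsub>G\<^esub> H l)"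
  by (induction n arbitrary: H) (auto simp: smult_linear_maps)

lemma multilinear_finsum:
  "(\<And>i. i \<in> I ==> multilinear K S G n (H i)) ==> multilinear K S G n (\<lambda>l. \<Oplus>\<^bsub>G\<^esub>i\<in>I. H i l)"
proof (induction I rule: infinite_finite_induct)
  case (insert i I)
  have "multilinear K S G n (\<lambda>l. H i l \<oplus>\<^bsub>G\<^esub> (\<Oplus>\<^bsub>G\<^esub>i\<in>I. H i l))"
   by (intro multilinear_add insert) (auto simp: insert)
  then show ?case
   by (rule multilinear_cong)
    (use insert in \<open>auto intro!: G.finsum_insert[symmetric] multilinear_closed\<close>)
qed (simp_all add: multilinear_zero)

lemma multilinear_Cons: "multilinear K S G (Suc n) H ==> x \<in> carrier S ==> multilinear K S G n (\<lambda>l. H (x # l))"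
  by simp

lemma multilinear_linear: "multilinear K S G (Suc n) H ==> l \<in> tuples S n ==> (\<lambda>x. H (x # l)) \<in> linear_maps K S G"
  by simp

lemma multilinear_zero_hd:
  assumes "multilinear K S G (Suc n) H" "l \<in> tuples S n"
  shows "H (\<zero>\<^bsub>S\<^esub> # l) = \<zero>\<^bsub>G\<^esub>"
proof -
  interpret abelian_group_hom S G "\<lambda>x. H (x # l)"
   using assms by (intro linear_maps_hom[of _ K] multilinear_linear[of n]) unfold_locales
  show ?thesis by simp
qed

lemma multilinear_hom:
  assumes "h \<in> linear_maps K G G'" "multilinear K S G n H"
  shows "multilinear K S G' n (\<lambda>l. h (H l))"
  using assms(2)
proof (induction n arbitrary: H)
  case 0
  then show ?case using assms by (simp add: linear_mapsD)
next
  case (Suc n)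
  have "(\<lambda>x. h (H (x # l))) \<in> linear_maps K S G'" if "l \<in> tuples S n" for l
   using linear_mapsD[OF multilinear_linear[OF Suc.prems that]] linear_mapsD[OF assms(1)]
   by (intro linear_mapsI) auto
  then show ?case using Suc by auto
qed

lemma multilinear_snoc:
  assumes "multilinear K S G (Suc n) H" "z \<in> carrier S"
  shows "multilinear K S G n (\<lambda>l. H (l @ [z]))"
  using assms(1)
proof (induction n arbitrary: H)
  case 0
  then show ?case using assms multilinear_closed[of "Suc 0" H "[z]"] by simp
next
  case (Suc n)
  show ?case
   unfolding multilinear.simps(2)[of K S G n]
  proof (intro conjI ballI)
   fix x assume "x \<in> carrier S"
   then show "multilinear K S G n (\<lambda>l. H ((x # l) @ [z]))"
    using Suc.IH[of "\<lambda>l. H (x # l)"] Suc.prems by auto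
  next
   fix l assume "l \<in> tuples S n"
   then show "(\<lambda>x. H ((x # l) @ [z])) \<in> linear_maps K S G"
    using multilinear_linear[OF Suc.prems, of "l @ [z]"] assms by (simp add: tuples_snocI)
  qed
qed

text \<open>The position \<open>0\<close> corresponds to the linearity clause of
  \<open>multilinear\<close> and the position \<open>Suc i\<close> to its recursive clause.\<close>

lemma multilinear_iff:
  "multilinear K S G n H \<longleftrightarrow> H \<in> tuples S n \<rightarrow> carrier G \<and>
   (\<forall>xs\<in>tuples S n. \<forall>i<n.
    (\<forall>x\<in>carrier S. \<forall>y\<in>carrier S.
     H (xs[i := x \<oplus>\<^bsub>S\<^esub> y]) = H (xs[i := x]) \<oplus>\<^bsub>G\<^esub> H (xs[i := y])) \<and>
    (\<forall>k\<in>carrier K. \<forall>x\<in>carrier S.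
     H (xs[i := k \<odot>\<^bsub>S\<^esub> x]) = k \<odot>\<^bsub>G\<^esub> H (xs[i := x])))"
proof (induction n arbitrary: H)
  case 0
  then show ?case by auto
next
  case (Suc n)
  have all: "(\<forall>xs\<in>tuples S (Suc n). P xs) \<longleftrightarrow> (\<forall>x\<in>carrier S. \<forall>l\<in>tuples S n. P (x # l))" for P
   by (auto simp: in_tuples_Suc)
  have alli: "(\<forall>i<Suc n. P i) \<longleftrightarrow> P 0 \<and> (\<forall>i<n. P (Suc i))" for P :: "nat => bool"
   by (auto simp: less_Suc_eq_0_disj)
  have ex: "\<zero>\<^bsub>S\<^esub> \<in> carrier S" by simp
  show ?case
   unfolding multilinear.simps Suc.IH all alli
   by (auto simp: linear_maps_def Pi_def in_tuples_Suc)
qed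

end

lemma cochains_iff:
  fixes K :: "'k ring" and T :: "('k, 't) module"
  assumes "module K T"
  shows "f \<in> cochains K T n \<longleftrightarrow> f \<in> extensional (tuples T n) \<and> multilinear K T T n f"
proof -
  interpret linear_context K T T using assms by (simp add: linear_context_def)
  show ?thesis
   unfolding multilinear_iff cochains_def PiE_def by auto
qed

section \<open>The Hochschild complex\<close>

text \<open>The cochain as a map of bimodules out of the bar resolution: two further arguments act
  from the left and from the right on the value.\<close>

definition sandwich :: "('k, 't) module => ('t list => 't) => 't list => 't" where
  "sandwich T f l = hd l \<otimes>\<^bsub>T\<^esub> f (butlast (tl l)) \<otimes>\<^bsub>T\<^esub> last l"

lemma sandwich_simp [simp]: "sandwich T f (y # xs @ [z]) = y \<otimes>\<^bsub>T\<^esub> f xs \<otimes>\<^bsub>T\<^esub> z"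
  by (simp add: sandwich_def)

lemma (in abelian_monoid) finsum_lessThan_Suc:
  assumes "f \<in> {..<Suc n} \<rightarrow> carrier G"
  shows "(\<Oplus>i\<in>{..<Suc n}. f i) = f 0 \<oplus> (\<Oplus>i\<in>{..<n}. f (Suc i))"
proof -
  have "{..<Suc n} = insert 0 (Suc ` {..<n})"
   by (rule lessThan_Suc_eq_insert_0)
  moreover have "(\<Oplus>i\<in>Suc ` {..<n}. f i) = (\<Oplus>i\<in>{..<n}. f (Suc i))"
   using assms by (intro finsum_reindex) auto
  ultimately show ?thesis
   using assms by (simp add: Pi_def)
qed

locale hochschild = assoc_algebra K T
  for K :: "'k ring" and T :: "('k, 't) module" (structure)

sublocale hochschild \<subseteq> Bar: bar_context T T
  by unfold_locales

sublocale hochschild \<subseteq> Lin: linear_context K T T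
  by unfold_locales

text \<open>Turns the recursion of \<open>bar\<close> into the alternating sum over
  \<open>contract\<close> that defines the Hochschild differential. The product with the last entry
  is kept apart, since for a sandwich it becomes the outer right term.\<close>

lemma (in bar_context) bar_snoc:
  assumes "xs \<in> tuples S (Suc n)" "z \<in> carrier S" "H \<in> tuples S (Suc n) \<rightarrow> carrier G"
  shows "bar S G H (xs @ [z]) =
   (\<Oplus>\<^bsub>G\<^esub>i\<in>{..<n}. alt i (H (contract S i xs @ [z]))) \<oplus>\<^bsub>G\<^esub>
   alt n (H (butlast xs @ [last xs \<otimes> z]))"
  using assms
proof (induction n arbitrary: xs H)
  case 0
  then obtain x where "xs = [x]" "x \<in> carrier S" by (auto simp: in_tuples_Suc)
  then show ?case using 0 by (auto simp: G.minus_eq Pi_def)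
next
  case (Suc n)
  then obtain x y ys where xs: "xs = x # y # ys" "x \<in> carrier S" "y \<in> carrier S" "ys \<in> tuples S n"
   by (auto simp: in_tuples_Suc)
  let ?H = "\<lambda>l. H (x # l)"
  have c: "contract S i xs @ [z] \<in> tuples S (Suc (Suc n))" if "i \<le> n" for i
   using Suc.prems that unfolding contract_def tuples_def
   by (auto dest!: in_set_takeD in_set_dropD intro!: S.m_closed simp: subset_iff)
  have c': "contract S i (y # ys) @ [z] \<in> tuples S (Suc n)" if "i < n" for i
   using xs Suc.prems that unfolding contract_def tuples_def
   by (auto dest!: in_set_takeD in_set_dropD intro!: S.m_closed simp: subset_iff nth_Cons split: nat.splits)
  have IH: "bar S G ?H ((y # ys) @ [z]) =
    (\<Oplus>\<^bsub>G\<^esub>i\<in>{..<n}. alt i (?H (contract S i (y # ys) @ [z]))) \<oplus>\<^bsub>G\<^esub>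
    alt n (?H (butlast (y # ys) @ [last (y # ys) \<otimes> z]))" (is "_ = ?s \<oplus>\<^bsub>G\<^esub> ?e")
   by (rule Suc.IH) (use xs Suc.prems in \<open>auto simp: Pi_def\<close>)
  have cs: "(\<lambda>i. alt i (?H (contract S i (y # ys) @ [z]))) \<in> {..<n} \<rightarrow> carrier G"
   using c' Suc.prems xs by (auto simp: Pi_def)
  then have s: "?s \<in> carrier G" by (rule G.finsum_closed)
  have blx: "butlast xs @ [last xs \<otimes> z] \<in> tuples S (Suc (Suc n))"
   using Suc.prems(1,2) by (cases xs rule: rev_cases) (auto simp: tuples_def)
  have bl: "H (butlast xs @ [last xs \<otimes> z]) \<in> carrier G"
   using blx Suc.prems by auto
  interpret neg: abelian_group_hom G G "\<lambda>x. \<ominus>\<^bsub>G\<^esub> x"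
   by (intro abelian_group_hom_of_additive abelian_group_G) (auto simp: G.minus_add)
  have "(\<Oplus>\<^bsub>G\<^esub>i\<in>{..<Suc n}. alt i (H (contract S i xs @ [z]))) =
    H (contract S 0 xs @ [z]) \<oplus>\<^bsub>G\<^esub> (\<Oplus>\<^bsub>G\<^esub>i\<in>{..<n}. alt (Suc i) (H (contract S (Suc i) xs @ [z])))"
   using c Suc.prems by (subst G.finsum_lessThan_Suc) (auto simp: Pi_def)
  also have "(\<Oplus>\<^bsub>G\<^esub>i\<in>{..<n}. alt (Suc i) (H (contract S (Suc i) xs @ [z]))) =
    (\<Oplus>\<^bsub>G\<^esub>i\<in>{..<n}. \<ominus>\<^bsub>G\<^esub> alt i (?H (contract S i (y # ys) @ [z])))"
   using c' Suc.prems xs by (intro G.finsum_cong') (auto simp: Pi_def contract_def)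
  also have "\<dots> = \<ominus>\<^bsub>G\<^esub> ?s"
   using cs by (simp add: neg.hom_finsum)
  finally have eq: "(\<Oplus>\<^bsub>G\<^esub>i\<in>{..<Suc n}. alt i (H (contract S i xs @ [z]))) =
    H ((x \<otimes> y) # ys @ [z]) \<ominus>\<^bsub>G\<^esub> ?s"
   by (simp add: contract_def xs G.minus_eq)
  have e: "alt (Suc n) (H (butlast xs @ [last xs \<otimes> z])) = \<ominus>\<^bsub>G\<^esub> ?e" "?e \<in> carrier G"
   using bl by (simp_all add: xs)
  have t: "H ((x \<otimes> y) # ys @ [z]) \<in> carrier G"
   using c[of 0] Suc.prems by (auto simp: contract_def xs)
  have "bar S G H (xs @ [z]) = H ((x \<otimes> y) # ys @ [z]) \<ominus>\<^bsub>G\<^esub> (?s \<oplus>\<^bsub>G\<^esub> ?e)"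
   using IH by (simp add: xs)
  also have "\<dots> = (H ((x \<otimes> y) # ys @ [z]) \<ominus>\<^bsub>G\<^esub> ?s) \<oplus>\<^bsub>G\<^esub> (\<ominus>\<^bsub>G\<^esub> ?e)"
   using s e t by (simp add: G.minus_eq G.minus_add G.a_ac)
  finally show ?case using e eq by simp
qed

lemma (in abelian_group) add_minus_cancel:
  "x \<in> carrier G ==> y \<in> carrier G ==> x \<oplus> y \<ominus> y = x"
  by (simp add: minus_eq a_assoc r_neg)

section \<open>The Hochschild differential through the bar differential\<close>

context hochschild
begin

abbreviation C :: "nat => ('k, 't list => 't) module" where "C \<equiv> cochain_module K T"
abbreviation Z :: "nat => ('k, 't list => 't) module" where "Z \<equiv> cocycle_module K T"
abbreviation mlin :: "nat => ('t list => 't) => bool" where "mlin \<equiv> multilinear K T T"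
abbreviation \<delta> :: "nat => ('t list => 't) => 't list => 't" where "\<delta> \<equiv> hochschild_d T"
abbreviation U :: "'t set" where "U \<equiv> carrier T"
abbreviation Ch :: "nat => ('t list => 't) set" where "Ch \<equiv> cochains K T"
abbreviation bd :: "nat => ('t list => 't) set" where "bd \<equiv> coboundaries K T"
abbreviation br :: "('t list => 't) => 't list => 't" where "br \<equiv> bar T T"
abbreviation tup :: "nat => 't list set" where "tup \<equiv> tuples T"
abbreviation lin :: "('t => 't) set" where "lin \<equiv> linear_maps K T T"
abbreviation sw :: "('t list => 't) => 't list => 't" where "sw \<equiv> sandwich T"

lemma mult_linear: "y \<in> U ==> z \<in> U ==> (\<lambda>t. y \<otimes> t \<otimes> z) \<in> lin"
  by (rule linear_mapsI) (auto simp: A.r_distr A.l_distr smult_mult_left smult_mult_right)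

lemma mult_left_linear: "y \<in> U ==> (\<lambda>t. y \<otimes> t) \<in> lin"
  by (rule linear_mapsI) (auto simp: A.r_distr smult_mult_right)

lemma mult_right_linear: "z \<in> U ==> (\<lambda>t. t \<otimes> z) \<in> lin"
  by (rule linear_mapsI) (auto simp: A.l_distr smult_mult_left)

lemma hom_of_linear: "h \<in> lin ==> abelian_group_hom T T h"
  by (rule linear_maps_hom[of _ K]) unfold_locales

lemma alt_eq: "Bar.alt = alt_sign T"
  by (auto simp: Bar.alt_def alt_sign_def fun_eq_iff)

lemma alt_hom:
  assumes "h \<in> lin" "x \<in> U"
  shows "h (Bar.alt j x) = Bar.alt j (h x)"
proof -
  interpret abelian_group_hom T T h by (rule hom_of_linear[OF assms(1)])
  show ?thesis using assms by (simp add: Bar.alt_def)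
qed

lemma contract_closed:
  assumes "xs \<in> tup (Suc n)" "i < n"
  shows "contract T i xs \<in> tup n"
  using assms unfolding contract_def tuples_def
  by (auto dest!: in_set_takeD in_set_dropD intro!: A.m_closed simp: subset_iff)

lemma butlast_closed: "xs \<in> tup (Suc n) ==> butlast xs \<in> tup n \<and> last xs \<in> U"
  by (cases xs rule: rev_cases) (auto simp: tuples_def)

text \<open>The product of \<open>y\<close> with the first argument and that of the last argument
  with \<open>z\<close> supply the two outer terms of \<open>\<delta>\<close>, the others its inner
  sum; the map \<open>t \<mapsto> y t z\<close> is additive and comes out in front.\<close>

lemma bar_sandwich:
  assumes f: "f \<in> tup n \<rightarrow> U" and xs: "xs \<in> tup (Suc n)"
   and y: "y \<in> U" and z: "z \<in> U"
  shows "br (sw f) (y # xs @ [z]) = y \<otimes> \<delta> n f xs \<otimes> z"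
proof -
  define h where "h = (\<lambda>t. y \<otimes> t \<otimes> z)"
  have h: "h \<in> lin" unfolding h_def by (rule mult_linear) fact+
  interpret h: abelian_group_hom T T h by (rule hom_of_linear[OF h])
  obtain x l where x: "xs = x # l" "x \<in> U" "l \<in> tup n"
   using xs by (auto simp: in_tuples_Suc)
  note f' = funcset_mem[OF f]
  have cc: "(\<lambda>i. f (contract T i xs)) \<in> {..<n} \<rightarrow> U"
   using f' contract_closed[OF xs] by auto
  then have cs: "(\<lambda>i. Bar.alt (Suc i) (f (contract T i xs))) \<in> {..<n} \<rightarrow> U"
   by (auto simp: Pi_def)
  have fb: "f (butlast xs) \<otimes> last xs \<in> U"
   using butlast_closed[OF xs] f' by auto
  have "br (sw f) (y # xs @ [z]) =
    sw f ((y \<otimes> x) # l @ [z]) \<ominus> br (\<lambda>l. sw f (y # l)) (xs @ [z])"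
   by (simp add: x)
  also have "br (\<lambda>l. sw f (y # l)) (xs @ [z]) =
    (\<Oplus>i\<in>{..<n}. Bar.alt i (sw f (y # contract T i xs @ [z]))) \<oplus>
    Bar.alt n (sw f (y # butlast xs @ [last xs \<otimes> z]))"
  proof (rule Bar.bar_snoc[OF xs z])
   show "(\<lambda>l. sw f (y # l)) \<in> tup (Suc n) \<rightarrow> U"
   proof
    fix l assume l: "l \<in> tup (Suc n)"
    then have "l = butlast l @ [last l]" by (cases l rule: rev_cases) (auto simp: tuples_def)
    then show "sw f (y # l) \<in> U"
     using butlast_closed[OF l] y f' by (metis A.m_closed sandwich_simp)
   qed
  qed
  also have "\<dots> = (\<Oplus>i\<in>{..<n}. Bar.alt i (h (f (contract T i xs)))) \<oplus>
    Bar.alt n (h (f (butlast xs) \<otimes> last xs))"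
   using butlast_closed[OF xs] y z f' by (simp add: h_def A.m_assoc)
  also have "(\<Oplus>i\<in>{..<n}. Bar.alt i (h (f (contract T i xs)))) =
    (\<Oplus>i\<in>{..<n}. \<ominus> h (Bar.alt (Suc i) (f (contract T i xs))))"
   using cc by (intro M.finsum_cong') (auto simp: alt_hom[OF h] Pi_def)
  also have "\<dots> = \<ominus> h (\<Oplus>i\<in>{..<n}. Bar.alt (Suc i) (f (contract T i xs)))"
  proof -
   interpret n: abelian_group_hom T T "\<lambda>x. \<ominus> x"
    by (intro abelian_group_hom_of_additive Bar.abelian_group_G) (auto simp: M.minus_add)
   show ?thesis
    using cs by (simp add: h.hom_finsum n.hom_finsum Pi_def)
  qed
  also have "Bar.alt n (h (f (butlast xs) \<otimes> last xs)) =
    \<ominus> h (Bar.alt (Suc n) (f (butlast xs) \<otimes> last xs))"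
   using fb by (simp add: alt_hom[OF h])
  also have "sw f ((y \<otimes> x) # l @ [z]) = h (x \<otimes> f l)"
   using x f' y z by (simp add: h_def A.m_assoc)
  finally have "br (sw f) (y # xs @ [z]) = h (\<delta> n f xs)"
   using xs x fb f' M.finsum_closed[OF cs]
   by (simp add: hochschild_d_def alt_eq[symmetric] M.minus_eq M.minus_add M.a_ac h.hom_add
     del: Bar.alt_Suc)
  then show ?thesis by (simp add: h_def)
qed

lemma d_extensional: "\<delta> n f \<in> extensional (tup (Suc n))"
  by (simp add: hochschild_d_def)

lemma d_apply:
  assumes "f \<in> tup n \<rightarrow> U" "xs \<in> tup (Suc n)"
  shows "\<delta> n f xs = br (sw f) (\<one> # xs @ [\<one>])"
proof -
  obtain x l where x: "xs = x # l" "x \<in> U" "l \<in> tup n"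
   using assms(2) by (auto simp: in_tuples_Suc)
  have "(\<lambda>i. alt_sign T (Suc i) (f (contract T i xs))) \<in> {..<n} \<rightarrow> U"
   using assms(1) contract_closed[OF assms(2)] unfolding alt_eq[symmetric] by (auto simp: Pi_def)
  then have "(\<Oplus>i\<in>{..<n}. alt_sign T (Suc i) (f (contract T i xs))) \<in> U"
   by (rule M.finsum_closed)
  then have "\<delta> n f xs \<in> U"
   unfolding hochschild_d_def using x assms butlast_closed[OF assms(2)]
   by (auto simp: alt_eq[symmetric] Pi_def)
  then show ?thesis by (simp add: bar_sandwich[OF assms])
qed

lemma sandwich_funcset:
  assumes "f \<in> tup n \<rightarrow> U"
  shows "sw f \<in> tup (Suc (Suc n)) \<rightarrow> U"
  using assms by (auto simp: in_tuples_Suc_Suc Pi_def)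

lemma d_funcset:
  assumes "f \<in> tup n \<rightarrow> U"
  shows "\<delta> n f \<in> tup (Suc n) \<rightarrow> U"
proof
  fix xs assume "xs \<in> tup (Suc n)"
  then show "\<delta> n f xs \<in> U"
   unfolding d_apply[OF assms \<open>xs \<in> tup (Suc n)\<close>]
   by (intro Bar.bar_closed[OF sandwich_funcset[OF assms]]) (auto intro: tuples_snocI)
qed

text \<open>In this form \<open>\<delta>\<close> can be iterated, and identities between iterated
  differentials become identities for \<open>bar\<close>.\<close>

lemma sandwich_d:
  assumes "f \<in> tup n \<rightarrow> U" "l \<in> tup (Suc (Suc (Suc n)))"
  shows "sw (\<delta> n f) l = br (sw f) l"
proof -
  obtain y xs z where l: "l = y # xs @ [z]"
   "y \<in> U" "z \<in> U" "xs \<in> tup (Suc n)"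
   using assms(2) by (subst (asm) in_tuples_Suc_Suc) blast
  then show ?thesis by (simp add: bar_sandwich[OF assms(1)])
qed

lemma sandwich_multilinear:
  assumes "mlin n f"
  shows "mlin (Suc (Suc n)) (sw f)"
proof -
  \<comment> \<open>The right factor is attached before the left one, because
    \<open>multilinear\<close> recurses on the first argument and the right factor is the argument
    it reaches last.\<close>
  have 1: "mlin (Suc n) (\<lambda>l. f (butlast l) \<otimes> last l)" if "mlin n f" for n f
   using that
  proof (induction n arbitrary: f)
   case 0
   then show ?case by (auto intro: mult_left_linear linear_mapsD(1))
  next
   case (Suc n)
   show ?case
    unfolding multilinear.simps(2)[of K T T "Suc n"]
   proof (intro conjI ballI)
    fix x assume x: "x \<in> U"
    have "mlin (Suc n) (\<lambda>l. f (x # butlast l) \<otimes> last l)"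
     using Suc.prems x by (intro Suc.IH) auto
    then show "mlin (Suc n) (\<lambda>l. f (butlast (x # l)) \<otimes> last (x # l))"
     by (rule Lin.multilinear_cong) (auto simp: in_tuples_Suc)
   next
    fix l assume l: "l \<in> tup (Suc n)"
    then have "(\<lambda>x. f (x # butlast l)) \<in> lin"
     using Suc.prems butlast_closed[OF l] by auto
    then show "(\<lambda>x. f (butlast (x # l)) \<otimes> last (x # l)) \<in> lin"
     using butlast_closed[OF l] l linear_mapsD[of "\<lambda>x. f (x # butlast l)" K T T]
     by (auto simp: in_tuples_Suc A.l_distr smult_mult_left intro!: linear_mapsI)
   qed
  qed
  have c: "f (butlast l) \<otimes> last l \<in> U" "f (butlast l) \<in> U" "last l \<in> U"
   if "l \<in> tup (Suc n)" for l
   using butlast_closed[OF that] Lin.multilinear_closed[OF assms] by auto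
  show ?thesis
   unfolding multilinear.simps(2)[of K T T "Suc n"]
  proof (intro conjI ballI)
   fix x assume x: "x \<in> U"
   have "mlin (Suc n) (\<lambda>l. x \<otimes> (f (butlast l) \<otimes> last l))"
    by (rule Lin.multilinear_hom[OF mult_left_linear[OF x] 1[OF assms]])
   then show "mlin (Suc n) (\<lambda>l. sw f (x # l))"
    by (rule Lin.multilinear_cong) (use c x in \<open>auto simp: sandwich_def A.m_assoc in_tuples_Suc\<close>)
  next
   fix l assume l: "l \<in> tup (Suc n)"
   have "(\<lambda>x. x \<otimes> (f (butlast l) \<otimes> last l)) \<in> lin"
    using c[OF l] by (intro mult_right_linear) auto
   then show "(\<lambda>x. sw f (x # l)) \<in> lin"
    by (rule Lin.linear_cong) (use c[OF l] l in \<open>auto simp: sandwich_def A.m_assoc in_tuples_Suc\<close>)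
  qed
qed

lemma bar_multilinear:
  "mlin n H ==> mlin (Suc n) (br H)"
proof (induction n arbitrary: H)
  case 0
  then show ?case by (simp add: Lin.zero_linear_map)
next
  case (Suc n)
  show ?case
   unfolding multilinear.simps(2)[of K T T "Suc n"]
  proof (intro conjI ballI)
   fix x assume x: "x \<in> U"
   have 1: "mlin (Suc n) (\<lambda>l. H ((x \<otimes> hd l) # tl l))"
    unfolding multilinear.simps(2)
   proof (intro conjI ballI)
    fix l assume "l \<in> tup n"
    then have "(\<lambda>y. H (y # l)) \<in> lin" using Suc.prems by simp
    from linear_mapsD[OF this] linear_mapsD[OF mult_left_linear[OF x]]
    show "(\<lambda>y. H ((x \<otimes> hd (y # l)) # tl (y # l))) \<in> lin"
     by (auto intro!: linear_mapsI)
   qed (use Suc.prems x in auto)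
   have "mlin (Suc n)
     (\<lambda>l. H ((x \<otimes> hd l) # tl l) \<ominus> br (\<lambda>l. H (x # l)) l)"
    using Suc.prems x by (intro Lin.multilinear_minus 1 Suc.IH) auto
   then show "mlin (Suc n) (\<lambda>l. br H (x # l))"
    by (rule Lin.multilinear_cong) (auto simp: in_tuples_Suc)
  next
   fix l assume l: "l \<in> tup (Suc n)"
   then obtain y zs where y: "l = y # zs" "y \<in> U" "zs \<in> tup n"
    by (auto simp: in_tuples_Suc)
   have f: "(\<lambda>l. H (x # l)) \<in> tup n \<rightarrow> U" if "x \<in> U" for x
    using Suc.prems that Lin.multilinear_funcset by auto
   have hom: "H ((a \<oplus> b) # l) = H (a # l) \<oplus> H (b # l)"
    "k \<in> carrier K ==> H ((k \<odot> a) # l) = k \<odot> H (a # l)"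
    if "a \<in> U" "b \<in> U" "l \<in> tup n" for a b l k
    using that linear_mapsD[OF Lin.multilinear_linear[OF Suc.prems, of l]] by auto
   have lin: "(\<lambda>x. H ((x \<otimes> y) # zs)) \<in> lin"
    using y linear_mapsD[OF Lin.multilinear_linear[OF Suc.prems, of zs]]
    by (auto intro!: linear_mapsI simp: A.l_distr smult_mult_left)
   have "(\<lambda>x. br (\<lambda>l. H (x # l)) l) \<in> lin"
   proof (rule linear_mapsI)
    fix a b assume ab: "a \<in> U" "b \<in> U"
    have "br (\<lambda>l. H ((a \<oplus> b) # l)) l = br (\<lambda>l. H (a # l) \<oplus> H (b # l)) l"
     using ab l by (intro Bar.bar_cong[of n]) (auto simp: hom)
    then show "br (\<lambda>l. H ((a \<oplus> b) # l)) l =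
      br (\<lambda>l. H (a # l)) l \<oplus> br (\<lambda>l. H (b # l)) l"
     using ab l f by (simp add: Bar.bar_add[of _ n])
   next
    fix k a assume ab: "a \<in> U" "k \<in> carrier K"
    have "br (\<lambda>l. H ((k \<odot> a) # l)) l = br (\<lambda>l. k \<odot> H (a # l)) l"
     using ab l by (intro Bar.bar_cong[of n]) (auto simp: hom)
    also have "\<dots> = k \<odot> br (\<lambda>l. H (a # l)) l"
     using ab l f by (intro Bar.bar_hom[of _ _ _ n] Bar.abelian_group_G) (auto simp: smult_r_distr)
    finally show "br (\<lambda>l. H ((k \<odot> a) # l)) l = k \<odot> br (\<lambda>l. H (a # l)) l" .
   qed (use f l in \<open>auto intro: Bar.bar_closed\<close>)
   then show "(\<lambda>x. br H (x # l)) \<in> lin"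
    using lin unfolding y by (simp add: Lin.minus_linear_maps)
  qed
qed

lemma cochains_iff': "f \<in> Ch n \<longleftrightarrow> f \<in> extensional (tup n) \<and> mlin n f"
  by (rule cochains_iff) unfold_locales

lemma cochains_multilinear: "f \<in> Ch n ==> mlin n f"
  by (simp add: cochains_iff')

lemma cochains_funcset: "f \<in> Ch n ==> f \<in> tup n \<rightarrow> U"
  by (simp add: cochains_iff' Lin.multilinear_funcset)

lemma cochains_closed [intro]: "f \<in> Ch n ==> xs \<in> tup n ==> f xs \<in> U"
  using cochains_funcset by blast

lemma restrict_cochains: "mlin n f ==> restrict f (tup n) \<in> Ch n"
  unfolding cochains_iff' by (auto intro: Lin.multilinear_cong)

lemma cochains_eqI:
  assumes "f \<in> Ch n" "g \<in> Ch n" "\<And>xs. xs \<in> tup n ==> f xs = g xs"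
  shows "f = g"
  using assms by (auto simp: cochains_iff' intro: extensionalityI)

lemma restrict_bar_sandwich:
  assumes "mlin (Suc (Suc n)) H"
  shows "(\<lambda>xs\<in>tup n. H (\<one> # xs @ [\<one>])) \<in> Ch n"
proof (rule restrict_cochains)
  have "mlin (Suc n) (\<lambda>l. H (\<one> # l))"
   using assms by (auto intro: Lin.multilinear_Cons)
  from Lin.multilinear_snoc[OF this, of "\<one>"]
  show "mlin n (\<lambda>xs. H (\<one> # xs @ [\<one>]))" by simp
qed

lemma d_cochains: "f \<in> Ch n ==> \<delta> n f \<in> Ch (Suc n)"
proof -
  assume f: "f \<in> Ch n"
  have "\<delta> n f = (\<lambda>xs\<in>tup (Suc n). br (sw f) (\<one> # xs @ [\<one>]))"
   by (rule extensionalityI[OF d_extensional]) (auto simp: d_apply[OF cochains_funcset[OF f]])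
  then show ?thesis
   using restrict_bar_sandwich[OF bar_multilinear[OF sandwich_multilinear[OF cochains_multilinear[OF f]]]]
   by simp
qed

section \<open>Cochains as a module with the linear map \<delta>\<close>

lemma cochain_simps [simp]:
  "carrier (C n) = Ch n"
  "zero (C n) = (\<lambda>xs\<in>tup n. \<zero>)"
  "add (C n) = (\<lambda>f g. \<lambda>xs\<in>tup n. f xs \<oplus> g xs)"
  "smult (C n) = (\<lambda>k f. \<lambda>xs\<in>tup n. k \<odot> f xs)"
  by (simp_all add: cochain_module_def)

lemma zero_cochain: "(\<lambda>xs\<in>tup n. \<zero>) \<in> Ch n"
  by (intro restrict_cochains Lin.multilinear_zero)

lemma add_cochain: "f \<in> Ch n ==> g \<in> Ch n ==>
   (\<lambda>xs\<in>tup n. f xs \<oplus> g xs) \<in> Ch n"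
  by (intro restrict_cochains Lin.multilinear_add cochains_multilinear)

lemma smult_cochain: "k \<in> carrier K ==> f \<in> Ch n ==>
   (\<lambda>xs\<in>tup n. k \<odot> f xs) \<in> Ch n"
  by (intro restrict_cochains Lin.multilinear_smult cochains_multilinear)

lemma minus_cochain: "f \<in> Ch n ==> g \<in> Ch n ==>
   (\<lambda>xs\<in>tup n. f xs \<ominus> g xs) \<in> Ch n"
  by (intro restrict_cochains Lin.multilinear_minus cochains_multilinear)

lemma cochain_module: "module K (C n)"
proof (rule moduleI)
  show "cring K" by (rule R.is_cring)
  show "abelian_group (C n)"
  proof (rule abelian_groupI)
   fix f assume f: "f \<in> carrier (C n)"
   let ?g = "\<lambda>xs\<in>tup n. (\<lambda>xs\<in>tup n. \<zero>) xs \<ominus> f xs"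
   have g: "?g \<in> Ch n" using f by (intro minus_cochain zero_cochain) simp
   have "?g \<oplus>\<^bsub>C n\<^esub> f = \<zero>\<^bsub>C n\<^esub>"
    using f cochains_closed[of f n] by (simp add: M.minus_eq M.l_neg cong: restrict_cong)
   then show "\<exists>g\<in>carrier (C n).
     g \<oplus>\<^bsub>C n\<^esub> f = \<zero>\<^bsub>C n\<^esub>"
    using g unfolding cochain_simps(1) by (intro bexI[of _ ?g])
   show "\<zero>\<^bsub>C n\<^esub> \<oplus>\<^bsub>C n\<^esub> f = f"
    using f add_cochain[OF zero_cochain, of f n]
    by (intro cochains_eqI[of _ n]) (auto simp: cochains_closed)
  next
   fix f g h
   assume "f \<in> carrier (C n)" "g \<in> carrier (C n)"
    "h \<in> carrier (C n)"
   then show "f \<oplus>\<^bsub>C n\<^esub> g \<oplus>\<^bsub>C n\<^esub> h =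
     f \<oplus>\<^bsub>C n\<^esub> (g \<oplus>\<^bsub>C n\<^esub> h)"
    by (simp add: cochains_closed M.a_assoc cong: restrict_cong)
  next
   fix f g
   assume "f \<in> carrier (C n)" "g \<in> carrier (C n)"
   then show "f \<oplus>\<^bsub>C n\<^esub> g = g \<oplus>\<^bsub>C n\<^esub> f"
    by (simp add: cochains_closed M.a_comm cong: restrict_cong)
  qed (simp_all add: zero_cochain add_cochain)
next
  fix f assume f: "f \<in> carrier (C n)"
  show "\<one>\<^bsub>K\<^esub> \<odot>\<^bsub>C n\<^esub> f = f"
   using f smult_cochain[of "\<one>\<^bsub>K\<^esub>" f n]
   by (intro cochains_eqI[of _ n]) (auto simp: cochains_closed)
qed (simp_all add: smult_cochain cochains_closed smult_l_distr smult_r_distr smult_assoc1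
   cong: restrict_cong)

sublocale C: module K "C n" for n
  by (rule cochain_module)

lemma minus_cochain_apply:
  assumes "f \<in> Ch n" "g \<in> Ch n"
  shows "f \<ominus>\<^bsub>C n\<^esub> g = (\<lambda>xs\<in>tup n. f xs \<ominus> g xs)" (is "_ = ?h")
proof -
  have h: "?h \<in> Ch n" using assms by (rule minus_cochain)
  have "?h \<oplus>\<^bsub>C n\<^esub> g = f"
   using h assms add_cochain[OF h]
   by (intro cochains_eqI[of _ n]) (auto simp: cochains_closed M.minus_eq M.a_assoc M.l_neg)
  moreover have "?h \<oplus>\<^bsub>C n\<^esub> g \<ominus>\<^bsub>C n\<^esub> g = ?h"
   using h assms by (intro C.M.add_minus_cancel) simp_all
  ultimately show ?thesis by metis
qed

lemma sandwich_add:
  assumes "f \<in> Ch n" "g \<in> Ch n" "l \<in> tup (Suc (Suc n))"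
  shows "sw (f \<oplus>\<^bsub>C n\<^esub> g) l = sw f l \<oplus> sw g l"
  using assms by (subst (asm) in_tuples_Suc_Suc) (auto simp: A.r_distr A.l_distr cochains_closed)

lemma sandwich_smult:
  assumes "f \<in> Ch n" "k \<in> carrier K" "l \<in> tup (Suc (Suc n))"
  shows "sw (k \<odot>\<^bsub>C n\<^esub> f) l = k \<odot> sw f l"
  using assms
  by (subst (asm) in_tuples_Suc_Suc) (auto simp: smult_mult_left smult_mult_right cochains_closed)

lemma d_linear: "\<delta> n \<in> linear_maps K (C n) (C (Suc n))"
proof (rule linear_mapsI)
  fix f g assume "f \<in> carrier (C n)" "g \<in> carrier (C n)"
  then have fg: "f \<in> Ch n" "g \<in> Ch n" by simp_all
  then have fg': "f \<oplus>\<^bsub>C n\<^esub> g \<in> Ch n" by (simp add: add_cochain)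
  show "\<delta> n (f \<oplus>\<^bsub>C n\<^esub> g) =
    \<delta> n f \<oplus>\<^bsub>C (Suc n)\<^esub> \<delta> n g"
  proof (rule cochains_eqI[of _ "Suc n"])
   fix xs assume xs: "xs \<in> tup (Suc n)"
   then have l: "\<one> # xs @ [\<one>] \<in> tup (Suc (Suc (Suc n)))" by (auto intro: tuples_snocI)
   show "\<delta> n (f \<oplus>\<^bsub>C n\<^esub> g) xs =
    (\<delta> n f \<oplus>\<^bsub>C (Suc n)\<^esub> \<delta> n g) xs"
    using Bar.bar_cong[OF sandwich_add[OF fg] l]
     Bar.bar_add[OF sandwich_funcset sandwich_funcset l, of f g] fg fg' xs
    by (simp add: d_apply cochains_funcset del: bar.simps cochain_simps(3))
     (simp add: cochain_simps(3) d_apply cochains_funcset del: bar.simps)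
  qed (use fg fg' in \<open>auto intro: d_cochains add_cochain simp del: cochain_simps(3)\<close>,
    use fg in \<open>simp add: d_cochains add_cochain\<close>)
next
  fix k f assume "k \<in> carrier K" "f \<in> carrier (C n)"
  then have kf: "k \<in> carrier K" "f \<in> Ch n" by simp_all
  then have kf': "k \<odot>\<^bsub>C n\<^esub> f \<in> Ch n" by (simp add: smult_cochain)
  show "\<delta> n (k \<odot>\<^bsub>C n\<^esub> f) =
    k \<odot>\<^bsub>C (Suc n)\<^esub> \<delta> n f"
  proof (rule cochains_eqI[of _ "Suc n"])
   fix xs assume xs: "xs \<in> tup (Suc n)"
   then have l: "\<one> # xs @ [\<one>] \<in> tup (Suc (Suc (Suc n)))" by (auto intro: tuples_snocI)
   have "br (\<lambda>l. k \<odot> sw f l) (\<one> # xs @ [\<one>]) =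
     k \<odot> br (sw f) (\<one> # xs @ [\<one>])"
    using kf l
    by (intro Bar.bar_hom[of _ _ _ "Suc (Suc n)"] Bar.abelian_group_G sandwich_funcset)
     (auto simp: smult_r_distr cochains_funcset)
   then show "\<delta> n (k \<odot>\<^bsub>C n\<^esub> f) xs =
    (k \<odot>\<^bsub>C (Suc n)\<^esub> \<delta> n f) xs"
    using Bar.bar_cong[OF sandwich_smult[OF kf(2,1)] l] kf kf' xs
    by (simp add: d_apply cochains_funcset del: bar.simps cochain_simps(4))
     (simp add: cochain_simps(4) d_apply cochains_funcset del: bar.simps)
  qed (use kf kf' in \<open>auto intro: d_cochains simp del: cochain_simps(4)\<close>,
    use kf in \<open>simp add: d_cochains smult_cochain\<close>)
qed (simp add: d_cochains)

lemma d_d: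
  assumes "f \<in> Ch n"
  shows "\<delta> (Suc n) (\<delta> n f) = \<zero>\<^bsub>C (Suc (Suc n))\<^esub>"
proof (rule cochains_eqI[of _ "Suc (Suc n)"])
  fix xs assume xs: "xs \<in> tup (Suc (Suc n))"
  then have l: "\<one> # xs @ [\<one>] \<in> tup (Suc (Suc (Suc (Suc n))))" by (auto intro: tuples_snocI)
  have f: "f \<in> tup n \<rightarrow> U" using assms by (rule cochains_funcset)
  have "\<delta> (Suc n) (\<delta> n f) xs =
    br (sw (\<delta> n f)) (\<one> # xs @ [\<one>])"
   by (rule d_apply[OF d_funcset[OF f] xs])
  also have "\<dots> = br (br (sw f)) (\<one> # xs @ [\<one>])"
   by (rule Bar.bar_cong[OF sandwich_d[OF f] l])
  also have "\<dots> = \<zero>"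
   by (rule Bar.bar_bar[OF sandwich_funcset[OF f] l])
  finally show "\<delta> (Suc n) (\<delta> n f) xs = \<zero>\<^bsub>C (Suc (Suc n))\<^esub> xs"
   using xs by simp
qed (use assms zero_cochain in \<open>auto intro: d_cochains\<close>)

end

section \<open>Quotient modules\<close>

lemma (in module) submoduleI':
  assumes "H \<subseteq> carrier M" "\<zero>\<^bsub>M\<^esub> \<in> H"
   and "\<And>a b. [|a \<in> H; b \<in> H|] ==> a \<oplus>\<^bsub>M\<^esub> b \<in> H"
   and "\<And>a x. [|a \<in> carrier R; x \<in> H|] ==> a \<odot>\<^bsub>M\<^esub> x \<in> H"
  shows "submodule H R M"
proof (rule submoduleI)
  fix x assume x: "x \<in> H"
  then have "\<ominus>\<^bsub>M\<^esub> x = (\<ominus> \<one>) \<odot>\<^bsub>M\<^esub> x"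
   using assms(1) smult_l_minus[OF R.one_closed, of x] by auto
  then show "\<ominus>\<^bsub>M\<^esub> x \<in> H"
   using assms(4)[of "\<ominus> \<one>" x] x by simp
qed (use assms in auto)

locale module_quotient = Z: module K Z + H: submodule S K Z
  for K :: "'k ring" and Z :: "('k, 'z) module" and S :: "'z set"
begin

sublocale abelian_subgroup S Z
  by (intro abelian_subgroupI3 additive_subgroupI H.subgroup_axioms) unfold_locales

definition cl :: "'z => 'z set" where
  "cl f = S +>\<^bsub>Z\<^esub> f"

lemma carrier_quotient: "carrier (quotient_module Z S) = cl ` carrier Z"
  by (auto simp: quotient_module_def cl_def A_RCOSETS_def RCOSETS_def a_r_coset_def)

lemma cl_eq_iff:
  assumes "f \<in> carrier Z" "g \<in> carrier Z"
  shows "cl f = cl g \<longleftrightarrow> f \<ominus>\<^bsub>Z\<^esub> g \<in> S"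
  using assms a_rcos_module a_repr_independence' a_rcos_self
  unfolding cl_def Z.minus_eq by metis

lemma in_cl_iff: "f \<in> carrier Z ==> g \<in> cl f \<longleftrightarrow> g \<in> carrier Z \<and> cl g = cl f"
  using a_elemrcos_carrier a_repr_independence' a_rcos_self unfolding cl_def by metis

lemma cl_add:
  "f \<in> carrier Z ==> g \<in> carrier Z ==> cl f \<oplus>\<^bsub>quotient_module Z S\<^esub> cl g = cl (f \<oplus>\<^bsub>Z\<^esub> g)"
  by (simp add: quotient_module_def cl_def a_rcos_sum)

text \<open>The scalar multiple of a coset is defined as a union over its members; as they differ by
  elements of a submodule, all of them contribute the same coset.\<close>

lemma cl_smult:
  assumes "k \<in> carrier K" "f \<in> carrier Z"
  shows "k \<odot>\<^bsub>quotient_module Z S\<^esub> cl f = cl (k \<odot>\<^bsub>Z\<^esub> f)"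
proof -
  have "cl (k \<odot>\<^bsub>Z\<^esub> g) = cl (k \<odot>\<^bsub>Z\<^esub> f)" if "g \<in> cl f" for g
  proof -
   have g: "g \<in> carrier Z" "g \<ominus>\<^bsub>Z\<^esub> f \<in> S"
    using that assms cl_eq_iff in_cl_iff by auto
   have "k \<odot>\<^bsub>Z\<^esub> g \<ominus>\<^bsub>Z\<^esub> k \<odot>\<^bsub>Z\<^esub> f = k \<odot>\<^bsub>Z\<^esub> (g \<ominus>\<^bsub>Z\<^esub> f)"
    using g assms by (simp add: Z.minus_eq Z.smult_r_distr Z.smult_r_minus)
   then show ?thesis using g assms by (simp add: cl_eq_iff)
  qed
  then have "(\<Union>x\<in>cl f. cl (k \<odot>\<^bsub>Z\<^esub> x)) = (\<Union>x\<in>cl f. cl (k \<odot>\<^bsub>Z\<^esub> f))"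
   by (intro SUP_cong) auto
  moreover have "f \<in> cl f" using assms by (simp add: in_cl_iff)
  ultimately have "(\<Union>x\<in>cl f. cl (k \<odot>\<^bsub>Z\<^esub> x)) = cl (k \<odot>\<^bsub>Z\<^esub> f)"
   by auto
  then show ?thesis
   by (simp add: quotient_module_def cl_def)
qed

lemma cl_zero: "\<zero>\<^bsub>quotient_module Z S\<^esub> = cl \<zero>\<^bsub>Z\<^esub>"
  using a_rcos_const[of "\<zero>\<^bsub>Z\<^esub>"] by (simp add: quotient_module_def cl_def)

lemma cl_eq_zero_iff: "f \<in> carrier Z ==> cl f = \<zero>\<^bsub>quotient_module Z S\<^esub> \<longleftrightarrow> f \<in> S"
  using cl_eq_iff[of f "\<zero>\<^bsub>Z\<^esub>"] by (simp add: cl_zero Z.minus_eq)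

lemma quotient_rep:
  assumes "X \<in> carrier (quotient_module Z S)"
  shows "(SOME f. f \<in> X) \<in> carrier Z" "cl (SOME f. f \<in> X) = X"
proof -
  obtain f where f: "f \<in> carrier Z" "X = cl f" using assms by (auto simp: carrier_quotient)
  then have "f \<in> X" by (simp add: in_cl_iff)
  then have "(SOME f. f \<in> X) \<in> X" by (rule someI)
  then show "(SOME f. f \<in> X) \<in> carrier Z" "cl (SOME f. f \<in> X) = X"
   using f by (auto simp: in_cl_iff)
qed

end

text \<open>The image is computed from a chosen representative, which gives a total function on
  sets; that the choice is immaterial for maps respecting the submodules is
  \<open>coset_map_cl\<close>.\<close>

definition coset_map ::
   "('z => 'y) => ('k, 'y) module => 'y set => 'z set => 'y set" where
  "coset_map h Z S X = S +>\<^bsub>Z\<^esub> h (SOME f. f \<in> X)"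

lemma coset_map_cl:
  assumes "module_quotient K Z S" "module_quotient K Z' S'"
   and h: "h \<in> linear_maps K Z Z'" "h ` S \<subseteq> S'" and f: "f \<in> carrier Z"
  shows "coset_map h Z' S' (module_quotient.cl Z S f) = module_quotient.cl Z' S' (h f)"
proof -
  interpret Q: module_quotient K Z S by fact
  interpret Q': module_quotient K Z' S' by fact
  interpret h: abelian_group_hom Z Z' h
   by (rule linear_maps_hom[OF h(1)]) unfold_locales
  define g where "g = (SOME g. g \<in> Q.cl f)"
  have "Q.cl f \<in> carrier (quotient_module Z S)" using f by (simp add: Q.carrier_quotient)
  from Q.quotient_rep[OF this] have g: "g \<in> carrier Z" "Q.cl g = Q.cl f"
   by (simp_all add: g_def)
  then have "g \<ominus>\<^bsub>Z\<^esub> f \<in> S" using f by (simp add: Q.cl_eq_iff)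
  then have "h (g \<ominus>\<^bsub>Z\<^esub> f) \<in> S'" using h(2) by blast
  then have "h g \<ominus>\<^bsub>Z'\<^esub> h f \<in> S'" using f g by simp
  then have "Q'.cl (h g) = Q'.cl (h f)" using f g by (simp add: Q'.cl_eq_iff)
  then show ?thesis by (simp add: coset_map_def Q'.cl_def g_def)
qed

lemma coset_map_linear:
  assumes "module_quotient K Z S" "module_quotient K Z' S'"
   and h: "h \<in> linear_maps K Z Z'" "h ` S \<subseteq> S'"
  shows "coset_map h Z' S' \<in> linear_maps K (quotient_module Z S) (quotient_module Z' S')"
proof -
  interpret Q: module_quotient K Z S by fact
  interpret Q': module_quotient K Z' S' by fact
  note [simp] = linear_mapsD[OF h(1)] coset_map_cl[OF assms]
  show ?thesis
   by (rule linear_mapsI)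
    (auto simp: Q.carrier_quotient Q'.carrier_quotient Q.cl_add Q'.cl_add Q.cl_smult Q'.cl_smult)
qed

section \<open>Hochschild cohomology and the cup product\<close>

context hochschild
begin

definition cocycles :: "nat => ('t list => 't) set" where
  "cocycles n = {f \<in> Ch n. \<delta> n f = \<zero>\<^bsub>C (Suc n)\<^esub>}"

lemma d_hom: "abelian_group_hom (C n) (C (Suc n)) (\<delta> n)"
  by (rule linear_maps_hom[OF d_linear]) unfold_locales

lemma cocycles_cochains: "f \<in> cocycles n ==> f \<in> Ch n"
  by (simp add: cocycles_def)

lemma cocycle_submodule: "submodule (cocycles n) K (C n)"
proof (rule C.submoduleI')
  interpret d: abelian_group_hom "C n" "C (Suc n)" "\<delta> n"
   by (rule d_hom)
  note mem = cocycles_def cochain_simps(1)[symmetric]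
  note [simp del] = cochain_simps
  show "\<zero>\<^bsub>C n\<^esub> \<in> cocycles n"
   by (simp add: mem)
  fix f assume f: "f \<in> cocycles n"
  show "k \<odot>\<^bsub>C n\<^esub> f \<in> cocycles n" if "k \<in> carrier K" for k
   using f that linear_mapsD(3)[OF d_linear that, of f] by (simp add: mem)
  fix g assume "g \<in> cocycles n"
  then show "f \<oplus>\<^bsub>C n\<^esub> g \<in> cocycles n"
   using f by (simp add: mem)
qed (auto simp: cocycles_def)

lemma cocycle_module_eq: "Z n = (C n)\<lparr>carrier := cocycles n\<rparr>"
  by (simp add: cocycle_module_def cocycles_def)

lemma cocycle_module: "module K (Z n)"
  unfolding cocycle_module_eq by (rule submodule.submodule_is_module[OF cocycle_submodule cochain_module])

sublocale Z: module K "Z n" for n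
  by (rule cocycle_module)

lemma cocycle_simps [simp]:
  "carrier (Z n) = cocycles n"
  "zero (Z n) = zero (C n)"
  "add (Z n) = add (C n)"
  "smult (Z n) = smult (C n)"
  by (simp_all add: cocycle_module_eq)

lemma minus_cocycle:
  assumes "f \<in> cocycles n" "g \<in> cocycles n"
  shows "f \<ominus>\<^bsub>Z n\<^esub> g = (\<lambda>xs\<in>tup n. f xs \<ominus> g xs)"
proof -
  have g: "f \<in> Ch n" "g \<in> Ch n" "f \<in> carrier (Z n)"
   "g \<in> carrier (Z n)" "f \<in> carrier (C n)" "g \<in> carrier (C n)"
   using assms by (simp_all add: cocycles_def)
  have "f \<ominus>\<^bsub>Z n\<^esub> g \<in> carrier (Z n)"
   using g by (intro Z.M.minus_closed)
  then have h: "f \<ominus>\<^bsub>Z n\<^esub> g \<in> carrier (C n)"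
   by (simp add: cocycles_def)
  have "(f \<ominus>\<^bsub>Z n\<^esub> g) \<oplus>\<^bsub>Z n\<^esub> g = f"
   using g by (simp add: Z.M.minus_eq Z.M.a_assoc Z.M.l_neg del: cocycle_simps)
  then have "(f \<ominus>\<^bsub>Z n\<^esub> g) \<oplus>\<^bsub>C n\<^esub> g = f"
   by simp
  then have "f \<ominus>\<^bsub>Z n\<^esub> g = f \<ominus>\<^bsub>C n\<^esub> g"
   using C.M.add_minus_cancel[OF h g(6)] by simp
  then show ?thesis using minus_cochain_apply g by simp
qed

lemma coboundaries_cocycles: "bd n \<subseteq> cocycles n"
proof (cases n)
  case 0
  then show ?thesis
   using submodule.axioms(1)[OF cocycle_submodule, of 0] subgroup.one_closed
   by (fastforce simp: coboundaries_def)
next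
  case (Suc p)
  then show ?thesis by (auto simp: coboundaries_def cocycles_def d_d d_cochains)
qed

lemma coboundary_submodule: "submodule (bd n) K (Z n)"
proof (cases n)
  case 0
  note [simp del] = cocycle_simps cochain_simps
  have "bd n = {\<zero>\<^bsub>Z n\<^esub>}"
   by (simp add: 0 coboundaries_def cocycle_simps)
  then show ?thesis by (intro Z.submoduleI') auto
next
  case (Suc p)
  interpret d: abelian_group_hom "C p" "C (Suc p)" "\<delta> p"
   by (rule d_hom)
  have sub: "bd n \<subseteq> carrier (Z n)"
   using coboundaries_cocycles by simp
  have eq: "bd n = \<delta> p ` carrier (C p)"
   by (simp add: Suc coboundaries_def)
  note [simp del] = cochain_simps
  show ?thesis
  proof (rule Z.submoduleI'[OF sub])
   show "\<zero>\<^bsub>Z n\<^esub> \<in> bd n"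
    unfolding eq by (rule image_eqI[of _ _ "\<zero>\<^bsub>C p\<^esub>"]) (simp_all add: Suc)
   show "f \<oplus>\<^bsub>Z n\<^esub> g \<in> bd n"
    if "f \<in> bd n" "g \<in> bd n" for f g
   proof -
    obtain f' g' where "f' \<in> carrier (C p)" "f = \<delta> p f'"
     "g' \<in> carrier (C p)" "g = \<delta> p g'"
     using \<open>f \<in> bd n\<close> \<open>g \<in> bd n\<close> unfolding eq by blast
    then show ?thesis
     unfolding eq by (intro image_eqI[of _ _ "f' \<oplus>\<^bsub>C p\<^esub> g'"]) (simp_all add: Suc)
   qed
   show "k \<odot>\<^bsub>Z n\<^esub> f \<in> bd n"
    if "k \<in> carrier K" "f \<in> bd n" for k f
   proof -
    obtain f' where "f' \<in> carrier (C p)" "f = \<delta> p f'"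
     using \<open>f \<in> bd n\<close> unfolding eq by blast
    then show ?thesis
     using \<open>k \<in> carrier K\<close> linear_mapsD(3)[OF d_linear, of k f' p] unfolding eq
     by (intro image_eqI[of _ _ "k \<odot>\<^bsub>C p\<^esub> f'"]) (simp_all add: Suc)
   qed
  qed
qed

sublocale Q: module_quotient K "Z n" "bd n" for n
  by (intro module_quotient.intro cocycle_module coboundary_submodule)

lemma carrier_HH: "carrier (HH K T n) = Q.cl n ` cocycles n"
  unfolding HH_def Q.carrier_quotient by simp

section \<open>The cup product on cohomology\<close>

lemma cup_apply:
  "xs \<in> tup p ==> ys \<in> tup q ==> cochain_cup T p q f g (xs @ ys) = f xs \<otimes> g ys"
  using tuples_appendI[of xs T p ys q] by (simp add: cochain_cup_def tuples_def)

lemma cup_cochains: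
  assumes "f \<in> Ch p" "g \<in> Ch q"
  shows "cochain_cup T p q f g \<in> Ch (p + q)"
proof -
  have "mlin (p + q) (\<lambda>xs. f (take p xs) \<otimes> g (drop p xs))"
   if "mlin p f" for f
   using that
  proof (induction p arbitrary: f)
   case 0
   then show ?case
    using Lin.multilinear_hom[OF mult_left_linear[of "f []"] cochains_multilinear[OF assms(2)]]
    by simp
  next
   case (Suc p)
   have "(\<lambda>x. f (x # take p l) \<otimes> g (drop p l)) \<in> lin"
    if l: "l \<in> tup (p + q)" for l
   proof -
    have "take p l \<in> tup p" "drop p l \<in> tup q"
     using l by (auto simp: tuples_def dest: in_set_takeD in_set_dropD)
    then have "g (drop p l) \<in> U" "(\<lambda>x. f (x # take p l)) \<in> lin"
     using assms(2) Suc.prems cochains_closed by auto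
    then show ?thesis
     using linear_mapsD[of "\<lambda>x. f (x # take p l)" K T T]
     by (intro linear_mapsI) (auto simp: A.l_distr smult_mult_left)
   qed
   moreover have "mlin (p + q) (\<lambda>l. f (x # take p l) \<otimes> g (drop p l))"
    if "x \<in> U" for x
    using Suc.IH[of "\<lambda>l. f (x # l)"] Suc.prems that by simp
   ultimately show ?case by simp
  qed
  from restrict_cochains[OF this[OF cochains_multilinear[OF assms(1)]]] show ?thesis
   by (simp add: cochain_cup_def)
qed

text \<open>The graded Leibniz rule, evaluated at a list cut around one entry \<open>x\<close>. This
  entry ends the arguments of \<open>\<delta> f\<close> in one summand and begins those of
  \<open>\<delta> g\<close> in the other; the term \<open>f(us) x g(vs)\<close> occurs in both with
  opposite signs and cancels.\<close>

lemma d_cup: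
  assumes f: "f \<in> Ch p" and g: "g \<in> Ch q"
   and us: "us \<in> tup p" and x: "x \<in> U" and vs: "vs \<in> tup q"
  shows "\<delta> (p + q) (cochain_cup T p q f g) (us @ x # vs) =
   \<delta> p f (us @ [x]) \<otimes> g vs \<oplus>
   Bar.alt p (f us \<otimes> \<delta> q g (x # vs))"
proof -
  note cf = cochains_funcset[OF f] note cg = cochains_funcset[OF g]
  note cfg = cup_cochains[OF f g]
  let ?\<Phi> = "sw (cochain_cup T p q f g)"
  have \<Phi>: "?\<Phi> \<in> tup (Suc (Suc (p + q))) \<rightarrow> U"
   by (rule sandwich_funcset[OF cochains_funcset[OF cfg]])
  \<comment> \<open>With the bordering unit appended the part after \<open>x\<close> is nonempty, so
    \<open>bar_append\<close> can cut between \<open>x\<close> and \<open>y\<close>; if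
    \<open>vs\<close> is empty, \<open>y\<close> is that unit.\<close>
  obtain y vs' where v: "vs @ [\<one>] = y # vs'" by (cases vs) auto
  have yv: "y \<in> U" "vs' \<in> tup q"
   using tuples_snocI[OF vs, of "\<one>"] by (simp_all add: v)
  have s1: "?\<Phi> (l @ y # vs') = sw f (l @ [\<one>]) \<otimes> g vs" if "l \<in> tup (Suc p)" for l
  proof -
   obtain z ls where l: "l = z # ls" "z \<in> U" "ls \<in> tup p"
    using \<open>l \<in> tup (Suc p)\<close> by (auto simp: in_tuples_Suc)
   have "?\<Phi> (l @ y # vs') = ?\<Phi> (z # (ls @ vs) @ [\<one>])"
    unfolding v[symmetric] l by simp
   also have "\<dots> = z \<otimes> (f ls \<otimes> g vs)"
    using l vs f g by (simp only: sandwich_simp cup_apply) (simp add: cochains_closed)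
   also have "\<dots> = sw f (l @ [\<one>]) \<otimes> g vs"
    using l vs f g by (simp add: cochains_closed A.m_assoc)
   finally show ?thesis .
  qed
  have s2: "?\<Phi> (\<one> # us @ m) = f us \<otimes> sw g (\<one> # m)" if "m \<in> tup (Suc q)" for m
  proof -
   have m: "m = butlast m @ [last m]" "butlast m \<in> tup q" "last m \<in> U"
    using that butlast_closed[OF that] by (auto simp: in_tuples_Suc)
   have "?\<Phi> (\<one> # us @ m) = ?\<Phi> (\<one> # (us @ butlast m) @ [last m])"
    using m(1) by simp
   also have "\<dots> = f us \<otimes> g (butlast m) \<otimes> last m"
    using m us f g by (simp only: sandwich_simp cup_apply) (simp add: cochains_closed)
   also have "\<dots> = f us \<otimes> sw g (\<one> # butlast m @ [last m])"
    using m(2,3) us f g by (simp add: cochains_closed A.m_assoc)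
   finally show ?thesis using m(1) by simp
  qed
  define F where "F = br (\<lambda>l. sw f (l @ [\<one>])) (\<one> # us @ [x])"
  define a where "a = f us"
  define c where "c = g vs"
  define s where "s = sw g (\<one> # (x \<otimes> y) # vs')"
  define b where "b = br (\<lambda>l. sw g (\<one> # x # l)) (y # vs')"
  have ux: "\<one> # us @ [x] \<in> tup (Suc (Suc p))" using us x by (auto intro: tuples_snocI)
  have sf: "(\<lambda>l. sw f (l @ [\<one>])) \<in> tup (Suc p) \<rightarrow> U"
   using sandwich_funcset[OF cf] by (auto intro: tuples_snocI)
  have sg: "(\<lambda>l. sw g (\<one> # x # l)) \<in> tup q \<rightarrow> U"
   using sandwich_funcset[OF cg] x by auto
  have closed: "F \<in> U" "a \<in> U" "c \<in> U" "s \<in> U" "b \<in> U"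
   unfolding F_def a_def c_def s_def b_def
   using us vs f g x yv Bar.bar_closed[OF sf ux] Bar.bar_closed[OF sg, of "y # vs'"]
    funcset_mem[OF sandwich_funcset[OF cg], of "\<one> # (x \<otimes> y) # vs'"]
   by (auto simp: cochains_closed)
  have df: "\<delta> p f (us @ [x]) = F \<oplus> Bar.alt (Suc p) (a \<otimes> x)"
  proof -
   have "\<delta> p f (us @ [x]) = br (sw f) ((\<one> # us) @ x # \<one> # [])"
    using us x by (subst d_apply[OF cf]) (auto intro: tuples_snocI)
   also have "\<dots> = F \<oplus> Bar.alt (Suc p) (sw f (\<one> # us @ [x])) \<ominus> Bar.alt (Suc p) \<zero>"
    using us x sandwich_funcset[OF cf]
    by (subst Bar.bar_append[where p="Suc p" and q=0]) (simp_all add: F_def)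
   finally show ?thesis
    using closed x us f by (simp add: a_def M.minus_eq Bar.alt_def cochains_closed)
  qed
  have dg: "\<delta> q g (x # vs) = x \<otimes> c \<ominus> (s \<ominus> b)"
  proof -
   have "\<delta> q g (x # vs) = br (sw g) (\<one> # x # (vs @ [\<one>]))"
    using vs x by (subst d_apply[OF cg]) auto
   also have "\<dots> = sw g ((\<one> \<otimes> x) # vs @ [\<one>]) \<ominus> (s \<ominus> b)"
    unfolding v by (simp add: s_def b_def)
   finally show ?thesis using x closed(3) by (simp add: c_def)
  qed
  have hd: "f us \<otimes> b = br (\<lambda>l. ?\<Phi> (\<one> # us @ x # l)) (y # vs')"
  proof -
   have "br (\<lambda>l. ?\<Phi> (\<one> # us @ x # l)) (y # vs') =
     br (\<lambda>l. a \<otimes> sw g (\<one> # x # l)) (y # vs')"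
    using x yv s2 by (intro Bar.bar_cong[of q]) (auto simp: a_def)
   also have "\<dots> = a \<otimes> b"
    unfolding b_def using closed yv sg
    by (intro Bar.bar_hom[of _ _ _ q] Bar.abelian_group_G) (auto simp: A.r_distr)
   finally show ?thesis by (simp add: a_def)
  qed
  have hf: "F \<otimes> g vs = br (\<lambda>l. ?\<Phi> (l @ y # vs')) (\<one> # us @ [x])"
  proof -
   have "br (\<lambda>l. ?\<Phi> (l @ y # vs')) (\<one> # us @ [x]) =
     br (\<lambda>l. sw f (l @ [\<one>]) \<otimes> c) (\<one> # us @ [x])"
    using ux s1 by (intro Bar.bar_cong[of "Suc p"]) (auto simp: c_def)
   also have "\<dots> = F \<otimes> c"
    unfolding F_def using closed ux sf
    by (intro Bar.bar_hom[of _ _ _ "Suc p"] Bar.abelian_group_G) (auto simp: A.l_distr)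
   finally show ?thesis by (simp add: c_def)
  qed
  have "\<delta> (p + q) (cochain_cup T p q f g) (us @ x # vs) =
    br ?\<Phi> ((\<one> # us) @ x # y # vs')"
  proof -
   have "us @ x # vs \<in> tup (Suc (p + q))" using us x vs by (auto simp: tuples_def)
   then show ?thesis
    using d_apply[OF cochains_funcset[OF cfg]] by (simp add: v del: bar.simps)
  qed
  also have "\<dots> = F \<otimes> c \<oplus> Bar.alt (Suc p) (a \<otimes> s) \<ominus> Bar.alt (Suc p) (a \<otimes> b)"
   using us x yv \<Phi> hd hf s2[of "(x \<otimes> y) # vs'"]
   by (subst Bar.bar_append[where p="Suc p" and q=q]) (simp_all add: s_def a_def c_def)
  also have "\<dots> = (F \<oplus> Bar.alt (Suc p) (a \<otimes> x)) \<otimes> c \<oplus>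
    Bar.alt p (a \<otimes> (x \<otimes> c \<ominus> (s \<ominus> b)))"
   using closed x unfolding Bar.alt_def
   by (cases "even p")
    (simp_all add: A.l_distr A.r_distr M.minus_eq M.minus_add A.l_minus A.r_minus A.m_assoc M.a_ac
     M.r_neg M.r_neg1 M.r_neg2)
  finally show ?thesis by (simp add: df dg a_def c_def)
qed

lemma tuples_split: "xs \<in> tup (p + q) ==> \<exists>us vs. xs = us @ vs \<and> us \<in> tup p \<and> vs \<in> tup q"
  by (intro exI[of _ "take p xs"] exI[of _ "drop p xs"])
   (auto simp: tuples_def dest: in_set_takeD in_set_dropD)

lemma tuples_split3:
  assumes "xs \<in> tup (Suc (p + q))"
  shows "\<exists>us x vs. xs = us @ x # vs \<and> us \<in> tup p \<and> x \<in> U \<and> vs \<in> tup q"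
proof -
  obtain us ys where "xs = us @ ys" "us \<in> tup p" "ys \<in> tup (Suc q)"
   using tuples_split[of xs p "Suc q"] assms by auto
  then show ?thesis by (auto simp: in_tuples_Suc)
qed

lemma cocycles_d: "f \<in> cocycles n ==> xs \<in> tup (Suc n) ==> \<delta> n f xs = \<zero>"
  by (simp add: cocycles_def)

lemma cocyclesI:
  assumes "f \<in> Ch n" "\<And>xs. xs \<in> tup (Suc n) ==> \<delta> n f xs = \<zero>"
  shows "f \<in> cocycles n"
proof -
  have "\<delta> n f = \<zero>\<^bsub>C (Suc n)\<^esub>"
   by (rule cochains_eqI[of _ "Suc n"]) (use assms zero_cochain in \<open>auto intro: d_cochains\<close>)
  then show ?thesis using assms by (simp add: cocycles_def)
qed

lemma alt_zero [simp]: "Bar.alt p \<zero> = \<zero>"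
  by (simp add: Bar.alt_def)

lemma cup_cocycles:
  assumes "f \<in> cocycles p" "g \<in> cocycles q"
  shows "cochain_cup T p q f g \<in> cocycles (p + q)"
proof (rule cocyclesI)
  note c = assms[THEN cocycles_cochains]
  show "cochain_cup T p q f g \<in> Ch (p + q)" using c by (rule cup_cochains)
  fix xs assume "xs \<in> tup (Suc (p + q))"
  then obtain us x vs where "xs = us @ x # vs" "us \<in> tup p" "x \<in> U" "vs \<in> tup q"
   using tuples_split3 by blast
  then show "\<delta> (p + q) (cochain_cup T p q f g) xs = \<zero>"
   using c assms by (simp add: d_cup cocycles_d tuples_snocI cochains_closed)
qed

lemma zero_coboundary: "(\<lambda>xs\<in>tup n. \<zero>) \<in> bd n"
  using Q.zero_closed[of n] by simp

text \<open>By the Leibniz rule the product of \<open>\<delta> h\<close> with a cocycle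
  \<open>g\<close> is the coboundary of the product of \<open>h\<close> and \<open>g\<close>. In
  degree 0 the only coboundary is zero.\<close>

lemma cup_coboundary_left:
  assumes "b \<in> bd p" "g \<in> cocycles q"
  shows "cochain_cup T p q b g \<in> bd (p + q)"
proof (cases p)
  case 0
  then have "cochain_cup T p q b g = (\<lambda>xs\<in>tup (p + q). \<zero>)"
   using assms cocycles_cochains[OF assms(2)]
   by (auto simp: coboundaries_def cochain_cup_def fun_eq_iff cochains_closed)
  then show ?thesis using zero_coboundary by simp
next
  case (Suc p')
  note c = cocycles_cochains[OF assms(2)]
  obtain h where h: "h \<in> Ch p'" "b = \<delta> p' h"
   using assms by (auto simp: coboundaries_def Suc)
  have "cochain_cup T p q b g = \<delta> (p' + q) (cochain_cup T p' q h g)"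
  proof (rule cochains_eqI[of _ "p + q"])
   fix xs assume "xs \<in> tup (p + q)"
   then obtain us x vs where xs: "xs = us @ x # vs" "us \<in> tup p'" "x \<in> U" "vs \<in> tup q"
    using tuples_split3[of xs p' q] by (auto simp: Suc)
   have ux: "us @ [x] \<in> tup p" using xs by (simp add: Suc tuples_snocI)
   have "cochain_cup T p q b g xs = b (us @ [x]) \<otimes> g vs"
    using cup_apply[OF ux xs(4)] by (simp add: xs)
   moreover have "b (us @ [x]) \<in> U"
    using ux h d_cochains[OF h(1)] by (auto simp: Suc)
   ultimately show "cochain_cup T p q b g xs = \<delta> (p' + q) (cochain_cup T p' q h g) xs"
    using d_cup[OF h(1) c xs(2-4)] xs assms h c by (simp add: cocycles_d cochains_closed)
  next
   show "cochain_cup T p q b g \<in> Ch (p + q)"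
    using c h d_cochains[OF h(1)] by (intro cup_cochains) (auto simp: Suc)
   show "\<delta> (p' + q) (cochain_cup T p' q h g) \<in> Ch (p + q)"
    using cup_cochains[OF h(1) c] d_cochains[of _ "p' + q"] by (simp add: Suc)
  qed
  then show ?thesis
   using cup_cochains[OF h(1) c] by (auto simp: coboundaries_def Suc)
qed

lemma cup_coboundary_right:
  assumes "f \<in> cocycles p" "b \<in> bd q"
  shows "cochain_cup T p q f b \<in> bd (p + q)"
proof (cases q)
  case 0
  then have "cochain_cup T p q f b = (\<lambda>xs\<in>tup (p + q). \<zero>)"
   using assms cocycles_cochains[OF assms(1)]
   by (intro extensionalityI[of _ "tup p"])
    (auto simp: coboundaries_def cochain_cup_def tuples_def cochains_closed)
  then show ?thesis using zero_coboundary by simp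
next
  case (Suc q')
  note c = cocycles_cochains[OF assms(1)]
  obtain h where h: "h \<in> Ch q'" "b = \<delta> q' h"
   using assms by (auto simp: coboundaries_def Suc)
  \<comment> \<open>The sign (-1)^p of the Leibniz rule, moved to the scalars so that coboundaries
    absorb it as a submodule over \<open>K\<close>.\<close>
  define k where "k = (if even p then \<one>\<^bsub>K\<^esub> else \<ominus>\<^bsub>K\<^esub> \<one>\<^bsub>K\<^esub>)"
  have k: "k \<in> carrier K" "\<And>x. x \<in> U ==> k \<odot> x = Bar.alt p x"
   by (auto simp: k_def Bar.alt_def smult_l_minus)
  have fh: "\<delta> (p + q') (cochain_cup T p q' f h) \<in> bd (p + q)"
   using cup_cochains[OF c h(1)] by (auto simp: coboundaries_def Suc)
  have "cochain_cup T p q f b = k \<odot>\<^bsub>C (p + q)\<^esub> \<delta> (p + q') (cochain_cup T p q' f h)"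
   (is "_ = ?r")
  proof (rule cochains_eqI[of _ "p + q"])
   fix xs assume "xs \<in> tup (p + q)"
   then obtain us x vs where xs: "xs = us @ x # vs" "us \<in> tup p" "x \<in> U" "vs \<in> tup q'"
    using tuples_split3[of xs p q'] by (auto simp: Suc)
   have xv: "x # vs \<in> tup q" using xs by (simp add: Suc)
   have "cochain_cup T p q f b xs = f us \<otimes> b (x # vs)"
    using cup_apply[OF xs(2) xv] by (simp add: xs)
   moreover have bc: "b (x # vs) \<in> U"
    using xv h d_cochains[OF h(1)] by (auto simp: Suc)
   moreover have "\<delta> (p + q') (cochain_cup T p q' f h) xs = Bar.alt p (f us \<otimes> b (x # vs))"
    using d_cup[OF c h(1) xs(2-4)] xs assms h c bc by (simp add: cocycles_d cochains_closed tuples_snocI)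
   moreover have "xs \<in> tup (p + q)" by fact
   ultimately show "cochain_cup T p q f b xs = ?r xs"
    using k c xs by (simp add: cochains_closed) (simp add: Bar.alt_def cochains_closed)
  next
   show "cochain_cup T p q f b \<in> Ch (p + q)"
    using c h d_cochains[OF h(1)] by (intro cup_cochains) (auto simp: Suc)
   show "?r \<in> Ch (p + q)"
    using smult_cochain[OF k(1), of _ "p + q"] cup_cochains[OF c h(1)] d_cochains[of _ "p + q'"] by (simp add: Suc)
  qed
  then show ?thesis
   using submodule.smult_closed[OF coboundary_submodule k(1) fh] by simp
qed

text \<open>If one factor is changed by a coboundary and then the other, each difference of products
  is a product with a coboundary. So all cosets in the union that defines the cup product
  coincide.\<close>

lemma HH_cup_cl:
  assumes "f \<in> cocycles p" "g \<in> cocycles q"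
  shows "HH_cup K T p q (Q.cl p f) (Q.cl q g) = Q.cl (p + q) (cochain_cup T p q f g)"
proof -
  have "Q.cl (p + q) (cochain_cup T p q f' g') = Q.cl (p + q) (cochain_cup T p q f g)"
   if "f' \<in> Q.cl p f" "g' \<in> Q.cl q g" for f' g'
  proof -
   have f': "f' \<in> cocycles p" "Q.cl p f' = Q.cl p f" and g': "g' \<in> cocycles q" "Q.cl q g' = Q.cl q g"
    using that assms Q.in_cl_iff by auto
   note c = assms[THEN cocycles_cochains] f'(1)[THEN cocycles_cochains] g'(1)[THEN cocycles_cochains]
   have "f' \<ominus>\<^bsub>Z p\<^esub> f \<in> bd p"
    using f' assms Q.cl_eq_iff by simp
   from cup_coboundary_left[OF this g'(1)]
   have 1: "cochain_cup T p q (f' \<ominus>\<^bsub>Z p\<^esub> f) g' \<in> bd (p + q)" .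
   have "cochain_cup T p q (f' \<ominus>\<^bsub>Z p\<^esub> f) g' =
     cochain_cup T p q f' g' \<ominus>\<^bsub>Z (p + q)\<^esub> cochain_cup T p q f g'"
    unfolding minus_cocycle[OF f'(1) assms(1)] minus_cocycle[OF cup_cocycles[OF f'(1) g'(1)] cup_cocycles[OF assms(1) g'(1)]]
   proof (rule ext)
    fix xs show "cochain_cup T p q (\<lambda>xs\<in>tup p. f' xs \<ominus> f xs) g' xs =
     (\<lambda>xs\<in>tup (p + q). cochain_cup T p q f' g' xs \<ominus> cochain_cup T p q f g' xs) xs"
    proof (cases "xs \<in> tup (p + q)")
     case True
     then obtain us vs where xs: "xs = us @ vs" "us \<in> tup p" "vs \<in> tup q"
      using tuples_split by blast
     then show ?thesis
      using c True by (simp add: cup_apply cochains_closed A.l_distr A.l_minus M.minus_eq)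
    qed (simp add: cochain_cup_def)
   qed
   with 1 have 1: "Q.cl (p + q) (cochain_cup T p q f' g') = Q.cl (p + q) (cochain_cup T p q f g')"
    using cup_cocycles f' g' assms by (simp add: Q.cl_eq_iff)
   have "g' \<ominus>\<^bsub>Z q\<^esub> g \<in> bd q"
    using g' assms Q.cl_eq_iff by simp
   from cup_coboundary_right[OF assms(1) this]
   have 2: "cochain_cup T p q f (g' \<ominus>\<^bsub>Z q\<^esub> g) \<in> bd (p + q)" .
   have "cochain_cup T p q f (g' \<ominus>\<^bsub>Z q\<^esub> g) =
     cochain_cup T p q f g' \<ominus>\<^bsub>Z (p + q)\<^esub> cochain_cup T p q f g"
    unfolding minus_cocycle[OF g'(1) assms(2)] minus_cocycle[OF cup_cocycles[OF assms(1) g'(1)] cup_cocycles[OF assms]]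
   proof (rule ext)
    fix xs show "cochain_cup T p q f (\<lambda>xs\<in>tup q. g' xs \<ominus> g xs) xs =
     (\<lambda>xs\<in>tup (p + q). cochain_cup T p q f g' xs \<ominus> cochain_cup T p q f g xs) xs"
    proof (cases "xs \<in> tup (p + q)")
     case True
     then obtain us vs where xs: "xs = us @ vs" "us \<in> tup p" "vs \<in> tup q"
      using tuples_split by blast
     then show ?thesis
      using c True by (simp add: cup_apply cochains_closed A.r_distr A.r_minus M.minus_eq)
    qed (simp add: cochain_cup_def)
   qed
   with 2 have "Q.cl (p + q) (cochain_cup T p q f g') = Q.cl (p + q) (cochain_cup T p q f g)"
    using cup_cocycles g' assms by (simp add: Q.cl_eq_iff)
   with 1 show ?thesis by simp
  qed
  then have "(\<Union>f'\<in>Q.cl p f. \<Union>g'\<in>Q.cl q g. Q.cl (p + q) (cochain_cup T p q f' g')) =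
    (\<Union>f'\<in>Q.cl p f. \<Union>g'\<in>Q.cl q g. Q.cl (p + q) (cochain_cup T p q f g))"
   by (intro SUP_cong refl)
  moreover have "f \<in> Q.cl p f" "g \<in> Q.cl q g" using assms by (simp_all add: Q.in_cl_iff)
  then have "Q.cl p f \<noteq> {}" "Q.cl q g \<noteq> {}" by blast+
  moreover have "HH_cup K T p q (Q.cl p f) (Q.cl q g) =
    (\<Union>f'\<in>Q.cl p f. \<Union>g'\<in>Q.cl q g. Q.cl (p + q) (cochain_cup T p q f' g'))"
   by (simp add: HH_cup_def Q.cl_def)
  ultimately show ?thesis by simp
qed

end

section \<open>Homotopies from dual bases\<close>

lemma (in linear_context) finsum_linear_maps:
  "(\<And>i. i \<in> I ==> f i \<in> linear_maps K S G) ==> (\<lambda>x. \<Oplus>\<^bsub>G\<^esub>i\<in>I. f i x) \<in> linear_maps K S G"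
proof (induction I rule: infinite_finite_induct)
  case (insert i I)
  have "(\<lambda>x. f i x \<oplus>\<^bsub>G\<^esub> (\<Oplus>\<^bsub>G\<^esub>i\<in>I. f i x)) \<in> linear_maps K S G"
   by (intro add_linear_maps insert) (auto simp: insert)
  then show ?case
   by (rule linear_cong)
    (use insert in \<open>auto intro!: G.finsum_insert[symmetric] dest: linear_mapsD(1)\<close>)
qed (simp_all add: zero_linear_map)

text \<open>A two-sided ideal \<open>N\<close> with elements \<open>w\<^sub>i\<close> of \<open>N\<close> and coordinates \<open>c\<^sub>i\<close>, with values in \<open>T\<close>,
  such that \<open>n = (\<Sum>i. c\<^sub>i(n) w\<^sub>i)\<close> is a locally finite sum. The coordinates are linear for the left
  action of \<open>T\<close> only; expanding repeatedly the leading entry of a list in \<open>W\<close> is a homotopy that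
  measures how far they are from being compatible with the right action.\<close>

locale prism = hochschild K T
  for K :: "'k ring" and T :: "('k, 't) module" (structure) +
  fixes J :: "'i set" and c :: "'i => 't => 't" and w :: "'i => 't"
   and N :: "'t set" and R :: "'t set"
  assumes N_subset: "N \<subseteq> U"
   and N_zero: "\<zero> \<in> N"
   and N_add: "n \<in> N ==> n' \<in> N ==> n \<oplus> n' \<in> N"
   and N_left: "t \<in> U ==> n \<in> N ==> t \<otimes> n \<in> N"
   and N_right: "n \<in> N ==> t \<in> U ==> n \<otimes> t \<in> N"
   and R_subset: "R \<subseteq> U"
   and w_N: "i \<in> J ==> w i \<in> N"
   and c_R: "i \<in> J ==> t \<in> U ==> c i t \<in> R"
   and c_add: "i \<in> J ==> n \<in> N ==> n' \<in> N ==> c i (n \<oplus> n') = c i n \<oplus> c i n'"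
   and c_left: "i \<in> J ==> t \<in> U ==> n \<in> N ==> c i (t \<otimes> n) = t \<otimes> c i n"
   and c_finite: "t \<in> U ==> finite {i \<in> J. c i t \<noteq> \<zero>}"
   and expand: "n \<in> N ==> (\<Oplus>i\<in>{i \<in> J. c i n \<noteq> \<zero>}. c i n \<otimes> w i) = n"
begin

text \<open>The element \<open>n\<close> is expanded into the sum of the tensors of
  \<open>c i n\<close> with \<open>w i\<close>, and \<open>G\<close> is applied to them. The sum
  runs over the nonzero coordinates only, since \<open>J\<close> may be infinite.\<close>

definition S :: "'t => ('t => 't => 't) => 't" where
  "S n G = (\<Oplus>i\<in>{i \<in> J. c i n \<noteq> \<zero>}. G (c i n) (w i))"

lemma N_carrier [simp, intro]: "n \<in> N ==> n \<in> U"
  using N_subset by blast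

lemma R_carrier [simp, intro]: "r \<in> R ==> r \<in> U"
  using R_subset by blast

lemma c_carrier [simp, intro]: "i \<in> J ==> t \<in> U ==> c i t \<in> U"
  using c_R by blast

lemma S_closed:
  assumes "n \<in> U" "\<And>a v. a \<in> R ==> v \<in> N ==> G a v \<in> U"
  shows "S n G \<in> U"
  unfolding S_def by (intro M.finsum_closed) (auto simp: assms c_R w_N)

lemma S_cong:
  assumes "n \<in> U" "\<And>a v. a \<in> R ==> v \<in> N ==> G' a v \<in> U"
   and "\<And>a v. a \<in> R ==> v \<in> N ==> G a v = G' a v"
  shows "S n G = S n G'"
  unfolding S_def by (intro M.finsum_cong') (auto simp: assms c_R w_N)

lemma S_hom:
  assumes "n \<in> U" "\<And>a v. a \<in> R ==> v \<in> N ==> G a v \<in> U"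
   and "h \<in> lin"
  shows "h (S n G) = S n (\<lambda>a v. h (G a v))"
proof -
  interpret h: abelian_group_hom T T h using assms(3) by (rule hom_of_linear)
  show ?thesis
   unfolding S_def by (intro h.hom_finsum) (auto simp: assms c_R w_N)
qed

lemma S_add:
  assumes "n \<in> U" "\<And>a v. a \<in> R ==> v \<in> N ==> G a v \<in> U"
   "\<And>a v. a \<in> R ==> v \<in> N ==> G' a v \<in> U"
  shows "S n (\<lambda>a v. G a v \<oplus> G' a v) = S n G \<oplus> S n G'"
  unfolding S_def by (intro M.finsum_addf) (auto simp: assms c_R w_N)

lemma S_minus:
  assumes "n \<in> U" "\<And>a v. a \<in> R ==> v \<in> N ==> G a v \<in> U"
   "\<And>a v. a \<in> R ==> v \<in> N ==> G' a v \<in> U"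
  shows "S n (\<lambda>a v. G a v \<ominus> G' a v) = S n G \<ominus> S n G'"
proof -
  interpret h: abelian_group_hom T T "\<lambda>x. \<ominus> x"
   by (intro abelian_group_hom_of_additive Bar.abelian_group_G) (auto simp: M.minus_add)
  have "S n (\<lambda>a v. \<ominus> G' a v) = \<ominus> S n G'"
   unfolding S_def by (intro h.hom_finsum[symmetric]) (auto simp: assms c_R w_N)
  then show ?thesis
   unfolding M.minus_eq using assms by (subst S_add) auto
qed

lemma S_zero [simp]: "S n (\<lambda>a v. \<zero>) = \<zero>"
  by (simp add: S_def)

text \<open>The range of summation of \<open>S\<close> depends on \<open>n\<close>. Enlarging it to
  a finite set common to several elements is what makes \<open>S\<close> additive and left linear in
  \<open>n\<close>.\<close>

lemma S_superset:
  assumes "n \<in> U" "finite F" "{i \<in> J. c i n \<noteq> \<zero>} \<subseteq> F" "F \<subseteq> J"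
   and "\<And>a v. a \<in> U ==> v \<in> N ==> G a v \<in> U"
   and "\<And>v. v \<in> N ==> G \<zero> v = \<zero>"
  shows "S n G = (\<Oplus>i\<in>F. G (c i n) (w i))"
  unfolding S_def using assms w_N
  by (intro M.add.finprod_mono_neutral_cong_left) auto

lemma zero_of_additive:
  assumes "g \<in> U \<rightarrow> U" "g (\<zero> \<oplus> \<zero>) = g \<zero> \<oplus> g \<zero>"
  shows "g \<zero> = \<zero>"
proof -
  have "g \<zero> \<in> U" using assms(1) by auto
  then show ?thesis using assms(2) by (metis M.add.r_cancel_one M.l_zero M.zero_closed)
qed

lemma S_add_first:
  assumes n: "n \<in> N" "n' \<in> N"
   and G: "\<And>a v. a \<in> U ==> v \<in> N ==> G a v \<in> U"
   and add: "\<And>a a' v. a \<in> U ==> a' \<in> U ==> v \<in> N ==> G (a \<oplus> a') v = G a v \<oplus> G a' v"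
  shows "S (n \<oplus> n') G = S n G \<oplus> S n' G"
proof -
  let ?F = "{i \<in> J. c i n \<noteq> \<zero>} \<union> {i \<in> J. c i n' \<noteq> \<zero>}"
  have F: "finite ?F" using c_finite n by auto
  have z: "G \<zero> v = \<zero>" if "v \<in> N" for v
   using that G add[of "\<zero>" "\<zero>" v] by (intro zero_of_additive) auto
  have "S (n \<oplus> n') G = (\<Oplus>i\<in>?F. G (c i (n \<oplus> n')) (w i))"
   using n F z G by (intro S_superset) (auto simp: c_add)
  also have "\<dots> = (\<Oplus>i\<in>?F. G (c i n) (w i) \<oplus> G (c i n') (w i))"
   using n G w_N by (intro M.finsum_cong') (auto simp: c_add add)
  also have "\<dots> = (\<Oplus>i\<in>?F. G (c i n) (w i)) \<oplus> (\<Oplus>i\<in>?F. G (c i n') (w i))"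
   using n G w_N by (intro M.finsum_addf) auto
  also have "(\<Oplus>i\<in>?F. G (c i n) (w i)) = S n G"
   using n F z G by (intro S_superset[symmetric]) auto
  also have "(\<Oplus>i\<in>?F. G (c i n') (w i)) = S n' G"
   using n F z G by (intro S_superset[symmetric]) auto
  finally show ?thesis .
qed

lemma S_left:
  assumes n: "n \<in> N" "t \<in> U"
   and G: "\<And>a v. a \<in> U ==> v \<in> N ==> G a v \<in> U"
   and add: "\<And>a a' v. a \<in> U ==> a' \<in> U ==> v \<in> N ==> G (a \<oplus> a') v = G a v \<oplus> G a' v"
  shows "S (t \<otimes> n) G = S n (\<lambda>a v. G (t \<otimes> a) v)"
proof -
  let ?F = "{i \<in> J. c i n \<noteq> \<zero>}"
  have F: "finite ?F" using c_finite n by auto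
  have z: "G \<zero> v = \<zero>" if "v \<in> N" for v
   using that G add[of "\<zero>" "\<zero>" v] by (intro zero_of_additive) auto
  have "S (t \<otimes> n) G = (\<Oplus>i\<in>?F. G (c i (t \<otimes> n)) (w i))"
   using n F z G by (intro S_superset) (auto simp: c_left)
  also have "\<dots> = S n (\<lambda>a v. G (t \<otimes> a) v)"
   unfolding S_def using n G w_N by (intro M.finsum_cong') (auto simp: c_left)
  finally show ?thesis .
qed

text \<open>The terms \<open>c i n\<close> times \<open>w i\<close> add up to \<open>n\<close>. As
  \<open>h\<close> is additive on \<open>N\<close> only, the partial sums are kept in
  \<open>N\<close> along the induction.\<close>

lemma S_mult:
  assumes n: "n \<in> N" and h: "\<And>n. n \<in> N ==> h n \<in> U"
   and add: "\<And>n n'. n \<in> N ==> n' \<in> N ==> h (n \<oplus> n') = h n \<oplus> h n'"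
  shows "S n (\<lambda>a v. h (a \<otimes> v)) = h n"
proof -
  have h0: "h \<zero> = \<zero>"
   using h[OF N_zero] add[OF N_zero N_zero] by (metis M.add.r_cancel_one M.l_zero M.zero_closed)
  have "h (\<Oplus>i\<in>F. c i n \<otimes> w i) = (\<Oplus>i\<in>F. h (c i n \<otimes> w i)) \<and> (\<Oplus>i\<in>F. c i n \<otimes> w i) \<in> N"
   if "finite F" "F \<subseteq> J" for F
   using that
  proof (induction F)
   case (insert i F)
   have "h (c j n \<otimes> w j) \<in> U" "c j n \<otimes> w j \<in> N" if "j \<in> insert i F" for j
    using insert n that by (auto intro!: h N_left w_N)
   then show ?case using insert n by (auto simp: Pi_def add intro!: N_add)
  qed (simp_all add: h0 N_zero)
  from this[OF c_finite, of n] show ?thesis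
   using n by (simp add: S_def expand)
qed

text \<open>Written out, an alternating sum of values
  \<open>H(c(n), c(w x_1), ..., w, x_j, ..., x_k)\<close>: the entries are expanded up to some
  position, where the basis element is left as an entry of its own. So \<open>W H\<close> takes one
  argument fewer than \<open>H\<close>, and it vanishes on a single entry because a basis element
  must be followed by some \<open>x_j\<close>.\<close>

fun W :: "('t list => 't) => 't list => 't" where
  "W H (n # x # xs) =
   S n (\<lambda>a v. H (a # v # x # xs) \<ominus> W (\<lambda>l. H (a # l)) ((v \<otimes> x) # xs))"
| "W H [n] = \<zero>"
| "W H [] = \<zero>"

text \<open>The expansion carried to the end: the value of \<open>H\<close> at
  \<open>c(n), c(w x_1), ..., w x_k\<close>. All entries but the last are coordinates, and the last
  one stays in \<open>N\<close>.\<close>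

fun V :: "('t list => 't) => 't list => 't" where
  "V H (n # x # xs) = S n (\<lambda>a v. V (\<lambda>l. H (a # l)) ((v \<otimes> x) # xs))"
| "V H [n] = H [n]"
| "V H [] = H []"

lemma W_closed:
  assumes "H \<in> tup (Suc (Suc k)) \<rightarrow> U" "l \<in> tup (Suc k)"
  shows "W H l \<in> U"
  using assms
proof (induction k arbitrary: H l)
  case 0
  then show ?case by (auto simp: in_tuples_Suc)
next
  case (Suc k)
  then obtain n x ys where l: "l = n # x # ys" "n \<in> U" "x \<in> U" "ys \<in> tup k"
   by (auto simp: in_tuples_Suc)
  have "W (\<lambda>l. H (a # l)) ((v \<otimes> x) # ys) \<in> U" if "a \<in> U" "v \<in> N" for a v
   using Suc.prems l that by (intro Suc.IH) (auto simp: Pi_def)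
  then show ?case
   using Suc.prems l by (auto intro!: S_closed simp: Pi_def)
qed

lemma W_cong:
  assumes "\<And>l. l \<in> tup (Suc (Suc k)) ==> H l = \<psi> l" "\<psi> \<in> tup (Suc (Suc k)) \<rightarrow> U"
   "l \<in> tup (Suc k)"
  shows "W H l = W \<psi> l"
  using assms
proof (induction k arbitrary: H \<psi> l)
  case 0
  then show ?case by (auto simp: in_tuples_Suc)
next
  case (Suc k)
  then obtain n x ys where l: "l = n # x # ys" "n \<in> U" "x \<in> U" "ys \<in> tup k"
   by (auto simp: in_tuples_Suc)
  have 1: "W (\<lambda>l. H (a # l)) ((v \<otimes> x) # ys) = W (\<lambda>l. \<psi> (a # l)) ((v \<otimes> x) # ys)"
   if "a \<in> U" "v \<in> N" for a v
   using Suc.prems l that by (intro Suc.IH) (auto simp: Pi_def)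
  have 2: "W (\<lambda>l. \<psi> (a # l)) ((v \<otimes> x) # ys) \<in> U" if "a \<in> U" "v \<in> N" for a v
   using Suc.prems l that by (intro W_closed[of _ k]) (auto simp: Pi_def)
  show ?case
   using Suc.prems l 1 2 by (auto intro!: S_cong simp: Pi_def)
qed

lemma W_hom:
  assumes "H \<in> tup (Suc (Suc k)) \<rightarrow> U" "l \<in> tup (Suc k)" "h \<in> lin"
  shows "W (\<lambda>l. h (H l)) l = h (W H l)"
  using assms(1,2)
proof (induction k arbitrary: H l)
  interpret h: abelian_group_hom T T h using assms(3) by (rule hom_of_linear)
  {
   case 0
   then show ?case by (auto simp: in_tuples_Suc)
  next
   case (Suc k)
   then obtain n x ys where l: "l = n # x # ys" "n \<in> U" "x \<in> U" "ys \<in> tup k"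
    by (auto simp: in_tuples_Suc)
   have 1: "W (\<lambda>l. h (H (a # l))) ((v \<otimes> x) # ys) = h (W (\<lambda>l. H (a # l)) ((v \<otimes> x) # ys))"
    if "a \<in> U" "v \<in> N" for a v
    using Suc.prems l that by (intro Suc.IH) (auto simp: Pi_def)
   have 2: "W (\<lambda>l. H (a # l)) ((v \<otimes> x) # ys) \<in> U" if "a \<in> U" "v \<in> N" for a v
    using Suc.prems l that by (intro W_closed[of _ k]) (auto simp: Pi_def)
   show ?case
    using Suc.prems l 1 2 assms(3) unfolding l W.simps
    by (subst S_hom) (auto intro!: S_cong simp: Pi_def)
  }
qed

lemma W_add:
  assumes "H \<in> tup (Suc (Suc k)) \<rightarrow> U" "\<psi> \<in> tup (Suc (Suc k)) \<rightarrow> U"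
   "l \<in> tup (Suc k)"
  shows "W (\<lambda>l. H l \<oplus> \<psi> l) l = W H l \<oplus> W \<psi> l"
  using assms
proof (induction k arbitrary: H \<psi> l)
  case 0
  then show ?case by (auto simp: in_tuples_Suc)
next
  case (Suc k)
  then obtain n x ys where l: "l = n # x # ys" "n \<in> U" "x \<in> U" "ys \<in> tup k"
   by (auto simp: in_tuples_Suc)
  have 1: "W (\<lambda>l. H (a # l) \<oplus> \<psi> (a # l)) ((v \<otimes> x) # ys) =
    W (\<lambda>l. H (a # l)) ((v \<otimes> x) # ys) \<oplus> W (\<lambda>l. \<psi> (a # l)) ((v \<otimes> x) # ys)"
   if "a \<in> U" "v \<in> N" for a v
   using Suc.prems l that by (intro Suc.IH) (auto simp: Pi_def)
  have 2: "W (\<lambda>l. H (a # l)) ((v \<otimes> x) # ys) \<in> U"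
   "W (\<lambda>l. \<psi> (a # l)) ((v \<otimes> x) # ys) \<in> U" if "a \<in> U" "v \<in> N" for a v
   using Suc.prems l that by (intro W_closed[of _ k]; auto simp: Pi_def)+
  have 3: "H (a # v # x # ys) \<in> U" "\<psi> (a # v # x # ys) \<in> U"
   if "a \<in> U" "v \<in> N" for a v
   using Suc.prems l that by (auto simp: Pi_def)
  have "S n (\<lambda>a v. H (a # v # x # ys) \<oplus> \<psi> (a # v # x # ys) \<ominus>
      W (\<lambda>l. H (a # l) \<oplus> \<psi> (a # l)) ((v \<otimes> x) # ys)) =
    S n (\<lambda>a v. (H (a # v # x # ys) \<ominus> W (\<lambda>l. H (a # l)) ((v \<otimes> x) # ys)) \<oplus>
     (\<psi> (a # v # x # ys) \<ominus> W (\<lambda>l. \<psi> (a # l)) ((v \<otimes> x) # ys)))"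
   using l 1 2 3 by (intro S_cong) (auto simp: M.minus_eq M.minus_add M.a_ac)
  then show ?case
   unfolding l W.simps using l 2 3 by (subst S_add[symmetric]) auto
qed

lemma W_minus:
  assumes "H \<in> tup (Suc (Suc k)) \<rightarrow> U" "\<psi> \<in> tup (Suc (Suc k)) \<rightarrow> U"
   "l \<in> tup (Suc k)"
  shows "W (\<lambda>l. H l \<ominus> \<psi> l) l = W H l \<ominus> W \<psi> l"
proof -
  have h: "(\<lambda>x. \<ominus> x) \<in> lin"
   by (intro linear_mapsI) (auto simp: M.minus_add smult_r_minus)
  have "W (\<lambda>l. H l \<ominus> \<psi> l) l = W H l \<oplus> W (\<lambda>l. \<ominus> \<psi> l) l"
   unfolding M.minus_eq using assms by (intro W_add) (auto simp: Pi_def)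
  then show ?thesis
   using W_hom[OF assms(2,3) h] by (simp add: M.minus_eq)
qed

lemma W_zero [simp]: "W (\<lambda>l. \<zero>) l = \<zero>"
proof (induction "length l" arbitrary: l)
  case (Suc k)
  then obtain n l' where l: "l = n # l'" by (cases l) auto
  then show ?case
   using Suc by (cases l') (simp_all add: M.minus_eq)
qed simp

lemma multilinear_add_hd:
  assumes "mlin (Suc k) H" "a \<in> U" "b \<in> U" "l \<in> tup k"
  shows "H ((a \<oplus> b) # l) = H (a # l) \<oplus> H (b # l)"
  using linear_mapsD(2)[OF Lin.multilinear_linear[OF assms(1,4)]] assms by simp

text \<open>An expansion may be rewritten after an addition or a left multiplication only if the
  expanded map is additive in the coordinate; this is the condition for the summand of
  \<open>W\<close>.\<close>

lemma W_first_additive: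
  assumes H: "mlin (Suc (Suc (Suc k))) H" and x: "x \<in> U" "ys \<in> tup k"
   and av: "a \<in> U" "a' \<in> U" "v \<in> N"
  shows "H ((a \<oplus> a') # v # x # ys) \<ominus> W (\<lambda>l. H ((a \<oplus> a') # l)) ((v \<otimes> x) # ys) =
   (H (a # v # x # ys) \<ominus> W (\<lambda>l. H (a # l)) ((v \<otimes> x) # ys)) \<oplus>
   (H (a' # v # x # ys) \<ominus> W (\<lambda>l. H (a' # l)) ((v \<otimes> x) # ys))"
   (is "?p \<ominus> ?w = (?p1 \<ominus> ?w1) \<oplus> (?p2 \<ominus> ?w2)")
proof -
  have f: "(\<lambda>l. H (a # l)) \<in> tup (Suc (Suc k)) \<rightarrow> U" if "a \<in> U" for a
   using Lin.multilinear_funcset[OF Lin.multilinear_Cons[OF H that]] .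
  have l: "(v \<otimes> x) # ys \<in> tup (Suc k)" using x av by auto
  have "?w = W (\<lambda>l. H (a # l) \<oplus> H (a' # l)) ((v \<otimes> x) # ys)"
   using multilinear_add_hd[OF H av(1,2)] l f av
   by (intro W_cong[of k]) (auto simp: Pi_def)
  also have "\<dots> = ?w1 \<oplus> ?w2"
   using f av l by (intro W_add) auto
  finally have 1: "?w = ?w1 \<oplus> ?w2" .
  have 2: "?p = ?p1 \<oplus> ?p2" using x av by (intro multilinear_add_hd[OF H]) auto
  have "?w1 \<in> U" "?w2 \<in> U" "?p1 \<in> U" "?p2 \<in> U"
   using av x funcset_mem[OF f, of a "v # x # ys"] funcset_mem[OF f, of a' "v # x # ys"]
   by (auto intro!: W_closed[OF f l])
  then show ?thesis using 1 2 by (simp add: M.minus_eq M.minus_add M.a_ac)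
qed

lemma W_first_closed:
  assumes H: "mlin (Suc (Suc (Suc k))) H" and x: "x \<in> U" "ys \<in> tup k"
   and av: "a \<in> U" "v \<in> N"
  shows "H (a # v # x # ys) \<ominus> W (\<lambda>l. H (a # l)) ((v \<otimes> x) # ys) \<in> U"
proof -
  have f: "(\<lambda>l. H (a # l)) \<in> tup (Suc (Suc k)) \<rightarrow> U"
   using Lin.multilinear_funcset[OF Lin.multilinear_Cons[OF H av(1)]] .
  show ?thesis
   using W_closed[OF f, of "(v \<otimes> x) # ys"] funcset_mem[OF f, of "v # x # ys"] x av by auto
qed

text \<open>The coordinates are left linear, so a left factor of the leading entry becomes a left
  factor of its coordinates.\<close>

lemma W_left:
  assumes "mlin (Suc (Suc k)) H" "t \<in> U" "n \<in> N" "l \<in> tup k"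
  shows "W (\<lambda>l. H ((t \<otimes> hd l) # tl l)) (n # l) = W H ((t \<otimes> n) # l)"
proof (cases l)
  case (Cons x ys)
  then obtain k' where k: "k = Suc k'" using assms by (cases k) auto
  then have x: "x \<in> U" "ys \<in> tup k'" using assms Cons by auto
  have H: "mlin (Suc (Suc (Suc k'))) H" using assms k by simp
  show ?thesis
   unfolding Cons W.simps
   using S_left[OF assms(3,2) W_first_closed[OF H x] W_first_additive[OF H x]] by simp
qed (simp)

lemma W_add_hd:
  assumes "mlin (Suc (Suc k)) H" "n \<in> N" "n' \<in> N" "l \<in> tup k"
  shows "W H ((n \<oplus> n') # l) = W H (n # l) \<oplus> W H (n' # l)"
proof (cases l)
  case (Cons x ys)
  then obtain k' where k: "k = Suc k'" using assms by (cases k) auto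
  then have x: "x \<in> U" "ys \<in> tup k'" using assms Cons by auto
  have H: "mlin (Suc (Suc (Suc k'))) H" using assms k by simp
  show ?thesis
   unfolding Cons W.simps
   using S_add_first[OF assms(2,3) W_first_closed[OF H x] W_first_additive[OF H x]] by simp
qed (simp)

lemma N_smult: "k \<in> carrier K ==> n \<in> N ==> k \<odot> n \<in> N"
  and smult_eq_mult: "k \<in> carrier K ==> t \<in> U ==> k \<odot> t = (k \<odot> \<one>) \<otimes> t"
proof -
  show e: "k \<odot> t = (k \<odot> \<one>) \<otimes> t" if "k \<in> carrier K" "t \<in> U" for k t
   using that by (simp add: smult_mult_left)
  show "k \<odot> n \<in> N" if "k \<in> carrier K" "n \<in> N"
   using that by (subst e) (auto intro: N_left)
qed

text \<open>The coordinates are assumed to be additive and left linear over \<open>T\<close>;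
  linearity over \<open>K\<close> follows by letting \<open>r\<close> act as the left factor
  \<open>r 1\<close>.\<close>

lemma W_smult_hd:
  assumes H: "mlin (Suc (Suc k)) H" and n: "n \<in> N" "l \<in> tup k" and r: "r \<in> carrier K"
  shows "W H ((r \<odot> n) # l) = r \<odot> W H (n # l)"
proof -
  have nl: "n # l \<in> tup (Suc k)" using n by auto
  have f: "H \<in> tup (Suc (Suc k)) \<rightarrow> U" using H by (rule Lin.multilinear_funcset)
  have "W H ((r \<odot> n) # l) = W H (((r \<odot> \<one>) \<otimes> n) # l)"
   using n r smult_eq_mult[of r n] by simp
  also have "\<dots> = W (\<lambda>l. H (((r \<odot> \<one>) \<otimes> hd l) # tl l)) (n # l)"
   using n r by (intro W_left[OF H, symmetric]) auto
  also have "\<dots> = W (\<lambda>l. r \<odot> H l) (n # l)"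
   using linear_mapsD(3)[OF Lin.multilinear_linear[OF H]] f r nl
   by (intro W_cong[of k]) (auto simp: in_tuples_Suc Pi_def smult_mult_left)
  also have "\<dots> = r \<odot> W H (n # l)"
   using f nl r by (intro W_hom linear_mapsI) (auto simp: smult_r_distr smult_assoc1[symmetric] R.m_comm)
  finally show ?thesis .
qed

lemma W_multilinear:
  assumes "mlin (Suc (Suc k)) H" "n \<in> N"
  shows "mlin k (\<lambda>l. W H (n # l))"
  using assms
proof (induction k arbitrary: n H)
  case (Suc k)
  have Ha: "mlin (Suc (Suc k)) (\<lambda>l. H (a # l))" if "a \<in> U" for a
   using Lin.multilinear_Cons[OF Suc.prems(1) that] .
  show ?case
   unfolding multilinear.simps(2)[of K T T k]
  proof (intro conjI ballI)
   fix x assume x: "x \<in> U"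
   show "mlin k (\<lambda>l. W H (n # x # l))"
    unfolding W.simps S_def
   proof (intro Lin.multilinear_finsum Lin.multilinear_minus)
    fix i assume "i \<in> {i \<in> J. c i n \<noteq> \<zero>}"
    then have i: "c i n \<in> U" "w i \<in> N" using w_N Suc.prems(2) by auto
    then show "mlin k (\<lambda>l. H (c i n # w i # x # l))"
     using Ha[OF i(1)] x by auto
    show "mlin k (\<lambda>l. W (\<lambda>l. H (c i n # l)) ((w i \<otimes> x) # l))"
     using i x by (intro Suc.IH Ha N_right) auto
   qed
  next
   fix l assume l: "l \<in> tup k"
   show "(\<lambda>x. W H (n # x # l)) \<in> lin"
    unfolding W.simps S_def
   proof (intro Lin.finsum_linear_maps Lin.minus_linear_maps)
    fix i assume "i \<in> {i \<in> J. c i n \<noteq> \<zero>}"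
    then have i: "c i n \<in> U" "w i \<in> N" using w_N Suc.prems(2) by auto
    then show "(\<lambda>x. H (c i n # w i # x # l)) \<in> lin"
     using Ha[OF i(1)] l by auto
    have f: "(\<lambda>l. H (c i n # l)) \<in> tup (Suc (Suc k)) \<rightarrow> U"
     by (rule Lin.multilinear_funcset[OF Ha[OF i(1)]])
    show "(\<lambda>x. W (\<lambda>l. H (c i n # l)) ((w i \<otimes> x) # l)) \<in> lin"
     using i l f W_add_hd[OF Ha[OF i(1)]] W_smult_hd[OF Ha[OF i(1)]] N_right[OF i(2)]
     by (intro linear_mapsI W_closed[of _ k]) (auto simp: A.r_distr smult_mult_right)
   qed
  qed
qed simp

text \<open>Every surviving term passes the last entry on unchanged: the term in which it would be
  multiplied by a basis element is \<open>W\<close> of a single entry, which is zero. So a linear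
  dependence of \<open>H\<close> on its last argument is inherited.\<close>

lemma W_last:
  assumes "\<And>l. l \<in> tup (Suc (Suc k)) ==> H (l @ [z]) = h (H (l @ [z']))"
   and "\<And>l. l \<in> tup (Suc (Suc k)) ==> H (l @ [z']) \<in> U"
   and z: "z \<in> U" "z' \<in> U" and h: "h \<in> lin"
   and "n \<in> U" "xs \<in> tup k"
  shows "W H (n # xs @ [z]) = h (W H (n # xs @ [z'])) \<and> W H (n # xs @ [z']) \<in> U"
proof -
  interpret h: abelian_group_hom T T h using h by (rule hom_of_linear)
  show ?thesis
   using assms(1,2,6,7)
  proof (induction k arbitrary: H n xs)
   case 0
   have [simp]: "xs = []" using 0 by simp
   have 1: "H [a, v, z] = h (H [a, v, z'])" "H [a, v, z'] \<in> U" if "a \<in> R" "v \<in> N" for a v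
    using 0(1,2)[of "[a, v]"] that by auto
   have "S n (\<lambda>a v. H [a, v, z] \<ominus> \<zero>) = S n (\<lambda>a v. h (H [a, v, z'] \<ominus> \<zero>))"
    using 0 1 by (intro S_cong) auto
   then show ?case
    using 0 1 by (auto simp: S_hom[OF _ _ h] intro!: S_closed)
  next
   case (Suc k)
   then obtain x ys where l: "xs = x # ys" "x \<in> U" "ys \<in> tup k"
    by (auto simp: in_tuples_Suc)
   have 1: "H (a # v # x # ys @ [z]) = h (H (a # v # x # ys @ [z']))"
     "H (a # v # x # ys @ [z']) \<in> U" if "a \<in> R" "v \<in> N" for a v
    using Suc.prems(1,2)[of "a # v # x # ys"] that l by auto
   have 2: "W (\<lambda>l. H (a # l)) ((v \<otimes> x) # ys @ [z]) = h (W (\<lambda>l. H (a # l)) ((v \<otimes> x) # ys @ [z']))"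
    "W (\<lambda>l. H (a # l)) ((v \<otimes> x) # ys @ [z']) \<in> U" if "a \<in> R" "v \<in> N" for a v
    using Suc.IH[of "\<lambda>l. H (a # l)" "v \<otimes> x" ys] Suc.prems(1,2)[of "a # _"] that l by auto
   have "W H (n # xs @ [z]) = S n (\<lambda>a v. h (H (a # v # x # ys @ [z']) \<ominus> W (\<lambda>l. H (a # l)) ((v \<otimes> x) # ys @ [z'])))"
    unfolding l append_Cons W.simps using Suc.prems 1 2 by (intro S_cong) auto
   then show ?case
    unfolding l append_Cons W.simps using Suc.prems 1 2 by (auto simp: S_hom[OF _ _ h] intro!: S_closed)
  qed
qed

end

lemma (in abelian_group) sub_cancel:
  assumes "a \<in> carrier G" "b \<in> carrier G" "c \<in> carrier G" "d \<in> carrier G" "e \<in> carrier G" "f \<in> carrier G"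
  shows "a \<ominus> (c \<oplus> e \<oplus> f \<ominus> b) \<ominus> (d \<ominus> c) = a \<oplus> b \<ominus> d \<ominus> e \<ominus> f"
  using assms by (simp add: minus_eq minus_add a_ac r_neg r_neg1 r_neg2)

section \<open>The projection \<open>V\<close> and the homotopy formula\<close>

context prism
begin

lemma V_closed:
  assumes "H \<in> tup (Suc k) \<rightarrow> U" "l \<in> tup (Suc k)"
  shows "V H l \<in> U"
  using assms
proof (induction k arbitrary: H l)
  case 0
  then show ?case by (auto simp: in_tuples_Suc)
next
  case (Suc k)
  then obtain n x ys where l: "l = n # x # ys" "n \<in> U" "x \<in> U" "ys \<in> tup k"
   by (auto simp: in_tuples_Suc)
  have "V (\<lambda>l. H (a # l)) ((v \<otimes> x) # ys) \<in> U" if "a \<in> U" "v \<in> N" for a v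
   using Suc.prems l that by (intro Suc.IH) (auto simp: Pi_def)
  then show ?case
   using l by (auto intro!: S_closed)
qed

text \<open>\<open>H\<close> is evaluated only at lists of coordinates followed by one element of
  \<open>N\<close>. Knowing \<open>H\<close> there is much less than knowing it everywhere, and this
  is how \<open>V\<close> forgets most of a cochain.\<close>

lemma V_cong:
  assumes "\<And>as v. as \<in> tup k ==> set as \<subseteq> R ==> v \<in> N ==> H (as @ [v]) = \<psi> (as @ [v])"
   "\<psi> \<in> tup (Suc k) \<rightarrow> U" "n \<in> N" "xs \<in> tup k"
  shows "V H (n # xs) = V \<psi> (n # xs)"
  using assms
proof (induction k arbitrary: H \<psi> n xs)
  case 0
  then show ?case using 0(1)[of "[]" n] by auto
next
  case (Suc k)
  then obtain x ys where l: "xs = x # ys" "x \<in> U" "ys \<in> tup k"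
   by (auto simp: in_tuples_Suc)
  have 1: "V (\<lambda>l. H (a # l)) ((v \<otimes> x) # ys) = V (\<lambda>l. \<psi> (a # l)) ((v \<otimes> x) # ys)"
   if "a \<in> R" "v \<in> N" for a v
  proof (rule Suc.IH)
   fix as v' assume "as \<in> tup k" "set as \<subseteq> R" "v' \<in> N"
   then show "H (a # as @ [v']) = \<psi> (a # as @ [v'])"
    using Suc.prems(1)[of "a # as" v'] that by auto
  qed (use Suc.prems(2) l that N_right in \<open>auto simp: Pi_def\<close>)
  have 2: "V (\<lambda>l. \<psi> (a # l)) ((v \<otimes> x) # ys) \<in> U" if "a \<in> R" "v \<in> N" for a v
   using Suc.prems l that by (intro V_closed[of _ k]) (auto simp: Pi_def)
  show ?case
   using Suc.prems l 1 2 by (auto intro!: S_cong)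
qed

lemma V_cong':
  assumes "\<And>l. l \<in> tup (Suc k) ==> H l = \<psi> l" "\<psi> \<in> tup (Suc k) \<rightarrow> U"
   "n \<in> N" "xs \<in> tup k"
  shows "V H (n # xs) = V \<psi> (n # xs)"
proof (rule V_cong)
  fix as v assume "as \<in> tup k" "v \<in> N"
  then show "H (as @ [v]) = \<psi> (as @ [v])"
   by (intro assms(1) tuples_snocI) auto
qed fact+

lemma V_hom:
  assumes "H \<in> tup (Suc k) \<rightarrow> U" "l \<in> tup (Suc k)" "h \<in> lin"
  shows "V (\<lambda>l. h (H l)) l = h (V H l)"
  using assms(1,2)
proof (induction k arbitrary: H l)
  case 0
  then show ?case by (auto simp: in_tuples_Suc)
next
  case (Suc k)
  then obtain n x ys where l: "l = n # x # ys" "n \<in> U" "x \<in> U" "ys \<in> tup k"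
   by (auto simp: in_tuples_Suc)
  have 1: "V (\<lambda>l. h (H (a # l))) ((v \<otimes> x) # ys) = h (V (\<lambda>l. H (a # l)) ((v \<otimes> x) # ys))"
   if "a \<in> U" "v \<in> N" for a v
   using Suc.prems l that by (intro Suc.IH) (auto simp: Pi_def)
  have 2: "V (\<lambda>l. H (a # l)) ((v \<otimes> x) # ys) \<in> U" if "a \<in> U" "v \<in> N" for a v
   using Suc.prems l that by (intro V_closed[of _ k]) (auto simp: Pi_def)
  show ?case
   using l 1 2 assms(3) unfolding l V.simps
   by (subst S_hom) (auto intro!: S_cong linear_mapsD(1)[OF assms(3)])
qed

lemma V_add:
  assumes "H \<in> tup (Suc k) \<rightarrow> U" "\<psi> \<in> tup (Suc k) \<rightarrow> U" "l \<in> tup (Suc k)"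
  shows "V (\<lambda>l. H l \<oplus> \<psi> l) l = V H l \<oplus> V \<psi> l"
  using assms
proof (induction k arbitrary: H \<psi> l)
  case 0
  then show ?case by (auto simp: in_tuples_Suc)
next
  case (Suc k)
  then obtain n x ys where l: "l = n # x # ys" "n \<in> U" "x \<in> U" "ys \<in> tup k"
   by (auto simp: in_tuples_Suc)
  have 1: "V (\<lambda>l. H (a # l) \<oplus> \<psi> (a # l)) ((v \<otimes> x) # ys) =
    V (\<lambda>l. H (a # l)) ((v \<otimes> x) # ys) \<oplus> V (\<lambda>l. \<psi> (a # l)) ((v \<otimes> x) # ys)"
   if "a \<in> U" "v \<in> N" for a v
   using Suc.prems l that by (intro Suc.IH) (auto simp: Pi_def)
  have 2: "V (\<lambda>l. H (a # l)) ((v \<otimes> x) # ys) \<in> U"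
   "V (\<lambda>l. \<psi> (a # l)) ((v \<otimes> x) # ys) \<in> U" if "a \<in> U" "v \<in> N" for a v
   using Suc.prems l that by (intro V_closed[of _ k]; auto simp: Pi_def)+
  show ?case
   unfolding l V.simps using l 1 2 by (subst S_add[symmetric]) (auto intro!: S_cong)
qed

lemma V_first_additive:
  assumes H: "mlin (Suc (Suc k)) H" and x: "x \<in> U" "ys \<in> tup k"
   and av: "a \<in> U" "a' \<in> U" "v \<in> N"
  shows "V (\<lambda>l. H ((a \<oplus> a') # l)) ((v \<otimes> x) # ys) =
   V (\<lambda>l. H (a # l)) ((v \<otimes> x) # ys) \<oplus> V (\<lambda>l. H (a' # l)) ((v \<otimes> x) # ys)"
proof -
  have f: "(\<lambda>l. H (a # l)) \<in> tup (Suc k) \<rightarrow> U" if "a \<in> U" for a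
   using Lin.multilinear_funcset[OF Lin.multilinear_Cons[OF H that]] .
  have "V (\<lambda>l. H ((a \<oplus> a') # l)) ((v \<otimes> x) # ys) =
    V (\<lambda>l. H (a # l) \<oplus> H (a' # l)) ((v \<otimes> x) # ys)"
   using multilinear_add_hd[OF H av(1,2)] x f av
   by (intro V_cong'[of k]) (auto simp: Pi_def intro: N_right)
  also have "\<dots> = V (\<lambda>l. H (a # l)) ((v \<otimes> x) # ys) \<oplus> V (\<lambda>l. H (a' # l)) ((v \<otimes> x) # ys)"
   using f av x by (intro V_add) auto
  finally show ?thesis .
qed

lemma V_first_closed:
  assumes H: "mlin (Suc (Suc k)) H" and x: "x \<in> U" "ys \<in> tup k"
   and av: "a \<in> U" "v \<in> N"
  shows "V (\<lambda>l. H (a # l)) ((v \<otimes> x) # ys) \<in> U"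
  using Lin.multilinear_funcset[OF Lin.multilinear_Cons[OF H av(1)]] x av
  by (intro V_closed[of _ k]) auto

lemma V_left:
  assumes "mlin (Suc k) H" "t \<in> U" "n \<in> N" "l \<in> tup k"
  shows "V (\<lambda>l. H ((t \<otimes> hd l) # tl l)) (n # l) = V H ((t \<otimes> n) # l)"
proof (cases l)
  case (Cons x ys)
  then obtain k' where k: "k = Suc k'" using assms by (cases k) auto
  then have x: "x \<in> U" "ys \<in> tup k'" using assms Cons by auto
  have H: "mlin (Suc (Suc k')) H" using assms k by simp
  show ?thesis
   unfolding Cons V.simps
   using S_left[OF assms(3,2), of "\<lambda>a v. V (\<lambda>l. H (a # l)) ((v \<otimes> x) # ys)"]
    V_first_closed[OF H x] V_first_additive[OF H x] by simp
qed simp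

lemma V_add_hd:
  assumes "mlin (Suc k) H" "n \<in> N" "n' \<in> N" "l \<in> tup k"
  shows "V H ((n \<oplus> n') # l) = V H (n # l) \<oplus> V H (n' # l)"
proof (cases l)
  case Nil
  then show ?thesis using multilinear_add_hd[OF assms(1), of n n' l] assms by simp
next
  case (Cons x ys)
  then obtain k' where k: "k = Suc k'" using assms by (cases k) auto
  then have x: "x \<in> U" "ys \<in> tup k'" using assms Cons by auto
  have H: "mlin (Suc (Suc k')) H" using assms k by simp
  show ?thesis
   unfolding Cons V.simps
   using S_add_first[OF assms(2,3), of "\<lambda>a v. V (\<lambda>l. H (a # l)) ((v \<otimes> x) # ys)"]
    V_first_closed[OF H x] V_first_additive[OF H x] by simp
qed

lemma V_smult_hd:
  assumes H: "mlin (Suc k) H" and n: "n \<in> N" "l \<in> tup k" and r: "r \<in> carrier K"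
  shows "V H ((r \<odot> n) # l) = r \<odot> V H (n # l)"
proof -
  have nl: "n # l \<in> tup (Suc k)" using n by auto
  have f: "H \<in> tup (Suc k) \<rightarrow> U" using H by (rule Lin.multilinear_funcset)
  have "V H ((r \<odot> n) # l) = V H (((r \<odot> \<one>) \<otimes> n) # l)"
   using n r smult_eq_mult[of r n] by simp
  also have "\<dots> = V (\<lambda>l. H (((r \<odot> \<one>) \<otimes> hd l) # tl l)) (n # l)"
   using n r by (intro V_left[OF H, symmetric]) auto
  also have "\<dots> = V (\<lambda>l. r \<odot> H l) (n # l)"
   using linear_mapsD(3)[OF Lin.multilinear_linear[OF H]] f r n
   by (intro V_cong'[of k]) (auto simp: in_tuples_Suc Pi_def smult_mult_left)
  also have "\<dots> = r \<odot> V H (n # l)"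
   using f nl r by (intro V_hom linear_mapsI) (auto simp: smult_r_distr smult_assoc1[symmetric] R.m_comm)
  finally show ?thesis .
qed

lemma V_multilinear:
  assumes "mlin (Suc k) H" "n \<in> N"
  shows "mlin k (\<lambda>l. V H (n # l))"
  using assms
proof (induction k arbitrary: n H)
  case 0
  then show ?case using Lin.multilinear_closed[OF 0(1), of "[n]"] by simp
next
  case (Suc k)
  have Ha: "mlin (Suc k) (\<lambda>l. H (a # l))" if "a \<in> U" for a
   using Lin.multilinear_Cons[OF Suc.prems(1) that] .
  show ?case
   unfolding multilinear.simps(2)[of K T T k]
  proof (intro conjI ballI)
   fix x assume x: "x \<in> U"
   show "mlin k (\<lambda>l. V H (n # x # l))"
    unfolding V.simps S_def
    using x Suc.prems(2) w_N by (intro Lin.multilinear_finsum Suc.IH Ha N_right) auto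
  next
   fix l assume l: "l \<in> tup k"
   show "(\<lambda>x. V H (n # x # l)) \<in> lin"
    unfolding V.simps S_def
   proof (intro Lin.finsum_linear_maps)
    fix i assume "i \<in> {i \<in> J. c i n \<noteq> \<zero>}"
    then have i: "c i n \<in> U" "w i \<in> N" using w_N Suc.prems(2) by auto
    have f: "(\<lambda>l. H (c i n # l)) \<in> tup (Suc k) \<rightarrow> U"
     by (rule Lin.multilinear_funcset[OF Ha[OF i(1)]])
    show "(\<lambda>x. V (\<lambda>l. H (c i n # l)) ((w i \<otimes> x) # l)) \<in> lin"
     using i l f V_add_hd[OF Ha[OF i(1)]] V_smult_hd[OF Ha[OF i(1)]] N_right[OF i(2)]
     by (intro linear_mapsI V_closed[of _ k]) (auto simp: A.r_distr smult_mult_right)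
   qed
  qed
qed

text \<open>In contrast to \<open>W\<close>, the last entry is absorbed by the expansion and arrives
  as \<open>v z\<close> with \<open>v\<close> in \<open>N\<close>; hence the form of the
  hypotheses.\<close>

lemma V_last:
  assumes "\<And>as v. as \<in> tup (Suc k) ==> v \<in> N ==>
    H (as @ [v \<otimes> z]) = h (H (as @ [v \<otimes> z']))"
   and "\<And>as v. as \<in> tup (Suc k) ==> v \<in> N ==> H (as @ [v \<otimes> z']) \<in> U"
   and h: "h \<in> lin"
   and "n \<in> U" "xs \<in> tup k"
  shows "V H (n # xs @ [z]) = h (V H (n # xs @ [z'])) \<and> V H (n # xs @ [z']) \<in> U"
proof -
  interpret h: abelian_group_hom T T h using h by (rule hom_of_linear)
  show ?thesis
   using assms(1,2,4,5)
  proof (induction k arbitrary: H n xs)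
   case 0
   have [simp]: "xs = []" using 0 by simp
   have 1: "H [a, v \<otimes> z] = h (H [a, v \<otimes> z'])" "H [a, v \<otimes> z'] \<in> U"
    if "a \<in> R" "v \<in> N" for a v
    using 0(1,2)[of "[a]" v] that by auto
   have "S n (\<lambda>a v. H [a, v \<otimes> z]) = S n (\<lambda>a v. h (H [a, v \<otimes> z']))"
    using 0 1 by (intro S_cong) auto
   then show ?case
    using 0 1 by (auto simp: S_hom[OF _ _ h] intro!: S_closed)
  next
   case (Suc k)
   then obtain x ys where l: "xs = x # ys" "x \<in> U" "ys \<in> tup k"
    by (auto simp: in_tuples_Suc)
   have 2: "V (\<lambda>l. H (a # l)) ((v \<otimes> x) # ys @ [z]) = h (V (\<lambda>l. H (a # l)) ((v \<otimes> x) # ys @ [z']))"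
    "V (\<lambda>l. H (a # l)) ((v \<otimes> x) # ys @ [z']) \<in> U" if "a \<in> R" "v \<in> N" for a v
    using Suc.IH[of "\<lambda>l. H (a # l)" "v \<otimes> x" ys] Suc.prems(1,2)[of "a # _"] that l by auto
   have "V H (n # xs @ [z]) = S n (\<lambda>a v. h (V (\<lambda>l. H (a # l)) ((v \<otimes> x) # ys @ [z'])))"
    unfolding l append_Cons V.simps using Suc.prems 2 by (intro S_cong) auto
   then show ?case
    unfolding l append_Cons V.simps using Suc.prems 2 by (auto simp: S_hom[OF _ _ h] intro!: S_closed)
  qed
qed

lemma c_zero: "i \<in> J ==> c i \<zero> = \<zero>"
  using c_left[of i "\<zero>" "\<zero>"] N_zero by simp

lemma S_zero_first: "S \<zero> G = \<zero>"
  by (simp add: S_def c_zero cong: conj_cong)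

text \<open>The hypothesis on \<open>S\<close> lets \<open>E\<close> pass from an element to the
  basis elements of its expansion. Being compatible with right multiplication, \<open>E\<close> is
  then handed on from entry to entry until it reaches the last one, where \<open>H\<close> turns it
  into \<open>h\<close>.\<close>

lemma V_equivariant:
  assumes E: "\<And>n. n \<in> N ==> E n \<in> N" "\<And>n t. n \<in> N ==> t \<in> U ==> E (n \<otimes> t) = E n \<otimes> t"
   and SE: "\<And>n G. n \<in> N ==> (\<And>a v. a \<in> R ==> v \<in> N ==> G a v \<in> U) ==>
    (\<And>a. a \<in> R ==> G a \<zero> = \<zero>) ==> S (E n) G = S n (\<lambda>a v. G a (E v))"
   and h: "h \<in> lin"
   and "\<And>as v. as \<in> tup k ==> v \<in> N ==> H (as @ [E v]) = h (H (as @ [v]))"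
   and "mlin (Suc k) H" "n \<in> N" "xs \<in> tup k"
  shows "V H (E n # xs) = h (V H (n # xs))"
  using assms(5-)
proof (induction k arbitrary: H n xs)
  case 0
  then show ?case using 0(1)[of "[]" n] by auto
next
  case (Suc k)
  then obtain x ys where l: "xs = x # ys" "x \<in> U" "ys \<in> tup k"
   by (auto simp: in_tuples_Suc)
  note cl = V_first_closed[OF Suc.prems(2) l(2,3)]
  \<comment> \<open>The hypothesis on \<open>S\<close> is available only for maps that vanish at
    \<open>v = 0\<close>. On a zero leading entry the expansion is an empty sum, unless the list has
    a single entry, where multilinearity of \<open>H\<close> takes over.\<close>
  have z: "V (\<lambda>l. H (a # l)) ((\<zero> \<otimes> x) # ys) = \<zero>" if "a \<in> R" for a
  proof (cases ys)
   case Nil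
   then have "k = 0" using l by (cases k) (auto simp: in_tuples_Suc)
   then have "mlin (Suc 0) (\<lambda>l. H (a # l))"
    using Lin.multilinear_Cons[OF Suc.prems(2), of a] that by simp
   from Lin.multilinear_zero_hd[OF this] show ?thesis using Nil l by simp
  next
   case (Cons y zs)
   then show ?thesis using l by (simp add: S_zero_first)
  qed
  have "V H (E n # xs) = S n (\<lambda>a v. V (\<lambda>l. H (a # l)) ((E v \<otimes> x) # ys))"
   unfolding l V.simps using Suc.prems cl z by (intro SE) auto
  also have "\<dots> = S n (\<lambda>a v. h (V (\<lambda>l. H (a # l)) ((v \<otimes> x) # ys)))"
  proof (intro S_cong linear_mapsD(1)[OF h] cl)
   fix a v assume av: "a \<in> R" "v \<in> N"
   have "V (\<lambda>l. H (a # l)) (E (v \<otimes> x) # ys) = h (V (\<lambda>l. H (a # l)) ((v \<otimes> x) # ys))"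
   proof (rule Suc.IH)
    fix as v' assume "as \<in> tup k" "v' \<in> N"
    then show "H (a # as @ [E v']) = h (H (a # as @ [v']))"
     using Suc.prems(1)[of "a # as" v'] av by auto
   qed (use Suc.prems(2) av l in \<open>auto intro: N_right\<close>)
   then show "V (\<lambda>l. H (a # l)) ((E v \<otimes> x) # ys) = h (V (\<lambda>l. H (a # l)) ((v \<otimes> x) # ys))"
    using E(2)[OF av(2) l(2)] by simp
  qed (use Suc.prems in auto)
  also have "\<dots> = h (V H (n # xs))"
   unfolding l V.simps using Suc.prems cl h by (intro S_hom[symmetric]) auto
  finally show ?case .
qed

lemma bar_S:
  assumes n: "n \<in> U" and l: "l \<in> tup (Suc k)"
   and G: "\<And>a v. a \<in> R ==> v \<in> N ==> G a v \<in> tup k \<rightarrow> U"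
  shows "br (\<lambda>l. S n (\<lambda>a v. G a v l)) l = S n (\<lambda>a v. br (G a v) l)"
  using l G
proof (induction l arbitrary: k G)
  case (Cons x l)
  show ?case
  proof (cases l)
   case (Cons y zs)
   then obtain k' where k: "k = Suc k'" using Cons.prems by (cases k) auto
   then have c: "x \<in> U" "y \<in> U" "zs \<in> tup k'" using Cons.prems Cons by auto
   have g: "(\<lambda>l. G a v (x # l)) \<in> tup k' \<rightarrow> U" if "a \<in> R" "v \<in> N" for a v
    using Cons.prems(2)[OF that] c k by (auto simp: Pi_def)
   have IH: "br (\<lambda>l. S n (\<lambda>a v. G a v (x # l))) (y # zs) =
     S n (\<lambda>a v. br (\<lambda>l. G a v (x # l)) (y # zs))"
    using Cons.IH[of k' "\<lambda>a v l. G a v (x # l)"] c g Cons by auto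
   have b: "br (\<lambda>l. G a v (x # l)) (y # zs) \<in> U" if "a \<in> R" "v \<in> N" for a v
    using g[OF that] c by (intro Bar.bar_closed[of _ k']) auto
   show ?thesis
    unfolding Cons bar.simps IH
    using n b Cons.prems(2) c k by (intro S_minus[symmetric]) (auto simp: Pi_def)
  qed simp
qed simp

text \<open>The homotopy formula holds only for lists that begin in \<open>N\<close>. Under
  \<open>bar\<close> this is enough, because the leading entry is multiplied from the right and
  remains in \<open>N\<close>.\<close>

lemma bar_cong_N:
  assumes "\<And>n l. n \<in> N ==> l \<in> tup k ==> H (n # l) = \<psi> (n # l)" "n \<in> N" "xs \<in> tup (Suc k)"
  shows "br H (n # xs) = br \<psi> (n # xs)"
proof -
  obtain x ys where xs: "xs = x # ys" "x \<in> U" "ys \<in> tup k"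
   using assms(3) by (auto simp: in_tuples_Suc)
  have "br (\<lambda>l. H (n # l)) xs = br (\<lambda>l. \<psi> (n # l)) xs"
   using assms by (intro Bar.bar_cong[of k]) auto
  then show ?thesis using assms xs by (simp add: N_right)
qed

text \<open>Induction on the length. In the summand of \<open>W (bar H)\<close> the product of
  coordinate and basis element recombines to \<open>n\<close> and gives \<open>H (n # xs)\<close>.
  The induction hypothesis for \<open>H (a # _)\<close> rewrites what is left into the negatives of
  the terms of \<open>bar (W H)\<close> and \<open>V H\<close>.\<close>

theorem prism:
  assumes "mlin (Suc k) H" "n \<in> N" "xs \<in> tup k"
  shows "W (br H) (n # xs) \<oplus> br (W H) (n # xs) \<oplus> V H (n # xs) = H (n # xs)"
  using assms
proof (induction k arbitrary: H n xs)
  case 0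
  then show ?case using Lin.multilinear_closed[OF 0(1), of "[n]"] by simp
next
  case (Suc k)
  then obtain x ys where l: "xs = x # ys" "x \<in> U" "ys \<in> tup k"
   by (auto simp: in_tuples_Suc)
  note H = Suc.prems(1) note n = Suc.prems(2)
  have f: "H \<in> tup (Suc (Suc k)) \<rightarrow> U" using H by (rule Lin.multilinear_funcset)
  have Ha: "mlin (Suc k) (\<lambda>l. H (a # l))" if "a \<in> U" for a
   using Lin.multilinear_Cons[OF H that] .
  have fa: "(\<lambda>l. H (a # l)) \<in> tup (Suc k) \<rightarrow> U" if "a \<in> U" for a
   using Lin.multilinear_funcset[OF Ha[OF that]] .
  have bfa: "br (\<lambda>l. H (a # l)) \<in> tup (Suc (Suc k)) \<rightarrow> U" if "a \<in> U" for a
   using Bar.bar_closed[OF fa[OF that]] by blast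
  \<comment> \<open>\<open>p1\<close>, \<open>p2\<close>, \<open>p3\<close> are the parts of
    \<open>bar H\<close> at the expanded list; \<open>p5\<close>, \<open>p6\<close>,
    \<open>p7\<close> are the three terms whose sum is \<open>p2\<close> by the induction
    hypothesis; \<open>p4\<close> comes from the product of the coordinate with the next entry
    inside \<open>W\<close>.\<close>
  define p1 where "p1 a v = H ((a \<otimes> v) # x # ys)" for a v
  define p2 where "p2 a v = H (a # (v \<otimes> x) # ys)" for a v
  define p3 where "p3 a v = br (\<lambda>l. H (a # v # l)) (x # ys)" for a v
  define p4 where "p4 a v = W H ((a \<otimes> (v \<otimes> x)) # ys)" for a v
  define p5 where "p5 a v = br (W (\<lambda>l. H (a # l))) ((v \<otimes> x) # ys)" for a v
  define p6 where "p6 a v = V (\<lambda>l. H (a # l)) ((v \<otimes> x) # ys)" for a v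
  define p7 where "p7 a v = W (br (\<lambda>l. H (a # l))) ((v \<otimes> x) # ys)" for a v
  have Wa: "W (\<lambda>l. H (a # l)) \<in> tup k \<rightarrow> U" if "a \<in> U" for a
  proof (cases k)
   case (Suc k')
   then show ?thesis using W_closed[of "\<lambda>l. H (a # l)" k'] fa[OF that] by auto
  qed auto
  have c: "p1 a v \<in> U" "p2 a v \<in> U" "p3 a v \<in> U" "p4 a v \<in> U"
   "p5 a v \<in> U" "p6 a v \<in> U" "p7 a v \<in> U"
   if av: "a \<in> R" "v \<in> N" for a v
  proof -
   show "p1 a v \<in> U" "p2 a v \<in> U"
    using f av l by (auto simp: p1_def p2_def Pi_def)
   show "p3 a v \<in> U" unfolding p3_def
    using fa[of a] av l by (intro Bar.bar_closed[of _ k]) (auto simp: Pi_def)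
   show "p4 a v \<in> U" unfolding p4_def
    using f av l by (intro W_closed[of _ k]) auto
   show "p5 a v \<in> U" unfolding p5_def
    using Wa av l by (intro Bar.bar_closed[of _ k]) auto
   show "p6 a v \<in> U" unfolding p6_def
    using fa av l by (intro V_closed[of _ k]) auto
   show "p7 a v \<in> U" unfolding p7_def
    using bfa av l by (intro W_closed[of _ k]) auto
  qed
  have IH: "p7 a v \<oplus> p5 a v \<oplus> p6 a v = p2 a v" if "a \<in> R" "v \<in> N" for a v
   unfolding p7_def p5_def p6_def p2_def using that l
   by (intro Suc.IH Ha N_right) auto
  have W7: "W (\<lambda>l. br H (a # l)) ((v \<otimes> x) # ys) = p4 a v \<ominus> p7 a v"
   if av: "a \<in> R" "v \<in> N" for a v
  proof -
   have vx: "(v \<otimes> x) # ys \<in> tup (Suc k)" using av l by auto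
   have g: "(\<lambda>l. H ((a \<otimes> hd l) # tl l)) \<in> tup (Suc (Suc k)) \<rightarrow> U"
    using f av by (auto simp: in_tuples_Suc Pi_def)
   have "W (\<lambda>l. br H (a # l)) ((v \<otimes> x) # ys) =
     W (\<lambda>l. H ((a \<otimes> hd l) # tl l) \<ominus> br (\<lambda>l. H (a # l)) l) ((v \<otimes> x) # ys)"
    using g bfa[of a] av vx by (intro W_cong[of k]) (auto simp: in_tuples_Suc Pi_def)
   also have "\<dots> = W (\<lambda>l. H ((a \<otimes> hd l) # tl l)) ((v \<otimes> x) # ys) \<ominus> p7 a v"
    unfolding p7_def using g bfa av vx by (intro W_minus) auto
   also have "W (\<lambda>l. H ((a \<otimes> hd l) # tl l)) ((v \<otimes> x) # ys) = p4 a v"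
    unfolding p4_def using H av l by (intro W_left) (auto intro: N_right)
   finally show ?thesis .
  qed
  have "W (br H) (n # xs) =
    S n (\<lambda>a v. p1 a v \<oplus> p3 a v \<ominus> p4 a v \<ominus> p5 a v \<ominus> p6 a v)"
   unfolding l W.simps
  proof (rule S_cong)
   fix a v assume av: "a \<in> R" "v \<in> N"
   have *: "br H (a # v # x # ys) = p1 a v \<ominus> (p2 a v \<ominus> p3 a v)"
    by (simp add: p1_def p2_def p3_def)
   show "br H (a # v # x # ys) \<ominus> W (\<lambda>l. br H (a # l)) ((v \<otimes> x) # ys) =
     p1 a v \<oplus> p3 a v \<ominus> p4 a v \<ominus> p5 a v \<ominus> p6 a v"
    unfolding W7[OF av] * IH[OF av, symmetric] using c[OF av] by (intro M.sub_cancel) auto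
  qed (use c n in auto)
  also have "\<dots> = S n p1 \<oplus> S n p3 \<ominus> S n p4 \<ominus> S n p5 \<ominus> S n p6"
   using c n by (simp add: S_minus S_add)
  also have "S n p1 = H (n # xs)"
   unfolding p1_def using n l f multilinear_add_hd[OF H]
   by (subst S_mult[of n "\<lambda>t. H (t # x # ys)"]) (auto simp: Pi_def)
  also have "S n p4 = W H ((n \<otimes> x) # ys)"
  proof -
   have "S n p4 = S n (\<lambda>a v. W H (((a \<otimes> v) \<otimes> x) # ys))"
    using n l c by (intro S_cong) (auto simp: p4_def A.m_assoc)
   also have "\<dots> = W H ((n \<otimes> x) # ys)"
    using n l f W_add_hd[OF H] W_closed[OF f]
    by (intro S_mult[of n "\<lambda>t. W H ((t \<otimes> x) # ys)"]) (auto simp: A.l_distr N_right)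
   finally show ?thesis .
  qed
  finally have 1: "W (br H) (n # xs) =
   H (n # xs) \<oplus> S n p3 \<ominus> W H ((n \<otimes> x) # ys) \<ominus> S n p5 \<ominus> S n p6" .
  have 2: "br (W H) (n # xs) = W H ((n \<otimes> x) # ys) \<ominus> (S n p3 \<ominus> S n p5)"
  proof -
   have "br (\<lambda>l. W H (n # l)) (x # ys) = S n p3 \<ominus> S n p5"
   proof (cases ys)
    case Nil
    then show ?thesis by (simp add: p3_def[abs_def] p5_def[abs_def] M.minus_eq)
   next
    case (Cons y zs)
    then obtain k' where k: "k = Suc k'" using l by (cases k) auto
    have g: "(\<lambda>l. H (a # v # l)) \<in> tup k \<rightarrow> U"
     "(\<lambda>l. W (\<lambda>l. H (a # l)) ((v \<otimes> hd l) # tl l)) \<in> tup k \<rightarrow> U"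
     if "a \<in> R" "v \<in> N" for a v
     using fa[of a] Wa[of a] that by (auto simp: k in_tuples_Suc Pi_def)
    have "br (\<lambda>l. W H (n # l)) (x # ys) =
      br (\<lambda>l. S n (\<lambda>a v. H (a # v # l) \<ominus> W (\<lambda>l. H (a # l)) ((v \<otimes> hd l) # tl l))) (x # ys)"
     using l by (intro Bar.bar_cong[of k]) (auto simp: k in_tuples_Suc)
    also have "\<dots> = S n (\<lambda>a v. br (\<lambda>l. H (a # v # l) \<ominus>
      W (\<lambda>l. H (a # l)) ((v \<otimes> hd l) # tl l)) (x # ys))"
     using n l g by (intro bar_S[of _ _ k]) (auto simp: Pi_def)
    also have "\<dots> = S n (\<lambda>a v. p3 a v \<ominus> p5 a v)"
    proof (rule S_cong)
     fix a v assume av: "a \<in> R" "v \<in> N"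
     show "br (\<lambda>l. H (a # v # l) \<ominus> W (\<lambda>l. H (a # l)) ((v \<otimes> hd l) # tl l)) (x # ys) =
       p3 a v \<ominus> p5 a v"
      using g[OF av] l av
      by (subst Bar.bar_minus[of _ k])
       (auto simp: p3_def p5_def Bar.bar_scale_hd[where n="Suc k"] simp del: bar.simps)
    qed (use c n in auto)
    also have "\<dots> = S n p3 \<ominus> S n p5"
     using c n by (intro S_minus) auto
    finally show ?thesis .
   qed
   then show ?thesis by (simp add: l)
  qed
  have 3: "V H (n # xs) = S n p6" by (simp add: l p6_def[abs_def])
  have "H (n # xs) \<in> U" "W H ((n \<otimes> x) # ys) \<in> U"
   "S n p3 \<in> U" "S n p5 \<in> U" "S n p6 \<in> U"
   using f n l c W_closed[OF f] by (auto intro!: S_closed simp: Pi_def)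
  then show ?case
   unfolding 1 2 3 by algebra
qed

lemma W_funcset: "H \<in> tup (Suc k) \<rightarrow> U ==> W H \<in> tup k \<rightarrow> U"
  by (cases k) (auto intro: W_closed)

text \<open>The homotopy formula for \<open>bar H\<close>, and that for \<open>H\<close> with
  \<open>bar\<close> applied to it, both leave \<open>bar H\<close> minus
  \<open>bar (W (bar H))\<close>, since \<open>bar\<close> squares to zero.\<close>

corollary V_bar:
  assumes H: "mlin (Suc k) H" and n: "n \<in> N" and xs: "xs \<in> tup (Suc k)"
  shows "V (br H) (n # xs) = br (V H) (n # xs)"
proof -
  have f: "H \<in> tup (Suc k) \<rightarrow> U" using H by (rule Lin.multilinear_funcset)
  have bf: "br H \<in> tup (Suc (Suc k)) \<rightarrow> U"
   using Bar.bar_closed[OF f] by blast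
  have Wf: "W H \<in> tup k \<rightarrow> U" using f by (rule W_funcset)
  have Wbf: "W (br H) \<in> tup (Suc k) \<rightarrow> U" using bf by (rule W_funcset)
  have bWf: "br (W H) \<in> tup (Suc k) \<rightarrow> U" using Bar.bar_closed[OF Wf] by blast
  have Vf: "V H \<in> tup (Suc k) \<rightarrow> U" using V_closed[OF f] by blast
  have nx: "n # xs \<in> tup (Suc (Suc k))" using n xs by auto
  have "W (br (br H)) (n # xs) = W (\<lambda>_. \<zero>) (n # xs)"
   using nx Bar.bar_bar[OF f] by (intro W_cong[of "Suc k"]) auto
  then have "br (W (br H)) (n # xs) \<oplus> V (br H) (n # xs) = br H (n # xs)"
   using prism[OF bar_multilinear[OF H] n xs] Bar.bar_closed[OF Wbf nx] V_closed[OF bf nx] by simp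
  also have "\<dots> = br (\<lambda>l. W (br H) l \<oplus> br (W H) l \<oplus> V H l) (n # xs)"
   using prism[OF H] n xs by (intro bar_cong_N[of k]) auto
  also have "\<dots> = br (W (br H)) (n # xs) \<oplus> br (br (W H)) (n # xs) \<oplus> br (V H) (n # xs)"
   using Wbf bWf Vf nx by (simp add: Bar.bar_add[of _ "Suc k"] Pi_def del: bar.simps)
  also have "br (br (W H)) (n # xs) = \<zero>"
   using Wf nx by (intro Bar.bar_bar[of _ k]) auto
  finally show ?thesis
   using Bar.bar_closed[OF Wbf nx] V_closed[OF bf nx] Bar.bar_closed[OF Vf nx] by simp
qed

end

section \<open>Triangular decompositions\<close>

lemma (in linear_context) multilinear_map:
  assumes "g \<in> linear_maps K S' S" "multilinear K S G n H"
  shows "multilinear K S' G n (\<lambda>l. H (map g l))"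
  using assms(2)
proof (induction n arbitrary: H)
  case (Suc n)
  have "(\<lambda>x. H (g x # map g l)) \<in> linear_maps K S' G" if "l \<in> tuples S' n" for l
  proof -
   have "map g l \<in> tuples S n"
    using that linear_mapsD(1)[OF assms(1)] by (auto simp: tuples_def)
   from linear_mapsD[OF multilinear_linear[OF Suc.prems this]] linear_mapsD[OF assms(1)]
   show ?thesis by (intro linear_mapsI) auto
  qed
  then show ?case using Suc linear_mapsD(1)[OF assms(1)] by auto
qed simp

locale peirce = hochschild K T
  for K :: "'k ring" and T :: "('k, 't) module" (structure) +
  fixes e1 e2 :: 't
  assumes e_closed: "e1 \<in> U" "e2 \<in> U"
   and e_idem: "e1 \<otimes> e1 = e1" "e2 \<otimes> e2 = e2"
   and e_sum: "e1 \<oplus> e2 = \<one>"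
   and e_triangular: "x \<in> U ==> e2 \<otimes> x \<otimes> e1 = \<zero>"
begin

definition \<alpha> :: "'t => 't" where "\<alpha> x = e1 \<otimes> x \<otimes> e1"
definition \<nu> :: "'t => 't" where "\<nu> x = e1 \<otimes> x \<otimes> e2"
definition \<beta> :: "'t => 't" where "\<beta> x = e2 \<otimes> x \<otimes> e2"

lemmas e_simps [simp] = e_closed e_idem

lemma \<alpha>_linear: "\<alpha> \<in> lin"
  and \<nu>_linear: "\<nu> \<in> lin"
  and \<beta>_linear: "\<beta> \<in> lin"
  unfolding \<alpha>_def[abs_def] \<nu>_def[abs_def] \<beta>_def[abs_def] by (intro mult_linear e_closed)+

lemma \<alpha>_closed [simp, intro]: "x \<in> U ==> \<alpha> x \<in> U"
  and \<nu>_closed [simp, intro]: "x \<in> U ==> \<nu> x \<in> U"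
  and \<beta>_closed [simp, intro]: "x \<in> U ==> \<beta> x \<in> U"
  by (simp_all add: \<alpha>_def \<nu>_def \<beta>_def)

lemma map_\<alpha>: "l \<in> tup n ==> map \<alpha> l \<in> tup n"
  and map_\<beta>: "l \<in> tup n ==> map \<beta> l \<in> tup n"
  by (auto simp: tuples_def)

lemma e_insert:
  assumes "x \<in> U" "y \<in> U"
  shows "x \<otimes> y = x \<otimes> e1 \<otimes> (e1 \<otimes> y) \<oplus> x \<otimes> e2 \<otimes> (e2 \<otimes> y)"
proof -
  have "x \<otimes> y = x \<otimes> (e1 \<oplus> e2) \<otimes> y" using assms by (simp add: e_sum)
  also have "\<dots> = x \<otimes> (e1 \<otimes> e1) \<otimes> y \<oplus> x \<otimes> (e2 \<otimes> e2) \<otimes> y"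
   using assms by (simp add: A.r_distr A.l_distr)
  finally show ?thesis using assms by (simp add: A.m_assoc del: e_idem)
qed

lemma e2_e1 [simp]: "e2 \<otimes> e1 = \<zero>"
  using e_triangular[of "\<one>"] by simp

lemma e1_e2 [simp]: "e1 \<otimes> e2 = \<zero>"
proof -
  have "e1 \<otimes> (e1 \<oplus> e2) = e1" by (simp add: e_sum)
  then have "e1 \<oplus> e1 \<otimes> e2 = e1" by (simp add: A.r_distr)
  then show ?thesis using M.add.r_cancel_one[of e1 "e1 \<otimes> e2"] by (simp add: M.a_comm)
qed

lemma e2_left: "x \<in> U ==> e2 \<otimes> x = \<beta> x"
  using A.r_distr[of e1 e2 "e2 \<otimes> x"] by (simp add: e_triangular \<beta>_def e_sum)

lemma e1_right: "x \<in> U ==> x \<otimes> e1 = \<alpha> x"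
  using A.l_distr[of e1 e2 "x \<otimes> e1"] e_triangular[of x]
  by (simp add: \<alpha>_def e_sum A.m_assoc)

lemma e1_left: "x \<in> U ==> e1 \<otimes> x = \<alpha> x \<oplus> \<nu> x"
  using A.r_distr[of e1 e2 "e1 \<otimes> x"] by (simp add: \<alpha>_def \<nu>_def e_sum)

text \<open>The term through \<open>e2\<close> contains \<open>e2 y e1 = 0\<close>. By triangularity
  the projections to the two diagonal corners are therefore multiplicative.\<close>

lemma \<alpha>_mult: "x \<in> U ==> y \<in> U ==> \<alpha> (x \<otimes> y) = \<alpha> x \<otimes> \<alpha> y"
  using e_insert[of "e1 \<otimes> x" "y \<otimes> e1"] e_triangular[of y]
  by (simp add: \<alpha>_def A.m_assoc)

lemma \<beta>_mult: "x \<in> U ==> y \<in> U ==> \<beta> (x \<otimes> y) = \<beta> x \<otimes> \<beta> y"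
  using e_insert[of "e2 \<otimes> x" "y \<otimes> e2"] e_triangular[of x]
  by (simp add: \<beta>_def A.m_assoc[symmetric])

lemma \<nu>_mult: "x \<in> U ==> y \<in> U ==> \<nu> (x \<otimes> y) = \<alpha> x \<otimes> \<nu> y \<oplus> \<nu> x \<otimes> \<beta> y"
  using e_insert[of "e1 \<otimes> x" "y \<otimes> e2"]
  by (simp add: \<alpha>_def \<beta>_def \<nu>_def A.m_assoc)

text \<open>The homotopy for \<open>N = T\<close> with coordinates \<open>t e1\<close> and
  \<open>t e2\<close>; the expansion is \<open>t = t e1 e1 + t e2 e2\<close>. Its projection
  \<open>E.V\<close> inserts \<open>e1 + e2\<close> between any two neighbours.\<close>

sublocale E: prism K T "UNIV :: bool set" "\<lambda>i t. t \<otimes> (if i then e1 else e2)"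
   "\<lambda>i. if i then e1 else e2" "U" "U"
proof
  fix n assume n: "n \<in> U"
  have "(\<Oplus>i\<in>{i \<in> UNIV. n \<otimes> (if i then e1 else e2) \<noteq> \<zero>}.
    n \<otimes> (if i then e1 else e2) \<otimes> (if i then e1 else e2)) =
    (\<Oplus>i\<in>UNIV. n \<otimes> (if i then e1 else e2) \<otimes> (if i then e1 else e2))"
   using n by (intro M.add.finprod_mono_neutral_cong_left) auto
  also have "\<dots> = n \<otimes> e1 \<otimes> e1 \<oplus> n \<otimes> e2 \<otimes> e2"
   using n by (simp add: UNIV_bool M.a_comm)
  also have "\<dots> = n"
   using n by (simp add: A.m_assoc A.r_distr[symmetric] e_sum)
  finally show "(\<Oplus>i\<in>{i \<in> UNIV. n \<otimes> (if i then e1 else e2) \<noteq> \<zero>}.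
    n \<otimes> (if i then e1 else e2) \<otimes> (if i then e1 else e2)) = n" .
qed (auto simp: A.l_distr A.m_assoc)

declare E.N_carrier [simp del, rule del] E.R_carrier [simp del, rule del]

text \<open>The sum over the positions at which a path in the triangular quiver can cross from the first
  to the second vertex.\<close>

fun crossing :: "('t list => 't) => 't list => 't" where
  "crossing H (x # xs) = H (\<nu> x # map \<beta> xs) \<oplus> crossing (\<lambda>l. H (\<alpha> x # l)) xs"
| "crossing H [] = \<zero>"

lemma crossing_closed:
  "H \<in> tup k \<rightarrow> U ==> l \<in> tup k ==> crossing H l \<in> U"
proof (induction l arbitrary: k H)
  case (Cons x xs)
  from Cons.prems obtain k' where k: "k = Suc k'" by (cases k) auto
  have "(\<lambda>l. H (\<alpha> x # l)) \<in> tup k' \<rightarrow> U"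
   using Cons.prems k by (auto simp: Pi_def)
  from Cons.IH[OF this] show ?case
   using Cons.prems k by (auto simp: Pi_def map_\<beta>)
qed simp

lemma E_V_Cons:
  assumes "mlin (Suc (Suc k)) H" "t \<in> U" "y \<in> U" "ys \<in> tup k"
  shows "E.V H (t # y # ys) =
   E.V (\<lambda>l. H ((t \<otimes> e1) # l)) ((e1 \<otimes> y) # ys) \<oplus>
   E.V (\<lambda>l. H ((t \<otimes> e2) # l)) ((e2 \<otimes> y) # ys)"
proof -
  let ?G = "\<lambda>a v. E.V (\<lambda>l. H (a # l)) ((v \<otimes> y) # ys)"
  have c: "?G a v \<in> U" if "a \<in> U" "v \<in> U" for a v
   using E.V_first_closed[OF assms(1,3,4)] that by simp
  have z: "?G \<zero> v = \<zero>" if "v \<in> U" for v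
   using E.V_first_additive[OF assms(1,3,4), of "\<zero>" "\<zero>" v] c that
   by (intro E.zero_of_additive) auto
  have "E.V H (t # y # ys) = (\<Oplus>i\<in>UNIV. ?G (t \<otimes> (if i then e1 else e2)) (if i then e1 else e2))"
   unfolding E.V.simps using c z assms by (intro E.S_superset) auto
  also have "\<dots> = ?G (t \<otimes> e1) e1 \<oplus> ?G (t \<otimes> e2) e2"
   using c assms by (simp add: UNIV_bool M.a_comm)
  finally show ?thesis .
qed

lemma E_V_zero:
  assumes "mlin (Suc (Suc k)) H" "l \<in> tup (Suc k)"
  shows "E.V (\<lambda>l. H (\<zero> # l)) l = \<zero>"
proof -
  have f: "(\<lambda>l. H (\<zero> # l)) \<in> tup (Suc k) \<rightarrow> U"
   using Lin.multilinear_funcset[OF Lin.multilinear_Cons[OF assms(1)]] by simp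
  obtain n xs where l: "l = n # xs" "n \<in> U" "xs \<in> tup k"
   using assms(2) by (auto simp: in_tuples_Suc)
  have "E.V (\<lambda>l. H (\<zero> # l)) l = E.V (\<lambda>l. (\<lambda>_. \<zero>) (H (\<zero> # l))) l"
   unfolding l using l Lin.multilinear_zero_hd[OF assms(1)]
   by (intro E.V_cong'[of k]) auto
  also have "\<dots> = \<zero>"
   using E.V_hom[OF f assms(2) Lin.zero_linear_map] by simp
  finally show ?thesis .
qed

text \<open>A path that starts at the second vertex stays there, because every term that returns to
  \<open>e1\<close> contains an element of \<open>e2 T e1 = 0\<close>.\<close>

lemma E_V_e2:
  assumes "mlin (Suc k) H" "x \<in> U" "xs \<in> tup k"
  shows "E.V H ((e2 \<otimes> x) # xs) = H (map \<beta> (x # xs))"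
  using assms
proof (induction xs arbitrary: k H x)
  case Nil
  then show ?case by (simp add: e2_left)
next
  case (Cons y ys)
  from Cons.prems obtain k' where k: "k = Suc k'" by (cases k) auto
  have 1: "E.V H ((e2 \<otimes> x) # y # ys) =
    E.V (\<lambda>l. H (\<zero> # l)) ((e1 \<otimes> y) # ys) \<oplus> E.V (\<lambda>l. H (\<beta> x # l)) ((e2 \<otimes> y) # ys)"
   using E_V_Cons[of k' H "e2 \<otimes> x" y ys] Cons.prems k e_triangular[of x] by (simp add: \<beta>_def)
  have 2: "E.V (\<lambda>l. H (\<beta> x # l)) ((e2 \<otimes> y) # ys) = H (map \<beta> (x # y # ys))"
   using Cons.IH[of k' "\<lambda>l. H (\<beta> x # l)" y] Cons.prems k Lin.multilinear_Cons[of k H "\<beta> x"] by simp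
  have "H (map \<beta> (x # y # ys)) \<in> U"
   using Lin.multilinear_closed[OF Cons.prems(1) map_\<beta>[of "x # y # ys"]] Cons.prems by simp
  then show ?case
   using 1 2 E_V_zero[of k' H "(e1 \<otimes> y) # ys"] Cons.prems k by simp
qed

text \<open>A path that starts at the first vertex either stays there or crosses exactly once; the
  two summands are these alternatives.\<close>

lemma E_V_e1:
  assumes "mlin (Suc k) H" "x \<in> U" "xs \<in> tup k"
  shows "E.V H ((e1 \<otimes> x) # xs) = H (map \<alpha> (x # xs)) \<oplus> crossing H (x # xs)"
  using assms
proof (induction xs arbitrary: k H x)
  case Nil
  then have "H [\<alpha> x \<oplus> \<nu> x] = H [\<alpha> x] \<oplus> H [\<nu> x]" "H [\<nu> x] \<in> U"
   using E.multilinear_add_hd[of k H "\<alpha> x" "\<nu> x" "[]"] Lin.multilinear_closed[of "Suc k" H "[\<nu> x]"]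
   by (simp_all del: multilinear.simps)
  then show ?case using Nil by (simp add: e1_left)
next
  case (Cons y ys)
  from Cons.prems obtain k' where k: "k = Suc k'" by (cases k) auto
  have 1: "E.V H ((e1 \<otimes> x) # y # ys) =
    E.V (\<lambda>l. H (\<alpha> x # l)) ((e1 \<otimes> y) # ys) \<oplus> E.V (\<lambda>l. H (\<nu> x # l)) ((e2 \<otimes> y) # ys)"
   using E_V_Cons[of k' H "e1 \<otimes> x" y ys] Cons.prems k by (simp add: \<alpha>_def \<nu>_def)
  have 2: "E.V (\<lambda>l. H (\<nu> x # l)) ((e2 \<otimes> y) # ys) = H (\<nu> x # map \<beta> (y # ys))"
   using E_V_e2[of k' "\<lambda>l. H (\<nu> x # l)" y ys] Cons.prems k Lin.multilinear_Cons[of k H "\<nu> x"] by simp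
  have 3: "E.V (\<lambda>l. H (\<alpha> x # l)) ((e1 \<otimes> y) # ys) =
    H (\<alpha> x # map \<alpha> (y # ys)) \<oplus> crossing (\<lambda>l. H (\<alpha> x # l)) (y # ys)"
   using Cons.IH[of k' "\<lambda>l. H (\<alpha> x # l)" y] Cons.prems k Lin.multilinear_Cons[of k H "\<alpha> x"] by simp
  have yy: "y # ys \<in> tup k" using Cons.prems by simp
  have "H (\<nu> x # map \<beta> (y # ys)) \<in> U" "H (\<alpha> x # map \<alpha> (y # ys)) \<in> U"
   "crossing (\<lambda>l. H (\<alpha> x # l)) (y # ys) \<in> U"
   using Lin.multilinear_funcset[OF Cons.prems(1)] map_\<beta>[OF yy] map_\<alpha>[OF yy] yy Cons.prems(2)
   by (auto intro!: crossing_closed[of _ k] simp del: crossing.simps simp: Pi_def)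
  then show ?case
   using 1 2 3 by (simp add: M.a_ac)
qed

text \<open>\<open>E.V\<close> commutes with \<open>bar\<close>, and so does the part with all
  entries in the first corner, because \<open>\<alpha>\<close> is multiplicative. The crossing part
  is the difference of the two.\<close>

lemma crossing_bar:
  assumes H: "mlin (Suc k) H" and l: "l \<in> tup (Suc (Suc k))"
  shows "crossing (br H) l = br (crossing H) l"
proof -
  obtain x xs where x: "l = x # xs" "x \<in> U" "xs \<in> tup (Suc k)"
   using l by (auto simp: in_tuples_Suc)
  have f: "H \<in> tup (Suc k) \<rightarrow> U" using H by (rule Lin.multilinear_funcset)
  have Cf: "crossing H \<in> tup (Suc k) \<rightarrow> U" using crossing_closed[OF f] by blast
  have bf: "br H \<in> tup (Suc (Suc k)) \<rightarrow> U" using Bar.bar_closed[OF f] by blast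
  have af: "(\<lambda>l. H (map \<alpha> l)) \<in> tup (Suc k) \<rightarrow> U" using f map_\<alpha> by auto
  have "br H (map \<alpha> l) \<oplus> crossing (br H) l = E.V (br H) ((e1 \<otimes> x) # xs)"
   unfolding x(1) using x by (intro E_V_e1[OF bar_multilinear[OF H], symmetric])
  also have "\<dots> = br (E.V H) ((e1 \<otimes> x) # xs)"
   using x by (intro E.V_bar[OF H]) auto
  also have "\<dots> = br (\<lambda>l. E.V H ((e1 \<otimes> hd l) # tl l)) l"
   unfolding x(1) using x by (intro Bar.bar_scale_hd[symmetric, of _ _ _ "Suc (Suc k)"]) auto
  also have "\<dots> = br (\<lambda>l. H (map \<alpha> l) \<oplus> crossing H l) l"
   using E_V_e1[OF H] l by (intro Bar.bar_cong[of "Suc k"]) (auto simp: in_tuples_Suc simp del: crossing.simps)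
  also have "\<dots> = br (\<lambda>l. H (map \<alpha> l)) l \<oplus> br (crossing H) l"
   by (rule Bar.bar_add[OF af Cf l])
  also have "br (\<lambda>l. H (map \<alpha> l)) l = br H (map \<alpha> l)"
   by (rule bar_map[symmetric, OF \<alpha>_mult l])
  finally show ?thesis
   using Bar.bar_closed[OF f map_\<alpha>[OF l]] crossing_closed[OF bf l] Bar.bar_closed[OF Cf l]
   by simp
qed

end

lemma linear_maps_comp:
  assumes "h \<in> linear_maps R N P" "f \<in> linear_maps R M N"
  shows "(\<lambda>x. h (f x)) \<in> linear_maps R M P"
  using linear_mapsD[OF assms(1)] linear_mapsD[OF assms(2)] by (intro linear_mapsI) auto

section \<open>The corners and the off-diagonal ideal\<close>

context peirce
begin

definition NN :: "'t set" where "NN = {n \<in> U. \<nu> n = n}"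
definition AA :: "'t set" where "AA = {a \<in> U. \<alpha> a = a}"

lemma \<alpha>_\<alpha> [simp]: "x \<in> U ==> \<alpha> (\<alpha> x) = \<alpha> x"
  by (simp add: \<alpha>_def A.m_assoc[symmetric]) (simp add: A.m_assoc)

lemma \<beta>_\<beta> [simp]: "x \<in> U ==> \<beta> (\<beta> x) = \<beta> x"
  by (simp add: \<beta>_def A.m_assoc[symmetric]) (simp add: A.m_assoc)

lemma \<nu>_\<nu> [simp]: "x \<in> U ==> \<nu> (\<nu> x) = \<nu> x"
  by (simp add: \<nu>_def A.m_assoc[symmetric]) (simp add: A.m_assoc)

lemma \<alpha>_\<nu> [simp]: "x \<in> U ==> \<alpha> (\<nu> x) = \<zero>"
  by (simp add: \<alpha>_def \<nu>_def A.m_assoc)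

lemma \<beta>_\<nu> [simp]: "x \<in> U ==> \<beta> (\<nu> x) = \<zero>"
  by (simp add: \<beta>_def \<nu>_def A.m_assoc[symmetric])

lemma \<nu>_\<alpha> [simp]: "x \<in> U ==> \<nu> (\<alpha> x) = \<zero>"
  by (simp add: \<alpha>_def \<nu>_def A.m_assoc)

lemma \<nu>_\<beta> [simp]: "x \<in> U ==> \<nu> (\<beta> x) = \<zero>"
  by (simp add: \<beta>_def \<nu>_def A.m_assoc[symmetric])

lemma \<alpha>_\<beta> [simp]: "x \<in> U ==> \<alpha> (\<beta> x) = \<zero>"
  by (simp add: \<alpha>_def \<beta>_def A.m_assoc[symmetric])

lemma \<beta>_\<alpha> [simp]: "x \<in> U ==> \<beta> (\<alpha> x) = \<zero>"
  by (simp add: \<alpha>_def \<beta>_def A.m_assoc[symmetric])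

lemma \<alpha>_one [simp]: "\<alpha> \<one> = e1" and \<nu>_one [simp]: "\<nu> \<one> = \<zero>" and \<beta>_one [simp]: "\<beta> \<one> = e2"
  by (simp_all add: \<alpha>_def \<beta>_def \<nu>_def)

lemma \<nu>_hom: "abelian_group_hom T T \<nu>"
  and \<alpha>_hom: "abelian_group_hom T T \<alpha>"
  and \<beta>_hom: "abelian_group_hom T T \<beta>"
  by (simp_all add: hom_of_linear \<nu>_linear \<alpha>_linear \<beta>_linear)

lemma \<nu>_zero [simp]: "\<nu> \<zero> = \<zero>" and \<alpha>_zero [simp]: "\<alpha> \<zero> = \<zero>" and \<beta>_zero [simp]: "\<beta> \<zero> = \<zero>"
  using abelian_group_hom.hom_zero \<nu>_hom \<alpha>_hom \<beta>_hom by blast+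

lemma NN_\<nu>: "n \<in> NN ==> \<nu> n = n"
  by (simp add: NN_def)

lemma NN_\<alpha>: "n \<in> NN ==> \<alpha> n = \<zero>"
  using \<alpha>_\<nu>[of n] by (simp add: NN_def)

lemma \<nu>_NN [simp, intro]: "x \<in> U ==> \<nu> x \<in> NN"
  by (simp add: NN_def)

lemma NN_I: "n \<in> U ==> \<nu> n = n ==> n \<in> NN"
  by (simp add: NN_def)

lemma NN_closed [simp, intro]: "n \<in> NN ==> n \<in> U"
  by (simp add: NN_def)

lemma decompose: "x \<in> U ==> x = \<alpha> x \<oplus> \<nu> x \<oplus> \<beta> x"
  using A.l_distr[of e1 e2 x] by (simp add: e_sum e1_left e2_left)

lemma eq_by_components:
  assumes "x \<in> U" "y \<in> U" "\<alpha> x = \<alpha> y" "\<nu> x = \<nu> y" "\<beta> x = \<beta> y"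
  shows "x = y"
  using decompose[OF assms(1)] decompose[OF assms(2)] assms(3-) by simp

end

text \<open>The operator \<open>Op\<close> is applied to the entries after the crossing of a path; it raises degrees by
  \<open>d\<close>, and the sign is the one with which it moves past the entries before the crossing.\<close>

locale crossing_lift = peirce K T e1 e2
  for K :: "'k ring" and T :: "('k, 't) module" (structure) and e1 e2 +
  fixes Op :: "('t list => 't) => 't list => 't" and d :: nat and neg :: bool
  assumes Op_closed: "H \<in> tup (d + Suc k) \<rightarrow> U ==> l \<in> tup (Suc k) ==> Op H l \<in> U"
   and Op_cong: "(\<And>l. l \<in> tup (d + Suc k) ==> H l = \<psi> l) ==> \<psi> \<in> tup (d + Suc k) \<rightarrow> U ==>
    n \<in> NN ==> l \<in> tup k ==> Op H (n # l) = Op \<psi> (n # l)"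
   and Op_hom: "H \<in> tup (d + Suc k) \<rightarrow> U ==> l \<in> tup (Suc k) ==> h \<in> lin ==>
    Op (\<lambda>l. h (H l)) l = h (Op H l)"
   and Op_add: "H \<in> tup (d + Suc k) \<rightarrow> U ==> \<psi> \<in> tup (d + Suc k) \<rightarrow> U ==>
    l \<in> tup (Suc k) ==> Op (\<lambda>l. H l \<oplus> \<psi> l) l = Op H l \<oplus> Op \<psi> l"
   and Op_multilinear: "mlin (d + Suc k) H ==> n \<in> NN ==>
    mlin k (\<lambda>l. Op H (n # l))"
   and Op_add_hd: "mlin (d + Suc k) H ==> n \<in> NN ==> n' \<in> NN ==> l \<in> tup k ==>
    Op H ((n \<oplus> n') # l) = Op H (n # l) \<oplus> Op H (n' # l)"
   and Op_smult_hd: "mlin (d + Suc k) H ==> n \<in> NN ==> l \<in> tup k ==> r \<in> carrier K ==>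
    Op H ((r \<odot> n) # l) = r \<odot> Op H (n # l)"
   and Op_left: "mlin (d + Suc k) H ==> t \<in> U ==> n \<in> NN ==> l \<in> tup k ==>
    Op (\<lambda>l. H ((t \<otimes> hd l) # tl l)) (n # l) = Op H ((t \<otimes> n) # l)"
begin

definition sg :: "'t => 't" where "sg x = (if neg then \<ominus> x else x)"

fun lift :: "('t list => 't) => 't list => 't" where
  "lift H (x # xs) = Op H (\<nu> x # map \<beta> xs) \<oplus> sg (lift (\<lambda>l. H (\<alpha> x # l)) xs)"
| "lift H [] = \<zero>"

lemma sg_linear: "sg \<in> lin"
  by (rule linear_mapsI) (auto simp: sg_def M.minus_add smult_r_minus)

lemma sg_closed [simp]: "x \<in> U ==> sg x \<in> U"
  by (simp add: sg_def)

lemma sg_hom: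
  assumes "h \<in> lin" "x \<in> U"
  shows "sg (h x) = h (sg x)"
proof -
  interpret h: abelian_group_hom T T h using assms(1) by (rule hom_of_linear)
  show ?thesis using assms by (simp add: sg_def)
qed

lemma \<alpha>_funcset: "H \<in> tup (d + Suc k) \<rightarrow> U ==> x \<in> U ==>
   (\<lambda>l. H (\<alpha> x # l)) \<in> tup (d + k) \<rightarrow> U"
  by (auto simp: Pi_def)

lemma lift_closed:
  "H \<in> tup (d + k) \<rightarrow> U ==> l \<in> tup k ==> lift H l \<in> U"
proof (induction k arbitrary: H l)
  case (Suc k)
  then obtain x xs where l: "l = x # xs" "x \<in> U" "xs \<in> tup k"
   by (auto simp: in_tuples_Suc)
  show ?case
   using Op_closed[OF Suc.prems(1), of "\<nu> x # map \<beta> xs"] Suc.IH[OF \<alpha>_funcset[OF Suc.prems(1) l(2)] l(3)] l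
   by (simp add: map_\<beta>)
qed simp

lemma lift_cong:
  "(\<And>l. l \<in> tup (d + k) ==> H l = \<psi> l) ==> \<psi> \<in> tup (d + k) \<rightarrow> U ==>
   l \<in> tup k ==> lift H l = lift \<psi> l"
proof (induction k arbitrary: H \<psi> l)
  case (Suc k)
  then obtain x xs where l: "l = x # xs" "x \<in> U" "xs \<in> tup k"
   by (auto simp: in_tuples_Suc)
  have "Op H (\<nu> x # map \<beta> xs) = Op \<psi> (\<nu> x # map \<beta> xs)"
   using Suc.prems(1,2) l map_\<beta>[OF l(3)] by (intro Op_cong[of k]) auto
  moreover have "lift (\<lambda>l. H (\<alpha> x # l)) xs = lift (\<lambda>l. \<psi> (\<alpha> x # l)) xs"
   using Suc.prems(1) l by (intro Suc.IH \<alpha>_funcset[OF Suc.prems(2)]) auto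
  ultimately show ?case by (simp add: l)
qed simp

lemma lift_hom:
  "H \<in> tup (d + k) \<rightarrow> U ==> l \<in> tup k ==> h \<in> lin ==>
   lift (\<lambda>l. h (H l)) l = h (lift H l)"
proof (induction k arbitrary: H l)
  case 0
  interpret h: abelian_group_hom T T h using 0(3) by (rule hom_of_linear)
  show ?case using 0 by simp
next
  case (Suc k)
  interpret h: abelian_group_hom T T h using Suc.prems(3) by (rule hom_of_linear)
  obtain x xs where l: "l = x # xs" "x \<in> U" "xs \<in> tup k"
   using Suc.prems by (auto simp: in_tuples_Suc)
  note f = \<alpha>_funcset[OF Suc.prems(1) l(2)]
  have b: "\<nu> x # map \<beta> xs \<in> tup (Suc k)" using l map_\<beta> by simp
  show ?case
   using Op_hom[OF Suc.prems(1) b Suc.prems(3)] Suc.IH[OF f l(3) Suc.prems(3)]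
    Op_closed[OF Suc.prems(1) b] lift_closed[OF f l(3)] Suc.prems(3)
   by (simp add: l sg_hom)
qed

lemma lift_add:
  "H \<in> tup (d + k) \<rightarrow> U ==> \<psi> \<in> tup (d + k) \<rightarrow> U ==> l \<in> tup k ==>
   lift (\<lambda>l. H l \<oplus> \<psi> l) l = lift H l \<oplus> lift \<psi> l"
proof (induction k arbitrary: H \<psi> l)
  case (Suc k)
  obtain x xs where l: "l = x # xs" "x \<in> U" "xs \<in> tup k"
   using Suc.prems by (auto simp: in_tuples_Suc)
  note f = \<alpha>_funcset[OF Suc.prems(1) l(2)] \<alpha>_funcset[OF Suc.prems(2) l(2)]
  have b: "\<nu> x # map \<beta> xs \<in> tup (Suc k)" using l map_\<beta> by simp
  show ?case
   using Op_add[OF Suc.prems(1,2) b] Suc.IH[OF f l(3)]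
    Op_closed[OF Suc.prems(1) b] lift_closed[OF f(1) l(3)] Op_closed[OF Suc.prems(2) b] lift_closed[OF f(2) l(3)]
   by (simp add: l linear_mapsD[OF sg_linear] M.a_ac)
qed simp

lemma lift_minus:
  assumes "H \<in> tup (d + k) \<rightarrow> U" "\<psi> \<in> tup (d + k) \<rightarrow> U" "l \<in> tup k"
  shows "lift (\<lambda>l. H l \<ominus> \<psi> l) l = lift H l \<ominus> lift \<psi> l"
proof -
  have h: "(\<lambda>x. \<ominus> x) \<in> lin"
   by (intro linear_mapsI) (auto simp: M.minus_add smult_r_minus)
  have "lift (\<lambda>l. H l \<ominus> \<psi> l) l = lift H l \<oplus> lift (\<lambda>l. \<ominus> \<psi> l) l"
   unfolding M.minus_eq using assms by (intro lift_add) (auto simp: Pi_def)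
  then show ?thesis
   using lift_hom[OF assms(2,3) h] by (simp add: M.minus_eq)
qed

lemma lift_zero:
  assumes "\<And>l. l \<in> tup (d + k) ==> H l = \<zero>" "l \<in> tup k"
  shows "lift H l = \<zero>"
proof -
  have f: "H \<in> tup (d + k) \<rightarrow> U" using assms(1) by auto
  have "lift H l = lift (\<lambda>l. (\<lambda>_. \<zero>) (H l)) l"
   using assms by (intro lift_cong[of k]) auto
  then show ?thesis using lift_hom[OF f assms(2) Lin.zero_linear_map] by simp
qed

lemma lift_multilinear: "mlin (d + k) H ==> mlin k (lift H)"
proof (induction k arbitrary: H)
  case (Suc k)
  have H: "mlin (Suc (d + k)) H" using Suc.prems by simp
  have ml: "mlin (d + k) (\<lambda>l. H (\<alpha> x # l))" if "x \<in> U" for x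
   using Lin.multilinear_Cons[OF H] that by simp
  note f = Lin.multilinear_funcset[OF ml]
  show ?case
   unfolding multilinear.simps(2)[of K T T k]
  proof (intro conjI ballI)
   fix x assume x: "x \<in> U"
   have "mlin k (\<lambda>l. Op H (\<nu> x # map \<beta> l))"
    using Lin.multilinear_map[OF \<beta>_linear Op_multilinear[OF Suc.prems \<nu>_NN[OF x]]] .
   then show "mlin k (\<lambda>l. lift H (x # l))"
    unfolding lift.simps using Lin.multilinear_hom[OF sg_linear Suc.IH[OF ml[OF x]]]
    by (rule Lin.multilinear_add)
  next
   fix l assume l: "l \<in> tup k"
   have b: "map \<beta> l \<in> tup k" using l by (rule map_\<beta>)
   have "(\<lambda>x. Op H (\<nu> x # map \<beta> l)) \<in> lin"
   proof (rule linear_mapsI)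
    fix x assume "x \<in> U"
    then show "Op H (\<nu> x # map \<beta> l) \<in> U"
     using Op_closed[OF Lin.multilinear_funcset[OF Suc.prems]] b by simp
   qed (use b in \<open>simp_all add: linear_mapsD[OF \<nu>_linear] Op_add_hd[OF Suc.prems] Op_smult_hd[OF Suc.prems]\<close>)
   moreover have "(\<lambda>x. lift (\<lambda>l. H (\<alpha> x # l)) l) \<in> lin"
   proof (rule linear_mapsI)
    fix x y assume xy: "x \<in> U" "y \<in> U"
    have "lift (\<lambda>l. H (\<alpha> (x \<oplus> y) # l)) l = lift (\<lambda>l. H (\<alpha> x # l) \<oplus> H (\<alpha> y # l)) l"
     using xy l f[OF xy(1)] f[OF xy(2)] E.multilinear_add_hd[OF H]
     by (intro lift_cong[of k]) (auto simp: linear_mapsD[OF \<alpha>_linear] Pi_def)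
    then show "lift (\<lambda>l. H (\<alpha> (x \<oplus> y) # l)) l = lift (\<lambda>l. H (\<alpha> x # l)) l \<oplus> lift (\<lambda>l. H (\<alpha> y # l)) l"
     using lift_add[OF f[OF xy(1)] f[OF xy(2)] l] by simp
   next
    fix r x assume rx: "r \<in> carrier K" "x \<in> U"
    have h: "(\<lambda>t. r \<odot> t) \<in> lin"
     using rx by (intro linear_mapsI) (auto simp: smult_r_distr smult_assoc1[symmetric] R.m_comm)
    have "lift (\<lambda>l. H (\<alpha> (r \<odot> x) # l)) l = lift (\<lambda>l. r \<odot> H (\<alpha> x # l)) l"
     using rx l f[OF rx(2)] linear_mapsD(3)[OF Lin.multilinear_linear[OF H]]
     by (intro lift_cong[of k]) (auto simp: linear_mapsD[OF \<alpha>_linear] Pi_def)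
    then show "lift (\<lambda>l. H (\<alpha> (r \<odot> x) # l)) l = r \<odot> lift (\<lambda>l. H (\<alpha> x # l)) l"
     using lift_hom[OF f[OF rx(2)] l h] by simp
   qed (use lift_closed[OF f l] in auto)
   ultimately show "(\<lambda>x. lift H (x # l)) \<in> lin"
    unfolding lift.simps by (intro Lin.add_linear_maps linear_maps_comp[OF sg_linear])
  qed
qed simp

text \<open>A leading entry from \<open>N\<close> is the crossing itself: a later crossing would
  involve its component in the first corner, which is zero.\<close>

lemma lift_NN:
  assumes H: "mlin (d + Suc k) H" and n: "n \<in> NN" and l: "l \<in> tup k"
  shows "lift H (n # l) = Op H (n # map \<beta> l)"
proof -
  have "lift (\<lambda>l. H (\<zero> # l)) l = \<zero>"
   using l Lin.multilinear_zero_hd[of "d + k" H] H by (intro lift_zero[of k]) auto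
  moreover have "Op H (n # map \<beta> l) \<in> U"
   using Op_closed[OF Lin.multilinear_funcset[OF H]] n map_\<beta>[OF l] by simp
  ultimately show ?thesis using n by (simp add: NN_\<nu> NN_\<alpha> sg_def)
qed

text \<open>The left factor moves from the leading entry into the first argument of the sandwich,
  where associativity releases it.\<close>

lemma lift_NN_left:
  assumes f: "mlin m f" "Suc (Suc m) = d + Suc k"
   and n: "n \<in> NN" "t \<in> U" and l: "l \<in> tup k"
  shows "lift (sw f) ((\<alpha> t \<otimes> n) # l) = \<alpha> t \<otimes> lift (sw f) (n # l)"
proof -
  have H: "mlin (d + Suc k) (sw f)"
   using sandwich_multilinear[OF f(1)] f(2) by simp
  note fc = Lin.multilinear_funcset[OF H]
  have tn: "\<alpha> t \<otimes> n \<in> NN" using n \<nu>_mult[of "\<alpha> t" n] NN_\<nu>[OF n(1)] by (intro NN_I) auto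
  have b: "map \<beta> l \<in> tup k" using l by (rule map_\<beta>)
  have "Op (sw f) ((\<alpha> t \<otimes> n) # map \<beta> l) =
    Op (\<lambda>l. sw f ((\<alpha> t \<otimes> hd l) # tl l)) (n # map \<beta> l)"
   using n b by (intro Op_left[OF H, symmetric]) auto
  also have "\<dots> = Op (\<lambda>l. \<alpha> t \<otimes> sw f l) (n # map \<beta> l)"
  proof (rule Op_cong)
   fix l assume "l \<in> tup (d + Suc k)"
   then obtain y xs z where "l = y # xs @ [z]" "y \<in> U" "z \<in> U" "xs \<in> tup m"
    unfolding f(2)[symmetric] by (subst (asm) in_tuples_Suc_Suc) blast
   then show "sw f ((\<alpha> t \<otimes> hd l) # tl l) = \<alpha> t \<otimes> sw f l"
    using n Lin.multilinear_closed[OF f(1)] by (simp add: A.m_assoc)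
  qed (use fc n b in auto)
  also have "\<dots> = \<alpha> t \<otimes> Op (sw f) (n # map \<beta> l)"
   using fc n b by (intro Op_hom[where k = k] mult_left_linear) auto
  finally show ?thesis using lift_NN[OF H] tn n l by simp
qed

text \<open>If the crossing is not in \<open>y\<close>, only \<open>\<alpha> y\<close> enters; it is
  then a left factor of the sandwich and can be pulled out, leaving a unit in its place.\<close>

lemma lift_split:
  assumes f: "mlin m f" "Suc (Suc m) = d + Suc k" and y: "y \<in> U" and l: "l \<in> tup k"
   and dk: "0 < d + k"
  shows "lift (sw f) (y # l) =
   lift (sw f) (\<nu> y # l) \<oplus> \<alpha> y \<otimes> lift (sw f) (\<one> # l)"
proof -
  have H: "mlin (d + Suc k) (sw f)"
   using sandwich_multilinear[OF f(1)] f(2) by simp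
  then have H': "mlin (Suc (d + k)) (sw f)" by simp
  have fe: "(\<lambda>l. sw f (e1 # l)) \<in> tup (d + k) \<rightarrow> U"
   using Lin.multilinear_funcset[OF Lin.multilinear_Cons[OF H' e_closed(1)]] .
  have b: "map \<beta> l \<in> tup k" using l by (rule map_\<beta>)
  have 1: "lift (\<lambda>l. sw f (\<alpha> y # l)) l = \<alpha> y \<otimes> lift (\<lambda>l. sw f (e1 # l)) l"
  proof -
   have ye: "\<alpha> y \<otimes> e1 = \<alpha> y" using y by (simp add: e1_right)
   have "lift (\<lambda>l. sw f (\<alpha> y # l)) l = lift (\<lambda>l. \<alpha> y \<otimes> sw f (e1 # l)) l"
   proof (rule lift_cong)
    fix l assume l: "l \<in> tup (d + k)"
    have "f (butlast l) \<in> U" "last l \<in> U"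
     using butlast_closed[of l m] l f dk Lin.multilinear_closed[OF f(1)] by auto
    then show "sw f (\<alpha> y # l) = \<alpha> y \<otimes> sw f (e1 # l)"
     using y l dk ye by (cases l) (auto simp: sandwich_def A.m_assoc[symmetric] tuples_def)
   qed (use fe y l in auto)
   also have "\<dots> = \<alpha> y \<otimes> lift (\<lambda>l. sw f (e1 # l)) l"
    using y by (intro lift_hom[OF fe l] mult_left_linear) auto
   finally show ?thesis .
  qed
  \<comment> \<open>The crossing in the leading unit contributes nothing, as
    \<open>\<nu> 1 = 0\<close>.\<close>
  have "Op (sw f) (\<zero> # map \<beta> l) = \<zero>"
  proof -
   have "\<zero> \<in> NN" by (intro NN_I) auto
   from Op_smult_hd[OF H this b, of "\<zero>\<^bsub>K\<^esub>"] show ?thesis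
    using Op_closed[OF Lin.multilinear_funcset[OF H], of "\<zero> # map \<beta> l"] b by simp
  qed
  then have "lift (sw f) (\<one> # l) = sg (lift (\<lambda>l. sw f (e1 # l)) l)"
   using lift_closed[OF fe l] by simp
  then have "sg (lift (\<lambda>l. sw f (\<alpha> y # l)) l) = \<alpha> y \<otimes> lift (sw f) (\<one> # l)"
   unfolding 1 using sg_hom[OF mult_left_linear lift_closed[OF fe l], of "\<alpha> y"] y by simp
  moreover have "lift (sw f) (\<nu> y # l) = Op (sw f) (\<nu> y # map \<beta> l)"
   using y l by (intro lift_NN[OF H]) auto
  ultimately show ?thesis by simp
qed

end

section \<open>Contraction of the crossing paths along a dual basis\<close>

locale crossing_prism = peirce K T e1 e2 +
  P: prism K T J c w "peirce.NN T e1 e2" "peirce.AA T e1"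
  for K :: "'k ring" and T :: "('k, 't) module" (structure) and e1 e2
   and J :: "'i set" and c :: "'i => 't => 't" and w :: "'i => 't"
begin

text \<open>\<open>W\<close> evaluates \<open>H\<close> at lists with one more entry than its own
  argument, whence \<open>d = 1\<close>; as an operator of odd degree it picks up a sign for every
  entry before the crossing.\<close>

sublocale KK: crossing_lift K T e1 e2 P.W "Suc 0" True
proof
  fix H k l assume "H \<in> tup (Suc 0 + Suc k) \<rightarrow> U" "l \<in> tup (Suc k)"
  then show "P.W H l \<in> U" by (intro P.W_closed[of _ k]) auto
next
  fix H \<psi> n l k
  assume "\<And>l. l \<in> tup (Suc 0 + Suc k) ==> H l = \<psi> l"
   "\<psi> \<in> tup (Suc 0 + Suc k) \<rightarrow> U" "n \<in> NN" "l \<in> tup k"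
  then show "P.W H (n # l) = P.W \<psi> (n # l)" by (intro P.W_cong[of k]) auto
qed (simp_all add: P.W_hom P.W_add P.W_multilinear P.W_add_hd P.W_smult_hd P.W_left del: multilinear.simps)

sublocale VV: crossing_lift K T e1 e2 P.V 0 False
proof
  fix H k l assume "H \<in> tup (0 + Suc k) \<rightarrow> U" "l \<in> tup (Suc k)"
  then show "P.V H l \<in> U" by (intro P.V_closed[of _ k]) auto
next
  fix H \<psi> n l k
  assume "\<And>l. l \<in> tup (0 + Suc k) ==> H l = \<psi> l"
   "\<psi> \<in> tup (0 + Suc k) \<rightarrow> U" "n \<in> NN" "l \<in> tup k"
  then show "P.V H (n # l) = P.V \<psi> (n # l)" by (intro P.V_cong'[of k]) auto
qed (simp_all add: P.V_hom P.V_add P.V_multilinear P.V_add_hd P.V_smult_hd P.V_left del: multilinear.simps)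

lemma KK_Cons: "KK.lift H (x # xs) = P.W H (\<nu> x # map \<beta> xs) \<ominus> KK.lift (\<lambda>l. H (\<alpha> x # l)) xs"
  by (simp add: KK.sg_def M.minus_eq)

lemma VV_Cons: "VV.lift H (x # xs) = P.V H (\<nu> x # map \<beta> xs) \<oplus> VV.lift (\<lambda>l. H (\<alpha> x # l)) xs"
  by (simp add: VV.sg_def)

declare KK.lift.simps(1) [simp del] VV.lift.simps(1) [simp del]

text \<open>The homotopy formula for \<open>W\<close> and \<open>V\<close> is applied from the
  crossing on and summed over the position of the crossing. What holds the sum together is
  \<open>\<nu> (x y) = \<alpha> x \<nu> y + \<nu> x \<beta> y\<close>: a product of neighbours
  crosses in exactly one of its factors.\<close>

theorem crossing_homotopy:
  assumes "mlin (Suc k) H" "l \<in> tup (Suc k)"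
  shows "KK.lift (br H) l \<oplus> br (KK.lift H) l \<oplus> VV.lift H l = crossing H l"
  using assms
proof (induction k arbitrary: H l)
  case 0
  then obtain z where l: "l = [z]" "z \<in> U" by (auto simp: in_tuples_Suc)
  then show ?case
   using Lin.multilinear_closed[OF 0(1), of "[\<nu> z]"] by (simp add: KK_Cons VV_Cons M.minus_eq)
next
  case (Suc k)
  then obtain x y zs where l: "l = x # y # zs" "x \<in> U" "y \<in> U" "zs \<in> tup k"
   by (auto simp: in_tuples_Suc)
  note H = Suc.prems(1)
  have f: "H \<in> tup (Suc (Suc k)) \<rightarrow> U" using H by (rule Lin.multilinear_funcset)
  have Ha: "mlin (Suc k) (\<lambda>l. H (\<alpha> x # l))"
   using Lin.multilinear_Cons[OF H] l by simp
  have fa: "(\<lambda>l. H (\<alpha> x # l)) \<in> tup (Suc k) \<rightarrow> U"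
   using Lin.multilinear_funcset[OF Ha] .
  have bfa: "br (\<lambda>l. H (\<alpha> x # l)) \<in> tup (Suc (Suc k)) \<rightarrow> U"
   using Bar.bar_closed[OF fa] by blast
  have bf: "br H \<in> tup (Suc (Suc (Suc k))) \<rightarrow> U"
   using Bar.bar_closed[OF f] by blast
  have yz: "y # zs \<in> tup (Suc k)" using l by simp
  have byz: "map \<beta> (y # zs) \<in> tup (Suc k)" and bz: "map \<beta> zs \<in> tup k"
   using map_\<beta>[OF yz] map_\<beta>[OF l(4)] by auto
  define p where "p = P.W (br H) (\<nu> x # map \<beta> (y # zs))"
  \<comment> \<open>\<open>q\<close> and \<open>r\<close> are the two cases for the product of
    \<open>x\<close> and \<open>y\<close>, the crossing in \<open>y\<close> and the crossing in
    \<open>x\<close>. The first cancels between the two homotopy terms, the second belongs to the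
    formula for the crossing in \<open>x\<close>.\<close>
  define q where "q = P.W H ((\<alpha> x \<otimes> \<nu> y) # map \<beta> zs)"
  define r where "r = P.W H ((\<nu> x \<otimes> \<beta> y) # map \<beta> zs)"
  define k0 where "k0 = KK.lift (\<lambda>l. H (\<alpha> (x \<otimes> y) # l)) zs"
  define m where "m = KK.lift (br (\<lambda>l. H (\<alpha> x # l))) (y # zs)"
  define u where "u = br (\<lambda>l. P.W H (\<nu> x # l)) (map \<beta> (y # zs))"
  define t where "t = br (KK.lift (\<lambda>l. H (\<alpha> x # l))) (y # zs)"
  define v where "v = P.V H (\<nu> x # map \<beta> (y # zs))"
  define v' where "v' = VV.lift (\<lambda>l. H (\<alpha> x # l)) (y # zs)"
  have Wx: "(\<lambda>l. P.W H (\<nu> x # l)) \<in> tup k \<rightarrow> U"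
   using l P.W_closed[of H k] f by auto
  have Ka: "KK.lift (\<lambda>l. H (\<alpha> x # l)) \<in> tup k \<rightarrow> U"
   using KK.lift_closed[of "\<lambda>l. H (\<alpha> x # l)" k] fa by auto
  have xy: "\<alpha> x \<otimes> \<nu> y \<in> NN" "\<nu> x \<otimes> \<beta> y \<in> NN"
   using l by (auto intro: P.N_left P.N_right)
  have closed: "p \<in> U" "q \<in> U" "r \<in> U" "k0 \<in> U" "m \<in> U"
   "u \<in> U" "t \<in> U" "v \<in> U" "v' \<in> U"
  proof -
   show "p \<in> U" unfolding p_def using bf byz l by (intro P.W_closed[of _ "Suc k"]) auto
   show "q \<in> U" "r \<in> U" unfolding q_def r_def using f bz l by (intro P.W_closed[of _ k]; auto)+
   have "(\<lambda>l. H (\<alpha> (x \<otimes> y) # l)) \<in> tup (Suc k) \<rightarrow> U"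
    using f l by (auto simp: Pi_def)
   then show "k0 \<in> U" unfolding k0_def using l by (intro KK.lift_closed[of _ k]) auto
   show "m \<in> U" unfolding m_def using bfa yz by (intro KK.lift_closed[of _ "Suc k"]) auto
   show "u \<in> U" unfolding u_def using Wx byz by (intro Bar.bar_closed[of _ k]) auto
   show "t \<in> U" unfolding t_def using Ka yz by (intro Bar.bar_closed[of _ k]) auto
   show "v \<in> U" unfolding v_def using f byz l by (intro P.V_closed[of _ "Suc k"]) auto
   show "v' \<in> U" unfolding v'_def using fa yz by (intro VV.lift_closed[of _ "Suc k"]) auto
  qed
  have 1: "KK.lift (\<lambda>l. br H (\<alpha> x # l)) (y # zs) = (q \<ominus> k0) \<ominus> m"
  proof -
   have g: "(\<lambda>l. H ((\<alpha> x \<otimes> hd l) # tl l)) \<in> tup (Suc (Suc k)) \<rightarrow> U"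
    using f l by (auto simp: in_tuples_Suc Pi_def)
   have "KK.lift (\<lambda>l. br H (\<alpha> x # l)) (y # zs) =
     KK.lift (\<lambda>l. H ((\<alpha> x \<otimes> hd l) # tl l) \<ominus> br (\<lambda>l. H (\<alpha> x # l)) l) (y # zs)"
    using g bfa yz by (intro KK.lift_cong[of "Suc k"]) (auto simp: in_tuples_Suc Pi_def)
   also have "\<dots> = KK.lift (\<lambda>l. H ((\<alpha> x \<otimes> hd l) # tl l)) (y # zs) \<ominus> m"
    unfolding m_def using g bfa yz by (intro KK.lift_minus) auto
   also have "KK.lift (\<lambda>l. H ((\<alpha> x \<otimes> hd l) # tl l)) (y # zs) = q \<ominus> k0"
    unfolding KK_Cons q_def k0_def using P.W_left[OF H, of "\<alpha> x" "\<nu> y" "map \<beta> zs"] l bz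
    by (simp add: \<alpha>_mult)
   finally show ?thesis .
  qed
  have 2: "KK.lift H ((x \<otimes> y) # zs) = (q \<oplus> r) \<ominus> k0"
   unfolding KK_Cons q_def r_def k0_def using P.W_add_hd[OF H xy bz] l by (simp add: \<nu>_mult)
  have 3: "br (\<lambda>l. KK.lift H (x # l)) (y # zs) = u \<ominus> t"
  proof -
   have "br (\<lambda>l. KK.lift H (x # l)) (y # zs) =
     br (\<lambda>l. P.W H (\<nu> x # map \<beta> l) \<ominus> KK.lift (\<lambda>l. H (\<alpha> x # l)) l) (y # zs)"
    by (simp only: KK_Cons)
   also have "\<dots> = br (\<lambda>l. P.W H (\<nu> x # map \<beta> l)) (y # zs) \<ominus> t"
    unfolding t_def using Wx Ka yz map_\<beta> by (intro Bar.bar_minus[of _ k]) auto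
   also have "br (\<lambda>l. P.W H (\<nu> x # map \<beta> l)) (y # zs) = u"
    unfolding u_def by (rule bar_map[symmetric, OF \<beta>_mult yz])
   finally show ?thesis .
  qed
  have 4: "p \<oplus> (r \<ominus> u) \<oplus> v = H (\<nu> x # map \<beta> (y # zs))"
   using P.prism[OF H \<nu>_NN[OF l(2)] byz] by (simp add: p_def r_def u_def v_def)
  have 5: "m \<oplus> t \<oplus> v' = crossing (\<lambda>l. H (\<alpha> x # l)) (y # zs)"
   unfolding m_def t_def v'_def by (rule Suc.IH[OF Ha yz])
  have "KK.lift (br H) l = p \<ominus> ((q \<ominus> k0) \<ominus> m)"
   unfolding l KK_Cons[of _ x] 1 p_def ..
  moreover have "br (KK.lift H) l = ((q \<oplus> r) \<ominus> k0) \<ominus> (u \<ominus> t)"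
   unfolding l bar.simps 2 3 ..
  moreover have "VV.lift H l = v \<oplus> v'"
   unfolding l VV_Cons[of _ x] v_def v'_def ..
  moreover have "crossing H l = (p \<oplus> (r \<ominus> u) \<oplus> v) \<oplus> (m \<oplus> t \<oplus> v')"
   unfolding l crossing.simps(1)[of _ x] 4 5 ..
  ultimately show ?case using closed by algebra
qed

text \<open>The argument of \<open>V_bar\<close>, with \<open>crossing\<close> in place of the
  identity; this works because \<open>crossing\<close> commutes with \<open>bar\<close>.\<close>

theorem VV_bar:
  assumes H: "mlin (Suc k) H" and l: "l \<in> tup (Suc (Suc k))"
  shows "VV.lift (br H) l = br (VV.lift H) l"
proof -
  have f: "H \<in> tup (Suc k) \<rightarrow> U" using H by (rule Lin.multilinear_funcset)
  have bf: "br H \<in> tup (Suc (Suc k)) \<rightarrow> U"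
   using Bar.bar_closed[OF f] by blast
  have Wf: "KK.lift H \<in> tup k \<rightarrow> U" using KK.lift_closed[of H k] f by auto
  have Wbf: "KK.lift (br H) \<in> tup (Suc k) \<rightarrow> U"
   using KK.lift_closed[of "br H" "Suc k"] bf by auto
  have bWf: "br (KK.lift H) \<in> tup (Suc k) \<rightarrow> U" using Bar.bar_closed[OF Wf] by blast
  have Vf: "VV.lift H \<in> tup (Suc k) \<rightarrow> U" using VV.lift_closed[of H "Suc k"] f by auto
  have Vbf: "VV.lift (br H) l \<in> U" using VV.lift_closed[of _ "Suc (Suc k)"] bf l by auto
  have "KK.lift (br (br H)) l = \<zero>"
   using l Bar.bar_bar[OF f] by (intro KK.lift_zero[of "Suc (Suc k)"]) auto
  then have "br (KK.lift (br H)) l \<oplus> VV.lift (br H) l = crossing (br H) l"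
   using crossing_homotopy[OF bar_multilinear[OF H] l] Bar.bar_closed[OF Wbf l] Vbf by simp
  also have "\<dots> = br (crossing H) l" by (rule crossing_bar[OF H l])
  also have "\<dots> = br (\<lambda>l. KK.lift (br H) l \<oplus> br (KK.lift H) l \<oplus> VV.lift H l) l"
   using crossing_homotopy[OF H] l by (intro Bar.bar_cong[of "Suc k"]) auto
  also have "\<dots> = br (KK.lift (br H)) l \<oplus> br (br (KK.lift H)) l \<oplus> br (VV.lift H) l"
   using Wbf bWf Vf l by (simp add: Bar.bar_add[of _ "Suc k"] Pi_def del: bar.simps)
  also have "br (br (KK.lift H)) l = \<zero>"
   using Wf l by (intro Bar.bar_bar[of _ k]) auto
  finally show ?thesis
   using Bar.bar_closed[OF Wbf l] Vbf Bar.bar_closed[OF Vf l] by simp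
qed

text \<open>A crossing in the last entry contributes nothing, since \<open>W\<close> vanishes on a
  single entry; so only the component \<open>\<beta> z\<close> of the last entry matters.\<close>

lemma KK_last:
  assumes "\<And>l. l \<in> tup (Suc k) ==> H (l @ [\<beta> z]) = h (H (l @ [\<beta> z']))"
   and "\<And>l. l \<in> tup (Suc k) ==> H (l @ [\<beta> z']) \<in> U"
   and z: "z \<in> U" "z' \<in> U" and h: "h \<in> lin" and "l \<in> tup k"
  shows "KK.lift H (l @ [z]) = h (KK.lift H (l @ [z'])) \<and> KK.lift H (l @ [z']) \<in> U"
proof -
  interpret h: abelian_group_hom T T h using h by (rule hom_of_linear)
  show ?thesis
   using assms(1,2,6)
  proof (induction k arbitrary: H l)
   case 0
   then show ?case by (simp add: KK_Cons M.minus_eq)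
  next
   case (Suc k)
   then obtain x xs where l: "l = x # xs" "x \<in> U" "xs \<in> tup k"
    by (auto simp: in_tuples_Suc)
   have 1: "P.W H (\<nu> x # map \<beta> xs @ [\<beta> z]) = h (P.W H (\<nu> x # map \<beta> xs @ [\<beta> z'])) \<and>
     P.W H (\<nu> x # map \<beta> xs @ [\<beta> z']) \<in> U"
    using Suc.prems(1,2) l z map_\<beta>[OF l(3)] h by (intro P.W_last[of k]) auto
   have 2: "KK.lift (\<lambda>l. H (\<alpha> x # l)) (xs @ [z]) = h (KK.lift (\<lambda>l. H (\<alpha> x # l)) (xs @ [z'])) \<and>
     KK.lift (\<lambda>l. H (\<alpha> x # l)) (xs @ [z']) \<in> U"
    using Suc.prems(1,2)[of "\<alpha> x # _"] l by (intro Suc.IH) auto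
   show ?case using 1 2 by (simp add: l KK_Cons)
  qed
qed

text \<open>The additional term is the path that crosses in the last entry, where \<open>V\<close>
  is evaluation. For the reference entry \<open>z'\<close> this path is excluded by
  \<open>\<nu> z' = 0\<close>.\<close>

lemma VV_last:
  assumes "\<And>as v. as \<in> tup k ==> v \<in> NN ==> H (as @ [v \<otimes> \<beta> z]) = h (H (as @ [v \<otimes> \<beta> z']))"
   and "\<And>as v. as \<in> tup k ==> v \<in> U ==> H (as @ [v]) \<in> U"
   and "\<And>as. as \<in> tup k ==> H (as @ [\<zero>]) = \<zero>"
   and z: "z \<in> U" "z' \<in> U" "\<nu> z' = \<zero>" and h: "h \<in> lin" and "l \<in> tup k"
  shows "VV.lift H (l @ [z]) = h (VV.lift H (l @ [z'])) \<oplus> H (map \<alpha> l @ [\<nu> z]) \<and>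
   VV.lift H (l @ [z']) \<in> U"
proof -
  interpret h: abelian_group_hom T T h using h by (rule hom_of_linear)
  show ?thesis
   using assms(1,2,3,8)
  proof (induction k arbitrary: H l)
   case 0
   then show ?case
    using 0(2)[of "[]" "\<nu> z"] 0(3)[of "[]"] z by (simp add: VV_Cons)
  next
   case (Suc k)
   then obtain x xs where l: "l = x # xs" "x \<in> U" "xs \<in> tup k"
    by (auto simp: in_tuples_Suc)
   have 1: "P.V H (\<nu> x # map \<beta> xs @ [\<beta> z]) = h (P.V H (\<nu> x # map \<beta> xs @ [\<beta> z'])) \<and>
     P.V H (\<nu> x # map \<beta> xs @ [\<beta> z']) \<in> U"
    using Suc.prems(1,2) l z map_\<beta>[OF l(3)] h by (intro P.V_last[of k]) auto
   have 2: "VV.lift (\<lambda>l. H (\<alpha> x # l)) (xs @ [z]) =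
     h (VV.lift (\<lambda>l. H (\<alpha> x # l)) (xs @ [z'])) \<oplus> H (\<alpha> x # map \<alpha> xs @ [\<nu> z]) \<and>
     VV.lift (\<lambda>l. H (\<alpha> x # l)) (xs @ [z']) \<in> U"
    using Suc.prems(1,2,3)[of "\<alpha> x # _"] l by (intro Suc.IH) auto
   have "H (\<alpha> x # map \<alpha> xs @ [\<nu> z]) \<in> U"
    using Suc.prems(2)[of "\<alpha> x # map \<alpha> xs" "\<nu> z"] l map_\<alpha>[OF l(3)] z by simp
   then show ?case using 1 2 h.hom_closed by (simp add: l VV_Cons M.a_assoc)
  qed
qed

lemma KK_sandwich_last:
  assumes f: "mlin n f" and l: "l \<in> tup n" and z: "z \<in> U"
  shows "KK.lift (sw f) (l @ [z]) = KK.lift (sw f) (l @ [\<one>]) \<otimes> \<beta> z"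
proof -
  have "e2 \<otimes> \<beta> z = \<beta> z" using z by (simp add: \<beta>_def A.m_assoc[symmetric])
  then have "sw f (l @ [\<beta> z]) = sw f (l @ [\<beta> \<one>]) \<otimes> \<beta> z"
   "sw f (l @ [\<beta> \<one>]) \<in> U" if "l \<in> tup (Suc n)" for l
   using that z Lin.multilinear_closed[OF f] by (auto simp: in_tuples_Suc A.m_assoc)
  from KK_last[OF this z A.one_closed mult_right_linear l] show ?thesis using z by auto
qed

lemma VV_sandwich_last:
  assumes f: "mlin n f" and l: "xs \<in> tup n" and z: "z \<in> U" and y: "y \<in> U"
  shows "VV.lift (sw f) (y # xs @ [z]) =
   VV.lift (sw f) (y # xs @ [\<one>]) \<otimes> \<beta> z \<oplus> \<alpha> y \<otimes> f (map \<alpha> xs) \<otimes> \<nu> z"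
proof -
  have e: "e2 \<otimes> \<beta> z = \<beta> z" using z by (simp add: \<beta>_def A.m_assoc[symmetric])
  have 1: "sw f (l @ [v \<otimes> \<beta> z]) = sw f (l @ [v \<otimes> \<beta> \<one>]) \<otimes> \<beta> z"
   if "l \<in> tup (Suc n)" "v \<in> NN" for l v
   using that z e Lin.multilinear_closed[OF f] by (auto simp: in_tuples_Suc A.m_assoc)
  have 2: "sw f (l @ [v]) \<in> U" if "l \<in> tup (Suc n)" "v \<in> U" for l v
   using that Lin.multilinear_closed[OF f] by (auto simp: in_tuples_Suc)
  have 3: "sw f (l @ [\<zero>]) = \<zero>" if "l \<in> tup (Suc n)" for l
   using that Lin.multilinear_closed[OF f] by (auto simp: in_tuples_Suc)
  have yl: "y # xs \<in> tup (Suc n)" using l y by simp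
  have "VV.lift (sw f) ((y # xs) @ [z]) =
   VV.lift (sw f) ((y # xs) @ [\<one>]) \<otimes> \<beta> z \<oplus> sw f (map \<alpha> (y # xs) @ [\<nu> z])"
   using VV_last[of "Suc n" "sw f" z "\<lambda>t. t \<otimes> \<beta> z" "\<one>" "y # xs"] 1 2 3 z yl
    mult_right_linear[of "\<beta> z"] by auto
  then show ?thesis by simp
qed

end

section \<open>Left linear endomorphisms of the off-diagonal ideal\<close>

context peirce
begin

text \<open>For \<open>N = M^m\<close> these are the \<open>m\<close> by \<open>m\<close> matrices
  over the endomorphisms of \<open>M\<close>. Only the values on \<open>N\<close> are constrained,
  so that explicit formulas are members without being cut down to \<open>N\<close>.\<close>

definition LN :: "('t => 't) set" where
  "LN = {\<theta>. (\<forall>n\<in>NN. \<theta> n \<in> NN) \<and> (\<forall>n\<in>NN. \<forall>n'\<in>NN. \<theta> (n \<oplus> n') = \<theta> n \<oplus> \<theta> n') \<and>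
   (\<forall>t\<in>U. \<forall>n\<in>NN. \<theta> (t \<otimes> n) = t \<otimes> \<theta> n)}"

lemma LN_I:
  assumes "\<And>n. n \<in> NN ==> \<theta> n \<in> NN"
   and "\<And>n n'. n \<in> NN ==> n' \<in> NN ==> \<theta> (n \<oplus> n') = \<theta> n \<oplus> \<theta> n'"
   and "\<And>t n. t \<in> U ==> n \<in> NN ==> \<theta> (t \<otimes> n) = t \<otimes> \<theta> n"
  shows "\<theta> \<in> LN"
  using assms by (auto simp: LN_def)

lemma LN_D:
  assumes "\<theta> \<in> LN"
  shows "n \<in> NN ==> \<theta> n \<in> NN"
   and "n \<in> NN ==> n' \<in> NN ==> \<theta> (n \<oplus> n') = \<theta> n \<oplus> \<theta> n'"
   and "t \<in> U ==> n \<in> NN ==> \<theta> (t \<otimes> n) = t \<otimes> \<theta> n"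
  using assms by (auto simp: LN_def)

lemma NN_add: "n \<in> NN ==> n' \<in> NN ==> n \<oplus> n' \<in> NN"
  by (intro NN_I) (auto simp: linear_mapsD[OF \<nu>_linear] NN_\<nu>)

lemma NN_minus: "n \<in> NN ==> n' \<in> NN ==> n \<ominus> n' \<in> NN"
  using abelian_group_hom.hom_minus[OF \<nu>_hom] by (intro NN_I) (auto simp: NN_\<nu>)

lemma NN_zero: "\<zero> \<in> NN"
  by (intro NN_I) auto

lemma NN_eq: "n \<in> NN ==> e1 \<otimes> n = n \<and> n \<otimes> e2 = n \<and> \<alpha> n = \<zero> \<and> \<beta> n = \<zero>"
proof -
  assume n: "n \<in> NN"
  have "e1 \<otimes> \<nu> n = \<nu> n" "\<nu> n \<otimes> e2 = \<nu> n"
   using n by (simp_all add: \<nu>_def A.m_assoc[symmetric]) (simp add: A.m_assoc)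
  then show ?thesis using n \<beta>_\<nu>[of n] by (simp add: NN_\<nu> NN_\<alpha>)
qed

lemma NN_left: "t \<in> U ==> n \<in> NN ==> t \<otimes> n = \<alpha> t \<otimes> n"
  using NN_eq[of n] A.m_assoc[of t e1 n] by (simp add: e1_right)

lemma NN_right: "t \<in> U ==> n \<in> NN ==> n \<otimes> t = n \<otimes> \<beta> t"
  using NN_eq[of n] A.m_assoc[of n e2 t] by (simp add: e2_left)

lemma NN_mult: "t \<in> U ==> n \<in> NN ==> t \<otimes> n \<in> NN" "t \<in> U ==> n \<in> NN ==> n \<otimes> t \<in> NN"
  using NN_eq[of n] NN_left[of t n] NN_right[of t n] by (auto intro!: NN_I simp: \<nu>_mult NN_\<nu>)

lemma LN_zero: "(\<lambda>_. \<zero>) \<in> LN"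
  by (intro LN_I) (auto simp: NN_zero)

lemma LN_id: "(\<lambda>n. n) \<in> LN"
  by (intro LN_I) auto

lemma LN_add: "\<theta> \<in> LN ==> \<theta>' \<in> LN ==> (\<lambda>n. \<theta> n \<oplus> \<theta>' n) \<in> LN"
  using LN_D[of \<theta>] LN_D[of \<theta>'] NN_add
  by (intro LN_I) (auto simp: M.a_ac A.r_distr NN_closed)

lemma LN_minus: "\<theta> \<in> LN ==> \<theta>' \<in> LN ==> (\<lambda>n. \<theta> n \<ominus> \<theta>' n) \<in> LN"
  using LN_D[of \<theta>] LN_D[of \<theta>'] NN_minus
  by (intro LN_I) (auto simp: M.a_ac A.r_distr A.r_minus NN_closed M.minus_eq M.minus_add)

lemma LN_left: "\<theta> \<in> LN ==> b \<in> U ==> (\<lambda>n. \<theta> (n \<otimes> b)) \<in> LN"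
  using LN_D[of \<theta>] NN_mult by (intro LN_I) (auto simp: A.l_distr A.m_assoc)

lemma LN_right: "\<theta> \<in> LN ==> b \<in> U ==> (\<lambda>n. \<theta> n \<otimes> b) \<in> LN"
  using LN_D[of \<theta>] NN_mult by (intro LN_I) (auto simp: A.l_distr A.m_assoc NN_closed)

lemma LN_cong: "\<theta> \<in> LN ==> (\<And>n. n \<in> NN ==> \<theta> n = \<theta>' n) ==> \<theta>' \<in> LN"
  by (auto simp: LN_def NN_add NN_mult)

end

context crossing_lift
begin

text \<open>The sandwich releases left factors, so the crossing part is left linear in its first
  argument. This is how a cochain of \<open>T\<close> becomes one with values in the endomorphisms
  of \<open>N\<close>.\<close>

lemma \<nu>_lift_LN:
  assumes f: "mlin m f" "Suc (Suc m) = d + Suc k" and l: "l \<in> tup k"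
  shows "(\<lambda>n. \<nu> (lift (sw f) (n # l))) \<in> LN"
proof -
  have ml: "mlin (Suc k) (lift (sw f))"
   using sandwich_multilinear[OF f(1)] f(2) by (intro lift_multilinear) simp
  have c: "lift (sw f) (n # l) \<in> U" if "n \<in> U" for n
   using Lin.multilinear_closed[OF ml, of "n # l"] that l by simp
  show ?thesis
  proof (rule LN_I)
   fix t n assume t: "t \<in> U" "n \<in> NN"
   then have "lift (sw f) ((t \<otimes> n) # l) = \<alpha> t \<otimes> lift (sw f) (n # l)"
    using lift_NN_left[OF f, of n t l] l NN_left[of t n] by simp
   then show "\<nu> (lift (sw f) ((t \<otimes> n) # l)) = t \<otimes> \<nu> (lift (sw f) (n # l))"
    using t c NN_left[of t "\<nu> (lift (sw f) (n # l))"] by (simp add: \<nu>_mult)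
  next
   fix n n' assume n: "n \<in> NN" "n' \<in> NN"
   then show "\<nu> (lift (sw f) ((n \<oplus> n') # l)) =
     \<nu> (lift (sw f) (n # l)) \<oplus> \<nu> (lift (sw f) (n' # l))"
    using E.multilinear_add_hd[OF ml, of n n' l] c l by (simp add: linear_mapsD(2)[OF \<nu>_linear])
  qed (simp add: c del: lift.simps)
qed

end

text \<open>\<open>\<kappa>\<close> is a map of bimodules over the second corner from the
  endomorphisms of \<open>N\<close> to the scalar ones, normalised by
  \<open>\<kappa> id = e2\<close>. \<open>EE\<close> stands for the matrix units: bimodule
  endomorphisms of \<open>N\<close> that pass through the expansion \<open>S\<close>, and numerous
  enough for an endomorphism commuting with all of them to be right multiplication by its value
  under \<open>\<kappa>\<close>.\<close>

locale retract = crossing_prism K T e1 e2 J c w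
  for K :: "'k ring" and T :: "('k, 't) module" (structure) and e1 e2
   and J :: "'i set" and c :: "'i => 't => 't" and w :: "'i => 't" +
  fixes \<kappa> :: "('t => 't) => 't" and EE :: "('t => 't) set"
  assumes \<kappa>_closed: "\<theta> \<in> LN ==> \<kappa> \<theta> \<in> U"
   and \<beta>_\<kappa>: "\<theta> \<in> LN ==> \<beta> (\<kappa> \<theta>) = \<kappa> \<theta>"
   and \<kappa>_cong: "\<theta> \<in> LN ==> (\<And>n. n \<in> NN ==> \<theta> n = \<theta>' n) ==> \<kappa> \<theta> = \<kappa> \<theta>'"
   and \<kappa>_add: "\<theta> \<in> LN ==> \<theta>' \<in> LN ==> \<kappa> (\<lambda>n. \<theta> n \<oplus> \<theta>' n) = \<kappa> \<theta> \<oplus> \<kappa> \<theta>'"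
   and \<kappa>_left: "\<theta> \<in> LN ==> b \<in> U ==> \<kappa> (\<lambda>n. \<theta> (n \<otimes> b)) = \<beta> b \<otimes> \<kappa> \<theta>"
   and \<kappa>_right: "\<theta> \<in> LN ==> b \<in> U ==> \<kappa> (\<lambda>n. \<theta> n \<otimes> b) = \<kappa> \<theta> \<otimes> \<beta> b"
   and \<kappa>_id: "\<kappa> (\<lambda>n. n) = e2"
   and EE_linear: "\<epsilon> \<in> EE ==> \<epsilon> \<in> lin"
   and EE_NN: "\<epsilon> \<in> EE ==> n \<in> NN ==> \<epsilon> n \<in> NN"
   and EE_right: "\<epsilon> \<in> EE ==> n \<in> NN ==> t \<in> U ==> \<epsilon> (n \<otimes> t) = \<epsilon> n \<otimes> t"
   and EE_left: "\<epsilon> \<in> EE ==> n \<in> NN ==> t \<in> U ==> \<epsilon> (t \<otimes> n) = t \<otimes> \<epsilon> n"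
   and EE_S: "\<epsilon> \<in> EE ==> n \<in> NN ==> (\<And>a v. a \<in> AA ==> v \<in> NN ==> G a v \<in> U) ==>
    (\<And>a. a \<in> AA ==> G a \<zero> = \<zero>) ==> P.S (\<epsilon> n) G = P.S n (\<lambda>a v. G a (\<epsilon> v))"
   and EE_central: "\<theta> \<in> LN ==> (\<And>\<epsilon> n. \<epsilon> \<in> EE ==> n \<in> NN ==> \<theta> (\<epsilon> n) = \<epsilon> (\<theta> n)) ==>
    n \<in> NN ==> \<theta> n = n \<otimes> \<kappa> \<theta>"
begin

lemma \<kappa>_mult: "b \<in> U ==> \<kappa> (\<lambda>n. n \<otimes> b) = \<beta> b"
proof -
  assume b: "b \<in> U"
  have "e2 \<otimes> \<beta> b = \<beta> b" using b by (simp add: e2_left)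
  then show ?thesis using \<kappa>_right[OF LN_id b] by (simp add: \<kappa>_id)
qed

lemma \<kappa>_zero: "\<kappa> (\<lambda>_. \<zero>) = \<zero>"
  using \<kappa>_add[OF LN_zero LN_zero] \<kappa>_closed[OF LN_zero]
  by (metis M.add.r_cancel_one M.l_zero M.zero_closed)

lemma \<kappa>_minus: 
  assumes "\<theta> \<in> LN" "\<theta>' \<in> LN"
  shows "\<kappa> (\<lambda>n. \<theta> n \<ominus> \<theta>' n) = \<kappa> \<theta> \<ominus> \<kappa> \<theta>'"
proof -
  have "\<kappa> \<theta> = \<kappa> (\<lambda>n. (\<theta> n \<ominus> \<theta>' n) \<oplus> \<theta>' n)"
   using assms LN_D[OF assms(1)] LN_D[OF assms(2)]
   by (intro \<kappa>_cong) (auto simp: M.minus_eq M.a_assoc M.l_neg NN_closed)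
  also have "\<dots> = \<kappa> (\<lambda>n. \<theta> n \<ominus> \<theta>' n) \<oplus> \<kappa> \<theta>'"
   using assms by (intro \<kappa>_add LN_minus)
  finally show ?thesis
   using \<kappa>_closed[OF LN_minus[OF assms]] \<kappa>_closed[OF assms(2)] by (simp add: M.add_minus_cancel)
qed

lemma \<kappa>_smult:
  assumes "\<theta> \<in> LN" "k \<in> carrier K"
  shows "\<kappa> (\<lambda>n. k \<odot> \<theta> n) = k \<odot> \<kappa> \<theta>" "(\<lambda>n. k \<odot> \<theta> n) \<in> LN"
proof -
  have e: "\<theta> n \<otimes> (k \<odot> \<one>) = k \<odot> \<theta> n" if "n \<in> NN" for n
   using assms LN_D(1)[OF assms(1) that] by (simp add: smult_mult_right)
  have L: "(\<lambda>n. \<theta> n \<otimes> (k \<odot> \<one>)) \<in> LN" using assms by (intro LN_right) auto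
  show "(\<lambda>n. k \<odot> \<theta> n) \<in> LN" using LN_cong[OF L e] .
  have "\<kappa> (\<lambda>n. k \<odot> \<theta> n) = \<kappa> (\<lambda>n. \<theta> n \<otimes> (k \<odot> \<one>))"
   using \<kappa>_cong[OF L e] by simp
  also have "\<dots> = \<beta> (\<kappa> \<theta>) \<otimes> \<beta> (k \<odot> \<one>)"
   using assms by (simp add: \<kappa>_right \<beta>_\<kappa>)
  also have "\<dots> = \<beta> (\<kappa> \<theta> \<otimes> (k \<odot> \<one>))"
   using assms \<kappa>_closed[OF assms(1)] by (intro \<beta>_mult[symmetric]) auto
  also have "\<dots> = k \<odot> \<kappa> \<theta>"
   using assms \<kappa>_closed[OF assms(1)] by (simp add: smult_mult_right linear_mapsD[OF \<beta>_linear] \<beta>_\<kappa>)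
  finally show "\<kappa> (\<lambda>n. k \<odot> \<theta> n) = k \<odot> \<kappa> \<theta>" .
qed

lemma \<kappa>_bar:
  assumes "\<And>l. l \<in> tup k ==> (\<lambda>n. \<Psi> n l) \<in> LN" "l \<in> tup (Suc k)"
  shows "(\<lambda>n. br (\<Psi> n) l) \<in> LN \<and> br (\<lambda>l. \<kappa> (\<lambda>n. \<Psi> n l)) l = \<kappa> (\<lambda>n. br (\<Psi> n) l)"
  using assms
proof (induction l arbitrary: k \<Psi>)
  case (Cons x l)
  show ?case
  proof (cases l)
   case Nil
   then show ?thesis by (simp add: LN_zero \<kappa>_zero)
  next
   case (Cons y zs)
   then obtain k' where k: "k = Suc k'" using Cons.prems(2) by (cases k) auto
   then have c: "x \<in> U" "y \<in> U" "zs \<in> tup k'" using Cons.prems(2) Cons by auto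
   have g: "(\<lambda>n. \<Psi> n (x # l)) \<in> LN" if "l \<in> tup k'" for l
    using Cons.prems(1)[of "x # l"] that c k by simp
   have IH: "(\<lambda>n. br (\<lambda>l. \<Psi> n (x # l)) (y # zs)) \<in> LN"
    "br (\<lambda>l. \<kappa> (\<lambda>n. \<Psi> n (x # l))) (y # zs) = \<kappa> (\<lambda>n. br (\<lambda>l. \<Psi> n (x # l)) (y # zs))"
    using Cons.IH[of k' "\<lambda>n l. \<Psi> n (x # l)"] g c Cons by auto
   have h: "(\<lambda>n. \<Psi> n ((x \<otimes> y) # zs)) \<in> LN"
    using Cons.prems(1)[of "(x \<otimes> y) # zs"] c k by simp
   show ?thesis
    unfolding Cons bar.simps IH(2) using LN_minus[OF h IH(1)] \<kappa>_minus[OF h IH(1)] by simp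
  qed
qed (simp add: LN_zero \<kappa>_zero)

lemma \<kappa>_multilinear:
  assumes "\<And>n. n \<in> NN ==> mlin k (\<Psi> n)" "\<And>l. l \<in> tup k ==> (\<lambda>n. \<Psi> n l) \<in> LN"
  shows "mlin k (\<lambda>l. \<kappa> (\<lambda>n. \<Psi> n l))"
  using assms
proof (induction k arbitrary: \<Psi>)
  case 0
  then show ?case by (auto intro: \<kappa>_closed)
next
  case (Suc k)
  show ?case
   unfolding multilinear.simps(2)[of K T T k]
  proof (intro conjI ballI)
   fix x assume x: "x \<in> U"
   show "mlin k (\<lambda>l. \<kappa> (\<lambda>n. \<Psi> n (x # l)))"
    using Suc.prems x by (intro Suc.IH) auto
  next
   fix l assume l: "l \<in> tup k"
   have L: "(\<lambda>n. \<Psi> n (x # l)) \<in> LN" if "x \<in> U" for x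
    using Suc.prems(2)[of "x # l"] that l by simp
   have lin: "(\<lambda>x. \<Psi> n (x # l)) \<in> lin" if "n \<in> NN" for n
    using Suc.prems(1)[OF that] l by simp
   show "(\<lambda>x. \<kappa> (\<lambda>n. \<Psi> n (x # l))) \<in> lin"
   proof (rule linear_mapsI)
    fix x y assume xy: "x \<in> U" "y \<in> U"
    have "\<kappa> (\<lambda>n. \<Psi> n ((x \<oplus> y) # l)) = \<kappa> (\<lambda>n. \<Psi> n (x # l) \<oplus> \<Psi> n (y # l))"
     using xy linear_mapsD(2)[OF lin] by (intro \<kappa>_cong L) auto
    then show "\<kappa> (\<lambda>n. \<Psi> n ((x \<oplus> y) # l)) = \<kappa> (\<lambda>n. \<Psi> n (x # l)) \<oplus> \<kappa> (\<lambda>n. \<Psi> n (y # l))"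
     using \<kappa>_add[OF L[OF xy(1)] L[OF xy(2)]] by simp
   next
    fix r x assume rx: "r \<in> carrier K" "x \<in> U"
    have "\<kappa> (\<lambda>n. \<Psi> n ((r \<odot> x) # l)) = \<kappa> (\<lambda>n. r \<odot> \<Psi> n (x # l))"
     using rx linear_mapsD(3)[OF lin] by (intro \<kappa>_cong L) auto
    then show "\<kappa> (\<lambda>n. \<Psi> n ((r \<odot> x) # l)) = r \<odot> \<kappa> (\<lambda>n. \<Psi> n (x # l))"
     using \<kappa>_smult(1)[OF L[OF rx(2)] rx(1)] by simp
   qed (use L \<kappa>_closed in auto)
  qed
qed

end

text \<open>A cochain of \<open>T\<close> with components \<open>g\<close>, \<open>\<Psi>(1, _, 1)\<close> and \<open>\<kappa>(\<Psi>(_, _, 1))\<close>. The map \<open>\<Psi>\<close> is an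
  endomorphism of \<open>N\<close> in its first argument, and \<open>\<kappa>\<close> projects it to the right multiplication by
  an element of \<open>B\<close>.\<close>

locale assemble = retract K T e1 e2 J c w \<kappa> EE
  for K :: "'k ring" and T :: "('k, 't) module" (structure) and e1 e2
   and J :: "'i set" and c :: "'i => 't => 't" and w :: "'i => 't" and \<kappa> EE +
  fixes g \<Psi> :: "'t list => 't" and m :: nat
  assumes \<Psi>_multilinear: "mlin (Suc (Suc m)) \<Psi>"
   and \<Psi>_split: "y \<in> U ==> l \<in> tup (Suc m) ==> \<Psi> (y # l) = \<Psi> (\<nu> y # l) \<oplus> \<alpha> y \<otimes> \<Psi> (\<one> # l)"
   and \<Psi>_last: "y \<in> U ==> xs \<in> tup m ==> z \<in> U ==>
    \<Psi> (y # xs @ [z]) = \<Psi> (y # xs @ [\<one>]) \<otimes> \<beta> z \<oplus> \<alpha> y \<otimes> g xs \<otimes> \<nu> z"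
   and \<Psi>_LN: "l \<in> tup (Suc m) ==> (\<lambda>n. \<Psi> (n # l)) \<in> LN"
   and \<Psi>_NN: "l \<in> tup (Suc (Suc m)) ==> \<Psi> l \<in> NN"
   and g_multilinear: "mlin m g"
   and g_\<alpha>: "xs \<in> tup m ==> \<alpha> (g xs) = g xs"
begin

definition K0 :: "'t list => 't" where "K0 xs = \<kappa> (\<lambda>n. \<Psi> (n # xs @ [\<one>]))"

definition F :: "'t list => 't" where
  "F = (\<lambda>xs\<in>tup m. g xs \<oplus> \<Psi> (\<one> # xs @ [\<one>]) \<oplus> K0 xs)"

text \<open>The deviation of an endomorphism from the scalar that \<open>\<kappa>\<close> assigns to
  it.\<close>

definition D :: "'t => 't list => 't" where
  "D n xs = \<Psi> (n # xs @ [\<one>]) \<ominus> n \<otimes> K0 xs"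

lemma \<Psi>_LN1: "xs \<in> tup m ==> (\<lambda>n. \<Psi> (n # xs @ [\<one>])) \<in> LN"
  by (intro \<Psi>_LN tuples_snocI) auto

lemma K0_closed: "xs \<in> tup m ==> K0 xs \<in> U \<and> \<beta> (K0 xs) = K0 xs"
  unfolding K0_def using \<kappa>_closed[OF \<Psi>_LN1] \<beta>_\<kappa>[OF \<Psi>_LN1] by blast

lemma K0_multilinear: "mlin m K0"
  unfolding K0_def[abs_def]
proof (rule \<kappa>_multilinear)
  fix n assume "n \<in> NN"
  from Lin.multilinear_snoc[OF Lin.multilinear_Cons[OF \<Psi>_multilinear, of n], of "\<one>"] this
  show "mlin m (\<lambda>l. \<Psi> (n # l @ [\<one>]))" by auto
qed (rule \<Psi>_LN1)

lemma \<Psi>_one_multilinear: "mlin m (\<lambda>xs. \<Psi> (\<one> # xs @ [\<one>]))"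
  using Lin.multilinear_snoc[OF Lin.multilinear_Cons[OF \<Psi>_multilinear, of "\<one>"], of "\<one>"] by auto

lemma \<Psi>_one_NN: "xs \<in> tup m ==> \<Psi> (\<one> # xs @ [\<one>]) \<in> NN"
  by (intro \<Psi>_NN) (auto intro: tuples_snocI)

lemma F_cochain: "F \<in> Ch m"
  unfolding F_def
  by (intro restrict_cochains Lin.multilinear_add g_multilinear K0_multilinear \<Psi>_one_multilinear)

lemma g_closed: "xs \<in> tup m ==> g xs \<in> U"
  using g_multilinear by (rule Lin.multilinear_closed)

lemma g_zero: "xs \<in> tup m ==> \<nu> (g xs) = \<zero> \<and> \<beta> (g xs) = \<zero>"
  using \<nu>_\<alpha>[OF g_closed] \<beta>_\<alpha>[OF g_closed] g_\<alpha> by metis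

lemma K0_zero: "xs \<in> tup m ==> \<nu> (K0 xs) = \<zero> \<and> \<alpha> (K0 xs) = \<zero>"
  using \<nu>_\<beta>[of "K0 xs"] \<alpha>_\<beta>[of "K0 xs"] K0_closed by metis

lemma F_components:
  assumes xs: "xs \<in> tup m"
  shows "\<alpha> (F xs) = g xs" "\<nu> (F xs) = \<Psi> (\<one> # xs @ [\<one>])" "\<beta> (F xs) = K0 xs"
  using g_closed[OF xs] g_zero[OF xs] g_\<alpha>[OF xs] K0_closed[OF xs] K0_zero[OF xs] NN_eq[OF \<Psi>_one_NN[OF xs]]
   NN_\<nu>[OF \<Psi>_one_NN[OF xs]] NN_closed[OF \<Psi>_one_NN[OF xs]] xs
  by (simp_all add: F_def linear_mapsD[OF \<alpha>_linear] linear_mapsD[OF \<nu>_linear] linear_mapsD[OF \<beta>_linear])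

lemma F_closed: "xs \<in> tup m ==> F xs \<in> U"
  using F_cochain by (rule cochains_closed)

lemma sandwich_F_\<alpha>:
  assumes "l \<in> tup (Suc (Suc m))"
  shows "\<alpha> (sw F l) = \<alpha> (sw g l)"
  using assms F_components g_closed g_\<alpha> F_closed
  by (subst (asm) in_tuples_Suc_Suc) (auto simp: \<alpha>_mult)

text \<open>Where \<open>y\<close> crosses, the sandwich contributes \<open>\<nu> y\<close> times
  \<open>K0 xs\<close>, while \<open>\<Psi>\<close> has its value at \<open>\<nu> y\<close>; the
  difference is \<open>D\<close>. All other terms agree by \<open>\<Psi>_split\<close> and
  \<open>\<Psi>_last\<close>.\<close>

lemma sandwich_F_\<nu>:
  assumes "y \<in> U" "z \<in> U" "xs \<in> tup m"
  shows "\<nu> (sw F (y # xs @ [z])) = \<Psi> (y # xs @ [z]) \<ominus> D (\<nu> y) xs \<otimes> \<beta> z"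
proof -
  define p where "p = \<Psi> (\<one> # xs @ [\<one>])"
  define q where "q = \<Psi> (\<nu> y # xs @ [\<one>])"
  have c: "p \<in> U" "q \<in> U" "g xs \<in> U" "K0 xs \<in> U" "F xs \<in> U"
   using NN_closed[OF \<Psi>_one_NN[OF assms(3)]] LN_D(1)[OF \<Psi>_LN1[OF assms(3)], of "\<nu> y"] assms
    g_closed K0_closed F_closed by (auto simp: p_def q_def)
  have "\<Psi> (y # xs @ [z]) = (q \<oplus> \<alpha> y \<otimes> p) \<otimes> \<beta> z \<oplus> \<alpha> y \<otimes> g xs \<otimes> \<nu> z"
   using \<Psi>_last[OF assms(1,3,2)] \<Psi>_split[OF assms(1), of "xs @ [\<one>]"] assms(3)
   by (simp add: p_def q_def tuples_snocI)
  moreover have "\<nu> (sw F (y # xs @ [z])) =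
    \<alpha> y \<otimes> g xs \<otimes> \<nu> z \<oplus> (\<alpha> y \<otimes> p \<oplus> \<nu> y \<otimes> K0 xs) \<otimes> \<beta> z"
   using assms c F_components[OF assms(3)] by (simp add: \<nu>_mult \<alpha>_mult p_def)
  moreover have "D (\<nu> y) xs = q \<ominus> \<nu> y \<otimes> K0 xs"
   by (simp add: D_def q_def)
  moreover have "\<alpha> y \<in> U" "\<nu> y \<in> U" "\<beta> z \<in> U" "\<nu> z \<in> U" using assms by auto
  ultimately show ?thesis using c by algebra
qed

text \<open>Linearity of \<open>\<kappa>\<close> on both sides brings \<open>y\<close> and
  \<open>z\<close> inside. There \<open>\<Psi>\<close> absorbs \<open>z\<close>, since the term with
  \<open>\<nu> z\<close> has the factor \<open>\<alpha> (n y)\<close>, which is zero for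
  \<open>n\<close> in \<open>N\<close>.\<close>

lemma sandwich_F_\<beta>:
  assumes "y \<in> U" "z \<in> U" "xs \<in> tup m"
  shows "\<beta> (sw F (y # xs @ [z])) = \<kappa> (\<lambda>n. \<Psi> ((n \<otimes> y) # xs @ [z]))"
proof -
  note L = \<Psi>_LN1[OF assms(3)]
  have "\<beta> (sw F (y # xs @ [z])) = \<beta> y \<otimes> K0 xs \<otimes> \<beta> z"
   using assms F_components[OF assms(3)] F_closed by (simp add: \<beta>_mult)
  also have "\<dots> = \<kappa> (\<lambda>n. \<Psi> ((n \<otimes> y) # xs @ [\<one>])) \<otimes> \<beta> z"
   unfolding K0_def using \<kappa>_left[OF L assms(1)] by simp
  also have "\<dots> = \<kappa> (\<lambda>n. \<Psi> ((n \<otimes> y) # xs @ [\<one>]) \<otimes> z)"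
   using \<kappa>_right[OF LN_left[OF L assms(1)] assms(2)] by simp
  also have "\<dots> = \<kappa> (\<lambda>n. \<Psi> ((n \<otimes> y) # xs @ [z]))"
  proof (rule \<kappa>_cong[OF LN_right[OF LN_left[OF L assms(1)] assms(2)]])
   fix n assume n: "n \<in> NN"
   then have ny: "n \<otimes> y \<in> NN" using assms by (auto intro: NN_mult)
   have "\<Psi> ((n \<otimes> y) # xs @ [\<one>]) \<in> NN" using LN_D(1)[OF L ny] .
   then show "\<Psi> ((n \<otimes> y) # xs @ [\<one>]) \<otimes> z = \<Psi> ((n \<otimes> y) # xs @ [z])"
    using \<Psi>_last[of "n \<otimes> y" xs z] NN_right[of z "\<Psi> ((n \<otimes> y) # xs @ [\<one>])"] NN_\<alpha>[OF ny] assms n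
     g_closed[OF assms(3)] by simp
  qed
  finally show ?thesis .
qed

lemma \<Psi>_funcset: "\<Psi> \<in> tup (Suc (Suc m)) \<rightarrow> U"
  using Lin.multilinear_funcset[OF \<Psi>_multilinear] .

lemma D_LN: "xs \<in> tup m ==> (\<lambda>n. D n xs) \<in> LN"
  unfolding D_def using K0_closed LN_right[OF LN_id] by (intro LN_minus \<Psi>_LN1) auto

text \<open>Each component of \<open>\<delta> F\<close> is \<open>bar\<close> of the same component
  of the sandwich. In the middle one the deviation from scalarity leaves a single term, the
  obstruction to \<open>F\<close> being transported by the differential of
  \<open>\<Psi>\<close>.\<close>

lemma dF_components:
  assumes xs: "xs \<in> tup (Suc m)"
  shows "\<alpha> (\<delta> m F xs) = \<alpha> (\<delta> m g xs)"
   and "\<nu> (\<delta> m F xs) =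
    br \<Psi> (\<one> # xs @ [\<one>]) \<ominus> D (\<nu> (hd xs)) (tl xs)"
   and "\<beta> (\<delta> m F xs) = \<kappa> (\<lambda>n. br \<Psi> (n # xs @ [\<one>]))"
proof -
  have F: "F \<in> tup m \<rightarrow> U" using F_cochain by (rule cochains_funcset)
  have g: "g \<in> tup m \<rightarrow> U" using g_multilinear by (rule Lin.multilinear_funcset)
  have l: "\<one> # xs @ [\<one>] \<in> tup (Suc (Suc (Suc m)))" using xs by (auto intro: tuples_snocI)
  note sF = sandwich_funcset[OF F] note sg = sandwich_funcset[OF g]
  have bar_lin: "br (\<lambda>l. h (H l)) (\<one> # xs @ [\<one>]) = h (br H (\<one> # xs @ [\<one>]))"
   if "h \<in> lin" "H \<in> tup (Suc (Suc m)) \<rightarrow> U" for h H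
   using linear_mapsD[OF that(1)] that(2) l by (intro Bar.bar_hom[of _ _ _ "Suc (Suc m)"] Bar.abelian_group_G) auto
  show "\<alpha> (\<delta> m F xs) = \<alpha> (\<delta> m g xs)"
   unfolding d_apply[OF F xs] d_apply[OF g xs] bar_lin[OF \<alpha>_linear sF, symmetric] bar_lin[OF \<alpha>_linear sg, symmetric]
   using sandwich_F_\<alpha> l by (rule Bar.bar_cong)
  define X where "X l = D (\<nu> (hd l)) (butlast (tl l)) \<otimes> \<beta> (last l)" for l
  have X: "X (y # xs @ [z]) = D (\<nu> y) xs \<otimes> \<beta> z" for y xs z by (simp add: X_def)
  have Xc: "X \<in> tup (Suc (Suc m)) \<rightarrow> U"
  proof
   fix l assume "l \<in> tup (Suc (Suc m))"
   then obtain y xs z where "l = y # xs @ [z]" "y \<in> U" "z \<in> U" "xs \<in> tup m"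
    by (subst (asm) in_tuples_Suc_Suc) blast
   then show "X l \<in> U" using LN_D(1)[OF D_LN, of xs "\<nu> y"] by (auto simp: X)
  qed
  have D0: "D \<zero> xs = \<zero>" if "xs \<in> tup m" for xs
   using LN_D(3)[OF D_LN[OF that], of "\<zero>" "\<zero>"] LN_D(1)[OF D_LN[OF that] NN_zero] NN_zero by simp
  obtain x xs' where x: "xs = x # xs'" "x \<in> U" "xs' \<in> tup m"
   using xs by (auto simp: in_tuples_Suc)
  have barX: "br X (\<one> # xs @ [\<one>]) = D (\<nu> x) xs'"
  proof -
   \<comment> \<open>In all these terms the bordering unit remains alone in the first slot, and
     \<open>\<nu> 1 = 0\<close>; only the product of the unit with \<open>x\<close>
     survives.\<close>
   have "br (\<lambda>l. X (\<one> # l)) (xs @ [\<one>]) = br (\<lambda>l. \<zero>) (xs @ [\<one>])"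
   proof (rule Bar.bar_cong)
    fix l assume "l \<in> tup (Suc m)"
    then have "l = butlast l @ [last l]" "butlast l \<in> tup m" "last l \<in> U"
     using butlast_closed[of l m] by (auto simp: in_tuples_Suc)
    then show "X (\<one> # l) = \<zero>"
     using X[of "\<one>" "butlast l" "last l"] D0 by simp
   qed (use xs in \<open>auto intro: tuples_snocI\<close>)
   moreover have "D (\<nu> x) xs' \<in> NN" using LN_D(1)[OF D_LN[OF x(3)]] x by simp
   ultimately show ?thesis
    using X[of x xs' "\<one>"] x NN_eq[of "D (\<nu> x) xs'"] by (simp add: M.minus_eq)
  qed
  have "\<nu> (\<delta> m F xs) = br (\<lambda>l. \<Psi> l \<ominus> X l) (\<one> # xs @ [\<one>])"
   unfolding d_apply[OF F xs] bar_lin[OF \<nu>_linear sF, symmetric]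
  proof (rule Bar.bar_cong[OF _ l])
   fix l assume "l \<in> tup (Suc (Suc m))"
   then obtain y xs z where "l = y # xs @ [z]" "y \<in> U" "z \<in> U" "xs \<in> tup m"
    by (subst (asm) in_tuples_Suc_Suc) blast
   then show "\<nu> (sw F l) = \<Psi> l \<ominus> X l"
    using sandwich_F_\<nu> X by simp
  qed
  also have "\<dots> = br \<Psi> (\<one> # xs @ [\<one>]) \<ominus> D (\<nu> x) xs'"
   using Bar.bar_minus[OF \<Psi>_funcset Xc l] barX by simp
  finally show "\<nu> (\<delta> m F xs) = br \<Psi> (\<one> # xs @ [\<one>]) \<ominus> D (\<nu> (hd xs)) (tl xs)"
   by (simp add: x)
  have L: "(\<lambda>n. \<Psi> ((n \<otimes> hd l) # tl l)) \<in> LN" if "l \<in> tup (Suc (Suc m))" for l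
   using that LN_left[OF \<Psi>_LN] by (auto simp: in_tuples_Suc[of l])
  have "\<beta> (\<delta> m F xs) = br (\<lambda>l. \<kappa> (\<lambda>n. \<Psi> ((n \<otimes> hd l) # tl l))) (\<one> # xs @ [\<one>])"
   unfolding d_apply[OF F xs] bar_lin[OF \<beta>_linear sF, symmetric]
  proof (rule Bar.bar_cong[OF _ l])
   fix l assume "l \<in> tup (Suc (Suc m))"
   then obtain y xs z where "l = y # xs @ [z]" "y \<in> U" "z \<in> U" "xs \<in> tup m"
    by (subst (asm) in_tuples_Suc_Suc) blast
   then show "\<beta> (sw F l) = \<kappa> (\<lambda>n. \<Psi> ((n \<otimes> hd l) # tl l))"
    using sandwich_F_\<beta> by simp
  qed
  also have "\<dots> = \<kappa> (\<lambda>n. br (\<lambda>l. \<Psi> ((n \<otimes> hd l) # tl l)) (\<one> # xs @ [\<one>]))"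
   using \<kappa>_bar[of "Suc (Suc m)" "\<lambda>n l. \<Psi> ((n \<otimes> hd l) # tl l)"] L l by blast
  also have "\<dots> = \<kappa> (\<lambda>n. br \<Psi> (n # xs @ [\<one>]))"
  proof (rule \<kappa>_cong)
   show "(\<lambda>n. br (\<lambda>l. \<Psi> ((n \<otimes> hd l) # tl l)) (\<one> # xs @ [\<one>])) \<in> LN"
    using \<kappa>_bar[of "Suc (Suc m)" "\<lambda>n l. \<Psi> ((n \<otimes> hd l) # tl l)"] L l by blast
   fix n assume "n \<in> NN"
   then show "br (\<lambda>l. \<Psi> ((n \<otimes> hd l) # tl l)) (\<one> # xs @ [\<one>]) = br \<Psi> (n # xs @ [\<one>])"
    using l Bar.bar_scale_hd[of n "\<one>" "xs @ [\<one>]" "Suc (Suc (Suc m))" \<Psi>] by (simp del: bar.simps)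
  qed
  finally show "\<beta> (\<delta> m F xs) = \<kappa> (\<lambda>n. br \<Psi> (n # xs @ [\<one>]))" .
qed

end

lemma (in peirce) AA_iff: "a \<in> AA \<longleftrightarrow> a \<in> carrier T \<and> \<alpha> a = a"
  by (simp add: AA_def)

context crossing_prism
begin

lemma VV_cong_ends:
  assumes "\<And>as v. as \<in> tup k ==> set as \<subseteq> AA ==> v \<in> NN ==> H (as @ [v]) = \<psi> (as @ [v])"
   "\<psi> \<in> tup (Suc k) \<rightarrow> U" "l \<in> tup (Suc k)"
  shows "VV.lift H l = VV.lift \<psi> l"
  using assms
proof (induction k arbitrary: H \<psi> l)
  case 0
  then obtain z where z: "l = [z]" "z \<in> U" by (auto simp: in_tuples_Suc)
  then show ?case using 0(1)[of "[]" "\<nu> z"] by (simp add: VV_Cons)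
next
  case (Suc k)
  then obtain x xs where l: "l = x # xs" "x \<in> U" "xs \<in> tup (Suc k)"
   by (auto simp: in_tuples_Suc)
  have xA: "\<alpha> x \<in> AA" using l AA_iff by simp
  have "P.V H (\<nu> x # map \<beta> xs) = P.V \<psi> (\<nu> x # map \<beta> xs)"
   using Suc.prems(1,2) l map_\<beta>[OF l(3)] by (intro P.V_cong[of "Suc k"]) auto
  moreover have "VV.lift (\<lambda>l. H (\<alpha> x # l)) xs = VV.lift (\<lambda>l. \<psi> (\<alpha> x # l)) xs"
  proof (rule Suc.IH)
   fix as v assume "as \<in> tup k" "set as \<subseteq> AA" "v \<in> NN"
   then show "H (\<alpha> x # as @ [v]) = \<psi> (\<alpha> x # as @ [v])"
    using Suc.prems(1)[of "\<alpha> x # as" v] l xA by simp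
  qed (use Suc.prems(2) l in \<open>auto simp: Pi_def\<close>)
  ultimately show ?case by (simp add: l VV_Cons)
qed

text \<open>All entries before the last are coordinates from \<open>A\<close>, so only values of the
  cochain on \<open>A\<close> occur; and as the last entry is in \<open>N\<close>, only their
  component in \<open>A\<close> counts.\<close>

lemma VV_sandwich_cong:
  assumes "\<And>xs. xs \<in> tup n ==> \<alpha> (f (map \<alpha> xs)) = \<alpha> (f' (map \<alpha> xs))"
   and f: "mlin n f" "mlin n f'" and l: "l \<in> tup (Suc (Suc n))"
  shows "VV.lift (sw f) l = VV.lift (sw f') l"
proof (rule VV_cong_ends[OF _ _ l])
  fix as v assume as: "as \<in> tup (Suc n)" "set as \<subseteq> AA" "v \<in> NN"
  then obtain a xs where a: "as = a # xs" "a \<in> U" "xs \<in> tup n"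
   by (auto simp: in_tuples_Suc)
  have xs: "map \<alpha> xs = xs" "\<alpha> a = a" using as(2) a AA_iff by (auto intro!: map_idI)
  have *: "a \<otimes> t \<otimes> v = a \<otimes> \<alpha> t \<otimes> v" if "t \<in> U" for t
   using a(2) as(3) that NN_left[of "t" v] by (simp add: A.m_assoc)
  show "sw f (as @ [v]) = sw f' (as @ [v])"
   using assms(1)[OF a(3)] *[OF Lin.multilinear_closed[OF f(1) a(3)]] *[OF Lin.multilinear_closed[OF f(2) a(3)]]
   by (simp add: a(1) xs)
next
  show "sw f' \<in> tup (Suc (Suc n)) \<rightarrow> U"
   using Lin.multilinear_funcset[OF f(2)] by (rule sandwich_funcset)
qed

lemma crossing_NN:
  assumes "H \<in> tup (Suc k) \<rightarrow> U"
   and "\<And>l. l \<in> tup k ==> \<nu> (H (l @ [e2])) = H (l @ [e2])"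
   and "\<And>l. l \<in> tup k ==> H (l @ [\<zero>]) = \<zero>" "l \<in> tup k"
  shows "crossing H (l @ [\<one>]) \<in> NN"
  using assms
proof (induction k arbitrary: H l)
  case 0
  then show ?case using 0(3)[of "[]"] NN_zero by simp
next
  case (Suc k)
  then obtain x xs where l: "l = x # xs" "x \<in> U" "xs \<in> tup k"
   by (auto simp: in_tuples_Suc)
  have b: "\<nu> x # map \<beta> xs \<in> tup (Suc k)" using l map_\<beta> by simp
  have 1: "H ((\<nu> x # map \<beta> xs) @ [e2]) \<in> NN"
   using Suc.prems(2)[OF b] funcset_mem[OF Suc.prems(1), of "(\<nu> x # map \<beta> xs) @ [e2]"] b
    tuples_snocI[OF b e_closed(2)]
   by (intro NN_I) auto
  have 2: "crossing (\<lambda>l. H (\<alpha> x # l)) (xs @ [\<one>]) \<in> NN"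
   using Suc.prems(2,3)[of "\<alpha> x # _"] l Suc.prems(1)
   by (intro Suc.IH) (auto simp: Pi_def simp flip: append_Cons)
  show ?case using 1 2 by (simp add: l NN_add)
qed

end

section \<open>Homotopy, projection and residual part of a cochain\<close>

context retract
begin

definition Hc :: "nat => ('t list => 't) => 't list => 't" where
  "Hc m f = (\<lambda>xs\<in>tup m. E.W (sw f) (\<one> # xs @ [\<one>]))"

definition \<Psi>K :: "('t list => 't) => 't list => 't" where
  "\<Psi>K f l = \<nu> (KK.lift (sw f) l)"

definition \<Psi>V :: "('t list => 't) => 't list => 't" where
  "\<Psi>V f l = \<nu> (VV.lift (sw f) l)"

text \<open>The homotopy uses up one argument, so \<open>f\<close> has degree \<open>Suc m\<close>
  while the assembled cochain has degree \<open>m\<close>. The component in \<open>A\<close> is zero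
  because no term of the homotopy crosses in the last entry.\<close>

lemma assemble_K:
  assumes f: "mlin (Suc m) f"
  shows "assemble K T e1 e2 J c w \<kappa> EE (\<lambda>_. \<zero>) (\<Psi>K f) m"
proof
  have ml: "mlin (Suc (Suc m)) (KK.lift (sw f))"
   using sandwich_multilinear[OF f] by (intro KK.lift_multilinear) simp
  show "mlin (Suc (Suc m)) (\<Psi>K f)"
   unfolding \<Psi>K_def[abs_def] by (rule Lin.multilinear_hom[OF \<nu>_linear ml])
  have c: "KK.lift (sw f) l \<in> U" if "l \<in> tup (Suc (Suc m))" for l
   using Lin.multilinear_closed[OF ml that] .
  show "\<Psi>K f l \<in> NN" if "l \<in> tup (Suc (Suc m))" for l
   unfolding \<Psi>K_def using c[OF that] by auto
  show "\<Psi>K f (y # l) = \<Psi>K f (\<nu> y # l) \<oplus> \<alpha> y \<otimes> \<Psi>K f (\<one> # l)"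
   if "y \<in> U" "l \<in> tup (Suc m)" for y l
   unfolding \<Psi>K_def KK.lift_split[OF f, of "Suc m" y l, simplified, OF that]
   using that c[of "\<nu> y # l"] c[of "\<one> # l"]
   by (simp add: linear_mapsD[OF \<nu>_linear] \<nu>_mult del: KK.lift.simps)
  show "\<Psi>K f (y # xs @ [z]) = \<Psi>K f (y # xs @ [\<one>]) \<otimes> \<beta> z \<oplus> \<alpha> y \<otimes> \<zero> \<otimes> \<nu> z"
   if "y \<in> U" "xs \<in> tup m" "z \<in> U" for y xs z
  proof -
   have "KK.lift (sw f) ((y # xs) @ [z]) = KK.lift (sw f) ((y # xs) @ [\<one>]) \<otimes> \<beta> z"
    using that by (intro KK_sandwich_last[OF f]) auto
   moreover have "KK.lift (sw f) (y # xs @ [\<one>]) \<in> U"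
    using that by (intro c) (auto intro: tuples_snocI)
   ultimately show ?thesis
    using that by (simp add: \<Psi>K_def \<nu>_mult)
  qed
  show "(\<lambda>n. \<Psi>K f (n # l)) \<in> LN" if "l \<in> tup (Suc m)" for l
   unfolding \<Psi>K_def using that by (intro KK.\<nu>_lift_LN[OF f]) auto
qed (simp_all add: Lin.multilinear_zero)

text \<open>Here the component in \<open>A\<close> is forced by the path that crosses in the last
  entry, which contributes the value of \<open>f\<close> on entries from \<open>A\<close>.\<close>

lemma assemble_V:
  assumes f: "mlin m f"
  shows "assemble K T e1 e2 J c w \<kappa> EE (\<lambda>xs. \<alpha> (f (map \<alpha> xs))) (\<Psi>V f) m"
proof
  have ml: "mlin (Suc (Suc m)) (VV.lift (sw f))"
   using sandwich_multilinear[OF f] by (intro VV.lift_multilinear) simp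
  show "mlin (Suc (Suc m)) (\<Psi>V f)"
   unfolding \<Psi>V_def[abs_def] by (rule Lin.multilinear_hom[OF \<nu>_linear ml])
  have c: "VV.lift (sw f) l \<in> U" if "l \<in> tup (Suc (Suc m))" for l
   using Lin.multilinear_closed[OF ml that] .
  have fc: "f (map \<alpha> xs) \<in> U" if "xs \<in> tup m" for xs
   using Lin.multilinear_closed[OF f map_\<alpha>[OF that]] .
  show "\<Psi>V f l \<in> NN" if "l \<in> tup (Suc (Suc m))" for l
   unfolding \<Psi>V_def using c[OF that] by auto
  show "\<Psi>V f (y # l) = \<Psi>V f (\<nu> y # l) \<oplus> \<alpha> y \<otimes> \<Psi>V f (\<one> # l)"
   if "y \<in> U" "l \<in> tup (Suc m)" for y l
   unfolding \<Psi>V_def VV.lift_split[OF f, of "Suc m" y l, simplified, OF that]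
   using that c[of "\<nu> y # l"] c[of "\<one> # l"]
   by (simp add: linear_mapsD[OF \<nu>_linear] \<nu>_mult del: VV.lift.simps)
  show "\<Psi>V f (y # xs @ [z]) = \<Psi>V f (y # xs @ [\<one>]) \<otimes> \<beta> z \<oplus> \<alpha> y \<otimes> \<alpha> (f (map \<alpha> xs)) \<otimes> \<nu> z"
   if "y \<in> U" "xs \<in> tup m" "z \<in> U" for y xs z
  proof -
   have "VV.lift (sw f) (y # xs @ [\<one>]) \<in> U"
    using that by (intro c) (auto intro: tuples_snocI)
   then show ?thesis
    unfolding \<Psi>V_def VV_sandwich_last[OF f that(2,3,1)]
    using that fc[OF that(2)] by (simp add: \<nu>_mult \<alpha>_mult linear_mapsD[OF \<nu>_linear])
  qed
  show "(\<lambda>n. \<Psi>V f (n # l)) \<in> LN" if "l \<in> tup (Suc m)" for l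
   unfolding \<Psi>V_def using that by (intro VV.\<nu>_lift_LN[OF f]) auto
  show "mlin m (\<lambda>xs. \<alpha> (f (map \<alpha> xs)))"
   by (intro Lin.multilinear_hom[OF \<alpha>_linear] Lin.multilinear_map[OF \<alpha>_linear] f)
  show "\<alpha> (\<alpha> (f (map \<alpha> xs))) = \<alpha> (f (map \<alpha> xs))" if "xs \<in> tup m" for xs
   using fc[OF that] by simp
qed

lemma crossing_zero:
  "(\<And>l. l \<in> tup k ==> H l = \<zero>) ==> l \<in> tup k ==> crossing H l = \<zero>"
proof (induction k arbitrary: H l)
  case (Suc k)
  then obtain x xs where l: "l = x # xs" "x \<in> U" "xs \<in> tup k"
   by (auto simp: in_tuples_Suc)
  have "crossing (\<lambda>l. H (\<alpha> x # l)) xs = \<zero>"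
   using Suc.prems(1) l by (intro Suc.IH) auto
  then show ?case using Suc.prems(1)[of "\<nu> x # map \<beta> xs"] l map_\<beta>[OF l(3)] by (simp add: l(1))
qed simp

text \<open>The matrix units pass through the expansion to the last entry of \<open>V\<close>, and
  there through the left factor \<open>a f(xs)\<close>. So the endomorphism commutes with all of
  them and is a scalar by \<open>EE_central\<close>.\<close>

lemma \<Psi>V_star:
  assumes f: "mlin m f" and xs: "xs \<in> tup m" and n: "n \<in> NN"
  shows "\<Psi>V f (n # xs @ [\<one>]) = n \<otimes> \<kappa> (\<lambda>n. \<Psi>V f (n # xs @ [\<one>]))"
proof (rule EE_central[OF _ _ n])
  interpret A: assemble K T e1 e2 J c w \<kappa> EE "\<lambda>xs. \<alpha> (f (map \<alpha> xs))" "\<Psi>V f" m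
   by (rule assemble_V[OF f])
  show "(\<lambda>n. \<Psi>V f (n # xs @ [\<one>])) \<in> LN" using xs by (rule A.\<Psi>_LN1)
  fix \<epsilon> n assume \<epsilon>: "\<epsilon> \<in> EE" and n: "n \<in> NN"
  let ?l = "map \<beta> (xs @ [\<one>])"
  have x1: "xs @ [\<one>] \<in> tup (Suc m)" using xs by (auto intro: tuples_snocI)
  have l: "?l \<in> tup (Suc m)" using map_\<beta>[OF x1] .
  have H: "mlin (Suc (Suc m)) (sw f)" using f by (rule sandwich_multilinear)
  \<comment> \<open>The values \<open>a f(xs) v\<close> with \<open>v\<close> in \<open>N\<close>
    lie in \<open>N\<close> already, so \<open>\<nu>\<close> changes nothing and \<open>V\<close>
    itself may be studied.\<close>
  have V: "\<Psi>V f (n # xs @ [\<one>]) = P.V (sw f) (n # ?l)" if n: "n \<in> NN" for n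
  proof -
   have "P.V (sw f) (n # ?l) = P.V (\<lambda>l. \<nu> (sw f l)) (n # ?l)"
   proof (rule P.V_cong[OF _ _ n l])
    fix as v assume as: "as \<in> tup (Suc m)" "set as \<subseteq> AA" "v \<in> NN"
    then obtain a xs where a: "as = a # xs" "a \<in> U" "xs \<in> tup m"
     by (auto simp: in_tuples_Suc)
    have "a \<otimes> f xs \<otimes> v \<in> NN"
     using a as Lin.multilinear_closed[OF f a(3)] by (intro NN_mult) auto
    then show "sw f (as @ [v]) = \<nu> (sw f (as @ [v]))"
     by (simp add: a(1) NN_\<nu>)
   qed (use Lin.multilinear_funcset[OF H] in auto)
   also have "\<dots> = \<nu> (P.V (sw f) (n # ?l))"
    using n l by (intro P.V_hom[OF Lin.multilinear_funcset[OF H] _ \<nu>_linear]) auto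
   finally show ?thesis
    unfolding \<Psi>V_def using VV.lift_NN[of "Suc m" "sw f" n "xs @ [\<one>]"] H n x1 by simp
  qed
  have "P.V (sw f) (\<epsilon> n # ?l) = \<epsilon> (P.V (sw f) (n # ?l))"
  proof (rule P.V_equivariant[OF _ _ _ EE_linear[OF \<epsilon>] _ H n l])
   fix as v assume as: "as \<in> tup (Suc m)" "v \<in> NN"
   then obtain a xs where a: "as = a # xs" "a \<in> U" "xs \<in> tup m"
    by (auto simp: in_tuples_Suc)
   show "sw f (as @ [\<epsilon> v]) = \<epsilon> (sw f (as @ [v]))"
    using a as Lin.multilinear_closed[OF f a(3)] EE_left[OF \<epsilon> as(2), of "a \<otimes> f xs"] by simp
  qed (use \<epsilon> in \<open>auto intro: EE_NN EE_right EE_S\<close>)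
  then show "\<Psi>V f (\<epsilon> n # xs @ [\<one>]) = \<epsilon> (\<Psi>V f (n # xs @ [\<one>]))"
   using V[OF n] V[OF EE_NN[OF \<epsilon> n]] by simp
qed

lemma bar_\<nu>:
  assumes "H \<in> tup k \<rightarrow> U" "l \<in> tup (Suc k)"
  shows "br (\<lambda>l. \<nu> (H l)) l = \<nu> (br H l)"
  using assms linear_mapsD[OF \<nu>_linear] by (intro Bar.bar_hom[of _ _ _ k] Bar.abelian_group_G) auto

lemma bar_\<Psi>V:
  assumes f: "f \<in> Ch m" and l: "l \<in> tup (Suc (Suc (Suc m)))"
  shows "br (\<Psi>V f) l = \<Psi>V (\<delta> m f) l"
proof -
  have H: "mlin (Suc (Suc m)) (sw f)"
   using cochains_multilinear[OF f] by (rule sandwich_multilinear)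
  note sf = Lin.multilinear_funcset[OF H]
  have "br (\<Psi>V f) l = \<nu> (br (VV.lift (sw f)) l)"
   unfolding \<Psi>V_def[abs_def] using VV.lift_closed[of "sw f" "Suc (Suc m)"] sf l
   by (intro bar_\<nu>) auto
  also have "br (VV.lift (sw f)) l = VV.lift (br (sw f)) l"
   by (rule VV_bar[OF H l, symmetric])
  also have "\<dots> = VV.lift (sw (\<delta> m f)) l"
   using l sandwich_d[OF cochains_funcset[OF f]] sandwich_funcset[OF cochains_funcset[OF d_cochains[OF f]]]
   by (intro VV.lift_cong[of "Suc (Suc (Suc m))"]) auto
  finally show ?thesis by (simp add: \<Psi>V_def[abs_def])
qed

text \<open>The cochain assembled from \<open>\<Psi>K f\<close>; the summand zero is its component
  in \<open>A\<close>, written out to match the form of \<open>assemble.F\<close>.\<close>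

definition Kc :: "nat => ('t list => 't) => 't list => 't" where
  "Kc m f = (\<lambda>xs\<in>tup m. \<zero> \<oplus> \<Psi>K f (\<one> # xs @ [\<one>]) \<oplus> \<kappa> (\<lambda>n. \<Psi>K f (n # xs @ [\<one>])))"

definition Qc :: "nat => ('t list => 't) => 't list => 't" where
  "Qc m f = (\<lambda>xs\<in>tup m. \<alpha> (f (map \<alpha> xs)) \<oplus> \<Psi>V f (\<one> # xs @ [\<one>]) \<oplus>
   \<kappa> (\<lambda>n. \<Psi>V f (n # xs @ [\<one>])))"

definition D :: "('t list => 't) => 't => 't list => 't" where
  "D f n xs = \<Psi>K f (n # xs @ [\<one>]) \<ominus> n \<otimes> \<kappa> (\<lambda>n. \<Psi>K f (n # xs @ [\<one>]))"

text \<open>The crossing entry serves as the argument of the endomorphism, so the remaining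
  arguments number one less. This is the origin of the shift in degree.\<close>

definition Dc :: "nat => ('t list => 't) => 't list => 't" where
  "Dc m f = (\<lambda>xs\<in>tup (Suc m). D f (\<nu> (hd xs)) (tl xs))"

lemma Kc_cochain:
  assumes "mlin (Suc m) f"
  shows "Kc m f \<in> Ch m"
proof -
  interpret A: assemble K T e1 e2 J c w \<kappa> EE "\<lambda>_. \<zero>" "\<Psi>K f" m by (rule assemble_K[OF assms])
  show ?thesis using A.F_cochain by (simp add: Kc_def A.F_def A.K0_def)
qed

lemma Kc_components:
  assumes f: "mlin (Suc m) f" and xs: "xs \<in> tup m"
  shows "\<alpha> (Kc m f xs) = \<zero>" "\<nu> (Kc m f xs) = \<Psi>K f (\<one> # xs @ [\<one>])"
   "\<beta> (Kc m f xs) = \<kappa> (\<lambda>n. \<Psi>K f (n # xs @ [\<one>]))"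
proof -
  interpret A: assemble K T e1 e2 J c w \<kappa> EE "\<lambda>_. \<zero>" "\<Psi>K f" m by (rule assemble_K[OF f])
  have "Kc m f = A.F" by (simp add: Kc_def A.F_def A.K0_def)
  then show "\<alpha> (Kc m f xs) = \<zero>" "\<nu> (Kc m f xs) = \<Psi>K f (\<one> # xs @ [\<one>])"
   "\<beta> (Kc m f xs) = \<kappa> (\<lambda>n. \<Psi>K f (n # xs @ [\<one>]))"
   using A.F_components[OF xs] by (simp_all add: A.K0_def)
qed

lemma Qc_cochain:
  assumes "mlin m f"
  shows "Qc m f \<in> Ch m"
proof -
  interpret A: assemble K T e1 e2 J c w \<kappa> EE "\<lambda>xs. \<alpha> (f (map \<alpha> xs))" "\<Psi>V f" m by (rule assemble_V[OF assms])
  show ?thesis using A.F_cochain by (simp add: Qc_def A.F_def A.K0_def)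
qed

lemma Qc_components:
  assumes f: "mlin m f" and xs: "xs \<in> tup m"
  shows "\<alpha> (Qc m f xs) = \<alpha> (f (map \<alpha> xs))" "\<nu> (Qc m f xs) = \<Psi>V f (\<one> # xs @ [\<one>])"
   "\<beta> (Qc m f xs) = \<kappa> (\<lambda>n. \<Psi>V f (n # xs @ [\<one>]))"
proof -
  interpret A: assemble K T e1 e2 J c w \<kappa> EE "\<lambda>xs. \<alpha> (f (map \<alpha> xs))" "\<Psi>V f" m by (rule assemble_V[OF f])
  have "Qc m f = A.F" by (simp add: Qc_def A.F_def A.K0_def)
  then show "\<alpha> (Qc m f xs) = \<alpha> (f (map \<alpha> xs))" "\<nu> (Qc m f xs) = \<Psi>V f (\<one> # xs @ [\<one>])"
   "\<beta> (Qc m f xs) = \<kappa> (\<lambda>n. \<Psi>V f (n # xs @ [\<one>]))"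
   using A.F_components[OF xs] by (simp_all add: A.K0_def)
qed

lemma d_map_\<alpha>:
  assumes f: "f \<in> Ch m" and xs: "xs \<in> tup (Suc m)"
  shows "\<alpha> (\<delta> m (\<lambda>xs. \<alpha> (f (map \<alpha> xs))) xs) = \<alpha> (\<delta> m f (map \<alpha> xs))"
proof -
  have g: "(\<lambda>xs. \<alpha> (f (map \<alpha> xs))) \<in> tup m \<rightarrow> U"
   using cochains_funcset[OF f] map_\<alpha> by auto
  have l: "\<one> # xs @ [\<one>] \<in> tup (Suc (Suc (Suc m)))" using xs by (auto intro: tuples_snocI)
  have bar_\<alpha>: "br (\<lambda>l. \<alpha> (H l)) l = \<alpha> (br H l)"
   if "H \<in> tup (Suc (Suc m)) \<rightarrow> U" "l \<in> tup (Suc (Suc (Suc m)))" for H l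
   using that linear_mapsD[OF \<alpha>_linear] by (intro Bar.bar_hom[of _ _ _ "Suc (Suc m)"] Bar.abelian_group_G) auto
  note sf = sandwich_funcset[OF cochains_funcset[OF f]]
  have "\<alpha> (\<delta> m (\<lambda>xs. \<alpha> (f (map \<alpha> xs))) xs) =
    br (\<lambda>l. \<alpha> (sw (\<lambda>xs. \<alpha> (f (map \<alpha> xs))) l)) (\<one> # xs @ [\<one>])"
   unfolding d_apply[OF g xs] by (rule bar_\<alpha>[OF sandwich_funcset[OF g] l, symmetric])
  also have "\<dots> = br (\<lambda>l. \<alpha> (sw f (map \<alpha> l))) (\<one> # xs @ [\<one>])"
  proof (rule Bar.bar_cong[OF _ l])
   fix l assume "l \<in> tup (Suc (Suc m))"
   then obtain y xs z where "l = y # xs @ [z]" "y \<in> U" "z \<in> U" "xs \<in> tup m"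
    by (subst (asm) in_tuples_Suc_Suc) blast
   moreover have "f (map \<alpha> xs) \<in> U" using f map_\<alpha>[OF calculation(4)] by auto
   ultimately show "\<alpha> (sw (\<lambda>xs. \<alpha> (f (map \<alpha> xs))) l) = \<alpha> (sw f (map \<alpha> l))"
    by (simp add: \<alpha>_mult)
  qed
  also have "\<dots> = br (\<lambda>l. \<alpha> (sw f l)) (map \<alpha> (\<one> # xs @ [\<one>]))"
   by (rule bar_map[OF \<alpha>_mult l, symmetric])
  also have "\<dots> = \<alpha> (br (sw f) (map \<alpha> (\<one> # xs @ [\<one>])))"
   by (rule bar_\<alpha>[OF sf map_\<alpha>[OF l]])
  \<comment> \<open>Under \<open>\<alpha>\<close> the bordering units become \<open>e1\<close>, so
    the sandwich delivers the corner component of the value.\<close>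
  also have "br (sw f) (map \<alpha> (\<one> # xs @ [\<one>])) =
    e1 \<otimes> \<delta> m f (map \<alpha> xs) \<otimes> e1"
   using bar_sandwich[OF cochains_funcset[OF f] map_\<alpha>[OF xs] e_closed(1) e_closed(1)] by simp
  also have "\<alpha> \<dots> = \<alpha> (\<delta> m f (map \<alpha> xs))"
   using cochains_closed[OF d_cochains[OF f] map_\<alpha>[OF xs]] \<alpha>_\<alpha> unfolding \<alpha>_def[symmetric] by blast
  finally show ?thesis .
qed

text \<open>The only obstruction is the term \<open>D\<close> in \<open>dF_components\<close>, and
  \<open>\<Psi>V_star\<close> makes it vanish.\<close>

theorem d_Qc:
  assumes f: "f \<in> Ch m"
  shows "\<delta> m (Qc m f) = Qc (Suc m) (\<delta> m f)"
proof (rule cochains_eqI[of _ "Suc m"])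
  note ml = cochains_multilinear[OF f] note dml = cochains_multilinear[OF d_cochains[OF f]]
  interpret A: assemble K T e1 e2 J c w \<kappa> EE "\<lambda>xs. \<alpha> (f (map \<alpha> xs))" "\<Psi>V f" m by (rule assemble_V[OF ml])
  have Q: "Qc m f = A.F" by (simp add: Qc_def A.F_def A.K0_def)
  show 1: "\<delta> m (Qc m f) \<in> Ch (Suc m)" by (intro d_cochains Qc_cochain ml)
  show 2: "Qc (Suc m) (\<delta> m f) \<in> Ch (Suc m)" by (intro Qc_cochain dml)
  fix xs assume xs: "xs \<in> tup (Suc m)"
  then obtain x xs' where x: "xs = x # xs'" "x \<in> U" "xs' \<in> tup m"
   by (auto simp: in_tuples_Suc)
  have l: "n # xs @ [\<one>] \<in> tup (Suc (Suc (Suc m)))" if "n \<in> U" for n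
   using xs that by (auto intro: tuples_snocI)
  note comp = Qc_components[OF dml xs]
  have D0: "A.D (\<nu> x) xs' = \<zero>"
   unfolding A.D_def A.K0_def using \<Psi>V_star[OF ml x(3), of "\<nu> x"] x NN_closed[OF LN_D(1)[OF A.\<Psi>_LN1[OF x(3)], of "\<nu> x"]]
   by (simp add: M.minus_eq M.r_neg)
  show "\<delta> m (Qc m f) xs = Qc (Suc m) (\<delta> m f) xs"
  proof (rule eq_by_components)
   show "\<alpha> (\<delta> m (Qc m f) xs) = \<alpha> (Qc (Suc m) (\<delta> m f) xs)"
    unfolding Q A.dF_components(1)[OF xs] d_map_\<alpha>[OF f xs] comp ..
   have "\<Psi>V (\<delta> m f) (\<one> # xs @ [\<one>]) \<in> U"
    using comp(2) 2 xs by (metis \<nu>_closed cochains_closed)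
   then show "\<nu> (\<delta> m (Qc m f) xs) = \<nu> (Qc (Suc m) (\<delta> m f) xs)"
    unfolding Q A.dF_components(2)[OF xs] comp bar_\<Psi>V[OF f l[OF A.one_closed]]
    using D0 by (simp add: x M.minus_eq)
   have L: "(\<lambda>n. \<Psi>V (\<delta> m f) (n # xs @ [\<one>])) \<in> LN"
    using assemble.\<Psi>_LN1[OF assemble_V[OF dml] xs] .
   show "\<beta> (\<delta> m (Qc m f) xs) = \<beta> (Qc (Suc m) (\<delta> m f) xs)"
    unfolding Q A.dF_components(3)[OF xs] comp
   proof (rule \<kappa>_cong[OF L, symmetric])
    fix n assume "n \<in> NN"
    then show "\<Psi>V (\<delta> m f) (n # xs @ [\<one>]) = br (\<Psi>V f) (n # xs @ [\<one>])"
     using bar_\<Psi>V[OF f l[of n]] by simp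
   qed
  qed (use 1 2 xs cochains_closed in auto)
qed

end

section \<open>The homotopy formula for cochains of the triangular algebra\<close>

context retract
begin

lemma Hc_cochain:
  assumes f: "mlin (Suc m) f"
  shows "Hc m f \<in> Ch m"
proof -
  have "mlin (Suc m) (\<lambda>l. E.W (sw f) (\<one> # l))"
   using sandwich_multilinear[OF f] by (intro E.W_multilinear) auto
  from restrict_cochains[OF Lin.multilinear_snoc[OF this, of "\<one>"]] show ?thesis
   by (simp add: Hc_def)
qed

text \<open>\<open>Hc\<close> records \<open>W\<close> for the border of units only. An arbitrary
  left border is recovered from left linearity of the homotopy, an arbitrary right border from the
  fact that the last entry is passed on unchanged.\<close>

lemma sandwich_Hc:
  assumes f: "mlin (Suc m) f" and y: "y \<in> U" "z \<in> U" "xs \<in> tup m"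
  shows "sw (Hc m f) (y # xs @ [z]) = E.W (sw f) (y # xs @ [z])"
proof -
  have H: "mlin (Suc (Suc (Suc m))) (sw f)" using f by (rule sandwich_multilinear)
  note sf = Lin.multilinear_funcset[OF H]
  have l: "xs @ [z] \<in> tup (Suc m)" "xs @ [\<one>] \<in> tup (Suc m)" using y by (auto intro: tuples_snocI)
  have w: "E.W (sw f) (\<one> # xs @ [\<one>]) \<in> U"
   using sf l by (intro E.W_closed[of _ "Suc m"]) auto
  have 1: "sw f (l @ [z]) = sw f (l @ [\<one>]) \<otimes> z" "sw f (l @ [\<one>]) \<in> U"
   if "l \<in> tup (Suc (Suc m))" for l
   using that y Lin.multilinear_closed[OF f] by (auto simp: in_tuples_Suc[of l])
  have last: "E.W (sw f) (\<one> # xs @ [z]) = E.W (sw f) (\<one> # xs @ [\<one>]) \<otimes> z"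
   using E.W_last[OF 1 y(2) A.one_closed mult_right_linear[OF y(2)] A.one_closed y(3)] by simp
  have "E.W (sw f) (y # xs @ [z]) = E.W (sw f) ((y \<otimes> \<one>) # xs @ [z])"
   using y by simp
  also have "\<dots> = E.W (\<lambda>l. sw f ((y \<otimes> hd l) # tl l)) (\<one> # xs @ [z])"
   using y l by (intro E.W_left[OF H, symmetric]) auto
  also have "\<dots> = E.W (\<lambda>l. y \<otimes> sw f l) (\<one> # xs @ [z])"
  proof (rule E.W_cong[of "Suc m"])
   fix l assume "l \<in> tup (Suc (Suc (Suc m)))"
   then obtain y' xs z where "l = y' # xs @ [z]" "y' \<in> U" "z \<in> U" "xs \<in> tup (Suc m)"
    by (subst (asm) in_tuples_Suc_Suc) blast
   then show "sw f ((y \<otimes> hd l) # tl l) = y \<otimes> sw f l"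
    using y Lin.multilinear_closed[OF f] by (simp add: A.m_assoc)
  qed (use y sf l in auto)
  also have "\<dots> = y \<otimes> E.W (sw f) (\<one> # xs @ [z])"
   using y sf l by (intro E.W_hom[of _ "Suc m"] mult_left_linear) auto
  finally show ?thesis using y w by (simp add: last Hc_def A.m_assoc)
qed

lemma bar_cong_long:
  assumes "\<And>l. l \<in> tup (Suc (Suc n)) ==> H l = \<psi> l" "l \<in> tup (Suc (Suc (Suc n)))"
  shows "br H l = br \<psi> l"
  using assms by (rule Bar.bar_cong)

lemma d_Hc:
  assumes f: "mlin (Suc m) f" and xs: "xs \<in> tup (Suc m)"
  shows "\<delta> m (Hc m f) xs = br (E.W (sw f)) (\<one> # xs @ [\<one>])"
proof -
  have l: "\<one> # xs @ [\<one>] \<in> tup (Suc (Suc (Suc m)))" using xs by (auto intro: tuples_snocI)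
  show ?thesis
   unfolding d_apply[OF cochains_funcset[OF Hc_cochain[OF f]] xs]
  proof (rule bar_cong_long[OF _ l])
   fix l assume "l \<in> tup (Suc (Suc m))"
   then obtain y xs z where "l = y # xs @ [z]" "y \<in> U" "z \<in> U" "xs \<in> tup m"
    by (subst (asm) in_tuples_Suc_Suc) blast
   then show "sw (Hc m f) l = E.W (sw f) l"
    using sandwich_Hc[OF f] by simp
  qed
qed

text \<open>Restriction of a cochain to the paths in the triangular quiver.\<close>

definition Pc :: "('t list => 't) => 't list => 't" where
  "Pc f xs = \<alpha> (f (map \<alpha> xs)) \<oplus> crossing (sw f) (\<one> # xs @ [\<one>]) \<oplus> \<beta> (f (map \<beta> xs))"

lemma crossing_Cons_NN:
  assumes f: "mlin n f" and xs: "xs \<in> tup n" and m: "m \<in> NN"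
  shows "crossing (sw f) (m # xs @ [\<one>]) = m \<otimes> f (map \<beta> xs)"
proof -
  have H: "mlin (Suc (Suc n)) (sw f)" using f by (rule sandwich_multilinear)
  have x1: "xs @ [\<one>] \<in> tup (Suc n)" using xs by (auto intro: tuples_snocI)
  have "crossing (\<lambda>l. sw f (\<zero> # l)) (xs @ [\<one>]) = \<zero>"
   using Lin.multilinear_zero_hd[OF H] x1 by (intro crossing_zero) auto
  moreover have fb: "f (map \<beta> xs) \<in> U" using Lin.multilinear_closed[OF f map_\<beta>[OF xs]] .
  moreover have "m \<otimes> f (map \<beta> xs) \<otimes> e2 = m \<otimes> f (map \<beta> xs)"
   using NN_eq[OF NN_mult(2)[OF fb m]] by blast
  ultimately show ?thesis using m by (simp add: NN_\<nu> NN_\<alpha>)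
qed

text \<open>Neither bordering unit can be the crossing, as \<open>\<nu> 1 = 0\<close>. Hence the
  right border always enters as \<open>e2\<close>, which places the value in
  \<open>N\<close>.\<close>

lemma crossing_one_NN:
  assumes f: "mlin n f" and xs: "xs \<in> tup n"
  shows "crossing (sw f) (\<one> # xs @ [\<one>]) =
    crossing (\<lambda>l. sw f (e1 # l)) (xs @ [\<one>]) \<and>
   crossing (sw f) (\<one> # xs @ [\<one>]) \<in> NN"
proof -
  have H: "mlin (Suc (Suc n)) (sw f)" using f by (rule sandwich_multilinear)
  have x1: "xs @ [\<one>] \<in> tup (Suc n)" using xs by (auto intro: tuples_snocI)
  have N: "crossing (\<lambda>l. sw f (e1 # l)) (xs @ [\<one>]) \<in> NN"
  proof (rule crossing_NN[OF _ _ _ xs])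
   show "(\<lambda>l. sw f (e1 # l)) \<in> tup (Suc n) \<rightarrow> U"
    using Lin.multilinear_funcset[OF Lin.multilinear_Cons[OF H, of e1]] by simp
   fix l assume l: "l \<in> tup n"
   then have fl: "f l \<in> U" using Lin.multilinear_closed[OF f] by blast
   show "\<nu> (sw f (e1 # l @ [e2])) = sw f (e1 # l @ [e2])"
    using fl \<nu>_\<nu>[OF fl] by (simp add: \<nu>_def[symmetric])
   show "sw f (e1 # l @ [\<zero>]) = \<zero>" using fl by simp
  qed
  moreover have "sw f (\<zero> # map \<beta> (xs @ [\<one>])) = \<zero>"
   using Lin.multilinear_zero_hd[OF H map_\<beta>[OF x1]] .
  ultimately show ?thesis by simp
qed

text \<open>The left unit splits as \<open>e1 + e2\<close>, so a path stays at the first vertex,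
  crosses, or stays at the second vertex; the right unit projects the value to the vertex where the
  path ends.\<close>

lemma E_V_sandwich:
  assumes f: "mlin n f" and xs: "xs \<in> tup n"
  shows "E.V (sw f) (\<one> # xs @ [\<one>]) = Pc f xs"
proof -
  have H: "mlin (Suc (Suc n)) (sw f)" using f by (rule sandwich_multilinear)
  obtain y ys where y: "xs @ [\<one>] = y # ys" by (cases xs) auto
  have yc: "y \<in> U" "ys \<in> tup n"
   using tuples_snocI[OF xs, of "\<one>"] by (simp_all add: y)
  have m: "map \<alpha> (y # ys) = map \<alpha> xs @ [e1]" "map \<beta> (y # ys) = map \<beta> xs @ [e2]"
   unfolding y[symmetric] by simp_all
  have "E.V (sw f) (\<one> # y # ys) =
    E.V (\<lambda>l. sw f (e1 # l)) ((e1 \<otimes> y) # ys) \<oplus> E.V (\<lambda>l. sw f (e2 # l)) ((e2 \<otimes> y) # ys)"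
   using E_V_Cons[OF H A.one_closed yc] by simp
  also have "E.V (\<lambda>l. sw f (e1 # l)) ((e1 \<otimes> y) # ys) =
    sw f (e1 # map \<alpha> (y # ys)) \<oplus> crossing (\<lambda>l. sw f (e1 # l)) (y # ys)"
   using Lin.multilinear_Cons[OF H, of e1] yc by (intro E_V_e1[of n]) auto
  also have "E.V (\<lambda>l. sw f (e2 # l)) ((e2 \<otimes> y) # ys) = sw f (e2 # map \<beta> (y # ys))"
   using Lin.multilinear_Cons[OF H, of e2] yc by (intro E_V_e2[of n]) auto
  finally show ?thesis
   unfolding m y[symmetric] Pc_def crossing_one_NN[OF f xs, THEN conjunct1]
   by (simp add: \<alpha>_def[symmetric] \<beta>_def[symmetric] del: crossing.simps)
qed

lemma Pc_components:
  assumes f: "mlin n f" and xs: "xs \<in> tup n"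
  shows "Pc f xs \<in> U" "\<alpha> (Pc f xs) = \<alpha> (f (map \<alpha> xs))"
   "\<nu> (Pc f xs) = crossing (sw f) (\<one> # xs @ [\<one>])" "\<beta> (Pc f xs) = \<beta> (f (map \<beta> xs))"
  using Lin.multilinear_closed[OF f map_\<alpha>[OF xs]] Lin.multilinear_closed[OF f map_\<beta>[OF xs]]
   NN_eq[OF crossing_one_NN[OF f xs, THEN conjunct2]] NN_\<nu>[OF crossing_one_NN[OF f xs, THEN conjunct2]]
   NN_closed[OF crossing_one_NN[OF f xs, THEN conjunct2]]
  by (simp_all add: Pc_def linear_mapsD[OF \<alpha>_linear] linear_mapsD[OF \<nu>_linear] linear_mapsD[OF \<beta>_linear]
   del: crossing.simps)

lemma homotopy_E:
  assumes f: "f \<in> Ch n" and xs: "xs \<in> tup n"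
  shows "f xs = Hc n (\<delta> n f) xs \<oplus>
   br (E.W (sw f)) (\<one> # xs @ [\<one>]) \<oplus> Pc f xs"
proof -
  note ml = cochains_multilinear[OF f]
  have H: "mlin (Suc (Suc n)) (sw f)" using ml by (rule sandwich_multilinear)
  have x1: "xs @ [\<one>] \<in> tup (Suc n)" using xs by (auto intro: tuples_snocI)
  have "E.W (br (sw f)) (\<one> # xs @ [\<one>]) = E.W (sw (\<delta> n f)) (\<one> # xs @ [\<one>])"
   using sandwich_d[OF cochains_funcset[OF f]] x1 sandwich_funcset[OF cochains_funcset[OF d_cochains[OF f]]]
   by (intro E.W_cong[of "Suc n"]) auto
  then have "Hc n (\<delta> n f) xs \<oplus> br (E.W (sw f)) (\<one> # xs @ [\<one>]) \<oplus> Pc f xs =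
    sw f (\<one> # xs @ [\<one>])"
   using E.prism[OF H A.one_closed x1] E_V_sandwich[OF ml xs] xs by (simp add: Hc_def)
  then show ?thesis using cochains_closed[OF f xs] by simp
qed

lemma homotopy_N:
  assumes f: "f \<in> Ch n" and l: "l \<in> tup (Suc (Suc n))"
  shows "\<Psi>K (\<delta> n f) l \<oplus> br (\<Psi>K f) l \<oplus> \<Psi>V f l = \<nu> (crossing (sw f) l)"
   and "br (\<Psi>K f) l \<in> NN"
proof -
  have H: "mlin (Suc (Suc n)) (sw f)"
   using cochains_multilinear[OF f] by (rule sandwich_multilinear)
  note sf = Lin.multilinear_funcset[OF H]
  have dsf: "sw (\<delta> n f) \<in> tup (Suc (Suc (Suc n))) \<rightarrow> U"
   using sandwich_funcset[OF cochains_funcset[OF d_cochains[OF f]]] .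
  have Kf: "KK.lift (sw f) \<in> tup (Suc n) \<rightarrow> U"
   using KK.lift_closed[of "sw f" "Suc n"] sf by auto
  have 1: "KK.lift (br (sw f)) l = KK.lift (sw (\<delta> n f)) l"
   using l sandwich_d[OF cochains_funcset[OF f]] dsf by (intro KK.lift_cong[of "Suc (Suc n)"]) auto
  have 2: "br (\<Psi>K f) l = \<nu> (br (KK.lift (sw f)) l)"
   unfolding \<Psi>K_def[abs_def] using Kf l by (intro bar_\<nu>) auto
  have c: "br (KK.lift (sw f)) l \<in> U" using Kf l by (intro Bar.bar_closed)
  then show "br (\<Psi>K f) l \<in> NN" by (simp add: 2)
  have "KK.lift (sw (\<delta> n f)) l \<in> U" "VV.lift (sw f) l \<in> U"
   using KK.lift_closed[of "sw (\<delta> n f)" "Suc (Suc n)"] dsf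
    VV.lift_closed[of "sw f" "Suc (Suc n)"] sf l by auto
  then show "\<Psi>K (\<delta> n f) l \<oplus> br (\<Psi>K f) l \<oplus> \<Psi>V f l = \<nu> (crossing (sw f) l)"
   using arg_cong[OF crossing_homotopy[OF H l], of \<nu>] c
   unfolding 1 2 \<Psi>K_def \<Psi>V_def by (simp add: linear_mapsD[OF \<nu>_linear])
qed

text \<open>For a first entry \<open>n\<close> from \<open>N\<close> the crossing part is right
  multiplication by \<open>f (map \<beta> xs)\<close>, and \<open>\<kappa>\<close> returns its
  component in \<open>B\<close>. So the formula for crossings, read under \<open>\<kappa>\<close>,
  is the formula for the component in \<open>B\<close>.\<close>

lemma homotopy_B:
  assumes f: "f \<in> Ch n" and xs: "xs \<in> tup n"
  shows "\<kappa> (\<lambda>n. \<Psi>K (\<delta> (length xs) f) (n # xs @ [\<one>])) \<oplus>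
   \<kappa> (\<lambda>n. br (\<Psi>K f) (n # xs @ [\<one>])) \<oplus> \<kappa> (\<lambda>n. \<Psi>V f (n # xs @ [\<one>])) = \<beta> (f (map \<beta> xs))"
   and "(\<lambda>n. br (\<Psi>K f) (n # xs @ [\<one>])) \<in> LN"
proof -
  note ml = cochains_multilinear[OF f] note dml = cochains_multilinear[OF d_cochains[OF f]]
  have n: "length xs = n" using xs by (simp add: tuples_def)
  have fb: "f (map \<beta> xs) \<in> U" using cochains_closed[OF f map_\<beta>[OF xs]] .
  have l: "m # xs @ [\<one>] \<in> tup (Suc (Suc n))" if "m \<in> NN" for m
   using xs that by (auto intro: tuples_snocI)
  have L1: "(\<lambda>m. \<Psi>K (\<delta> n f) (m # xs @ [\<one>])) \<in> LN"
   using assemble.\<Psi>_LN1[OF assemble_K[OF dml] xs] .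
  have L2: "(\<lambda>m. \<Psi>V f (m # xs @ [\<one>])) \<in> LN"
   using assemble.\<Psi>_LN1[OF assemble_V[OF ml] xs] .
  have L3: "(\<lambda>m. m \<otimes> f (map \<beta> xs)) \<in> LN" using LN_right[OF LN_id fb] .
  have e: "\<Psi>K (\<delta> n f) (m # xs @ [\<one>]) \<oplus> br (\<Psi>K f) (m # xs @ [\<one>]) \<oplus> \<Psi>V f (m # xs @ [\<one>]) =
    m \<otimes> f (map \<beta> xs)" if m: "m \<in> NN" for m
   using homotopy_N(1)[OF f l[OF m]] crossing_Cons_NN[OF ml xs m] NN_\<nu>[OF NN_mult(2)[OF fb m]] by simp
  \<comment> \<open>Solved for the bar term, because left linearity is known for the other three
    terms and is inherited by their combination.\<close>
  have e': "m \<otimes> f (map \<beta> xs) \<ominus> \<Psi>V f (m # xs @ [\<one>]) \<ominus> \<Psi>K (\<delta> n f) (m # xs @ [\<one>]) =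
    br (\<Psi>K f) (m # xs @ [\<one>])" if m: "m \<in> NN" for m
   unfolding e[OF m, symmetric]
   using NN_closed[OF LN_D(1)[OF L1 m]] NN_closed[OF LN_D(1)[OF L2 m]] NN_closed[OF homotopy_N(2)[OF f l[OF m]]]
   by algebra
  show L4: "(\<lambda>m. br (\<Psi>K f) (m # xs @ [\<one>])) \<in> LN"
   by (rule LN_cong[OF LN_minus[OF LN_minus[OF L3 L2] L1] e'])
  have "\<beta> (f (map \<beta> xs)) = \<kappa> (\<lambda>m. m \<otimes> f (map \<beta> xs))" using fb by (simp add: \<kappa>_mult)
  also have "\<dots> = \<kappa> (\<lambda>m. \<Psi>K (\<delta> n f) (m # xs @ [\<one>]) \<oplus> br (\<Psi>K f) (m # xs @ [\<one>]) \<oplus> \<Psi>V f (m # xs @ [\<one>]))"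
   using e by (intro \<kappa>_cong[OF L3]) simp
  also have "\<dots> = \<kappa> (\<lambda>n'. \<Psi>K (\<delta> n f) (n' # xs @ [\<one>])) \<oplus>
   \<kappa> (\<lambda>n. br (\<Psi>K f) (n # xs @ [\<one>])) \<oplus> \<kappa> (\<lambda>n. \<Psi>V f (n # xs @ [\<one>]))"
   using L1 L2 L4 by (simp add: \<kappa>_add LN_add)
  finally show "\<kappa> (\<lambda>n. \<Psi>K (\<delta> (length xs) f) (n # xs @ [\<one>])) \<oplus>
   \<kappa> (\<lambda>n. br (\<Psi>K f) (n # xs @ [\<one>])) \<oplus> \<kappa> (\<lambda>n. \<Psi>V f (n # xs @ [\<one>])) = \<beta> (f (map \<beta> xs))"
   by (simp add: n)
qed

lemma Dc_cochain:
  assumes f: "mlin (Suc m) f"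
  shows "Dc m f \<in> Ch (Suc m)"
  unfolding Dc_def
proof (rule restrict_cochains)
  interpret A: assemble K T e1 e2 J c w \<kappa> EE "\<lambda>_. \<zero>" "\<Psi>K f" m by (rule assemble_K[OF f])
  have D: "D f n xs = A.D n xs" for n xs by (simp add: D_def A.D_def A.K0_def)
  have DL: "(\<lambda>n. D f n xs) \<in> LN" if "xs \<in> tup m" for xs
   unfolding D by (rule A.D_LN[OF that])
  have ml: "mlin m (D f n)" if n: "n \<in> NN" for n
  proof -
   have "mlin m (\<lambda>xs. \<Psi>K f (n # xs @ [\<one>]))"
    using Lin.multilinear_snoc[OF Lin.multilinear_Cons[OF A.\<Psi>_multilinear, of n], of "\<one>"] n by auto
   then show ?thesis
    unfolding D A.D_def[abs_def] using n
    by (intro Lin.multilinear_minus Lin.multilinear_hom[OF mult_left_linear] A.K0_multilinear) auto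
  qed
  show "mlin (Suc m) (\<lambda>xs. D f (\<nu> (hd xs)) (tl xs))"
   unfolding multilinear.simps(2)
  proof (intro conjI ballI)
   fix x assume "x \<in> U"
   then show "mlin m (\<lambda>l. D f (\<nu> (hd (x # l))) (tl (x # l)))" using ml by simp
  next
   fix l assume l: "l \<in> tup m"
   show "(\<lambda>x. D f (\<nu> (hd (x # l))) (tl (x # l))) \<in> lin"
   proof (rule linear_mapsI)
    fix k x assume k: "k \<in> carrier K" "x \<in> U"
    have "\<nu> (k \<odot> x) = (k \<odot> \<one>) \<otimes> \<nu> x"
     using k by (simp add: linear_mapsD[OF \<nu>_linear] smult_mult_left)
    then have "D f (\<nu> (k \<odot> x)) l = (k \<odot> \<one>) \<otimes> D f (\<nu> x) l"
     using k LN_D(3)[OF DL[OF l], of "k \<odot> \<one>" "\<nu> x"] by simp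
    then show "D f (\<nu> (hd ((k \<odot> x) # l))) (tl ((k \<odot> x) # l)) = k \<odot> D f (\<nu> (hd (x # l))) (tl (x # l))"
     using k LN_D(1)[OF DL[OF l], of "\<nu> x"] by (simp add: smult_mult_left)
   qed (use LN_D[OF DL[OF l]] in \<open>auto simp: linear_mapsD[OF \<nu>_linear]\<close>)
  qed
qed

text \<open>After the idempotents have been inserted, both sides are compared corner by corner. The
  middle corner of \<open>\<delta> (Kc f)\<close> differs from \<open>bar (\<Psi>K f)\<close> by the
  deviation from scalarity; this is what brings in \<open>Dc\<close>.\<close>

theorem homotopy:
  assumes f: "f \<in> Ch (Suc m)" and xs: "xs \<in> tup (Suc m)"
  shows "f xs = Qc (Suc m) f xs \<oplus> Dc m f xs \<oplus>
   \<delta> m (Hc m f) xs \<oplus> \<delta> m (Kc m f) xs \<oplus>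
   Hc (Suc m) (\<delta> (Suc m) f) xs \<oplus> Kc (Suc m) (\<delta> (Suc m) f) xs"
proof -
  note ml = cochains_multilinear[OF f] note dml = cochains_multilinear[OF d_cochains[OF f]]
  interpret A: assemble K T e1 e2 J c w \<kappa> EE "\<lambda>_. \<zero>" "\<Psi>K f" m by (rule assemble_K[OF ml])
  have KA: "Kc m f = A.F" by (simp add: Kc_def A.F_def A.K0_def)
  have D: "D f n xs = A.D n xs" for n xs by (simp add: D_def A.D_def A.K0_def)
  have len: "length xs = Suc m" using xs by (simp add: tuples_def)
  obtain x xs' where x: "xs = x # xs'" "x \<in> U" "xs' \<in> tup m"
   using xs by (auto simp: in_tuples_Suc)
  have l: "n # xs @ [\<one>] \<in> tup (Suc (Suc (Suc m)))" if "n \<in> U" for n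
   using xs that by (auto intro: tuples_snocI)
  have DN: "Dc m f xs \<in> NN"
   using xs LN_D(1)[OF A.D_LN[OF x(3)], of "\<nu> x"] x by (simp add: Dc_def D)
  have dK: "\<delta> m (Kc m f) xs \<in> U" and Kd: "Kc (Suc m) (\<delta> (Suc m) f) xs \<in> U"
   and Q: "Qc (Suc m) f xs \<in> U"
   and dH: "\<delta> m (Hc m f) xs \<in> U" and Hd: "Hc (Suc m) (\<delta> (Suc m) f) xs \<in> U"
   using Kc_cochain[OF ml] Kc_cochain[OF dml] Qc_cochain[OF ml] Hc_cochain[OF ml] Hc_cochain[OF dml] d_cochains xs
   by (auto intro!: cochains_closed)
  have d0: "\<alpha> (\<delta> m (\<lambda>_. \<zero>) xs) = \<zero>"
  proof -
   have "\<delta> m (\<lambda>_. \<zero>) xs = br (\<lambda>_. \<zero>) (\<one> # xs @ [\<one>])"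
    unfolding d_apply[OF funcsetI[OF M.zero_closed] xs]
   proof (rule bar_cong_long[OF _ l[OF A.one_closed]])
    fix l assume "l \<in> tup (Suc (Suc m))"
    then obtain y xs z where "l = y # xs @ [z]" "y \<in> U" "z \<in> U" "xs \<in> tup m"
     by (subst (asm) in_tuples_Suc_Suc) blast
    then show "sw (\<lambda>_. \<zero>) l = \<zero>" by simp
   qed
   then show ?thesis by (simp del: bar.simps)
  qed
  note QC = Qc_components[OF ml xs] note KC = Kc_components[OF dml xs] note DK = A.dF_components[OF xs]
  have "Pc f xs = Qc (Suc m) f xs \<oplus> Dc m f xs \<oplus> \<delta> m (Kc m f) xs \<oplus> Kc (Suc m) (\<delta> (Suc m) f) xs"
   (is "_ = ?r")
  proof (rule eq_by_components)
   have c: "\<alpha> ?r = \<alpha> (Qc (Suc m) f xs) \<oplus> \<alpha> (\<delta> m (Kc m f) xs) \<oplus> \<alpha> (Kc (Suc m) (\<delta> (Suc m) f) xs)"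
    "\<nu> ?r = \<nu> (Qc (Suc m) f xs) \<oplus> Dc m f xs \<oplus> \<nu> (\<delta> m (Kc m f) xs) \<oplus> \<nu> (Kc (Suc m) (\<delta> (Suc m) f) xs)"
    "\<beta> ?r = \<beta> (Qc (Suc m) f xs) \<oplus> \<beta> (\<delta> m (Kc m f) xs) \<oplus> \<beta> (Kc (Suc m) (\<delta> (Suc m) f) xs)"
    using Q DN dK Kd NN_eq[OF DN] NN_\<nu>[OF DN]
    by (simp_all add: linear_mapsD[OF \<alpha>_linear] linear_mapsD[OF \<nu>_linear] linear_mapsD[OF \<beta>_linear])
   have "\<alpha> (f (map \<alpha> xs)) \<in> U" using cochains_closed[OF f map_\<alpha>[OF xs]] by simp
   then show "\<alpha> (Pc f xs) = \<alpha> ?r"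
    unfolding c unfolding Pc_components[OF ml xs] QC KC KA DK(1) d0 by simp
   have "\<Psi>K (\<delta> (Suc m) f) (\<one> # xs @ [\<one>]) \<in> U"
    "\<Psi>V f (\<one> # xs @ [\<one>]) \<in> U" "br (\<Psi>K f) (\<one> # xs @ [\<one>]) \<in> U"
    using KC(2) QC(2) Kd Q homotopy_N(2)[OF f l[OF A.one_closed]] \<nu>_closed by (metis, metis, blast)
   then show "\<nu> (Pc f xs) = \<nu> ?r"
    using homotopy_N(1)[OF f l[OF A.one_closed]] NN_\<nu>[OF crossing_one_NN[OF ml xs, THEN conjunct2]] DN[THEN NN_closed] xs x
    unfolding c unfolding Pc_components[OF ml xs] QC KC KA DK(2)
    by (simp add: Dc_def D del: crossing.simps bar.simps) algebra
   have "\<kappa> (\<lambda>n. \<Psi>K (\<delta> (Suc m) f) (n # xs @ [\<one>])) \<in> U"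
    "\<kappa> (\<lambda>n. \<Psi>V f (n # xs @ [\<one>])) \<in> U" "\<kappa> (\<lambda>n. br (\<Psi>K f) (n # xs @ [\<one>])) \<in> U"
    using KC(3) QC(3) Kd Q \<kappa>_closed[OF homotopy_B(2)[OF f xs]] \<beta>_closed by (metis, metis, blast)
   then show "\<beta> (Pc f xs) = \<beta> ?r"
    unfolding c unfolding Pc_components[OF ml xs] QC KC KA DK(3) homotopy_B(1)[OF f xs, unfolded len, symmetric]
    by (simp add: M.a_ac)
  qed (use Pc_components[OF ml xs] Q DN dK Kd in auto)
  then show ?thesis
   using homotopy_E[OF f xs] d_Hc[OF ml xs] Q NN_closed[OF DN] dK Kd dH Hd by (simp add: M.a_ac)
qed

text \<open>There is no lower degree, so the coboundary terms and \<open>Dc\<close> are absent.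
  Correspondingly \<open>bar (\<Psi>K f)\<close> vanishes at \<open>n, 1\<close>, because
  \<open>\<Psi>K f\<close> is zero on a single entry.\<close>

theorem homotopy_0:
  assumes f: "f \<in> Ch 0"
  shows "f [] = Qc 0 f [] \<oplus> Hc 0 (\<delta> 0 f) [] \<oplus> Kc 0 (\<delta> 0 f) []"
proof -
  note ml = cochains_multilinear[OF f] note dml = cochains_multilinear[OF d_cochains[OF f]]
  have xs: "[] \<in> tup 0" by simp
  have l: "n # [] @ [\<one>] \<in> tup (Suc (Suc 0))" if "n \<in> U" for n using that by simp
  have Kd: "Kc 0 (\<delta> 0 f) [] \<in> U" and Q: "Qc 0 f [] \<in> U"
   and Hd: "Hc 0 (\<delta> 0 f) [] \<in> U"
   using Kc_cochain[OF dml] Qc_cochain[OF ml] Hc_cochain[OF dml] xs by (auto intro!: cochains_closed)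
  note QC = Qc_components[OF ml xs] note KC = Kc_components[OF dml xs]
  have b0: "br (\<Psi>K f) [n, \<one>] = \<zero>" if "n \<in> U" for n
   using that by (simp add: \<Psi>K_def KK_Cons M.minus_eq)
  have "Pc f [] = Qc 0 f [] \<oplus> Kc 0 (\<delta> 0 f) []" (is "_ = ?r")
  proof (rule eq_by_components)
   have c: "\<alpha> ?r = \<alpha> (Qc 0 f []) \<oplus> \<alpha> (Kc 0 (\<delta> 0 f) [])"
    "\<nu> ?r = \<nu> (Qc 0 f []) \<oplus> \<nu> (Kc 0 (\<delta> 0 f) [])"
    "\<beta> ?r = \<beta> (Qc 0 f []) \<oplus> \<beta> (Kc 0 (\<delta> 0 f) [])"
    using Q Kd by (simp_all add: linear_mapsD[OF \<alpha>_linear] linear_mapsD[OF \<nu>_linear] linear_mapsD[OF \<beta>_linear])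
   have "\<alpha> (f (map \<alpha> [])) \<in> U" using cochains_closed[OF f xs] by simp
   then show "\<alpha> (Pc f []) = \<alpha> ?r"
    unfolding c unfolding Pc_components[OF ml xs] QC KC by simp
   have "\<Psi>K (\<delta> 0 f) (\<one> # [] @ [\<one>]) \<in> U"
    "\<Psi>V f (\<one> # [] @ [\<one>]) \<in> U"
    using KC(2) QC(2) Kd Q \<nu>_closed by metis+
   then show "\<nu> (Pc f []) = \<nu> ?r"
    using homotopy_N(1)[OF f l[OF A.one_closed]] NN_\<nu>[OF crossing_one_NN[OF ml xs, THEN conjunct2]]
    unfolding c unfolding Pc_components[OF ml xs] QC KC
    by (simp add: b0 M.a_comm del: crossing.simps bar.simps)
   have "\<kappa> (\<lambda>n. \<Psi>K (\<delta> 0 f) (n # [] @ [\<one>])) \<in> U"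
    "\<kappa> (\<lambda>n. \<Psi>V f (n # [] @ [\<one>])) \<in> U"
    using KC(3) QC(3) Kd Q \<beta>_closed by metis+
   moreover have "\<kappa> (\<lambda>n. br (\<Psi>K f) (n # [] @ [\<one>])) = \<zero>"
    using \<kappa>_cong[OF LN_zero, of "\<lambda>n. br (\<Psi>K f) (n # [] @ [\<one>])"] b0 \<kappa>_zero by auto
   ultimately show "\<beta> (Pc f []) = \<beta> ?r"
    unfolding c unfolding Pc_components[OF ml xs] QC KC homotopy_B(1)[OF f xs, symmetric]
    by (simp add: M.a_comm del: bar.simps)
  qed (use Pc_components[OF ml xs] Q Kd in auto)
  then show ?thesis
   using homotopy_E[OF f xs] Q Kd Hd by (simp add: M.a_ac M.minus_eq)
qed

end

section \<open>Cochains supported on a crossing in the first entry\<close>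

context retract
begin

definition from_N :: "nat => ('t => 't list => 't) => 't list => 't" where
  "from_N m \<Theta> = (\<lambda>xs\<in>tup (Suc m). \<Theta> (\<nu> (hd xs)) (tl xs))"

lemma Dc_eq: "Dc m f = from_N m (D f)"
  by (simp add: Dc_def from_N_def)

lemma from_N_Cons: "x \<in> U ==> xs \<in> tup m ==> from_N m \<Theta> (x # xs) = \<Theta> (\<nu> x) xs"
  by (simp add: from_N_def)

lemma LN_0: "\<theta> \<in> LN ==> \<theta> \<zero> = \<zero>"
  using LN_D(3)[of \<theta> "\<zero>" "\<zero>"] LN_D(1)[of \<theta> "\<zero>"] NN_zero by simp

text \<open>The outer left term and the product of the first two entries both contain the value at
  \<open>\<alpha> x \<nu> y\<close>, which cancels. What remains is the differential with
  \<open>\<nu> x\<close> held in front, and the sign records that one entry was passed.\<close>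

lemma d_from_N:
  assumes \<Theta>: "\<And>xs. xs \<in> tup m ==> (\<lambda>n. \<Theta> n xs) \<in> LN"
   and F: "from_N m \<Theta> \<in> Ch m'" "m' = Suc m" and x: "x \<in> U" "xs \<in> tup (Suc m)"
  shows "\<delta> m' (from_N m \<Theta>) (x # xs) =
   \<ominus> br (\<lambda>l. \<Theta> (hd l) (butlast (tl l)) \<otimes> last l) (\<nu> x # xs @ [\<one>])"
proof -
  let ?H = "sw (from_N m \<Theta>)"
  let ?\<Theta> = "\<lambda>l. \<Theta> (hd l) (butlast (tl l)) \<otimes> last l"
  obtain y ys where y: "xs = y # ys" "y \<in> U" "ys \<in> tup m"
   using x by (auto simp: in_tuples_Suc)
  have NL: "\<Theta> n ys \<in> NN" if "n \<in> NN" "ys \<in> tup m" for n ys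
   using LN_D(1)[OF \<Theta>[OF that(2)] that(1)] .
  have xy: "\<alpha> x \<otimes> \<nu> y \<in> NN" "\<nu> x \<otimes> y \<in> NN" "\<nu> (x \<otimes> y) = \<alpha> x \<otimes> \<nu> y \<oplus> \<nu> x \<otimes> y"
   using x y NN_right[of y "\<nu> x"] by (auto intro: NN_mult simp: \<nu>_mult)
  have f: "?H \<in> tup (Suc (Suc (Suc m))) \<rightarrow> U"
   using sandwich_funcset[OF cochains_funcset[OF F(1)]] F(2) by simp
  have x1: "xs @ [\<one>] \<in> tup (Suc (Suc m))" using x by (auto intro: tuples_snocI)
  have b: "br (\<lambda>l. ?H (\<one> # x # l)) (y # ys @ [\<one>]) = br (\<lambda>l. ?\<Theta> (\<nu> x # l)) (y # ys @ [\<one>])"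
  proof (rule Bar.bar_cong)
   fix l assume l: "l \<in> tup (Suc m)"
   then have "l = butlast l @ [last l]" "butlast l \<in> tup m" "last l \<in> U"
    using butlast_closed[of l m] by (auto simp: in_tuples_Suc)
   then obtain us z where us: "l = us @ [z]" "us \<in> tup m" "z \<in> U" by blast
   have "?H (\<one> # (x # us) @ [z]) = \<Theta> (\<nu> x) us \<otimes> z"
    using x us NN_closed[OF NL[of "\<nu> x" us]] unfolding sandwich_simp by (simp add: from_N_Cons)
   then show "?H (\<one> # x # l) = ?\<Theta> (\<nu> x # l)" by (simp add: us)
  next
   show "y # ys @ [\<one>] \<in> tup (Suc (Suc m))" using x1 y by simp
  qed
  define u where "u = br (\<lambda>l. ?\<Theta> (\<nu> x # l)) (y # ys @ [\<one>])"
  define p where "p = \<Theta> (\<alpha> x \<otimes> \<nu> y) ys"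
  define q where "q = \<Theta> (\<nu> x \<otimes> y) ys"
  have uc: "u \<in> U"
   unfolding u_def
  proof (rule Bar.bar_closed)
   show "(\<lambda>l. ?\<Theta> (\<nu> x # l)) \<in> tup (Suc m) \<rightarrow> U"
    using butlast_closed NL[of "\<nu> x"] x by auto
   show "y # ys @ [\<one>] \<in> tup (Suc (Suc m))" using x1 y by simp
  qed
  have pq: "p \<in> NN" "q \<in> NN" using NL xy y by (auto simp: p_def q_def)
  have "\<delta> m' (from_N m \<Theta>) (x # xs) = br ?H (\<one> # x # y # ys @ [\<one>])"
   using x y F by (subst d_apply[OF cochains_funcset[OF F(1)]]) auto
  also have "\<dots> = ?H (x # y # ys @ [\<one>]) \<ominus> (?H (\<one> # (x \<otimes> y) # ys @ [\<one>]) \<ominus> u)"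
   unfolding bar.simps b u_def using x by simp
  also have "?H (x # y # ys @ [\<one>]) = x \<otimes> \<Theta> (\<nu> y) ys"
   using sandwich_simp[of T "from_N m \<Theta>" x "y # ys" "\<one>"] y x NN_closed[OF NL[of "\<nu> y" ys]] by (simp add: from_N_Cons)
  also have "\<dots> = p"
   unfolding p_def using LN_D(3)[OF \<Theta>[OF y(3)], of x "\<nu> y"] NN_left[of x "\<nu> y"] x y by simp
  also have "?H (\<one> # (x \<otimes> y) # ys @ [\<one>]) = \<Theta> (\<nu> (x \<otimes> y)) ys"
   using sandwich_simp[of T "from_N m \<Theta>" "\<one>" "(x \<otimes> y) # ys" "\<one>"] y x NN_closed[OF NL[of "\<nu> (x \<otimes> y)" ys]]
   by (simp add: from_N_Cons)
  also have "\<dots> = p \<oplus> q"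
   unfolding p_def q_def xy(3) by (rule LN_D(2)[OF \<Theta>[OF y(3)] xy(1,2)])
  also have "p \<ominus> (p \<oplus> q \<ominus> u) = \<ominus> (q \<ominus> u)"
   using uc NN_closed[OF pq(1)] NN_closed[OF pq(2)] by algebra
  also have "q \<ominus> u = br ?\<Theta> (\<nu> x # xs @ [\<one>])"
   using NN_closed[OF pq(2)] by (simp add: y(1) u_def q_def)
  finally show ?thesis .
qed

text \<open>Every term of \<open>W\<close> evaluates \<open>\<psi>\<close> with a coordinate in the
  first slot.\<close>

lemma W_vanish:
  assumes "\<And>a l. a \<in> AA ==> l \<in> tup (Suc k) ==> \<psi> (a # l) = \<zero>" "l \<in> tup (Suc k)"
  shows "P.W \<psi> l = \<zero>"
proof (cases k)
  case 0
  then show ?thesis using assms(2) by (auto simp: in_tuples_Suc)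
next
  case (Suc k')
  then obtain n x xs where l: "l = n # x # xs" "n \<in> U" "x \<in> U" "xs \<in> tup k'"
   using assms(2) by (auto simp: in_tuples_Suc)
  have "P.W (\<lambda>l. \<psi> (a # l)) ((v \<otimes> x) # xs) = P.W (\<lambda>l. \<zero>) ((v \<otimes> x) # xs)"
   if "a \<in> AA" "v \<in> NN" for a v
   using assms(1) that l Suc by (intro P.W_cong[of k']) auto
  then have "P.W \<psi> l = P.S n (\<lambda>a v. \<zero>)"
   unfolding l P.W.simps using l assms(1) Suc by (intro P.S_cong) (auto simp: M.minus_eq)
  then show ?thesis by simp
qed

text \<open>Only the first step of the expansion in \<open>W\<close> survives: in all further terms
  the entry after the first coordinate is again from \<open>A\<close>, where \<open>from_N\<close>
  vanishes. The surviving sum recombines to \<open>\<Theta> n xs\<close>.\<close>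

lemma D_from_N:
  assumes \<Theta>: "\<And>xs. xs \<in> tup m ==> (\<lambda>n. \<Theta> n xs) \<in> LN"
   and \<beta>: "\<And>n xs. n \<in> NN ==> xs \<in> tup m ==> \<Theta> n (map \<beta> xs) = \<Theta> n xs"
   and F: "from_N m \<Theta> \<in> Ch (Suc m)" and n: "n \<in> NN" and xs: "xs \<in> tup m"
  shows "\<Psi>K (from_N m \<Theta>) (n # xs @ [\<one>]) = \<Theta> n xs"
proof -
  let ?H = "sw (from_N m \<Theta>)"
  have H: "mlin (Suc (Suc (Suc m))) ?H"
   using sandwich_multilinear[OF cochains_multilinear[OF F]] .
  have x1: "xs @ [\<one>] \<in> tup (Suc m)" using xs by (auto intro: tuples_snocI)
  have b: "map \<beta> xs \<in> tup m" using xs by (rule map_\<beta>)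
  obtain y ys where y: "map \<beta> xs @ [e2] = y # ys" by (cases "map \<beta> xs") auto
  have yc: "y \<in> U" "ys \<in> tup m"
   using tuples_snocI[OF b e_closed(2)] by (simp_all add: y)
  have NL: "\<Theta> n xs \<in> NN" if "n \<in> NN" for n
   using LN_D(1)[OF \<Theta>[OF xs] that] .
  have "KK.lift ?H (n # xs @ [\<one>]) = P.W ?H (n # y # ys)"
   using KK.lift_NN[of "Suc m" ?H n "xs @ [\<one>]"] H n x1 by (simp add: y[symmetric] del: P.W.simps)
  also have "\<dots> = P.S n (\<lambda>a v. \<Theta> (a \<otimes> v) xs)"
   unfolding P.W.simps
  proof (rule P.S_cong)
   fix a v assume av: "a \<in> AA" "v \<in> NN"
   have ac: "a \<in> U" using av by auto
   have "?H (a # v # y # ys) = ?H (a # (v # map \<beta> xs) @ [e2])" by (simp add: y)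
   also have "\<dots> = a \<otimes> \<Theta> v xs \<otimes> e2"
    using av b xs unfolding sandwich_simp by (simp add: from_N_Cons NN_\<nu> \<beta>)
   also have "\<dots> = \<Theta> (a \<otimes> v) xs"
    using NN_eq[OF NN_mult(1)[OF ac NL[OF av(2)]]] LN_D(3)[OF \<Theta>[OF xs] ac av(2)] by simp
   finally have 1: "?H (a # v # y # ys) = \<Theta> (a \<otimes> v) xs" .
   have 2: "P.W (\<lambda>l. ?H (a # l)) ((v \<otimes> y) # ys) = \<zero>"
   proof (rule W_vanish)
    fix a' l assume a': "a' \<in> AA" "l \<in> tup (Suc m)"
    then have "l = butlast l @ [last l]" "butlast l \<in> tup m" "last l \<in> U"
     using butlast_closed[of l m] by (auto simp: in_tuples_Suc)
    then obtain us z where us: "l = us @ [z]" "us \<in> tup m" "z \<in> U" by blast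
    have "\<nu> a' = \<zero>" "a' \<in> U" using a'(1) AA_iff[of a'] \<nu>_\<alpha>[of a'] by auto
    then have "?H (a # (a' # us) @ [z]) = \<zero>"
     using us ac LN_0[OF \<Theta>[OF us(2)]] unfolding sandwich_simp by (simp add: from_N_Cons)
    then show "?H (a # a' # l) = \<zero>" by (simp add: us)
   qed (use av yc in auto)
   show "?H (a # v # y # ys) \<ominus> P.W (\<lambda>l. ?H (a # l)) ((v \<otimes> y) # ys) = \<Theta> (a \<otimes> v) xs"
    unfolding 1 2 using NN_closed[OF NL[OF NN_mult(1)[OF ac av(2)]]] by (simp add: M.minus_eq)
  qed (use n NL NN_mult(1) NN_closed in auto)
  also have "\<dots> = \<Theta> n xs"
   using n NL LN_D(2)[OF \<Theta>[OF xs]] by (intro P.S_mult) auto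
  finally show ?thesis unfolding \<Psi>K_def using NL[OF n] by (simp add: NN_\<nu>)
qed

lemma from_N_fixed:
  assumes \<Theta>: "\<And>xs. xs \<in> tup m ==> (\<lambda>n. \<Theta> n xs) \<in> LN"
   and \<kappa>0: "\<And>xs. xs \<in> tup m ==> \<kappa> (\<lambda>n. \<Theta> n xs) = \<zero>"
   and \<beta>: "\<And>n xs. n \<in> NN ==> xs \<in> tup m ==> \<Theta> n (map \<beta> xs) = \<Theta> n xs"
   and F: "from_N m \<Theta> \<in> Ch (Suc m)" and n: "n \<in> NN" and xs: "xs \<in> tup m"
  shows "D (from_N m \<Theta>) n xs = \<Theta> n xs"
proof -
  have "\<kappa> (\<lambda>n. \<Psi>K (from_N m \<Theta>) (n # xs @ [\<one>])) = \<zero>"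
   using \<kappa>_cong[OF \<Theta>[OF xs], of "\<lambda>n. \<Psi>K (from_N m \<Theta>) (n # xs @ [\<one>])"] D_from_N[OF \<Theta> \<beta> F _ xs] \<kappa>0[OF xs] by simp
  then show ?thesis
   unfolding D_def using D_from_N[OF \<Theta> \<beta> F n xs] n NN_closed[OF LN_D(1)[OF \<Theta>[OF xs] n]] by (simp add: M.minus_eq)
qed

text \<open>\<open>Qc\<close> sees only the restriction to \<open>A\<close>; therefore it can be
  turned into a section of that restriction.\<close>

lemma Qc_cong:
  assumes f: "mlin m f" "mlin m f'"
   and eq: "\<And>xs. xs \<in> tup m ==> \<alpha> (f (map \<alpha> xs)) = \<alpha> (f' (map \<alpha> xs))"
  shows "Qc m f = Qc m f'"
proof (rule cochains_eqI[OF Qc_cochain[OF f(1)] Qc_cochain[OF f(2)]])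
  fix xs assume xs: "xs \<in> tup m"
  have V: "\<Psi>V f l = \<Psi>V f' l" if "l \<in> tup (Suc (Suc m))" for l
   unfolding \<Psi>V_def using VV_sandwich_cong[OF eq f that] by simp
  have l: "n # xs @ [\<one>] \<in> tup (Suc (Suc m))" if "n \<in> U" for n
   using xs that by (auto intro: tuples_snocI)
  have "\<kappa> (\<lambda>n. \<Psi>V f (n # xs @ [\<one>])) = \<kappa> (\<lambda>n. \<Psi>V f' (n # xs @ [\<one>]))"
  proof (rule \<kappa>_cong)
   show "(\<lambda>n. \<Psi>V f (n # xs @ [\<one>])) \<in> LN"
    using assemble.\<Psi>_LN1[OF assemble_V[OF f(1)] xs] .
   show "\<Psi>V f (n # xs @ [\<one>]) = \<Psi>V f' (n # xs @ [\<one>])" if "n \<in> NN" for n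
    using V[OF l[OF NN_closed[OF that]]] .
  qed
  then show "Qc m f xs = Qc m f' xs"
   using xs V[OF l[OF A.one_closed]] eq[OF xs] by (simp add: Qc_def)
qed

lemma zero_multilinear: "mlin m (\<lambda>xs\<in>tup m. \<zero>)"
  using cochains_multilinear[OF zero_cochain] .

lemma Qc_zero:
  assumes f: "mlin m f" and z: "\<And>xs. xs \<in> tup m ==> \<alpha> (f (map \<alpha> xs)) = \<zero>"
   and xs: "xs \<in> tup m"
  shows "Qc m f xs = \<zero>"
proof -
  let ?z = "\<lambda>xs\<in>tup m. \<zero>"
  have Q: "Qc m f = Qc m ?z"
   using z map_\<alpha> by (intro Qc_cong[OF f zero_multilinear]) auto
  have V0: "\<Psi>V ?z l = \<zero>" if "l \<in> tup (Suc (Suc m))" for l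
  proof -
   have "sw ?z l = \<zero>" if l: "l \<in> tup (Suc (Suc m))" for l
    using l by (subst (asm) in_tuples_Suc_Suc) auto
   then show ?thesis unfolding \<Psi>V_def using VV.lift_zero[of "Suc (Suc m)" "sw ?z" l] that by simp
  qed
  have l: "n # xs @ [\<one>] \<in> tup (Suc (Suc m))" if "n \<in> U" for n
   using xs that by (auto intro: tuples_snocI)
  have "\<kappa> (\<lambda>n. \<Psi>V ?z (n # xs @ [\<one>])) = \<kappa> (\<lambda>_. \<zero>)"
   using V0[OF l[OF NN_closed]] by (intro \<kappa>_cong[OF LN_zero, symmetric]) simp
  then show ?thesis
   unfolding Q using xs map_\<alpha>[OF xs] V0[OF l[OF A.one_closed]] by (simp add: Qc_def \<kappa>_zero)
qed

lemma Hc_zero: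
  assumes "\<And>xs. xs \<in> tup (Suc m) ==> f xs = \<zero>" "xs \<in> tup m"
  shows "Hc m f xs = \<zero>"
proof -
  have l: "\<one> # xs @ [\<one>] \<in> tup (Suc (Suc m))"
   using assms(2) by (auto intro: tuples_snocI)
  have "sw f l = \<zero>" if l: "l \<in> tup (Suc (Suc (Suc m)))" for l
   using l assms(1) by (subst (asm) in_tuples_Suc_Suc) auto
  then have "E.W (sw f) (\<one> # xs @ [\<one>]) = E.W (\<lambda>_. \<zero>) (\<one> # xs @ [\<one>])"
   using l by (intro E.W_cong[of "Suc m"]) auto
  then show ?thesis using assms(2) by (simp add: Hc_def)
qed

lemma Kc_zero:
  assumes "\<And>xs. xs \<in> tup (Suc m) ==> f xs = \<zero>" "xs \<in> tup m"
  shows "Kc m f xs = \<zero>"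
proof -
  have l: "n # xs @ [\<one>] \<in> tup (Suc (Suc m))" if "n \<in> U" for n
   using assms(2) that by (auto intro: tuples_snocI)
  have "sw f l = \<zero>" if l: "l \<in> tup (Suc (Suc (Suc m)))" for l
   using l assms(1) by (subst (asm) in_tuples_Suc_Suc) auto
  then have K0: "\<Psi>K f (n # xs @ [\<one>]) = \<zero>" if "n \<in> U" for n
   unfolding \<Psi>K_def using KK.lift_zero[of "Suc (Suc m)" "sw f" "n # xs @ [\<one>]"] l[OF that] by simp
  have "\<kappa> (\<lambda>n. \<Psi>K f (n # xs @ [\<one>])) = \<kappa> (\<lambda>_. \<zero>)"
   using K0 by (intro \<kappa>_cong[OF LN_zero, symmetric]) auto
  then show ?thesis using assms(2) K0[OF A.one_closed] by (simp add: Kc_def \<kappa>_zero)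
qed

lemma d_add_apply:
  assumes "f \<in> Ch m" "g \<in> Ch m" "xs \<in> tup (Suc m)"
  shows "\<delta> m (f \<oplus>\<^bsub>C m\<^esub> g) xs = \<delta> m f xs \<oplus> \<delta> m g xs"
  using linear_mapsD(2)[OF d_linear, of f m g] assms by simp

lemma d_zero_apply:
  assumes "f \<in> Ch m" "\<And>xs. xs \<in> tup m ==> f xs = \<zero>" "xs \<in> tup (Suc m)"
  shows "\<delta> m f xs = \<zero>"
proof -
  have "f = \<zero>\<^bsub>C m\<^esub>"
   using assms(1,2) zero_cochain by (intro cochains_eqI[of _ m]) auto
  then show ?thesis
   using abelian_group_hom.hom_zero[OF d_hom, of m] assms(3) by simp
qed

theorem cocycle_homotopy:
  assumes f: "f \<in> cocycles (Suc m)"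
  shows "\<exists>h\<in>Ch m. \<forall>xs\<in>tup (Suc m).
   f xs = Qc (Suc m) f xs \<oplus> Dc m f xs \<oplus> \<delta> m h xs"
proof
  have fc: "f \<in> Ch (Suc m)" using f by (rule cocycles_cochains)
  note ml = cochains_multilinear[OF fc]
  note H = Hc_cochain[OF ml] note Kc = Kc_cochain[OF ml]
  let ?h = "Hc m f \<oplus>\<^bsub>C m\<^esub> Kc m f"
  show h: "?h \<in> Ch m" using add_cochain[OF H Kc] by simp
  show "\<forall>xs\<in>tup (Suc m). f xs = Qc (Suc m) f xs \<oplus> Dc m f xs \<oplus> \<delta> m ?h xs"
  proof
   fix xs assume xs: "xs \<in> tup (Suc m)"
   have "Hc (Suc m) (\<delta> (Suc m) f) xs = \<zero>" "Kc (Suc m) (\<delta> (Suc m) f) xs = \<zero>"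
    using cocycles_d[OF f] xs by (intro Hc_zero Kc_zero; simp)+
   moreover have "Qc (Suc m) f xs \<in> U" "Dc m f xs \<in> U"
    "\<delta> m (Hc m f) xs \<in> U" "\<delta> m (Kc m f) xs \<in> U"
    using Qc_cochain[OF ml] Dc_cochain[OF ml] d_cochains[OF H] d_cochains[OF Kc] xs by (auto intro: cochains_closed)
   ultimately show "f xs = Qc (Suc m) f xs \<oplus> Dc m f xs \<oplus> \<delta> m ?h xs"
    using homotopy[OF fc xs] d_add_apply[OF H Kc xs] by (simp add: M.a_assoc)
  qed
qed

theorem cocycle_homotopy_0:
  assumes f: "f \<in> cocycles 0"
  shows "f [] = Qc 0 f []"
proof -
  have fc: "f \<in> Ch 0" using f by (rule cocycles_cochains)
  have "Hc 0 (\<delta> 0 f) [] = \<zero>" "Kc 0 (\<delta> 0 f) [] = \<zero>"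
   using cocycles_d[OF f] by (intro Hc_zero Kc_zero; simp)+
  moreover have "Qc 0 f [] \<in> U"
   using Qc_cochain[OF cochains_multilinear[OF fc]] by auto
  ultimately show ?thesis using homotopy_0[OF fc] by simp
qed

text \<open>On such a cocycle \<open>Qc\<close> is zero and \<open>Dc\<close> is the identity, so
  the homotopy formula leaves only the statement that two coboundaries cancel.\<close>

lemma from_N_homotopy:
  assumes \<Theta>: "\<And>xs. xs \<in> tup m ==> (\<lambda>n. \<Theta> n xs) \<in> LN"
   and \<kappa>0: "\<And>xs. xs \<in> tup m ==> \<kappa> (\<lambda>n. \<Theta> n xs) = \<zero>"
   and \<beta>: "\<And>n xs. n \<in> NN ==> xs \<in> tup m ==> \<Theta> n (map \<beta> xs) = \<Theta> n xs"
   and I: "from_N m \<Theta> \<in> cocycles (Suc m)" and xs: "xs \<in> tup (Suc m)"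
  shows "Qc (Suc m) (from_N m \<Theta>) xs = \<zero>"
   and "\<delta> m (Hc m (from_N m \<Theta>)) xs \<oplus> \<delta> m (Kc m (from_N m \<Theta>)) xs = \<zero>"
proof -
  let ?I = "from_N m \<Theta>"
  have Ic: "?I \<in> Ch (Suc m)" using I by (rule cocycles_cochains)
  note ml = cochains_multilinear[OF Ic]
  show Q0: "Qc (Suc m) ?I xs = \<zero>"
  proof (rule Qc_zero[OF ml _ xs])
   fix xs assume "xs \<in> tup (Suc m)"
   then obtain x ys where "xs = x # ys" "x \<in> U" "ys \<in> tup m"
    by (auto simp: in_tuples_Suc)
   then show "\<alpha> (?I (map \<alpha> xs)) = \<zero>"
    using LN_0[OF \<Theta>[OF map_\<alpha>]] map_\<alpha> by (simp add: from_N_Cons)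
  qed
  obtain x ys where x: "xs = x # ys" "x \<in> U" "ys \<in> tup m"
   using xs by (auto simp: in_tuples_Suc)
  have D: "Dc m ?I xs = ?I xs"
   using from_N_fixed[OF \<Theta> \<kappa>0 \<beta> Ic _ x(3), of "\<nu> x"] x by (simp add: Dc_eq from_N_Cons)
  have "Hc (Suc m) (\<delta> (Suc m) ?I) xs = \<zero>" "Kc (Suc m) (\<delta> (Suc m) ?I) xs = \<zero>"
   using cocycles_d[OF I] xs by (intro Hc_zero Kc_zero; simp)+
  moreover have c: "?I xs \<in> U"
   "\<delta> m (Hc m ?I) xs \<in> U" "\<delta> m (Kc m ?I) xs \<in> U"
   using Ic d_cochains[OF Hc_cochain[OF ml]] d_cochains[OF Kc_cochain[OF ml]] xs by (auto intro: cochains_closed)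
  ultimately have "?I xs = ?I xs \<oplus> (\<delta> m (Hc m ?I) xs \<oplus> \<delta> m (Kc m ?I) xs)"
   by (subst homotopy[OF Ic xs]) (simp add: Q0 D M.a_assoc)
  then show "\<delta> m (Hc m ?I) xs \<oplus> \<delta> m (Kc m ?I) xs = \<zero>"
   by (rule iffD1[OF M.add.l_cancel_one'[OF c(1) M.a_closed[OF c(2,3)]]])
qed

text \<open>If \<open>from_N\<close> of a family is the coboundary of some \<open>F\<close>, it is
  also that of \<open>Dc F\<close>, which is again supported on a first crossing. To see this,
  \<delta> is applied to the homotopy formula of \<open>F\<close>; the homotopies of
  \<open>\<delta> F\<close> drop out by \<open>from_N_homotopy\<close>. Injectivity in cohomology
  rests on this.\<close>

theorem from_N_coboundary:
  assumes \<Theta>: "\<And>xs. xs \<in> tup (Suc m) ==> (\<lambda>n. \<Theta> n xs) \<in> LN"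
   and \<kappa>0: "\<And>xs. xs \<in> tup (Suc m) ==> \<kappa> (\<lambda>n. \<Theta> n xs) = \<zero>"
   and \<beta>: "\<And>n xs. n \<in> NN ==> xs \<in> tup (Suc m) ==> \<Theta> n (map \<beta> xs) = \<Theta> n xs"
   and F: "F \<in> Ch (Suc m)" and dF: "\<delta> (Suc m) F = from_N (Suc m) \<Theta>"
   and xs: "xs \<in> tup (Suc (Suc m))"
  shows "\<delta> (Suc m) F xs = \<delta> (Suc m) (Dc m F) xs"
proof -
  let ?I = "from_N (Suc m) \<Theta>" let ?C = "C (Suc m)"
  note ml = cochains_multilinear[OF F]
  have Ic: "?I \<in> Ch (Suc (Suc m))" using d_cochains[OF F] dF by simp
  note mlI = cochains_multilinear[OF Ic]
  have I: "?I \<in> cocycles (Suc (Suc m))"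
   using Ic d_d[OF F] by (simp add: cocycles_def dF)
  define q where "q = Qc (Suc m) F"
  define d where "d = Dc m F"
  define h where "h = \<delta> m (Hc m F)"
  define k where "k = \<delta> m (Kc m F)"
  define h' where "h' = Hc (Suc m) ?I"
  define k' where "k' = Kc (Suc m) ?I"
  have c: "q \<in> Ch (Suc m)" "d \<in> Ch (Suc m)" "h \<in> Ch (Suc m)"
   "k \<in> Ch (Suc m)" "h' \<in> Ch (Suc m)" "k' \<in> Ch (Suc m)"
   unfolding q_def d_def h_def k_def h'_def k'_def
   by (intro Qc_cochain Dc_cochain d_cochains Hc_cochain Kc_cochain ml mlI)+
  have add: "f \<oplus>\<^bsub>?C\<^esub> g \<in> Ch (Suc m)" if "f \<in> Ch (Suc m)" "g \<in> Ch (Suc m)" for f g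
   using add_cochain[OF that] by simp
  have "F = q \<oplus>\<^bsub>?C\<^esub> d \<oplus>\<^bsub>?C\<^esub> h \<oplus>\<^bsub>?C\<^esub> k \<oplus>\<^bsub>?C\<^esub> h' \<oplus>\<^bsub>?C\<^esub> k'"
  proof (rule cochains_eqI[OF F])
   show "q \<oplus>\<^bsub>?C\<^esub> d \<oplus>\<^bsub>?C\<^esub> h \<oplus>\<^bsub>?C\<^esub> k \<oplus>\<^bsub>?C\<^esub> h' \<oplus>\<^bsub>?C\<^esub> k' \<in> Ch (Suc m)"
    by (intro add c)
   fix xs assume "xs \<in> tup (Suc m)"
   then show "F xs = (q \<oplus>\<^bsub>?C\<^esub> d \<oplus>\<^bsub>?C\<^esub> h \<oplus>\<^bsub>?C\<^esub> k \<oplus>\<^bsub>?C\<^esub> h' \<oplus>\<^bsub>?C\<^esub> k') xs"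
    using homotopy[OF F] by (simp add: q_def d_def h_def k_def h'_def k'_def dF)
  qed
  then have "\<delta> (Suc m) F xs = \<delta> (Suc m) (q \<oplus>\<^bsub>?C\<^esub> d \<oplus>\<^bsub>?C\<^esub> h \<oplus>\<^bsub>?C\<^esub> k \<oplus>\<^bsub>?C\<^esub> h' \<oplus>\<^bsub>?C\<^esub> k') xs"
   by simp
  also have "\<dots> = \<delta> (Suc m) q xs \<oplus> \<delta> (Suc m) d xs \<oplus> \<delta> (Suc m) h xs \<oplus>
    \<delta> (Suc m) k xs \<oplus> \<delta> (Suc m) h' xs \<oplus> \<delta> (Suc m) k' xs"
   using c xs by (simp add: d_add_apply add del: cochain_simps(3))
  also have "\<delta> (Suc m) q xs = \<zero>"
   unfolding q_def d_Qc[OF F] dF using from_N_homotopy(1)[OF \<Theta> \<kappa>0 \<beta> I xs] .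
  also have "\<delta> (Suc m) h xs = \<zero>"
   unfolding h_def using d_d[OF Hc_cochain[OF ml]] xs by simp
  also have "\<delta> (Suc m) k xs = \<zero>"
   unfolding k_def using d_d[OF Kc_cochain[OF ml]] xs by simp
  finally show ?thesis
   using from_N_homotopy(2)[OF \<Theta> \<kappa>0 \<beta> I xs] cochains_closed[OF d_cochains[OF c(2)] xs]
    cochains_closed[OF d_cochains[OF c(5)] xs] cochains_closed[OF d_cochains[OF c(6)] xs]
   by (simp add: h'_def k'_def d_def M.a_assoc)
qed

text \<open>In degree 0 there is no \<open>Dc F\<close>, so the same computation leaves
  zero.\<close>

theorem from_N_coboundary_0:
  assumes \<Theta>: "\<And>xs. xs \<in> tup 0 ==> (\<lambda>n. \<Theta> n xs) \<in> LN"
   and \<kappa>0: "\<And>xs. xs \<in> tup 0 ==> \<kappa> (\<lambda>n. \<Theta> n xs) = \<zero>"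
   and \<beta>: "\<And>n xs. n \<in> NN ==> xs \<in> tup 0 ==> \<Theta> n (map \<beta> xs) = \<Theta> n xs"
   and F: "F \<in> Ch 0" and dF: "\<delta> 0 F = from_N 0 \<Theta>"
   and xs: "xs \<in> tup (Suc 0)"
  shows "\<delta> 0 F xs = \<zero>"
proof -
  let ?I = "from_N 0 \<Theta>" let ?C = "C 0"
  note ml = cochains_multilinear[OF F]
  have Ic: "?I \<in> Ch (Suc 0)" using d_cochains[OF F] dF by simp
  note mlI = cochains_multilinear[OF Ic]
  have I: "?I \<in> cocycles (Suc 0)"
   using Ic d_d[OF F] by (simp add: cocycles_def dF)
  define q where "q = Qc 0 F"
  define h' where "h' = Hc 0 ?I"
  define k' where "k' = Kc 0 ?I"
  have c: "q \<in> Ch 0" "h' \<in> Ch 0" "k' \<in> Ch 0"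
   unfolding q_def h'_def k'_def by (intro Qc_cochain Hc_cochain Kc_cochain ml mlI)+
  have add: "f \<oplus>\<^bsub>?C\<^esub> g \<in> Ch 0" if "f \<in> Ch 0" "g \<in> Ch 0" for f g
   using add_cochain[OF that] by simp
  have "F = q \<oplus>\<^bsub>?C\<^esub> h' \<oplus>\<^bsub>?C\<^esub> k'"
  proof (rule cochains_eqI[OF F])
   show "q \<oplus>\<^bsub>?C\<^esub> h' \<oplus>\<^bsub>?C\<^esub> k' \<in> Ch 0"
    by (intro add c)
   fix xs :: "'t list" assume "xs \<in> tup 0"
   then show "F xs = (q \<oplus>\<^bsub>?C\<^esub> h' \<oplus>\<^bsub>?C\<^esub> k') xs"
    using homotopy_0[OF F] by (simp add: q_def h'_def k'_def dF)
  qed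
  then have "\<delta> 0 F xs = \<delta> 0 (q \<oplus>\<^bsub>?C\<^esub> h' \<oplus>\<^bsub>?C\<^esub> k') xs"
   by simp
  also have "\<dots> = \<delta> 0 q xs \<oplus> \<delta> 0 h' xs \<oplus> \<delta> 0 k' xs"
   using c xs by (simp add: d_add_apply add del: cochain_simps(3))
  also have "\<delta> 0 q xs = \<zero>"
   unfolding q_def d_Qc[OF F] dF using from_N_homotopy(1)[OF \<Theta> \<kappa>0 \<beta> I xs] .
  finally show ?thesis
   using from_N_homotopy(2)[OF \<Theta> \<kappa>0 \<beta> I xs]
    cochains_closed[OF d_cochains[OF c(2)] xs] cochains_closed[OF d_cochains[OF c(3)] xs]
   by (simp add: h'_def k'_def M.a_assoc)
qed

end

section \<open>The triangular algebra of a projective module\<close>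

type_synonym ('a, 'm) matrix = "'a \<times> (nat => 'm) \<times> ('m => 'm)"

locale endo_triangular = A: hochschild K A + L: left_module A M
  for K :: "'k ring" and A :: "('k, 'a) module" and M :: "('a, 'm) module" +
  fixes m :: nat and B :: "('k, 'm => 'm) module" and N :: "('a, nat => 'm, 'm => 'm) bimodule"
   and T :: "('k, ('a, 'm) matrix) module" (structure)
  assumes m: "0 < m"
   and B_def: "B = opposite_algebra (endomorphism_algebra A M)"
   and N_def: "N = bimodule_power m (endo_bimodule M)"
   and T_def: "T = triangular_algebra A N B"
begin

abbreviation scalar :: "'k => 'm => 'm" where
  "scalar k x \<equiv> (k \<odot>\<^bsub>A\<^esub> \<one>\<^bsub>A\<^esub>) \<odot>\<^bsub>M\<^esub> x"

lemma scalar_simps [simp]: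
  "k \<in> carrier K ==> x \<in> carrier M ==> scalar k x \<in> carrier M"
  "x \<in> carrier M ==> scalar \<one>\<^bsub>K\<^esub> x = x"
  by (simp_all add: L.smult_closed L.smult_one)

lemma scalar_mult: "k \<in> carrier K ==> l \<in> carrier K ==> x \<in> carrier M ==>
   scalar (k \<otimes>\<^bsub>K\<^esub> l) x = scalar k (scalar l x)"
  by (simp add: L.smult_assoc1[symmetric] A.smult_mult_left A.smult_assoc1)

lemma scalar_distr:
  "k \<in> carrier K ==> l \<in> carrier K ==> x \<in> carrier M ==>
   scalar (k \<oplus>\<^bsub>K\<^esub> l) x = scalar k x \<oplus>\<^bsub>M\<^esub> scalar l x"
  "k \<in> carrier K ==> x \<in> carrier M ==> y \<in> carrier M ==>
   scalar k (x \<oplus>\<^bsub>M\<^esub> y) = scalar k x \<oplus>\<^bsub>M\<^esub> scalar k y"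
  by (simp_all add: A.smult_l_distr L.smult_l_distr L.smult_r_distr)

lemma scalar_smult:
  assumes "k \<in> carrier K" "a \<in> carrier A" "x \<in> carrier M"
  shows "scalar k (a \<odot>\<^bsub>M\<^esub> x) = (k \<odot>\<^bsub>A\<^esub> a) \<odot>\<^bsub>M\<^esub> x" "a \<odot>\<^bsub>M\<^esub> scalar k x = (k \<odot>\<^bsub>A\<^esub> a) \<odot>\<^bsub>M\<^esub> x"
  using assms by (simp_all add: L.smult_assoc1[symmetric] A.smult_mult_left A.smult_mult_right)

lemma smult_A_commute: "k \<in> carrier K ==> l \<in> carrier K ==> a \<in> carrier A ==>
   k \<odot>\<^bsub>A\<^esub> (l \<odot>\<^bsub>A\<^esub> a) = l \<odot>\<^bsub>A\<^esub> (k \<odot>\<^bsub>A\<^esub> a)"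
  by (simp add: A.smult_assoc1[symmetric] A.R.m_comm)

text \<open>In the opposite algebra maps are composed in the order in which they act from the
  right.\<close>

lemma B_fields:
  "x \<in> carrier M ==> (b \<otimes>\<^bsub>B\<^esub> b') x = b' (b x)"
  "x \<in> carrier M ==> (b \<oplus>\<^bsub>B\<^esub> b') x = b x \<oplus>\<^bsub>M\<^esub> b' x"
  "x \<in> carrier M ==> (k \<odot>\<^bsub>B\<^esub> b) x = scalar k (b x)"
  "x \<in> carrier M ==> \<one>\<^bsub>B\<^esub> x = x"
  "x \<in> carrier M ==> \<zero>\<^bsub>B\<^esub> x = \<zero>\<^bsub>M\<^esub>"
  by (simp_all add: B_def opposite_algebra_def endomorphism_algebra_def compose_def)

lemma B_carrier: "carrier B = linear_maps A M M \<inter> extensional (carrier M)"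
  by (simp add: B_def opposite_algebra_def endomorphism_algebra_def)

lemma B_D:
  assumes "b \<in> carrier B"
  shows "x \<in> carrier M ==> b x \<in> carrier M"
   and "x \<in> carrier M ==> y \<in> carrier M ==> b (x \<oplus>\<^bsub>M\<^esub> y) = b x \<oplus>\<^bsub>M\<^esub> b y"
   and "a \<in> carrier A ==> x \<in> carrier M ==> b (a \<odot>\<^bsub>M\<^esub> x) = a \<odot>\<^bsub>M\<^esub> b x"
  using assms by (auto simp: B_carrier linear_maps_def)

lemma B_zero_arg: "b \<in> carrier B ==> b \<zero>\<^bsub>M\<^esub> = \<zero>\<^bsub>M\<^esub>"
  using B_D(1)[of b "\<zero>\<^bsub>M\<^esub>"] B_D(2)[of b "\<zero>\<^bsub>M\<^esub>" "\<zero>\<^bsub>M\<^esub>"] by simp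

lemma B_I:
  assumes "b \<in> extensional (carrier M)"
   and "\<And>x. x \<in> carrier M ==> b x \<in> carrier M"
   and "\<And>x y. x \<in> carrier M ==> y \<in> carrier M ==> b (x \<oplus>\<^bsub>M\<^esub> y) = b x \<oplus>\<^bsub>M\<^esub> b y"
   and "\<And>a x. a \<in> carrier A ==> x \<in> carrier M ==> b (a \<odot>\<^bsub>M\<^esub> x) = a \<odot>\<^bsub>M\<^esub> b x"
  shows "b \<in> carrier B"
  using assms by (auto simp: B_carrier linear_maps_def)

lemma B_eqI: "b \<in> carrier B ==> b' \<in> carrier B ==> (\<And>x. x \<in> carrier M ==> b x = b' x) ==> b = b'"
  by (auto simp: B_carrier intro: extensionalityI)

lemma smult_M_zero: "a \<in> carrier A ==> a \<odot>\<^bsub>M\<^esub> \<zero>\<^bsub>M\<^esub> = \<zero>\<^bsub>M\<^esub>"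
  using L.smult_r_distr[of a "\<zero>\<^bsub>M\<^esub>" "\<zero>\<^bsub>M\<^esub>"] L.smult_closed[of a "\<zero>\<^bsub>M\<^esub>"] by simp

lemma zero_smult_M: "x \<in> carrier M ==> \<zero>\<^bsub>A\<^esub> \<odot>\<^bsub>M\<^esub> x = \<zero>\<^bsub>M\<^esub>"
  using L.smult_l_distr[of "\<zero>\<^bsub>A\<^esub>" "\<zero>\<^bsub>A\<^esub>" x] L.smult_closed[of "\<zero>\<^bsub>A\<^esub>" x] by simp

lemma B_closed [simp]:
  assumes b: "b \<in> carrier B"
  shows "b' \<in> carrier B ==> b \<otimes>\<^bsub>B\<^esub> b' \<in> carrier B"
   and "b' \<in> carrier B ==> b \<oplus>\<^bsub>B\<^esub> b' \<in> carrier B"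
   and "k \<in> carrier K ==> k \<odot>\<^bsub>B\<^esub> b \<in> carrier B"
proof -
  have e: "b \<otimes>\<^bsub>B\<^esub> b' \<in> extensional (carrier M)" "b \<oplus>\<^bsub>B\<^esub> b' \<in> extensional (carrier M)"
   "k \<odot>\<^bsub>B\<^esub> b \<in> extensional (carrier M)"
   by (auto simp: B_def opposite_algebra_def endomorphism_algebra_def compose_def)
  show "b \<otimes>\<^bsub>B\<^esub> b' \<in> carrier B" if "b' \<in> carrier B"
   using b that by (intro B_I[OF e(1)]) (simp_all add: B_fields B_D L.smult_closed)
  show "b \<oplus>\<^bsub>B\<^esub> b' \<in> carrier B" if "b' \<in> carrier B"
   using b that by (intro B_I[OF e(2)]) (simp_all add: B_fields B_D L.smult_closed L.smult_r_distr L.M.a_ac)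
  show "k \<odot>\<^bsub>B\<^esub> b \<in> carrier B" if "k \<in> carrier K"
   using b that by (intro B_I[OF e(3)]) (simp_all add: B_fields B_D L.smult_closed scalar_smult scalar_distr)
qed

lemma B_one_zero [simp]: "\<one>\<^bsub>B\<^esub> \<in> carrier B" "\<zero>\<^bsub>B\<^esub> \<in> carrier B"
proof -
  have e: "\<one>\<^bsub>B\<^esub> \<in> extensional (carrier M)" "\<zero>\<^bsub>B\<^esub> \<in> extensional (carrier M)"
   by (auto simp: B_def opposite_algebra_def endomorphism_algebra_def)
  show "\<one>\<^bsub>B\<^esub> \<in> carrier B"
   by (rule B_I[OF e(1)]) (simp_all add: B_fields L.smult_closed)
  show "\<zero>\<^bsub>B\<^esub> \<in> carrier B"
   by (rule B_I[OF e(2)]) (simp_all add: B_fields L.smult_closed smult_M_zero)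
qed

lemmas M_simps = L.smult_closed L.smult_l_distr L.smult_r_distr L.smult_assoc1 L.smult_one
  scalar_distr scalar_mult scalar_smult smult_M_zero zero_smult_M

lemma B_abelian: "abelian_group B"
proof (rule abelian_groupI)
  fix b assume b: "b \<in> carrier B"
  have "(\<lambda>x\<in>carrier M. \<ominus>\<^bsub>M\<^esub> b x) \<in> carrier B"
   using b
   by (intro B_I) (auto simp: B_D L.smult_closed L.M.minus_add L.M.a_ac
     intro!: L.M.minus_equality simp: L.smult_r_distr[symmetric] L.M.r_neg smult_M_zero)
  moreover have "(\<lambda>x\<in>carrier M. \<ominus>\<^bsub>M\<^esub> b x) \<oplus>\<^bsub>B\<^esub> b = \<zero>\<^bsub>B\<^esub>"
   using b calculation by (intro B_eqI) (auto simp: B_fields B_D L.M.l_neg)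
  ultimately show "\<exists>y\<in>carrier B. y \<oplus>\<^bsub>B\<^esub> b = \<zero>\<^bsub>B\<^esub>" by blast
qed (auto intro!: B_eqI simp: B_fields B_D L.M.a_ac)

lemma B_algebra: "assoc_algebra K B"
proof -
  have "ring B"
   using B_abelian
   by (intro ringI monoidI) (auto intro!: B_eqI simp: B_fields B_D)
  moreover have "module K B"
   using A.R.cring_axioms B_abelian
   by (intro moduleI) (auto intro!: B_eqI simp: B_fields B_D scalar_distr scalar_mult L.smult_one)
  moreover have "assoc_algebra_axioms K B"
   by unfold_locales (auto intro!: B_eqI simp: B_fields B_D)
  ultimately show ?thesis by (intro assoc_algebra.intro)
qed

lemma N_fields:
  "j < m ==> (n \<oplus>\<^bsub>N\<^esub> n') j = n j \<oplus>\<^bsub>M\<^esub> n' j"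
  "j < m ==> (a \<odot>\<^bsub>N\<^esub> n) j = a \<odot>\<^bsub>M\<^esub> n j"
  "j < m ==> ract N n b j = b (n j)"
  "j < m ==> \<zero>\<^bsub>N\<^esub> j = \<zero>\<^bsub>M\<^esub>"
  by (simp_all add: N_def bimodule_power_def module_power_def endo_bimodule_def module.defs)

lemma N_carrier: "carrier N = {..<m} \<rightarrow>\<^sub>E carrier M"
  by (simp add: N_def bimodule_power_def module_power_def endo_bimodule_def module.defs)

lemma N_D [simp]: "n \<in> carrier N ==> j < m ==> n j \<in> carrier M"
  by (auto simp: N_carrier)

lemma N_eqI: "n \<in> carrier N ==> n' \<in> carrier N ==> (\<And>j. j < m ==> n j = n' j) ==> n = n'"
  by (auto simp: N_carrier intro: PiE_ext)

lemma N_closed [simp]: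
  "n \<in> carrier N ==> n' \<in> carrier N ==> n \<oplus>\<^bsub>N\<^esub> n' \<in> carrier N"
  "n \<in> carrier N ==> a \<in> carrier A ==> a \<odot>\<^bsub>N\<^esub> n \<in> carrier N"
  "n \<in> carrier N ==> b \<in> carrier B ==> ract N n b \<in> carrier N"
  "\<zero>\<^bsub>N\<^esub> \<in> carrier N"
  unfolding N_carrier
  by (auto simp: N_def bimodule_power_def module_power_def endo_bimodule_def module.defs
    L.smult_closed B_D PiE_iff)

lemma N_inverse: "n \<in> carrier N ==> \<exists>n'\<in>carrier N. n' \<oplus>\<^bsub>N\<^esub> n = \<zero>\<^bsub>N\<^esub>"
proof -
  assume n: "n \<in> carrier N"
  then have "(\<lambda>j\<in>{..<m}. \<ominus>\<^bsub>M\<^esub> n j) \<in> carrier N" by (auto simp: N_carrier)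
  moreover have "(\<lambda>j\<in>{..<m}. \<ominus>\<^bsub>M\<^esub> n j) \<oplus>\<^bsub>N\<^esub> n = \<zero>\<^bsub>N\<^esub>"
   using n calculation by (intro N_eqI) (auto simp: N_fields L.M.l_neg)
  ultimately show ?thesis by blast
qed

lemma N_abelian: "abelian_group N"
  by (rule abelian_groupI) (auto intro!: N_eqI N_inverse simp: N_fields L.M.a_ac)

lemma T_fields [simp]:
  "(a, n, b) \<otimes> (a', n', b') = (a \<otimes>\<^bsub>A\<^esub> a', (a \<odot>\<^bsub>N\<^esub> n') \<oplus>\<^bsub>N\<^esub> ract N n b', b \<otimes>\<^bsub>B\<^esub> b')"
  "(a, n, b) \<oplus> (a', n', b') = (a \<oplus>\<^bsub>A\<^esub> a', n \<oplus>\<^bsub>N\<^esub> n', b \<oplus>\<^bsub>B\<^esub> b')"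
  "k \<odot> (a, n, b) = (k \<odot>\<^bsub>A\<^esub> a, (k \<odot>\<^bsub>A\<^esub> \<one>\<^bsub>A\<^esub>) \<odot>\<^bsub>N\<^esub> n, k \<odot>\<^bsub>B\<^esub> b)"
  "carrier T = carrier A \<times> carrier N \<times> carrier B"
  by (simp_all add: T_def triangular_algebra_def)

lemma T_one: "\<one> = (\<one>\<^bsub>A\<^esub>, \<zero>\<^bsub>N\<^esub>, \<one>\<^bsub>B\<^esub>)" and T_zero: "\<zero> = (\<zero>\<^bsub>A\<^esub>, \<zero>\<^bsub>N\<^esub>, \<zero>\<^bsub>B\<^esub>)"
  by (simp_all add: T_def triangular_algebra_def)

sublocale B: hochschild K B
  using B_algebra by (simp add: hochschild_def)

sublocale NG: abelian_group N
  by (rule N_abelian)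

lemma T_abelian: "abelian_group T"
proof (rule abelian_groupI)
  fix x assume "x \<in> carrier T"
  then obtain a n b where x: "x = (a, n, b)" "a \<in> carrier A" "n \<in> carrier N" "b \<in> carrier B" by auto
  then show "\<exists>y\<in>carrier T. y \<oplus> x = \<zero>"
   by (intro bexI[of _ "(\<ominus>\<^bsub>A\<^esub> a, \<ominus>\<^bsub>N\<^esub> n, \<ominus>\<^bsub>B\<^esub> b)"])
    (auto simp: T_zero A.M.l_neg NG.l_neg B.M.l_neg)
qed (auto simp: T_zero A.M.a_ac NG.a_ac B.M.a_ac)

lemma T_algebra: "assoc_algebra K T"
proof -
  have "ring T"
   using T_abelian
   by (intro ringI monoidI)
    (auto intro!: N_eqI simp: T_one N_fields B_D B_fields M_simps A.A.m_assoc B.A.m_assoc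
     A.A.l_distr A.A.r_distr B.A.l_distr B.A.r_distr L.M.a_ac B_zero_arg)
  moreover have "module K T"
   using A.R.cring_axioms T_abelian
   by (intro moduleI) (auto intro!: N_eqI simp: N_fields M_simps A.smult_l_distr A.smult_r_distr
     A.smult_assoc1 B.smult_l_distr B.smult_r_distr B.smult_assoc1 smult_A_commute)
  moreover have "assoc_algebra_axioms K T"
   by unfold_locales (auto intro!: N_eqI simp: N_fields M_simps B_D B_fields A.smult_mult_left A.smult_mult_right
     B.smult_mult_left B.smult_mult_right)
  ultimately show ?thesis by (intro assoc_algebra.intro)
qed

end

section \<open>Corners and matrix entries of the triangular algebra\<close>

context endo_triangular
begin

definition E1 :: "('a, 'm) matrix" where "E1 = (\<one>\<^bsub>A\<^esub>, \<zero>\<^bsub>N\<^esub>, \<zero>\<^bsub>B\<^esub>)"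
definition E2 :: "('a, 'm) matrix" where "E2 = (\<zero>\<^bsub>A\<^esub>, \<zero>\<^bsub>N\<^esub>, \<one>\<^bsub>B\<^esub>)"

lemma N_zero_simps:
  "a \<in> carrier A ==> a \<odot>\<^bsub>N\<^esub> \<zero>\<^bsub>N\<^esub> = \<zero>\<^bsub>N\<^esub>"
  "n \<in> carrier N ==> \<zero>\<^bsub>A\<^esub> \<odot>\<^bsub>N\<^esub> n = \<zero>\<^bsub>N\<^esub>"
  "n \<in> carrier N ==> \<one>\<^bsub>A\<^esub> \<odot>\<^bsub>N\<^esub> n = n"
  "b \<in> carrier B ==> ract N \<zero>\<^bsub>N\<^esub> b = \<zero>\<^bsub>N\<^esub>"
  "n \<in> carrier N ==> ract N n \<zero>\<^bsub>B\<^esub> = \<zero>\<^bsub>N\<^esub>"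
  "n \<in> carrier N ==> ract N n \<one>\<^bsub>B\<^esub> = n"
  by (auto intro!: N_eqI simp: N_fields M_simps B_fields B_zero_arg)

sublocale peirce K T E1 E2
proof -
  interpret T: assoc_algebra K T by (rule T_algebra)
  show "peirce K T E1 E2"
   by unfold_locales (auto simp: E1_def E2_def T_one T_zero N_zero_simps)
qed

lemma components:
  assumes "a \<in> carrier A" "n \<in> carrier N" "b \<in> carrier B"
  shows "\<alpha> (a, n, b) = (a, \<zero>\<^bsub>N\<^esub>, \<zero>\<^bsub>B\<^esub>)" "\<nu> (a, n, b) = (\<zero>\<^bsub>A\<^esub>, n, \<zero>\<^bsub>B\<^esub>)" "\<beta> (a, n, b) = (\<zero>\<^bsub>A\<^esub>, \<zero>\<^bsub>N\<^esub>, b)"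
  unfolding \<alpha>_def \<nu>_def \<beta>_def using assms by (simp_all add: E1_def E2_def N_zero_simps)

lemma NN_iff: "x \<in> NN \<longleftrightarrow> (\<exists>n\<in>carrier N. x = (\<zero>\<^bsub>A\<^esub>, n, \<zero>\<^bsub>B\<^esub>))"
proof
  assume x: "x \<in> NN"
  then obtain a n b where "x = (a, n, b)" "a \<in> carrier A" "n \<in> carrier N" "b \<in> carrier B"
   using NN_closed[OF x] by auto
  then show "\<exists>n\<in>carrier N. x = (\<zero>\<^bsub>A\<^esub>, n, \<zero>\<^bsub>B\<^esub>)" using NN_\<nu>[OF x] components[of a n b] by auto
qed (auto intro!: NN_I simp: components)

lemma AA_elements: "(a, n, b) \<in> AA \<longleftrightarrow> a \<in> carrier A \<and> n = \<zero>\<^bsub>N\<^esub> \<and> b = \<zero>\<^bsub>B\<^esub>"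
  using components[of a n b] by (auto simp: AA_def)

definition col :: "nat => 'm => nat => 'm" where
  "col j x = (\<lambda>l\<in>{..<m}. if l = j then x else \<zero>\<^bsub>M\<^esub>)"

lemma col_closed [simp]: "x \<in> carrier M ==> col j x \<in> carrier N"
  by (auto simp: col_def N_carrier)

lemma col_apply: "l < m ==> col j x l = (if l = j then x else \<zero>\<^bsub>M\<^esub>)"
  by (simp add: col_def)

lemma col_simps:
  "x \<in> carrier M ==> y \<in> carrier M ==> col j (x \<oplus>\<^bsub>M\<^esub> y) = col j x \<oplus>\<^bsub>N\<^esub> col j y"
  "a \<in> carrier A ==> x \<in> carrier M ==> col j (a \<odot>\<^bsub>M\<^esub> x) = a \<odot>\<^bsub>N\<^esub> col j x"
  "b \<in> carrier B ==> x \<in> carrier M ==> col j (b x) = ract N (col j x) b"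
  "col j \<zero>\<^bsub>M\<^esub> = \<zero>\<^bsub>N\<^esub>"
  by (auto intro!: N_eqI simp: N_fields col_apply M_simps B_D B_zero_arg)

definition entry :: "nat => ('a, 'm) matrix => 'm" where
  "entry j x = fst (snd x) j"

lemma entry_simp [simp]: "entry j (a, n, b) = n j"
  by (simp add: entry_def)

lemma entry_hom: "j < m ==> abelian_group_hom T M (entry j)"
  using A.M.abelian_group_axioms
  by (intro abelian_group_hom_of_additive M.abelian_group_axioms L.M.abelian_group_axioms)
   (auto simp: N_fields)

lemma entry_closed [simp]: "x \<in> U ==> j < m ==> entry j x \<in> carrier M"
  by auto

definition inc :: "nat => 'm => ('a, 'm) matrix" where
  "inc j x = (\<zero>\<^bsub>A\<^esub>, col j x, \<zero>\<^bsub>B\<^esub>)"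

lemma inc_NN [simp]: "x \<in> carrier M ==> inc j x \<in> NN"
  unfolding NN_iff inc_def by (intro bexI[of _ "col j x"]) auto

lemma entry_inc: "l < m ==> entry l (inc j x) = (if l = j then x else \<zero>\<^bsub>M\<^esub>)"
  by (simp add: inc_def col_apply)

lemma NN_eqI: "x \<in> NN ==> y \<in> NN ==> (\<And>j. j < m ==> entry j x = entry j y) ==> x = y"
  by (auto simp: NN_iff intro: N_eqI)

lemma entry_NN:
  assumes "j < m" "n \<in> NN"
  shows "n' \<in> NN ==> entry j (n \<oplus> n') = entry j n \<oplus>\<^bsub>M\<^esub> entry j n'"
   and "t \<in> U ==> entry j (t \<otimes> n) = fst t \<odot>\<^bsub>M\<^esub> entry j n"
   and "t \<in> U ==> entry j (n \<otimes> t) = snd (snd t) (entry j n)"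
   and "entry j n \<in> carrier M"
  using assms by (auto simp: NN_iff N_fields M_simps B_D B_fields N_zero_simps)

lemma inc_simps:
  "x \<in> carrier M ==> y \<in> carrier M ==> inc j (x \<oplus>\<^bsub>M\<^esub> y) = inc j x \<oplus> inc j y"
  "t \<in> U ==> x \<in> carrier M ==> inc j (fst t \<odot>\<^bsub>M\<^esub> x) = t \<otimes> inc j x"
  "t \<in> U ==> x \<in> carrier M ==> inc j (snd (snd t) x) = inc j x \<otimes> t"
  by (auto simp: inc_def col_simps N_zero_simps)

text \<open>The function is the matrix entry of the endomorphism \<open>\<theta>\<close> from place
  \<open>j\<close> to place \<open>l\<close>; left linearity of \<open>\<theta>\<close> makes it
  linear over \<open>A\<close>.\<close>

lemma ext_B:
  assumes "\<theta> \<in> LN" "l < m"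
  shows "(\<lambda>x\<in>carrier M. entry l (\<theta> (inc j x))) \<in> carrier B"
proof (rule B_I)
  fix x assume x: "x \<in> carrier M"
  show "(\<lambda>x\<in>carrier M. entry l (\<theta> (inc j x))) x \<in> carrier M"
   using x entry_NN(4)[OF assms(2) LN_D(1)[OF assms(1)]] by simp
  show "(\<lambda>x\<in>carrier M. entry l (\<theta> (inc j x))) (x \<oplus>\<^bsub>M\<^esub> y) =
    (\<lambda>x\<in>carrier M. entry l (\<theta> (inc j x))) x \<oplus>\<^bsub>M\<^esub> (\<lambda>x\<in>carrier M. entry l (\<theta> (inc j x))) y"
   if "y \<in> carrier M" for y
   using x that assms(2) LN_D[OF assms(1)] by (simp add: inc_simps entry_NN)
  fix a assume a: "a \<in> carrier A"
  have t: "(a, \<zero>\<^bsub>N\<^esub>, \<zero>\<^bsub>B\<^esub>) \<in> U" using a by simp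
  show "(\<lambda>x\<in>carrier M. entry l (\<theta> (inc j x))) (a \<odot>\<^bsub>M\<^esub> x) = a \<odot>\<^bsub>M\<^esub> (\<lambda>x\<in>carrier M. entry l (\<theta> (inc j x))) x"
   using x a inc_simps(2)[OF t x, of j] LN_D(3)[OF assms(1) t inc_NN[OF x]]
    entry_NN(2)[OF assms(2) LN_D(1)[OF assms(1) inc_NN[OF x]] t] by (simp add: L.smult_closed)
qed simp

definition \<kappa> :: "(('a, 'm) matrix => ('a, 'm) matrix) => ('a, 'm) matrix" where
  "\<kappa> \<theta> = (\<zero>\<^bsub>A\<^esub>, \<zero>\<^bsub>N\<^esub>, \<lambda>x\<in>carrier M. entry 0 (\<theta> (inc 0 x)))"

text \<open>The matrix units of \<open>M^m\<close>: the entry at \<open>j\<close> is moved to the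
  place \<open>l\<close> and all others are dropped.\<close>

definition EE :: "(('a, 'm) matrix => ('a, 'm) matrix) set" where
  "EE = {\<lambda>x. inc l (entry j x) | j l. j < m \<and> l < m}"

end

text \<open>Stated with a condition on the pairs because the coordinates are summed over their
  support; the full index set of the basis may be infinite.\<close>

lemma (in abelian_group) finsum_row:
  assumes "j \<in> L" "\<And>l i. l \<in> L ==> i \<in> I ==> P l i ==> h l i \<in> carrier G"
   "\<And>l i. l \<in> L ==> i \<in> I ==> P l i ==> l \<noteq> j ==> h l i = \<zero>" "finite {p \<in> L \<times> I. P (fst p) (snd p)}"
  shows "(\<Oplus>p\<in>{p \<in> L \<times> I. P (fst p) (snd p)}. h (fst p) (snd p)) = (\<Oplus>i\<in>{i \<in> I. P j i}. h j i)"
proof -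
  have z: "h l i = \<zero>" if "l \<in> L" "i \<in> I" "P l i" "(l, i) \<notin> Pair j ` {i \<in> I. P j i}" for l i
   using that assms(3) by (cases "l = j") auto
  have "(\<Oplus>p\<in>{p \<in> L \<times> I. P (fst p) (snd p)}. h (fst p) (snd p)) = (\<Oplus>p\<in>Pair j ` {i \<in> I. P j i}. h (fst p) (snd p))"
   using assms by (intro add.finprod_mono_neutral_cong_right) (auto intro: z)
  also have "\<dots> = (\<Oplus>i\<in>{i \<in> I. P j i}. h j i)"
   using assms(1,2) by (subst add.finprod_reindex) (auto simp: inj_on_def)
  finally show ?thesis .
qed

section \<open>A dual basis of \<open>M^m\<close>\<close>

locale endo_projective = endo_triangular K A M m B N T
  for K :: "'k ring" and A :: "('k, 'a) module" and M :: "('a, 'm) module" and m B N and T (structure) +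
  fixes I :: "'i set" and u :: "'m => 'i => 'a" and v :: "('i => 'a) => 'm"
  assumes u: "u \<in> linear_maps A M (free_module A I)"
   and v: "v \<in> linear_maps A (free_module A I) M"
   and vu: "x \<in> carrier M ==> v (u x) = x"
begin

definition unit :: "'i => 'i => 'a" where
  "unit i = (\<lambda>k\<in>I. if k = i then \<one>\<^bsub>A\<^esub> else \<zero>\<^bsub>A\<^esub>)"

lemma free_module_fields:
  "carrier (free_module A I) = {f \<in> I \<rightarrow>\<^sub>E carrier A. finite {i \<in> I. f i \<noteq> \<zero>\<^bsub>A\<^esub>}}"
  "f \<oplus>\<^bsub>free_module A I\<^esub> g = (\<lambda>i\<in>I. f i \<oplus>\<^bsub>A\<^esub> g i)"
  "a \<odot>\<^bsub>free_module A I\<^esub> f = (\<lambda>i\<in>I. a \<otimes>\<^bsub>A\<^esub> f i)"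
  by (simp_all add: free_module_def)

lemma unit_free: "unit i \<in> carrier (free_module A I)"
proof -
  have "{k \<in> I. unit i k \<noteq> \<zero>\<^bsub>A\<^esub>} \<subseteq> {i}" by (auto simp: unit_def)
  then show ?thesis by (auto simp: free_module_fields unit_def dest: finite_subset)
qed

lemma unit_M: "v (unit i) \<in> carrier M"
  using linear_mapsD(1)[OF v unit_free] .

text \<open>Induction on a finite set containing the support: one coordinate at a time is split off
  as a multiple of a unit vector.\<close>

lemma v_support:
  assumes "finite F" "F \<subseteq> I" "f \<in> carrier (free_module A I)" "{i \<in> I. f i \<noteq> \<zero>\<^bsub>A\<^esub>} \<subseteq> F"
  shows "v f = (\<Oplus>\<^bsub>M\<^esub>i\<in>F. f i \<odot>\<^bsub>M\<^esub> v (unit i))"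
  using assms
proof (induction F arbitrary: f rule: finite_induct)
  case empty
  \<comment> \<open>A vector with empty support satisfies \<open>f + f = f\<close>, from which the
    vanishing of its image follows by cancellation.\<close>
  have "f \<oplus>\<^bsub>free_module A I\<^esub> f = f"
   using empty by (intro extensionalityI[of _ I]) (auto simp: free_module_fields PiE_iff)
  then have "v f \<oplus>\<^bsub>M\<^esub> v f = v f" by (simp only: linear_mapsD(2)[OF v empty(2,2), symmetric])
  then show ?case using linear_mapsD(1)[OF v empty(2)] by simp
next
  case (insert k F)
  let ?g = "\<lambda>i\<in>I. if i = k then \<zero>\<^bsub>A\<^esub> else f i"
  have fc: "\<And>i. i \<in> I ==> f i \<in> carrier A" using insert.prems by (auto simp: free_module_fields)
  have gF: "{i \<in> I. ?g i \<noteq> \<zero>\<^bsub>A\<^esub>} \<subseteq> F" using insert.prems by auto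
  from finite_subset[OF this insert.hyps(1)] have g: "?g \<in> carrier (free_module A I)"
   using fc unfolding free_module_fields by auto
  have IH: "v ?g = (\<Oplus>\<^bsub>M\<^esub>i\<in>F. ?g i \<odot>\<^bsub>M\<^esub> v (unit i))"
   using insert.prems by (intro insert.IH[OF _ g gF]) auto
  have fk: "f k \<in> carrier A" "k \<in> I" using fc insert.prems by auto
  have s: "f k \<odot>\<^bsub>free_module A I\<^esub> unit k \<in> carrier (free_module A I)"
  proof -
   have "{i \<in> I. (f k \<odot>\<^bsub>free_module A I\<^esub> unit k) i \<noteq> \<zero>\<^bsub>A\<^esub>} \<subseteq> {k}"
    using fk by (auto simp: free_module_fields unit_def)
   then show ?thesis using fk by (auto simp: free_module_fields unit_def dest: finite_subset)
  qed
  have f: "f = f k \<odot>\<^bsub>free_module A I\<^esub> unit k \<oplus>\<^bsub>free_module A I\<^esub> ?g"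
   using insert.prems fk fc
   by (intro extensionalityI[of _ I]) (auto simp: free_module_fields PiE_iff unit_def)
  have "v f = f k \<odot>\<^bsub>M\<^esub> v (unit k) \<oplus>\<^bsub>M\<^esub> v ?g"
   by (subst f) (simp only: linear_mapsD(2)[OF v s g] linear_mapsD(3)[OF v fk(1) unit_free])
  also have "v ?g = (\<Oplus>\<^bsub>M\<^esub>i\<in>F. f i \<odot>\<^bsub>M\<^esub> v (unit i))"
   unfolding IH using insert.prems insert.hyps fc unit_M
   by (intro L.M.finsum_cong') (auto simp: L.smult_closed)
  also have "f k \<odot>\<^bsub>M\<^esub> v (unit k) \<oplus>\<^bsub>M\<^esub> \<dots> = (\<Oplus>\<^bsub>M\<^esub>i\<in>insert k F. f i \<odot>\<^bsub>M\<^esub> v (unit i))"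
   using insert.prems insert.hyps fc unit_M
   by (intro L.M.finsum_insert[symmetric]) (auto simp: L.smult_closed)
  finally show ?case .
qed

lemma u_D: "x \<in> carrier M ==> i \<in> I ==> u x i \<in> carrier A"
  "x \<in> carrier M ==> y \<in> carrier M ==> i \<in> I ==> u (x \<oplus>\<^bsub>M\<^esub> y) i = u x i \<oplus>\<^bsub>A\<^esub> u y i"
  "x \<in> carrier M ==> a \<in> carrier A ==> i \<in> I ==> u (a \<odot>\<^bsub>M\<^esub> x) i = a \<otimes>\<^bsub>A\<^esub> u x i"
  "x \<in> carrier M ==> finite {i \<in> I. u x i \<noteq> \<zero>\<^bsub>A\<^esub>}"
  using linear_mapsD[OF u] by (auto simp: free_module_fields)

lemma expand_M: "x \<in> carrier M ==> (\<Oplus>\<^bsub>M\<^esub>i\<in>{i \<in> I. u x i \<noteq> \<zero>\<^bsub>A\<^esub>}. u x i \<odot>\<^bsub>M\<^esub> v (unit i)) = x"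
  using v_support[of "{i \<in> I. u x i \<noteq> \<zero>\<^bsub>A\<^esub>}" "u x"] linear_mapsD(1)[OF u] u_D(4) vu by simp

text \<open>The dual basis is indexed by a place in \<open>M^m\<close> together with a basis index
  of \<open>M\<close>. The coordinate is put into the first corner, from where it acts on the
  off-diagonal ideal from the left.\<close>

definition coord :: "nat \<times> 'i => ('a, 'm) matrix => ('a, 'm) matrix" where
  "coord p x = (u (entry (fst p) x) (snd p), \<zero>\<^bsub>N\<^esub>, \<zero>\<^bsub>B\<^esub>)"

definition basis :: "nat \<times> 'i => ('a, 'm) matrix" where
  "basis p = inc (fst p) (v (unit (snd p)))"

lemma coord_support:
  "{p \<in> {..<m} \<times> I. coord p x \<noteq> \<zero>} = {p \<in> {..<m} \<times> I. u (entry (fst p) x) (snd p) \<noteq> \<zero>\<^bsub>A\<^esub>}"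
  by (auto simp: coord_def T_zero)

lemma coord_finite: 
  assumes "x \<in> U"
  shows "finite {p \<in> {..<m} \<times> I. u (entry (fst p) x) (snd p) \<noteq> \<zero>\<^bsub>A\<^esub>}"
proof -
  have "{p \<in> {..<m} \<times> I. u (entry (fst p) x) (snd p) \<noteq> \<zero>\<^bsub>A\<^esub>} = Sigma {..<m} (\<lambda>j. {i \<in> I. u (entry j x) i \<noteq> \<zero>\<^bsub>A\<^esub>})"
   by auto
  then show ?thesis using u_D(4)[OF entry_closed[OF assms]] by (auto intro: finite_SigmaI)
qed

text \<open>The expansion is checked entry by entry: at the place \<open>j\<close> only pairs with
  first index \<open>j\<close> contribute, and there the sum is the expansion of an element of
  \<open>M\<close>.\<close>

lemma prism_T: "prism K T ({..<m} \<times> I) coord basis NN AA"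
proof (unfold_locales)
  show "NN \<subseteq> U" "AA \<subseteq> U" using NN_closed AA_def by auto
  show "\<zero> \<in> NN" by (rule NN_zero)
  fix n assume n: "n \<in> NN"
  show "n \<oplus> n' \<in> NN" if "n' \<in> NN" for n' using NN_add n that .
  show "t \<otimes> n \<in> NN" "n \<otimes> t \<in> NN" if "t \<in> U" for t using NN_mult n that by auto
  show "coord p (n \<oplus> n') = coord p n \<oplus> coord p n'" if "p \<in> {..<m} \<times> I" "n' \<in> NN" for p n'
   using n that by (cases p) (simp add: coord_def entry_NN u_D del: T_fields, simp)
  show "coord p (t \<otimes> n) = t \<otimes> coord p n" if "p \<in> {..<m} \<times> I" "t \<in> U" for p t
  proof -
   have "u (entry (fst p) (t \<otimes> n)) (snd p) = fst t \<otimes>\<^bsub>A\<^esub> u (entry (fst p) n) (snd p)"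
    using that n mem_Times_iff[of t] by (cases p) (auto simp: entry_NN u_D simp del: T_fields(1-3))
   moreover have "t \<otimes> coord p n = (fst t \<otimes>\<^bsub>A\<^esub> u (entry (fst p) n) (snd p), \<zero>\<^bsub>N\<^esub>, \<zero>\<^bsub>B\<^esub>)"
    using that(2) by (auto simp: coord_def N_zero_simps)
   ultimately show ?thesis by (simp only: coord_def)
  qed
  let ?F = "{p \<in> {..<m} \<times> I. u (entry (fst p) n) (snd p) \<noteq> \<zero>\<^bsub>A\<^esub>}"
  have nT: "n \<in> U" using NN_closed[OF n] .
  have t: "coord p n \<otimes> basis p = inc (fst p) (u (entry (fst p) n) (snd p) \<odot>\<^bsub>M\<^esub> v (unit (snd p)))"
   if "p \<in> {..<m} \<times> I" for p
   using that u_D(1)[OF entry_NN(4)[OF _ n], of "fst p" "snd p"] unit_M inc_simps(2)[of "coord p n" "v (unit (snd p))" "fst p"]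
   by (auto simp: coord_def basis_def)
  have c: "coord p n \<otimes> basis p \<in> NN" if "p \<in> {..<m} \<times> I" for p
   unfolding t[OF that] using that u_D(1)[OF entry_NN(4)[OF _ n]] unit_M by (intro inc_NN L.smult_closed) auto
  have cT: "coord p n \<otimes> basis p \<in> U" if "p \<in> ?F" for p
   using NN_closed[OF c] that by blast
  have "(\<Oplus>p\<in>?F. coord p n \<otimes> basis p) = n"
  proof (rule NN_eqI[OF _ n])
   have "\<nu> (\<Oplus>p\<in>?F. coord p n \<otimes> basis p) = (\<Oplus>p\<in>?F. \<nu> (coord p n \<otimes> basis p))"
    by (intro abelian_group_hom.hom_finsum[OF \<nu>_hom] Pi_I cT)
   also have "\<dots> = (\<Oplus>p\<in>?F. coord p n \<otimes> basis p)"
    using c NN_\<nu> by (intro M.finsum_cong' Pi_I cT) auto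
   finally show "(\<Oplus>p\<in>?F. coord p n \<otimes> basis p) \<in> NN"
    by (intro NN_I M.finsum_closed Pi_I cT)
   fix j assume j: "j < m"
   have "entry j (\<Oplus>p\<in>?F. coord p n \<otimes> basis p) = (\<Oplus>\<^bsub>M\<^esub>p\<in>?F. entry j (coord p n \<otimes> basis p))"
    by (intro abelian_group_hom.hom_finsum[OF entry_hom[OF j]] Pi_I cT)
   also have "\<dots> = (\<Oplus>\<^bsub>M\<^esub>p\<in>?F. if j = fst p then u (entry (fst p) n) (snd p) \<odot>\<^bsub>M\<^esub> v (unit (snd p)) else \<zero>\<^bsub>M\<^esub>)"
    using c j u_D(1)[OF entry_NN(4)[OF _ n]] unit_M
    by (intro L.M.finsum_cong') (auto simp: t entry_inc L.smult_closed)
   also have "\<dots> = (\<Oplus>\<^bsub>M\<^esub>i\<in>{i \<in> I. u (entry j n) i \<noteq> \<zero>\<^bsub>A\<^esub>}. if j = j then u (entry j n) i \<odot>\<^bsub>M\<^esub> v (unit i) else \<zero>\<^bsub>M\<^esub>)"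
    using j u_D(1)[OF entry_NN(4)[OF _ n]] unit_M coord_finite[OF nT]
    by (intro L.M.finsum_row[where h = "\<lambda>l i. if j = l then u (entry l n) i \<odot>\<^bsub>M\<^esub> v (unit i) else \<zero>\<^bsub>M\<^esub>"
      and P = "\<lambda>l i. u (entry l n) i \<noteq> \<zero>\<^bsub>A\<^esub>"]) (auto simp: L.smult_closed)
   also have "\<dots> = entry j n" using expand_M[OF entry_NN(4)[OF j n]] by simp
   finally show "entry j (\<Oplus>p\<in>?F. coord p n \<otimes> basis p) = entry j n" .
  qed
  then show "(\<Oplus>p\<in>{p \<in> {..<m} \<times> I. coord p n \<noteq> \<zero>}. coord p n \<otimes> basis p) = n"
   unfolding coord_support .
next
  fix p assume p: "p \<in> {..<m} \<times> I"
  show "basis p \<in> NN" using unit_M by (simp add: basis_def)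
  show "coord p t \<in> AA" if "t \<in> U" for t
   using p that u_D(1)[OF entry_closed[OF that]] by (auto simp: coord_def AA_elements)
next
  show "finite {p \<in> {..<m} \<times> I. coord p x \<noteq> \<zero>}" if "x \<in> U" for x
   unfolding coord_support by (rule coord_finite[OF that])
qed

sublocale crossing_prism K T E1 E2 "{..<m} \<times> I" coord basis
  using prism_T by (intro crossing_prism.intro peirce_axioms)

text \<open>Both sides reduce to one sum over \<open>I\<close> for the entry at \<open>j\<close>. On
  the left the moved element has coordinates at the place \<open>l\<close> only; on the right the
  matrix unit kills all basis elements except those at the place \<open>j\<close>.\<close>

lemma EE_S_T:
  assumes n: "n \<in> NN" and G: "\<And>a v. a \<in> AA ==> v \<in> NN ==> G a v \<in> U"
   and G0: "\<And>a. a \<in> AA ==> G a \<zero> = \<zero>" and j: "j < m" "l < m"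
  shows "P.S (inc l (entry j n)) G = P.S n (\<lambda>a v. G a (inc l (entry j v)))"
proof -
  let ?a = "\<lambda>x. (x, \<zero>\<^bsub>N\<^esub>, \<zero>\<^bsub>B\<^esub>)"
  have x: "entry k n \<in> carrier M" if "k < m" for k using entry_NN(4)[OF that n] .
  have l: "inc l (entry j n) \<in> U" using NN_closed[OF inc_NN[OF x[OF j(1)]]] .
  have zA: "u \<zero>\<^bsub>M\<^esub> i = \<zero>\<^bsub>A\<^esub>" if "i \<in> I" for i
   using u_D(1)[of "\<zero>\<^bsub>M\<^esub>" i] u_D(2)[of "\<zero>\<^bsub>M\<^esub>" "\<zero>\<^bsub>M\<^esub>" i] that by simp
  have inc0: "inc l \<zero>\<^bsub>M\<^esub> = \<zero>" for l by (simp add: inc_def col_simps T_zero)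
  have GA: "G (?a a) w \<in> U" if "a \<in> carrier A" "w \<in> NN" for a w
   using G[of "?a a" w] that by (simp add: AA_elements)
  have "P.S (inc l (entry j n)) G = (\<Oplus>p\<in>{p \<in> {..<m} \<times> I. u (entry (fst p) (inc l (entry j n))) (snd p) \<noteq> \<zero>\<^bsub>A\<^esub>}.
    G (?a (u (entry (fst p) (inc l (entry j n))) (snd p))) (inc (fst p) (v (unit (snd p)))))"
   unfolding P.S_def coord_support by (simp add: coord_def basis_def)
  also have "\<dots> = (\<Oplus>i\<in>{i \<in> I. u (entry l (inc l (entry j n))) i \<noteq> \<zero>\<^bsub>A\<^esub>}.
    G (?a (u (entry l (inc l (entry j n))) i)) (inc l (v (unit i))))"
   using j l x[OF j(1)] u_D(1) entry_closed[OF l] unit_M zA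
   by (intro M.finsum_row[where h = "\<lambda>k i. G (?a (u (entry k (inc l (entry j n))) i)) (inc k (v (unit i)))"
      and P = "\<lambda>k i. u (entry k (inc l (entry j n))) i \<noteq> \<zero>\<^bsub>A\<^esub>"] coord_finite[OF l])
    (auto simp: entry_inc simp del: T_fields intro!: GA split: if_splits)
  also have "\<dots> = (\<Oplus>i\<in>{i \<in> I. u (entry j n) i \<noteq> \<zero>\<^bsub>A\<^esub>}. G (?a (u (entry j n) i)) (inc l (entry j (inc j (v (unit i))))))"
   using j by (simp add: entry_inc)
  also have "\<dots> = (\<Oplus>p\<in>{p \<in> {..<m} \<times> I. u (entry (fst p) n) (snd p) \<noteq> \<zero>\<^bsub>A\<^esub>}.
    G (?a (u (entry (fst p) n) (snd p))) (inc l (entry j (inc (fst p) (v (unit (snd p)))))))"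
   using j x u_D(1) unit_M inc0 G0
   by (intro M.finsum_row[symmetric,
     where h = "\<lambda>k i. G (?a (u (entry k n) i)) (inc l (entry j (inc k (v (unit i)))))"
      and P = "\<lambda>k i. u (entry k n) i \<noteq> \<zero>\<^bsub>A\<^esub>"] coord_finite[OF NN_closed[OF n]])
    (auto simp: entry_inc AA_elements simp del: T_fields intro!: GA)
  also have "\<dots> = P.S n (\<lambda>a v. G a (inc l (entry j v)))"
   unfolding P.S_def coord_support by (simp add: coord_def basis_def)
  finally show ?thesis .
qed

sublocale retract K T E1 E2 "{..<m} \<times> I" coord basis \<kappa> EE
proof
  fix \<theta> assume \<theta>: "\<theta> \<in> LN"
  note b = ext_B[OF \<theta> m, of 0]
  show "\<kappa> \<theta> \<in> U" "\<beta> (\<kappa> \<theta>) = \<kappa> \<theta>" using b by (simp_all add: \<kappa>_def components)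
  show "\<kappa> \<theta> = \<kappa> \<theta>'" if "\<And>n. n \<in> NN ==> \<theta> n = \<theta>' n" for \<theta>'
   using that by (simp add: \<kappa>_def cong: restrict_cong)
  show "\<kappa> (\<lambda>n. \<theta> n \<oplus> \<theta>' n) = \<kappa> \<theta> \<oplus> \<kappa> \<theta>'" if \<theta>': "\<theta>' \<in> LN" for \<theta>'
  proof -
   have "(\<lambda>x\<in>carrier M. entry 0 (\<theta> (inc 0 x) \<oplus> \<theta>' (inc 0 x))) =
     (\<lambda>x\<in>carrier M. entry 0 (\<theta> (inc 0 x))) \<oplus>\<^bsub>B\<^esub> (\<lambda>x\<in>carrier M. entry 0 (\<theta>' (inc 0 x)))"
    using b ext_B[OF \<theta>' m, of 0] ext_B[OF LN_add[OF \<theta> \<theta>'] m, of 0] LN_D(1)[OF \<theta>] LN_D(1)[OF \<theta>'] m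
    by (intro B_eqI) (auto simp: B_fields entry_NN)
   then show ?thesis by (simp add: \<kappa>_def)
  qed
  fix t assume t: "t \<in> U"
  have tb: "snd (snd t) \<in> carrier B" using t by auto
  have \<beta>t: "\<beta> t = (\<zero>\<^bsub>A\<^esub>, \<zero>\<^bsub>N\<^esub>, snd (snd t))" using t by (auto simp: components)
  have "(\<lambda>x\<in>carrier M. entry 0 (\<theta> (inc 0 x \<otimes> t))) = snd (snd t) \<otimes>\<^bsub>B\<^esub> (\<lambda>x\<in>carrier M. entry 0 (\<theta> (inc 0 x)))"
   using b ext_B[OF LN_left[OF \<theta> t] m, of 0] tb
   by (intro B_eqI) (auto simp: B_fields B_D inc_simps(3)[OF t])
  then show "\<kappa> (\<lambda>n. \<theta> (n \<otimes> t)) = \<beta> t \<otimes> \<kappa> \<theta>"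
   using b by (simp add: \<kappa>_def \<beta>t N_zero_simps)
  have "(\<lambda>x\<in>carrier M. entry 0 (\<theta> (inc 0 x) \<otimes> t)) = (\<lambda>x\<in>carrier M. entry 0 (\<theta> (inc 0 x))) \<otimes>\<^bsub>B\<^esub> snd (snd t)"
   using b ext_B[OF LN_right[OF \<theta> t] m, of 0] tb LN_D(1)[OF \<theta>] m t
   by (intro B_eqI) (auto simp: B_fields B_D entry_NN simp del: T_fields)
  then show "\<kappa> (\<lambda>n. \<theta> n \<otimes> t) = \<kappa> \<theta> \<otimes> \<beta> t"
   using b tb by (simp add: \<kappa>_def \<beta>t N_zero_simps)
next
  have "(\<lambda>x\<in>carrier M. entry 0 (inc 0 x)) = \<one>\<^bsub>B\<^esub>"
   using ext_B[OF LN_id m, of 0] m by (intro B_eqI) (auto simp: B_fields entry_inc)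
  then show "\<kappa> (\<lambda>n. n) = E2" by (simp add: \<kappa>_def E2_def)
next
  fix \<epsilon> assume "\<epsilon> \<in> EE"
  then obtain j l where \<epsilon>: "\<epsilon> = (\<lambda>x. inc l (entry j x))" "j < m" "l < m" by (auto simp: EE_def)
  show "\<epsilon> \<in> lin"
   by (rule linear_mapsI) (use \<epsilon> in \<open>auto simp: inc_def N_fields col_simps\<close>)
  fix n assume n: "n \<in> NN"
  show "\<epsilon> n \<in> NN" using \<epsilon> n entry_NN(4) by simp
  fix t assume t: "t \<in> U"
  show "\<epsilon> (n \<otimes> t) = \<epsilon> n \<otimes> t" "\<epsilon> (t \<otimes> n) = t \<otimes> \<epsilon> n"
   using \<epsilon> n t entry_NN[OF \<epsilon>(2) n] inc_simps(2,3)[OF t entry_NN(4)[OF \<epsilon>(2) n], of l] by simp_all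
next
  fix \<epsilon> n G
  assume "\<epsilon> \<in> EE" "n \<in> NN" "\<And>a v. a \<in> AA ==> v \<in> NN ==> G a v \<in> U"
   "\<And>a. a \<in> AA ==> G a \<zero> = \<zero>"
  then show "P.S (\<epsilon> n) G = P.S n (\<lambda>a v. G a (\<epsilon> v))"
   using EE_S_T[of n G] by (auto simp: EE_def)
next
  fix \<theta> n assume \<theta>: "\<theta> \<in> LN" and c: "\<And>\<epsilon> n. \<epsilon> \<in> EE ==> n \<in> NN ==> \<theta> (\<epsilon> n) = \<epsilon> (\<theta> n)" and n: "n \<in> NN"
  note b = ext_B[OF \<theta> m, of 0]
  have kc: "\<kappa> \<theta> \<in> U" using b by (simp add: \<kappa>_def)
  show "\<theta> n = n \<otimes> \<kappa> \<theta>"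
  proof (rule NN_eqI[OF LN_D(1)[OF \<theta> n] NN_mult(2)[OF kc n]])
   fix j assume j: "j < m"
   \<comment> \<open>The entry at \<open>j\<close> is moved to the place 0, where
     \<open>\<kappa>\<close> can read it; commuting with this matrix unit determines every entry of
     \<open>\<theta> n\<close>.\<close>
   have "(\<lambda>x. inc 0 (entry j x)) \<in> EE" unfolding EE_def using j m by blast
   then have "\<theta> (inc 0 (entry j n)) = inc 0 (entry j (\<theta> n))" using c n by blast
   then have "entry 0 (\<theta> (inc 0 (entry j n))) = entry j (\<theta> n)" using m by (simp add: entry_inc)
   then show "entry j (\<theta> n) = entry j (n \<otimes> \<kappa> \<theta>)"
    using entry_NN(3)[OF j n kc] entry_NN(4)[OF j n] by (simp add: \<kappa>_def)
  qed
qed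

end

section \<open>Linearity of the projection\<close>

context retract
begin

lemma \<Psi>V_add:
  assumes "f \<in> Ch n" "g \<in> Ch n" "l \<in> tup (Suc (Suc n))"
  shows "\<Psi>V (f \<oplus>\<^bsub>C n\<^esub> g) l = \<Psi>V f l \<oplus> \<Psi>V g l"
proof -
  note F = sandwich_funcset[OF cochains_funcset[OF assms(1)]] sandwich_funcset[OF cochains_funcset[OF assms(2)]]
  have "VV.lift (sw (f \<oplus>\<^bsub>C n\<^esub> g)) l = VV.lift (\<lambda>l. sw f l \<oplus> sw g l) l"
  proof (rule VV.lift_cong[of "Suc (Suc n)"])
   show "sw (f \<oplus>\<^bsub>C n\<^esub> g) l = sw f l \<oplus> sw g l"
    if "l \<in> tup (0 + Suc (Suc n))" for l using sandwich_add[OF assms(1,2)] that by simp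
  qed (use F assms(3) in \<open>auto simp: Pi_def\<close>)
  also have "\<dots> = VV.lift (sw f) l \<oplus> VV.lift (sw g) l"
   using F assms(3) by (intro VV.lift_add) auto
  finally show ?thesis
   unfolding \<Psi>V_def using VV.lift_closed[of "sw f" "Suc (Suc n)" l] VV.lift_closed[of "sw g" "Suc (Suc n)" l] F assms(3)
   by (simp add: linear_mapsD(2)[OF \<nu>_linear])
qed

lemma \<Psi>V_smult:
  assumes "f \<in> Ch n" "k \<in> carrier K" "l \<in> tup (Suc (Suc n))"
  shows "\<Psi>V (k \<odot>\<^bsub>C n\<^esub> f) l = k \<odot> \<Psi>V f l"
proof -
  note F = sandwich_funcset[OF cochains_funcset[OF assms(1)]]
  have h: "(\<lambda>x. k \<odot> x) \<in> lin"
   using assms(2) by (intro linear_mapsI) (auto simp: smult_r_distr smult_assoc1[symmetric] R.m_comm)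
  have "VV.lift (sw (k \<odot>\<^bsub>C n\<^esub> f)) l = VV.lift (\<lambda>l. k \<odot> sw f l) l"
  proof (rule VV.lift_cong[of "Suc (Suc n)"])
   show "sw (k \<odot>\<^bsub>C n\<^esub> f) l = k \<odot> sw f l"
    if "l \<in> tup (0 + Suc (Suc n))" for l using sandwich_smult[OF assms(1,2)] that by simp
  qed (use F assms(2,3) in \<open>auto simp: Pi_def\<close>)
  also have "\<dots> = k \<odot> VV.lift (sw f) l"
   using F assms(3) h by (intro VV.lift_hom) auto
  finally show ?thesis
   unfolding \<Psi>V_def using VV.lift_closed[of "sw f" "Suc (Suc n)" l] F assms(2,3)
   by (simp add: linear_mapsD(3)[OF \<nu>_linear])
qed

lemma Qc_apply: "xs \<in> tup m ==> Qc m f xs = \<alpha> (f (map \<alpha> xs)) \<oplus>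
   \<Psi>V f (\<one> # xs @ [\<one>]) \<oplus> \<kappa> (\<lambda>n. \<Psi>V f (n # xs @ [\<one>]))"
  by (simp add: Qc_def)

lemma Qc_linear: "Qc m \<in> linear_maps K (C m) (C m)"
proof (rule linear_mapsI)
  show "Qc m f \<in> carrier (C m)" if "f \<in> carrier (C m)" for f
   using Qc_cochain[OF cochains_multilinear] that by simp
  fix f assume "f \<in> carrier (C m)"
  then have f: "f \<in> Ch m" by simp
  have LN: "(\<lambda>n. \<Psi>V f (n # xs @ [\<one>])) \<in> LN" if "f \<in> Ch m" "xs \<in> tup m" for f xs
   using assemble.\<Psi>_LN1[OF assemble_V[OF cochains_multilinear[OF that(1)]] that(2)] .
  have cl: "\<Psi>V f l \<in> U" if "f \<in> Ch m" "l \<in> tup (Suc (Suc m))" for f l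
   using that VV.lift_closed[of "sw f" "Suc (Suc m)" l] sandwich_funcset[OF cochains_funcset[OF that(1)]]
   by (simp add: \<Psi>V_def)
  have l: "n # xs @ [\<one>] \<in> tup (Suc (Suc m))" if "n \<in> U" "xs \<in> tup m" for n xs
   using that by (auto intro: tuples_snocI)
  { fix g assume "g \<in> carrier (C m)"
   then have g: "g \<in> Ch m" by simp
   let ?h = "f \<oplus>\<^bsub>C m\<^esub> g"
   have h: "?h \<in> Ch m" using add_cochain[OF f g] by simp
   have "Qc m ?h = (\<lambda>xs\<in>tup m. Qc m f xs \<oplus> Qc m g xs)"
   proof (rule cochains_eqI[OF Qc_cochain[OF cochains_multilinear[OF h]] add_cochain[OF Qc_cochain Qc_cochain]])
    fix xs assume xs: "xs \<in> tup m"
    have "\<kappa> (\<lambda>n. \<Psi>V ?h (n # xs @ [\<one>])) = \<kappa> (\<lambda>n. \<Psi>V f (n # xs @ [\<one>]) \<oplus> \<Psi>V g (n # xs @ [\<one>]))"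
     using \<Psi>V_add[OF f g l[OF NN_closed xs]] by (intro \<kappa>_cong LN[OF h xs])
    also have "\<dots> = \<kappa> (\<lambda>n. \<Psi>V f (n # xs @ [\<one>])) \<oplus> \<kappa> (\<lambda>n. \<Psi>V g (n # xs @ [\<one>]))"
     by (intro \<kappa>_add LN f g xs)
    finally have 1: "\<kappa> (\<lambda>n. \<Psi>V ?h (n # xs @ [\<one>])) = \<dots>" .
    have 2: "\<alpha> (?h (map \<alpha> xs)) = \<alpha> (f (map \<alpha> xs)) \<oplus> \<alpha> (g (map \<alpha> xs))"
     using map_\<alpha>[OF xs] cochains_closed[OF f] cochains_closed[OF g] by (simp add: linear_mapsD(2)[OF \<alpha>_linear])
    have 3: "Qc m ?h xs = \<alpha> (f (map \<alpha> xs)) \<oplus> \<alpha> (g (map \<alpha> xs)) \<oplus>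
      (\<Psi>V f (\<one> # xs @ [\<one>]) \<oplus> \<Psi>V g (\<one> # xs @ [\<one>])) \<oplus>
      (\<kappa> (\<lambda>n. \<Psi>V f (n # xs @ [\<one>])) \<oplus> \<kappa> (\<lambda>n. \<Psi>V g (n # xs @ [\<one>])))"
     unfolding Qc_apply[OF xs] 1 2 \<Psi>V_add[OF f g l[OF A.one_closed xs]] ..
    show "Qc m ?h xs = (\<lambda>xs\<in>tup m. Qc m f xs \<oplus> Qc m g xs) xs"
     unfolding 3 using xs map_\<alpha>[OF xs] cochains_closed[OF f] cochains_closed[OF g]
      cl[OF f l[OF A.one_closed xs]] cl[OF g l[OF A.one_closed xs]] \<kappa>_closed[OF LN[OF f xs]] \<kappa>_closed[OF LN[OF g xs]]
     by (simp add: Qc_def M.a_ac)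
   qed (use f g in \<open>auto intro: cochains_multilinear\<close>)
   then show "Qc m ?h = Qc m f \<oplus>\<^bsub>C m\<^esub> Qc m g" by simp
  }
  fix k assume k: "k \<in> carrier K"
  let ?h = "k \<odot>\<^bsub>C m\<^esub> f"
  have h: "?h \<in> Ch m" using smult_cochain[OF k f] by simp
  have "Qc m ?h = (\<lambda>xs\<in>tup m. k \<odot> Qc m f xs)"
  proof (rule cochains_eqI[OF Qc_cochain[OF cochains_multilinear[OF h]] smult_cochain[OF k Qc_cochain]])
   fix xs assume xs: "xs \<in> tup m"
   have "\<kappa> (\<lambda>n. \<Psi>V ?h (n # xs @ [\<one>])) = \<kappa> (\<lambda>n. k \<odot> \<Psi>V f (n # xs @ [\<one>]))"
    using \<Psi>V_smult[OF f k l[OF NN_closed xs]] by (intro \<kappa>_cong LN[OF h xs])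
   also have "\<dots> = k \<odot> \<kappa> (\<lambda>n. \<Psi>V f (n # xs @ [\<one>]))"
    by (intro \<kappa>_smult(1) LN f k xs)
   finally have 1: "\<kappa> (\<lambda>n. \<Psi>V ?h (n # xs @ [\<one>])) = \<dots>" .
   have 2: "\<alpha> (?h (map \<alpha> xs)) = k \<odot> \<alpha> (f (map \<alpha> xs))"
    using map_\<alpha>[OF xs] cochains_closed[OF f] k by (simp add: linear_mapsD(3)[OF \<alpha>_linear])
   have 3: "Qc m ?h xs = k \<odot> \<alpha> (f (map \<alpha> xs)) \<oplus> k \<odot> \<Psi>V f (\<one> # xs @ [\<one>]) \<oplus>
     k \<odot> \<kappa> (\<lambda>n. \<Psi>V f (n # xs @ [\<one>]))"
    unfolding Qc_apply[OF xs] 1 2 \<Psi>V_smult[OF f k l[OF A.one_closed xs]] ..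
   show "Qc m ?h xs = (\<lambda>xs\<in>tup m. k \<odot> Qc m f xs) xs"
    unfolding 3 using xs map_\<alpha>[OF xs] cochains_closed[OF f] k
     cl[OF f l[OF A.one_closed xs]] \<kappa>_closed[OF LN[OF f xs]]
    by (simp add: Qc_def smult_r_distr)
  qed (use f in \<open>auto intro: cochains_multilinear\<close>)
  then show "Qc m ?h = k \<odot>\<^bsub>C m\<^esub> Qc m f" by simp
qed

end

section \<open>Restriction to the first diagonal entry\<close>

context endo_projective
begin

definition diag :: "'a => ('a, 'm) matrix" where
  "diag a = (a, \<zero>\<^bsub>N\<^esub>, \<zero>\<^bsub>B\<^esub>)"

lemma diag_closed [simp]: "a \<in> carrier A ==> diag a \<in> U"
  and fst_closed [simp]: "x \<in> U ==> fst x \<in> carrier A"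
  by (auto simp: diag_def)

lemma diag_simps:
  "a \<in> carrier A ==> a' \<in> carrier A ==> diag (a \<oplus>\<^bsub>A\<^esub> a') = diag a \<oplus> diag a'"
  "a \<in> carrier A ==> a' \<in> carrier A ==> diag (a \<otimes>\<^bsub>A\<^esub> a') = diag a \<otimes> diag a'"
  "k \<in> carrier K ==> a \<in> carrier A ==> diag (k \<odot>\<^bsub>A\<^esub> a) = k \<odot> diag a"
  by (simp_all add: diag_def N_zero_simps)

lemma fst_simps:
  "x \<in> U ==> y \<in> U ==> fst (x \<oplus> y) = fst x \<oplus>\<^bsub>A\<^esub> fst y"
  "x \<in> U ==> y \<in> U ==> fst (x \<otimes> y) = fst x \<otimes>\<^bsub>A\<^esub> fst y"
  "k \<in> carrier K ==> x \<in> U ==> fst (k \<odot> x) = k \<odot>\<^bsub>A\<^esub> fst x"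
  by auto

lemma fst_diag [simp]: "fst (diag a) = a"
  by (simp add: diag_def)

lemma \<alpha>_diag: "x \<in> U ==> \<alpha> x = diag (fst x)"
  by (cases x) (simp add: components diag_def)

lemma diag_linear: "diag \<in> linear_maps K A T" and fst_linear: "fst \<in> linear_maps K T A"
  by (rule linear_mapsI; simp add: diag_simps fst_simps del: T_fields)+

lemma map_diag: "as \<in> tuples A n ==> map diag as \<in> tup n"
  by (auto simp: tuples_def simp del: T_fields)

lemma map_fst: "xs \<in> tup n ==> map fst xs \<in> tuples A n"
  by (simp add: tuples_def subset_iff del: T_fields split_paired_All) (use fst_closed in blast)

lemma map_fst_diag [simp]: "map fst (map diag as) = as"
  by (induction as) auto

sublocale TA: linear_context K T A
  by unfold_locales

sublocale AT: linear_context K A T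
  by unfold_locales

definition res :: "nat => ((('a, 'm) matrix) list => ('a, 'm) matrix) => 'a list => 'a" where
  "res n f = (\<lambda>as\<in>tuples A n. fst (f (map diag as)))"

text \<open>Extension by zero. It is in general not compatible with \<delta>, because a right factor
  from the off-diagonal ideal acts nontrivially on the values; the projection \<open>Qc\<close>
  repairs this.\<close>

definition pad :: "nat => ('a list => 'a) => (('a, 'm) matrix) list => ('a, 'm) matrix" where
  "pad n g = (\<lambda>xs\<in>tup n. diag (g (map fst xs)))"

lemma res_cochain: "f \<in> Ch n ==> res n f \<in> cochains K A n"
  unfolding res_def
  by (rule A.restrict_cochains[OF TA.multilinear_map[OF diag_linear Lin.multilinear_hom[OF fst_linear cochains_multilinear]]])

lemma pad_cochain: "g \<in> cochains K A n ==> pad n g \<in> Ch n"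
  unfolding pad_def
  by (rule restrict_cochains[OF AT.multilinear_map[OF fst_linear A.Lin.multilinear_hom[OF diag_linear A.cochains_multilinear]]])

lemma res_pad:
  assumes "g \<in> cochains K A n"
  shows "res n (pad n g) = g"
proof (rule A.cochains_eqI[OF res_cochain[OF pad_cochain[OF assms]] assms])
  show "res n (pad n g) as = g as" if "as \<in> tuples A n" for as
   using that map_diag[OF that] by (simp add: res_def pad_def del: map_map)
qed

lemma fst_d:
  assumes f: "f \<in> Ch n" and as: "as \<in> tuples A (Suc n)"
  shows "fst (\<delta> n f (map diag as)) = hochschild_d A n (res n f) as"
proof -
  note fc = cochains_funcset[OF f] and rc = A.cochains_funcset[OF res_cochain[OF f]]
  let ?l = "\<one>\<^bsub>A\<^esub> # as @ [\<one>\<^bsub>A\<^esub>]"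
  have l: "?l \<in> tuples A (Suc (Suc (Suc n)))" using as by (auto intro: tuples_snocI)
  have dc: "\<delta> n f (map diag as) \<in> U"
   using cochains_closed[OF d_cochains[OF f] map_diag[OF as]] .
  have E: "diag \<one>\<^bsub>A\<^esub> \<in> U" by (rule diag_closed[OF A.A.one_closed])
  have "hochschild_d A n (res n f) as = bar A A (sandwich A (res n f)) ?l"
   by (rule A.d_apply[OF rc as])
  also have "\<dots> = bar A A (\<lambda>l. fst (sw f (map diag l))) ?l"
  proof (rule A.Bar.bar_cong[OF _ l])
   fix l assume "l \<in> tuples A (Suc (Suc n))"
   then obtain y us z where l: "l = y # us @ [z]" "y \<in> carrier A" "us \<in> tuples A n" "z \<in> carrier A"
    by (subst (asm) in_tuples_Suc_Suc) auto
   have "f (map diag us) \<in> U" using cochains_closed[OF f map_diag[OF l(3)]] .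
   then show "sandwich A (res n f) l = fst (sw f (map diag l))"
    using l by (simp add: res_def fst_simps del: T_fields)
  qed
  also have "\<dots> = fst (bar A T (\<lambda>l. sw f (map diag l)) ?l)"
  proof (rule bar_context.bar_hom)
   show "bar_context A T" by unfold_locales
   show "(\<lambda>l. sw f (map diag l)) \<in> tuples A (Suc (Suc n)) \<rightarrow> U"
    using sandwich_funcset[OF fc] map_diag by (auto simp: Pi_def simp del: T_fields)
  qed (use l A.M.abelian_group_axioms fst_simps(1) in \<open>auto simp del: T_fields\<close>)
  also have "bar A T (\<lambda>l. sw f (map diag l)) ?l = br (sw f) (map diag ?l)"
   by (rule bar_map[symmetric, OF _ l]) (rule diag_simps(2))
  also have "\<dots> = diag \<one>\<^bsub>A\<^esub> \<otimes> \<delta> n f (map diag as) \<otimes> diag \<one>\<^bsub>A\<^esub>"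
   using bar_sandwich[OF fc map_diag[OF as] E E] by simp
  finally show ?thesis using dc E by (simp add: fst_simps del: T_fields)
qed

lemma d_res:
  assumes "f \<in> Ch n"
  shows "hochschild_d A n (res n f) = res (Suc n) (\<delta> n f)"
proof (rule A.cochains_eqI[OF A.d_cochains[OF res_cochain[OF assms]] res_cochain[OF d_cochains[OF assms]]])
  show "hochschild_d A n (res n f) as = res (Suc n) (\<delta> n f) as" if "as \<in> tuples A (Suc n)" for as
   using that fst_d[OF assms that, symmetric] by (simp only: res_def[of "Suc n"] restrict_apply' simp_thms)
qed

lemma res_linear: "res n \<in> linear_maps K (C n) (cochain_module K A n)"
proof (rule linear_mapsI)
  fix f assume "f \<in> carrier (C n)"
  then have f: "f \<in> Ch n" by simp
  show "res n f \<in> carrier (cochain_module K A n)" using res_cochain[OF f] by simp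
  show "res n (f \<oplus>\<^bsub>C n\<^esub> g) = res n f \<oplus>\<^bsub>cochain_module K A n\<^esub> res n g"
   if "g \<in> carrier (C n)" for g
   using f that map_diag cochains_closed by (auto simp: res_def fst_simps fun_eq_iff simp del: T_fields)
  show "res n (k \<odot>\<^bsub>C n\<^esub> f) = k \<odot>\<^bsub>cochain_module K A n\<^esub> res n f" if "k \<in> carrier K" for k
   using f that map_diag cochains_closed by (auto simp: res_def fst_simps fun_eq_iff simp del: T_fields)
qed

lemma res_cup:
  assumes "f \<in> Ch p" "g \<in> Ch q"
  shows "res (p + q) (cochain_cup T p q f g) = cochain_cup A p q (res p f) (res q g)"
proof (rule A.cochains_eqI[OF res_cochain[OF cup_cochains[OF assms]] A.cup_cochains[OF assms[THEN res_cochain]]])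
  fix as assume "as \<in> tuples A (p + q)"
  then obtain us vs where as: "as = us @ vs" "us \<in> tuples A p" "vs \<in> tuples A q"
   using A.tuples_split by blast
  have "us @ vs \<in> tuples A (p + q)" using as by (intro tuples_appendI)
  then show "res (p + q) (cochain_cup T p q f g) as = cochain_cup A p q (res p f) (res q g) as"
   using as cup_apply[OF map_diag[OF as(2)] map_diag[OF as(3)], of f g] A.cup_apply[OF as(2,3), of "res p f" "res q g"]
    cochains_closed[OF assms(1) map_diag[OF as(2)]] cochains_closed[OF assms(2) map_diag[OF as(3)]]
   by (simp add: res_def fst_simps del: T_fields)
qed

definition sec :: "nat => ('a list => 'a) => (('a, 'm) matrix) list => ('a, 'm) matrix" where
  "sec n g = Qc n (pad n g)"

lemma sec_cochain: "g \<in> cochains K A n ==> sec n g \<in> Ch n"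
  unfolding sec_def by (intro Qc_cochain cochains_multilinear pad_cochain)

lemma \<alpha>_cochain:
  assumes "f \<in> Ch n" "xs \<in> tup n"
  shows "\<alpha> (f (map \<alpha> xs)) = diag (res n f (map fst xs))"
proof -
  have "map \<alpha> xs = map diag (map fst xs)"
   using assms(2) \<alpha>_diag by (auto simp: tuples_def simp del: T_fields)
  then show ?thesis
   using \<alpha>_diag[OF cochains_closed[OF assms(1) map_diag[OF map_fst[OF assms(2)]]]] map_fst[OF assms(2)]
   by (simp add: res_def del: map_map T_fields)
qed

text \<open>\<open>Qc\<close> depends only on the restriction to \<open>A\<close>, so replacing
  \<open>f\<close> by the extension by zero of its restriction has no effect.\<close>

lemma sec_res: 
  assumes "f \<in> Ch n"
  shows "sec n (res n f) = Qc n f"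
  unfolding sec_def
proof (rule Qc_cong)
  fix xs assume "xs \<in> tup n"
  then show "\<alpha> (pad n (res n f) (map \<alpha> xs)) = \<alpha> (f (map \<alpha> xs))"
   using \<alpha>_cochain[OF assms, of xs] \<alpha>_cochain[OF pad_cochain[OF res_cochain[OF assms]], of xs]
   by (simp add: res_pad[OF res_cochain[OF assms]])
qed (use assms in \<open>auto intro: cochains_multilinear pad_cochain res_cochain\<close>)

lemma res_sec: 
  assumes g: "g \<in> cochains K A n"
  shows "res n (sec n g) = g"
proof (rule A.cochains_eqI[OF res_cochain[OF sec_cochain[OF g]] g])
  fix as assume as: "as \<in> tuples A n"
  note p = pad_cochain[OF g]
  have q: "Qc n (pad n g) (map diag as) \<in> U"
   using cochains_closed[OF Qc_cochain[OF cochains_multilinear[OF p]] map_diag[OF as]] .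
  have "diag (fst (Qc n (pad n g) (map diag as))) = \<alpha> (pad n g (map \<alpha> (map diag as)))"
   using Qc_components(1)[OF cochains_multilinear[OF p] map_diag[OF as]] \<alpha>_diag[OF q] by simp
  also have "\<dots> = diag (g as)"
   using \<alpha>_cochain[OF p map_diag[OF as]] res_pad[OF g] by (simp del: map_map)
  finally have "fst (Qc n (pad n g) (map diag as)) = g as" by (simp add: diag_def)
  then show "res n (sec n g) as = g as" using as by (simp add: res_def sec_def)
qed

text \<open>\<open>Qc\<close> commutes with \<delta>, so both sides are \<open>Qc\<close> of
  cochains that have the same restriction to \<open>A\<close>.\<close>

lemma d_sec:
  assumes g: "g \<in> cochains K A n"
  shows "\<delta> n (sec n g) = sec (Suc n) (hochschild_d A n g)"
proof -
  note p = pad_cochain[OF g]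
  have "\<delta> n (sec n g) = Qc (Suc n) (\<delta> n (pad n g))"
   unfolding sec_def by (rule d_Qc[OF p])
  also have "\<dots> = sec (Suc n) (res (Suc n) (\<delta> n (pad n g)))"
   by (rule sec_res[OF d_cochains[OF p], symmetric])
  also have "res (Suc n) (\<delta> n (pad n g)) = hochschild_d A n g"
   using d_res[OF p] res_pad[OF g] by simp
  finally show ?thesis .
qed

lemma sec_linear: "sec n \<in> linear_maps K (cochain_module K A n) (C n)"
proof -
  have "pad n \<in> linear_maps K (cochain_module K A n) (C n)"
  proof (rule linear_mapsI)
   fix f assume "f \<in> carrier (cochain_module K A n)"
   then have f: "f \<in> cochains K A n" by simp
   show "pad n f \<in> carrier (C n)" using pad_cochain[OF f] by simp
   show "pad n (f \<oplus>\<^bsub>cochain_module K A n\<^esub> g) = pad n f \<oplus>\<^bsub>C n\<^esub> pad n g"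
    if "g \<in> carrier (cochain_module K A n)" for g
    using f that map_fst A.cochains_closed by (auto simp: pad_def diag_simps fun_eq_iff simp del: T_fields)
   show "pad n (k \<odot>\<^bsub>cochain_module K A n\<^esub> f) = k \<odot>\<^bsub>C n\<^esub> pad n f" if "k \<in> carrier K" for k
    using f that map_fst A.cochains_closed by (auto simp: pad_def diag_simps fun_eq_iff simp del: T_fields)
  qed
  from linear_mapsD[OF this] linear_mapsD[OF Qc_linear] show ?thesis
   unfolding sec_def[abs_def] by (intro linear_mapsI) auto
qed

end

lemma (in bar_context) bar_finsum:
  assumes "finite I" "\<And>i. i \<in> I ==> H i \<in> tuples S n \<rightarrow> carrier G" "l \<in> tuples S (Suc n)"
  shows "bar S G (\<lambda>l. \<Oplus>\<^bsub>G\<^esub>i\<in>I. H i l) l = (\<Oplus>\<^bsub>G\<^esub>i\<in>I. bar S G (H i) l)"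
  using assms(1,2)
proof (induction I rule: finite_induct)
  case (insert i I)
  have "bar S G (\<lambda>l. \<Oplus>\<^bsub>G\<^esub>i\<in>insert i I. H i l) l = bar S G (\<lambda>l. H i l \<oplus>\<^bsub>G\<^esub> (\<Oplus>\<^bsub>G\<^esub>i\<in>I. H i l)) l"
   using insert by (intro bar_cong[OF _ assms(3)] G.finsum_insert) (auto simp: Pi_def)
  also have "\<dots> = bar S G (H i) l \<oplus>\<^bsub>G\<^esub> bar S G (\<lambda>l. \<Oplus>\<^bsub>G\<^esub>i\<in>I. H i l) l"
   using insert by (intro bar_add[OF _ _ assms(3)]) (auto simp: Pi_def)
  also have "\<dots> = (\<Oplus>\<^bsub>G\<^esub>i\<in>insert i I. bar S G (H i) l)"
   using insert assms(3) by (subst G.finsum_insert) (auto intro!: bar_closed[of _ n])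
  finally show ?case .
qed simp

context peirce
begin

lemma LN_finsum:
  assumes "finite I" "\<And>i. i \<in> I ==> \<theta> i \<in> LN"
  shows "(\<lambda>n. \<Oplus>i\<in>I. \<theta> i n) \<in> LN"
  using assms
proof (induction I rule: finite_induct)
  case (insert i I)
  have "(\<lambda>n. \<theta> i n \<oplus> (\<Oplus>i\<in>I. \<theta> i n)) \<in> LN" using insert by (intro LN_add) auto
  then show ?case
  proof (rule LN_cong)
   fix n assume "n \<in> NN"
   then show "\<theta> i n \<oplus> (\<Oplus>i\<in>I. \<theta> i n) = (\<Oplus>i\<in>insert i I. \<theta> i n)"
    using insert.hyps NN_closed[OF LN_D(1)[OF insert.prems]] by (intro M.finsum_insert[symmetric]) auto
  qed
qed (simp add: LN_zero)

lemma LN_hom_finsum: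
  assumes "\<theta> \<in> LN" "finite I" "\<And>i. i \<in> I ==> f i \<in> NN"
  shows "(\<Oplus>i\<in>I. f i) \<in> NN \<and> \<theta> (\<Oplus>i\<in>I. f i) = (\<Oplus>i\<in>I. \<theta> (f i))"
  using assms(2,3)
proof (induction I rule: finite_induct)
  case empty
  have "\<theta> \<zero> = \<zero>"
   using LN_D(3)[OF assms(1), of "\<zero>" "\<zero>"] LN_D(1)[OF assms(1), of "\<zero>"] NN_zero by simp
  then show ?case by (simp add: NN_zero)
next
  case (insert i I)
  then show ?case
   using LN_D(1,2)[OF assms(1)] NN_closed NN_add
   by (subst (1 2 3) M.finsum_insert) auto
qed

lemma LN_linear:
  assumes "\<theta> \<in> LN"
  shows "(\<lambda>x. \<theta> (\<nu> x)) \<in> lin"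
proof (rule linear_mapsI)
  fix x assume x: "x \<in> U"
  show "\<theta> (\<nu> x) \<in> U" using LN_D(1)[OF assms] x NN_closed by simp
  show "\<theta> (\<nu> (x \<oplus> y)) = \<theta> (\<nu> x) \<oplus> \<theta> (\<nu> y)" if "y \<in> U" for y
   using x that LN_D(2)[OF assms] by (simp add: linear_mapsD(2)[OF \<nu>_linear])
  fix k assume k: "k \<in> carrier K"
  have "\<nu> (k \<odot> x) = (k \<odot> \<one>) \<otimes> \<nu> x"
   using x k by (simp add: linear_mapsD(3)[OF \<nu>_linear] smult_mult_left)
  then show "\<theta> (\<nu> (k \<odot> x)) = k \<odot> \<theta> (\<nu> x)"
   using LN_D(3)[OF assms, of "k \<odot> \<one>" "\<nu> x"] LN_D(1)[OF assms] x k NN_closed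
   by (simp add: smult_mult_left)
qed

end

section \<open>Cochains with values in the off-diagonal ideal\<close>

context endo_projective
begin

text \<open>The pairs \<open>(src t, tgt t)\<close> with \<open>t < m\<^sup>2 - 1\<close> are the positions of an \<open>m \<times> m\<close> matrix other than
  \<open>(0, 0)\<close>.\<close>

definition src :: "nat => nat" where "src t = Suc t div m"
definition tgt :: "nat => nat" where "tgt t = Suc t mod m"

lemma src_tgt:
  assumes "t < m\<^sup>2 - 1"
  shows "src t < m" "tgt t < m" "src t * m + tgt t = Suc t"
  using assms m by (auto simp: src_def tgt_def power2_eq_square less_mult_imp_div_less)

lemma src_tgt_eq: "src t = src t' ==> tgt t = tgt t' ==> t = t'"
  unfolding src_def tgt_def by (metis div_mult_mod_eq nat.inject)

lemma not_src_tgt_0: "src t = 0 ==> tgt t \<noteq> 0"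
  using m by (simp add: src_def tgt_def div_eq_0_iff)

definition bet :: "('a, 'm) matrix => 'm => 'm" where "bet x = snd (snd x)"
definition ib :: "('m => 'm) => ('a, 'm) matrix" where "ib b = (\<zero>\<^bsub>A\<^esub>, \<zero>\<^bsub>N\<^esub>, b)"

lemma bet_simps:
  "x \<in> U ==> bet x \<in> carrier B"
  "x \<in> U ==> y \<in> U ==> bet (x \<oplus> y) = bet x \<oplus>\<^bsub>B\<^esub> bet y"
  "x \<in> U ==> y \<in> U ==> bet (x \<otimes> y) = bet x \<otimes>\<^bsub>B\<^esub> bet y"
  "k \<in> carrier K ==> x \<in> U ==> bet (k \<odot> x) = k \<odot>\<^bsub>B\<^esub> bet x"
  "bet \<one> = \<one>\<^bsub>B\<^esub>"
  by (auto simp: bet_def T_one)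

lemma bet_ib [simp]: "bet (ib b) = b"
  by (simp add: bet_def ib_def)

lemma ib_bet: "x \<in> U ==> \<beta> x = ib (bet x)"
  by (cases x) (simp add: components ib_def bet_def)

lemma ib_simps:
  "b \<in> carrier B ==> ib b \<in> U"
  "b \<in> carrier B ==> b' \<in> carrier B ==> ib (b \<oplus>\<^bsub>B\<^esub> b') = ib b \<oplus> ib b'"
  "k \<in> carrier K ==> b \<in> carrier B ==> ib (k \<odot>\<^bsub>B\<^esub> b) = k \<odot> ib b"
  by (simp_all add: ib_def N_zero_simps)

lemma bet_linear: "bet \<in> linear_maps K T B"
  by (rule linear_mapsI; simp add: bet_simps del: T_fields)

lemma map_bet: "xs \<in> tup n ==> map bet xs \<in> tuples B n"
  by (simp add: tuples_def subset_iff del: T_fields split_paired_All) (use bet_simps(1) in blast)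

lemma map_ib: "bs \<in> tuples B n ==> map ib bs \<in> tup n"
  using ib_simps(1) by (auto simp: tuples_def simp del: T_fields)

lemma map_bet_ib [simp]: "map bet (map ib bs) = bs"
  by (induction bs) auto

lemma map_bet_\<beta>: "xs \<in> tup n ==> map bet (map \<beta> xs) = map bet xs"
  using ib_bet by (auto simp: tuples_def simp del: T_fields)

lemma map_\<beta>_bet: "xs \<in> tup n ==> map ib (map bet xs) = map \<beta> xs"
  using ib_bet by (auto simp: tuples_def simp del: T_fields)

lemma term_LN: "b \<in> carrier B ==> j < m ==> (\<lambda>n. inc k (b (entry j n))) \<in> LN"
  by (intro LN_I) (auto simp: entry_NN B_D inc_simps simp del: T_fields)

text \<open>The action on \<open>n\<close> of the matrix that has the entries \<open>g t\<close> at
  the chosen positions and zero at \<open>(0, 0)\<close>.\<close>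

definition \<Theta> :: "(nat => ('m => 'm) list => 'm => 'm) => ('a, 'm) matrix =>
   (('a, 'm) matrix) list => ('a, 'm) matrix" where
  "\<Theta> g n xs = (\<Oplus>t\<in>{..<m\<^sup>2 - 1}. inc (tgt t) (g t (map bet xs) (entry (src t) n)))"

definition families :: "nat => (nat => ('m => 'm) list => 'm => 'm) set" where
  "families p = {g. \<forall>t<m\<^sup>2 - 1. g t \<in> cochains K B p}"

lemma families_D: "g \<in> families p ==> t < m\<^sup>2 - 1 ==> xs \<in> tup p ==> g t (map bet xs) \<in> carrier B"
  using B.cochains_closed map_bet by (auto simp: families_def)

lemma \<Theta>_LN: "g \<in> families p ==> xs \<in> tup p ==> (\<lambda>n. \<Theta> g n xs) \<in> LN"
  unfolding \<Theta>_def using families_D src_tgt(1) by (intro LN_finsum term_LN) auto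

lemma entry_\<Theta>:
  assumes g: "g \<in> families p" and xs: "xs \<in> tup p" and n: "n \<in> NN" and k: "k < m"
  shows "entry k (\<Theta> g n xs) = (\<Oplus>\<^bsub>M\<^esub>t\<in>{..<m\<^sup>2 - 1}. if k = tgt t then g t (map bet xs) (entry (src t) n) else \<zero>\<^bsub>M\<^esub>)"
proof -
  have c: "g t (map bet xs) (entry (src t) n) \<in> carrier M" if "t < m\<^sup>2 - 1" for t
   using B_D(1)[OF families_D[OF g that xs]] entry_NN(4)[OF src_tgt(1)[OF that] n] by simp
  have "entry k (\<Theta> g n xs) = (\<Oplus>\<^bsub>M\<^esub>t\<in>{..<m\<^sup>2 - 1}. entry k (inc (tgt t) (g t (map bet xs) (entry (src t) n))))"
   unfolding \<Theta>_def using c by (intro abelian_group_hom.hom_finsum[OF entry_hom[OF k]] Pi_I NN_closed inc_NN) auto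
  then show ?thesis using k by (simp add: entry_inc)
qed

definition comp :: "nat => nat => (('a, 'm) matrix => ('a, 'm) matrix) => 'm => 'm" where
  "comp j l \<theta> = (\<lambda>x\<in>carrier M. entry l (\<theta> (inc j x)))"

lemma comp_\<Theta>:
  assumes g: "g \<in> families p" and xs: "xs \<in> tup p" and t: "t < m\<^sup>2 - 1"
  shows "comp (src t) (tgt t) (\<lambda>n. \<Theta> g n xs) = g t (map bet xs)"
proof (rule B_eqI)
  show "comp (src t) (tgt t) (\<lambda>n. \<Theta> g n xs) \<in> carrier B"
   unfolding comp_def by (rule ext_B[OF \<Theta>_LN[OF g xs] src_tgt(2)[OF t]])
  show "g t (map bet xs) \<in> carrier B" by (rule families_D[OF g t xs])
  fix x assume x: "x \<in> carrier M"
  have "entry (tgt t) (\<Theta> g (inc (src t) x) xs) = (\<Oplus>\<^bsub>M\<^esub>t'\<in>{..<m\<^sup>2 - 1}. if t = t' then g t' (map bet xs) x else \<zero>\<^bsub>M\<^esub>)"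
   unfolding entry_\<Theta>[OF g xs inc_NN[OF x] src_tgt(2)[OF t]]
   using src_tgt(1) B_D(1)[OF families_D[OF g _ xs]] x src_tgt_eq B_zero_arg[OF families_D[OF g _ xs]]
   by (intro L.M.finsum_cong') (auto simp: entry_inc)
  also have "\<dots> = g t (map bet xs) x"
   using t B_D(1)[OF families_D[OF g _ xs]] x by (intro L.M.add.finprod_singleton) auto
  finally show "comp (src t) (tgt t) (\<lambda>n. \<Theta> g n xs) x = g t (map bet xs) x" using x by (simp add: comp_def)
qed

text \<open>\<open>\<kappa>\<close> reads the position \<open>(0, 0)\<close>, which is not of the
  form \<open>(src t, tgt t)\<close>.\<close>

lemma \<kappa>_\<Theta>:
  assumes g: "g \<in> families p" and xs: "xs \<in> tup p"
  shows "\<kappa> (\<lambda>n. \<Theta> g n xs) = \<zero>"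
proof -
  have "(\<lambda>x\<in>carrier M. entry 0 (\<Theta> g (inc 0 x) xs)) = \<zero>\<^bsub>B\<^esub>"
  proof (rule B_eqI[OF ext_B[OF \<Theta>_LN[OF g xs] m] B_one_zero(2)])
   fix x assume x: "x \<in> carrier M"
   have "entry 0 (\<Theta> g (inc 0 x) xs) = (\<Oplus>\<^bsub>M\<^esub>t'\<in>{..<m\<^sup>2 - 1}. \<zero>\<^bsub>M\<^esub>)"
    unfolding entry_\<Theta>[OF g xs inc_NN[OF x] m]
    using src_tgt(1) x B_zero_arg[OF families_D[OF g _ xs]]
    by (intro L.M.finsum_cong') (auto simp: entry_inc dest: not_src_tgt_0)
   then show "(\<lambda>x\<in>carrier M. entry 0 (\<Theta> g (inc 0 x) xs)) x = \<zero>\<^bsub>B\<^esub> x" using x by (simp add: B_fields)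
  qed
  then show ?thesis by (simp add: \<kappa>_def T_zero)
qed

text \<open>For a fixed target \<open>k\<close> the sources run through all places, except that
  \<open>(0, 0)\<close> is missing when \<open>k = 0\<close>; there \<open>h\<close> is assumed to
  vanish.\<close>

lemma finsum_src_tgt:
  assumes "k < m" "\<And>j. j < m ==> h j \<in> carrier M" "k = 0 ==> h 0 = \<zero>\<^bsub>M\<^esub>"
  shows "(\<Oplus>\<^bsub>M\<^esub>t\<in>{..<m\<^sup>2 - 1}. if k = tgt t then h (src t) else \<zero>\<^bsub>M\<^esub>) = (\<Oplus>\<^bsub>M\<^esub>j\<in>{..<m}. h j)"
proof -
  \<comment> \<open>The position \<open>(j, k)\<close> has number \<open>j * m + k\<close>, and its
    index \<open>t\<close> is one less because the numbering skips \<open>(0, 0)\<close>; so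
    \<open>(0, 0)\<close> must be excluded before subtracting.\<close>
  let ?J = "{j. j < m \<and> 0 < j * m + k}"
  have st: "src (j * m + k - 1) = j" "tgt (j * m + k - 1) = k" if "j \<in> ?J" for j
   using that assms(1) by (simp_all add: src_def tgt_def)
  have lt: "j * m + k - 1 < m\<^sup>2 - 1" if "j \<in> ?J" for j
  proof -
   have "Suc j * m \<le> m * m" using that by (intro mult_le_mono1) simp
   then have "j * m + k < m * m" using assms(1) by simp
   moreover have "0 < j * m + k" using that by blast
   ultimately show ?thesis unfolding power2_eq_square by linarith
  qed
  have "(\<Oplus>\<^bsub>M\<^esub>t\<in>{..<m\<^sup>2 - 1}. if k = tgt t then h (src t) else \<zero>\<^bsub>M\<^esub>) =
    (\<Oplus>\<^bsub>M\<^esub>t\<in>(\<lambda>j. j * m + k - 1) ` ?J. if k = tgt t then h (src t) else \<zero>\<^bsub>M\<^esub>)"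
  proof (rule L.M.add.finprod_mono_neutral_cong_right)
   fix t assume t: "t \<in> {..<m\<^sup>2 - 1} - (\<lambda>j. j * m + k - 1) ` ?J"
   have "k \<noteq> tgt t"
   proof
    assume "k = tgt t"
    then have "t = src t * m + k - 1" "src t \<in> ?J" using src_tgt[of t] t by auto
    then show False using t by blast
   qed
   then show "(if k = tgt t then h (src t) else \<zero>\<^bsub>M\<^esub>) = \<zero>\<^bsub>M\<^esub>" by simp
  qed (use lt src_tgt assms in auto)
  also have "\<dots> = (\<Oplus>\<^bsub>M\<^esub>j\<in>?J. if k = tgt (j * m + k - 1) then h (src (j * m + k - 1)) else \<zero>\<^bsub>M\<^esub>)"
  proof (rule L.M.add.finprod_reindex)
   show "inj_on (\<lambda>j. j * m + k - 1) ?J" using st(1) by (rule inj_on_inverseI)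
  qed (use src_tgt lt assms(2) st in auto)
  also have "\<dots> = (\<Oplus>\<^bsub>M\<^esub>j\<in>{..<m}. h j)"
   using assms st m by (intro L.M.add.finprod_mono_neutral_cong_left) auto
  finally show ?thesis .
qed

text \<open>An endomorphism is determined by its matrix entries, and
  \<open>\<kappa> \<theta> = 0\<close> says that the one at \<open>(0, 0)\<close> is zero; the other
  \<open>m^2 - 1\<close> therefore recover it.\<close>

lemma \<Theta>_expand:
  assumes \<theta>: "\<theta> \<in> LN" and \<kappa>0: "\<kappa> \<theta> = \<zero>" and n: "n \<in> NN"
   and g: "g \<in> families p" "\<And>t. t < m\<^sup>2 - 1 ==> g t (map bet xs) = comp (src t) (tgt t) \<theta>" and xs: "xs \<in> tup p"
  shows "\<Theta> g n xs = \<theta> n"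
proof (rule NN_eqI)
  show "\<Theta> g n xs \<in> NN" using LN_D(1)[OF \<Theta>_LN[OF g(1) xs] n] .
  show "\<theta> n \<in> NN" using LN_D(1)[OF \<theta> n] .
  fix k assume k: "k < m"
  have e: "entry j n \<in> carrier M" if "j < m" for j using entry_NN(4)[OF that n] .
  have z: "entry 0 (\<theta> (inc 0 x)) = \<zero>\<^bsub>M\<^esub>" if "x \<in> carrier M" for x
  proof -
   have "(\<lambda>x\<in>carrier M. entry 0 (\<theta> (inc 0 x))) = \<zero>\<^bsub>B\<^esub>" using \<kappa>0 by (simp add: \<kappa>_def T_zero)
   from fun_cong[OF this, of x] show ?thesis using that by (simp add: B_fields)
  qed
  have s: "(\<Oplus>j\<in>{..<m}. inc j (entry j n)) \<in> NN \<and> \<theta> (\<Oplus>j\<in>{..<m}. inc j (entry j n)) = (\<Oplus>j\<in>{..<m}. \<theta> (inc j (entry j n)))"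
   using e by (intro LN_hom_finsum \<theta>) auto
  have "(\<Oplus>j\<in>{..<m}. inc j (entry j n)) = n"
  proof (rule NN_eqI[OF _ n])
   fix l assume l: "l < m"
   have "entry l (\<Oplus>j\<in>{..<m}. inc j (entry j n)) = (\<Oplus>\<^bsub>M\<^esub>j\<in>{..<m}. entry l (inc j (entry j n)))"
    using e by (intro abelian_group_hom.hom_finsum[OF entry_hom[OF l]] Pi_I NN_closed inc_NN) auto
   also have "\<dots> = (\<Oplus>\<^bsub>M\<^esub>j\<in>{..<m}. if l = j then entry j n else \<zero>\<^bsub>M\<^esub>)" using l by (simp add: entry_inc)
   also have "\<dots> = entry l n" using l e by (intro L.M.add.finprod_singleton) auto
   finally show "entry l (\<Oplus>j\<in>{..<m}. inc j (entry j n)) = entry l n" .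
  qed (use s in blast)
  then have "\<theta> n = (\<Oplus>j\<in>{..<m}. \<theta> (inc j (entry j n)))" using s by simp
  then have "entry k (\<theta> n) = (\<Oplus>\<^bsub>M\<^esub>j\<in>{..<m}. entry k (\<theta> (inc j (entry j n))))"
   using abelian_group_hom.hom_finsum[OF entry_hom[OF k], of "\<lambda>j. \<theta> (inc j (entry j n))" "{..<m}"]
    NN_closed[OF LN_D(1)[OF \<theta> inc_NN]] e by (auto simp: Pi_def)
  also have "\<dots> = (\<Oplus>\<^bsub>M\<^esub>t\<in>{..<m\<^sup>2 - 1}. if k = tgt t then entry k (\<theta> (inc (src t) (entry (src t) n))) else \<zero>\<^bsub>M\<^esub>)"
   using z e k entry_NN(4)[OF k LN_D(1)[OF \<theta> inc_NN]] by (intro finsum_src_tgt[symmetric]) auto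
  also have "\<dots> = entry k (\<Theta> g n xs)"
   unfolding entry_\<Theta>[OF g(1) xs n k]
   using g(2) e src_tgt(1) entry_NN(4)[OF k LN_D(1)[OF \<theta> inc_NN]] k B_D(1)[OF families_D[OF g(1) _ xs]]
   by (intro L.M.finsum_cong') (auto simp: comp_def)
  finally show "entry k (\<Theta> g n xs) = entry k (\<theta> n)" by simp
qed

definition inj :: "nat => (nat => ('m => 'm) list => 'm => 'm) => (('a, 'm) matrix) list => ('a, 'm) matrix" where
  "inj p g = from_N p (\<Theta> g)"

sublocale BT: linear_context K B T
  by unfold_locales

lemma inj_cochain:
  assumes g: "g \<in> families p"
  shows "inj p g \<in> Ch (Suc p)"
  unfolding inj_def from_N_def \<Theta>_def
proof (rule restrict_cochains[OF Lin.multilinear_finsum])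
  fix t assume "t \<in> {..<m\<^sup>2 - 1}"
  then have t: "t < m\<^sup>2 - 1" by simp
  have gt: "g t \<in> cochains K B p" using g t by (simp add: families_def)
  show "mlin (Suc p) (\<lambda>xs. inc (tgt t) (g t (map bet (tl xs)) (entry (src t) (\<nu> (hd xs)))))"
   unfolding multilinear.simps list.sel
  proof (intro conjI ballI)
   fix y assume y: "y \<in> U"
   let ?x = "entry (src t) (\<nu> y)"
   have x: "?x \<in> carrier M" using entry_closed[OF \<nu>_closed[OF y] src_tgt(1)[OF t]] .
   have "(\<lambda>b. inc (tgt t) (b ?x)) \<in> linear_maps K B T"
    by (rule linear_mapsI) (use x in \<open>auto simp: B_D B_fields inc_def col_simps N_zero_simps\<close>)
   then show "mlin p (\<lambda>l. inc (tgt t) (g t (map bet l) ?x))"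
    by (rule BT.multilinear_map[OF bet_linear B.Lin.multilinear_hom[OF _ B.cochains_multilinear[OF gt]]])
  next
   fix l assume l: "l \<in> tup p"
   show "(\<lambda>x. inc (tgt t) (g t (map bet l) (entry (src t) (\<nu> x)))) \<in> lin"
    by (rule LN_linear[OF term_LN[OF families_D[OF g t l] src_tgt(1)[OF t]]])
  qed
qed

text \<open>The leading entry \<open>n\<close> plays the part of the left border: the entry of
  \<open>n y\<close> is \<open>bet y\<close> applied to the entry of \<open>n\<close>, which is left
  multiplication by \<open>bet y\<close> in \<open>B\<close>. So \<open>bar\<close> yields the
  Hochschild differential of \<open>B\<close>, evaluated at the entry of \<open>n\<close>.\<close>

lemma bar_term:
  fixes j k :: nat and g
  defines "H \<equiv> \<lambda>l. inc k (g (map bet (butlast (tl l))) (entry j (hd l))) \<otimes> last l"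
  assumes g: "g \<in> cochains K B p" and j: "j < m" and n: "n \<in> NN" and xs: "xs \<in> tup (Suc p)"
  shows "H \<in> tup (Suc (Suc p)) \<rightarrow> U"
   and "br H (n # xs @ [\<one>]) = inc k (hochschild_d B p g (map bet xs) (entry j n))"
proof -
  let ?s = "sandwich B g" and ?x = "entry j n"
  note gc = B.cochains_funcset[OF g]
  note sc = B.sandwich_funcset[OF gc]
  have x: "?x \<in> carrier M" using entry_NN(4)[OF j n] .
  have nT: "n \<in> U" using NN_closed[OF n] .
  have s: "H (y # l) = inc k (?s (\<one>\<^bsub>B\<^esub> # map bet l) (entry j y))" "H (y # l) \<in> U"
   if "y \<in> U" "l \<in> tup (Suc p)" for y l
  proof -
   have "l = butlast l @ [last l]" "butlast l \<in> tup p" "last l \<in> U"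
    using that butlast_closed[of l p] by (auto simp: in_tuples_Suc simp del: T_fields)
   then obtain us z where l: "l = us @ [z]" "us \<in> tup p" "z \<in> U" by blast
   have gu: "g (map bet us) \<in> carrier B" using B.cochains_closed[OF g map_bet[OF l(2)]] .
   have e: "entry j y \<in> carrier M" using entry_closed[OF that(1) j] .
   have bz: "bet z \<in> carrier B" using bet_simps(1)[OF l(3)] .
   have "H (y # l) = inc k (bet z (g (map bet us) (entry j y)))"
    using inc_simps(3)[OF l(3) B_D(1)[OF gu e], of k] by (simp add: H_def l bet_def)
   moreover have "?s (\<one>\<^bsub>B\<^esub> # map bet l) (entry j y) = bet z (g (map bet us) (entry j y))"
    using sandwich_simp[of B g "\<one>\<^bsub>B\<^esub>" "map bet us" "bet z"] gu e bz by (simp add: l B_fields B_D)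
   ultimately show "H (y # l) = inc k (?s (\<one>\<^bsub>B\<^esub> # map bet l) (entry j y))" by simp
   show "H (y # l) \<in> U"
    using \<open>H (y # l) = inc k (bet z _)\<close> NN_closed[OF inc_NN[OF B_D(1)[OF bz B_D(1)[OF gu e]]]] by simp
  qed
  show "H \<in> tup (Suc (Suc p)) \<rightarrow> U"
  proof
   fix l assume "l \<in> tup (Suc (Suc p))"
   then obtain y l' where "l = y # l'" "y \<in> U" "l' \<in> tup (Suc p)"
    by (auto simp: in_tuples_Suc[of _ _ "Suc p"] simp del: T_fields)
   then show "H l \<in> U" using s(2) by simp
  qed
  obtain y ys where y: "xs = y # ys" "y \<in> U" "ys \<in> tup p"
   using xs by (auto simp: in_tuples_Suc simp del: T_fields)
  have ys1: "ys @ [\<one>] \<in> tup (Suc p)" using y by (intro tuples_snocI A.one_closed)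
  have yB: "bet y \<in> carrier B" using bet_simps(1)[OF y(2)] .
  have bys: "map bet (ys @ [\<one>]) = map bet ys @ [\<one>\<^bsub>B\<^esub>]" by (simp add: bet_simps)
  have bys1: "map bet ys @ [\<one>\<^bsub>B\<^esub>] \<in> tuples B (Suc p)" using map_bet[OF ys1] by (simp only: bys)
  have ny: "n \<otimes> y \<in> U" "entry j (n \<otimes> y) = bet y ?x"
   using A.m_closed[OF nT y(2)] entry_NN(3)[OF j n y(2)] by (simp_all only: bet_def)
  define h where "h = (\<lambda>b. inc k (b ?x))"
  have h: "h \<in> carrier B \<rightarrow> U"
   unfolding h_def using NN_closed[OF inc_NN[OF B_D(1)[OF _ x]]] by auto
  have hadd: "h (b \<oplus>\<^bsub>B\<^esub> b') = h b \<oplus> h b'" if "b \<in> carrier B" "b' \<in> carrier B" for b b'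
   using that x by (simp add: h_def B_fields inc_simps B_D del: T_fields)
  interpret h: abelian_group_hom B T h
   using h hadd by (intro abelian_group_hom_of_additive B_abelian T_abelian) auto
  have 1: "H ((n \<otimes> y) # ys @ [\<one>]) = h (?s (bet y # map bet ys @ [\<one>\<^bsub>B\<^esub>]))"
  proof -
   have gu: "g (map bet ys) \<in> carrier B" using B.cochains_closed[OF g map_bet[OF y(3)]] .
   show ?thesis
    unfolding s(1)[OF ny(1) ys1] ny(2) bys h_def
    using sandwich_simp[of B g "\<one>\<^bsub>B\<^esub>" "map bet ys" "\<one>\<^bsub>B\<^esub>"] sandwich_simp[of B g "bet y" "map bet ys" "\<one>\<^bsub>B\<^esub>"] gu x yB
    by (simp add: B_fields B_D)
  qed
  have 2: "br (\<lambda>l. H (n # l)) (y # ys @ [\<one>]) = h (bar B B (\<lambda>l. ?s (\<one>\<^bsub>B\<^esub> # l)) (bet y # map bet ys @ [\<one>\<^bsub>B\<^esub>]))"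
  proof -
   have yl: "y # ys @ [\<one>] \<in> tup (Suc (Suc p))" using y(2) ys1 by (simp del: T_fields)
   have f: "(\<lambda>l. ?s (\<one>\<^bsub>B\<^esub> # l)) \<in> tuples B (Suc p) \<rightarrow> carrier B" using sc by (auto simp: Pi_def)
   have "br (\<lambda>l. H (n # l)) (y # ys @ [\<one>]) = br (\<lambda>l. h (?s (\<one>\<^bsub>B\<^esub> # map bet l))) (y # ys @ [\<one>])"
    using s(1)[OF nT] by (intro Bar.bar_cong[OF _ yl]) (simp add: h_def)
   also have "\<dots> = bar B T (\<lambda>l. h (?s (\<one>\<^bsub>B\<^esub> # l))) (map bet (y # ys @ [\<one>]))"
    by (rule bar_map[symmetric, OF _ yl]) (rule bet_simps(3))
   also have "\<dots> = h (bar B B (\<lambda>l. ?s (\<one>\<^bsub>B\<^esub> # l)) (map bet (y # ys @ [\<one>])))"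
    using h hadd T_abelian f map_bet[OF yl] by (intro B.Bar.bar_hom[of _ _ _ "Suc p"]) auto
   finally show ?thesis by (simp add: bet_simps)
  qed
  have f: "(\<lambda>l. ?s (\<one>\<^bsub>B\<^esub> # l)) \<in> tuples B (Suc p) \<rightarrow> carrier B" using sc by (auto simp: Pi_def)
  have c: "?s (bet y # map bet ys @ [\<one>\<^bsub>B\<^esub>]) \<in> carrier B" "bar B B (\<lambda>l. ?s (\<one>\<^bsub>B\<^esub> # l)) (bet y # map bet ys @ [\<one>\<^bsub>B\<^esub>]) \<in> carrier B"
   using funcset_mem[OF sc, of "bet y # map bet ys @ [\<one>\<^bsub>B\<^esub>]"] B.Bar.bar_closed[OF f, of "bet y # map bet ys @ [\<one>\<^bsub>B\<^esub>]"] yB bys1 by auto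
  have "hochschild_d B p g (map bet xs) = bar B B ?s (\<one>\<^bsub>B\<^esub> # map bet xs @ [\<one>\<^bsub>B\<^esub>])"
   by (rule B.d_apply[OF gc map_bet[OF xs]])
  also have "\<dots> = ?s (bet y # map bet ys @ [\<one>\<^bsub>B\<^esub>]) \<ominus>\<^bsub>B\<^esub> bar B B (\<lambda>l. ?s (\<one>\<^bsub>B\<^esub> # l)) (bet y # map bet ys @ [\<one>\<^bsub>B\<^esub>])"
   using yB by (simp add: y(1))
  finally have "h (hochschild_d B p g (map bet xs)) = br H (n # xs @ [\<one>])"
   using c 1 2 by (simp add: y(1))
  then show "br H (n # xs @ [\<one>]) = inc k (hochschild_d B p g (map bet xs) ?x)" by (simp add: h_def)
qed

text \<open>The sign is that of \<open>d_from_N\<close>: the crossing entry stands before the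
  arguments from \<open>B\<close>. It does not affect cocycles and coboundaries.\<close>

lemma d_inj:
  assumes g: "g \<in> families p" and xs: "xs \<in> tup (Suc (Suc p))"
  shows "\<delta> (Suc p) (inj p g) xs = \<ominus> inj (Suc p) (\<lambda>t. hochschild_d B p (g t)) xs"
proof -
  obtain x ys where x: "xs = x # ys" "x \<in> U" "ys \<in> tup (Suc p)"
   using xs by (auto simp: in_tuples_Suc simp del: T_fields)
  define H where "H = (\<lambda>t l. inc (tgt t) (g t (map bet (butlast (tl l))) (entry (src t) (hd l))) \<otimes> last l)"
  have gt: "g t \<in> cochains K B p" if "t < m\<^sup>2 - 1" for t using g that by (simp add: families_def)
  have \<nu>: "\<nu> x \<in> NN" using x(2) by (intro NN_I) (simp_all del: T_fields)
  note bt = bar_term[OF gt src_tgt(1) \<nu> x(3)]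
  have l: "\<nu> x # ys @ [\<one>] \<in> tup (Suc (Suc (Suc p)))"
   using tuples_snocI[OF x(3) A.one_closed] \<nu>_closed[OF x(2)] by (simp del: T_fields)
  have "\<delta> (Suc p) (inj p g) xs =
    \<ominus> br (\<lambda>l. \<Theta> g (hd l) (butlast (tl l)) \<otimes> last l) (\<nu> x # ys @ [\<one>])"
   unfolding inj_def x(1)
   by (rule d_from_N[OF \<Theta>_LN[OF g] inj_cochain[OF g, unfolded inj_def] refl x(2,3)])
  also have "br (\<lambda>l. \<Theta> g (hd l) (butlast (tl l)) \<otimes> last l) (\<nu> x # ys @ [\<one>]) =
    br (\<lambda>l. \<Oplus>t\<in>{..<m\<^sup>2 - 1}. H t l) (\<nu> x # ys @ [\<one>])"
  proof (rule Bar.bar_cong[OF _ l])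
   fix l assume "l \<in> tup (Suc (Suc p))"
   then obtain y us z where l: "l = y # us @ [z]" "y \<in> U" "us \<in> tup p" "z \<in> U"
    by (subst (asm) in_tuples_Suc_Suc) auto
   have "inc (tgt t) (g t (map bet us) (entry (src t) y)) \<in> U" if "t < m\<^sup>2 - 1" for t
    using NN_closed[OF inc_NN[OF B_D(1)[OF families_D[OF g that l(3)] entry_closed[OF l(2) src_tgt(1)[OF that]]]]] .
   then show "\<Theta> g (hd l) (butlast (tl l)) \<otimes> last l = (\<Oplus>t\<in>{..<m\<^sup>2 - 1}. H t l)"
    unfolding \<Theta>_def H_def using l(4) by (intro A.finsum_ldistr) (auto simp: l(1) simp del: T_fields)
  qed
  also have "\<dots> = (\<Oplus>t\<in>{..<m\<^sup>2 - 1}. br (H t) (\<nu> x # ys @ [\<one>]))"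
   using bt(1) by (intro Bar.bar_finsum[OF _ _ l]) (auto simp: H_def simp del: T_fields)
  also have "\<dots> = \<Theta> (\<lambda>t. hochschild_d B p (g t)) (\<nu> x) ys"
   unfolding \<Theta>_def
  proof (rule M.finsum_cong')
   show "br (H t) (\<nu> x # ys @ [\<one>]) =
     inc (tgt t) (hochschild_d B p (g t) (map bet ys) (entry (src t) (\<nu> x)))" if "t \<in> {..<m\<^sup>2 - 1}" for t
   proof -
    have t: "t < m\<^sup>2 - 1" using that by simp
    show ?thesis unfolding H_def by (rule bar_term(2)[OF gt[OF t] src_tgt(1)[OF t] \<nu> x(3)])
   qed
   show "(\<lambda>t. inc (tgt t) (hochschild_d B p (g t) (map bet ys) (entry (src t) (\<nu> x)))) \<in> {..<m\<^sup>2 - 1} \<rightarrow> U"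
    using NN_closed[OF inc_NN[OF B_D(1)[OF B.cochains_closed[OF B.d_cochains[OF gt] map_bet[OF x(3)]] entry_NN(4)[OF src_tgt(1) \<nu>]]]]
    by auto
  qed simp
  also have "\<dots> = inj (Suc p) (\<lambda>t. hochschild_d B p (g t)) xs"
   using x by (simp add: inj_def from_N_Cons del: T_fields)
  finally show ?thesis .
qed

end

section \<open>The residual part of a cocycle\<close>

context retract
begin

lemma \<Psi>K_LN: "mlin (Suc m) f ==> xs \<in> tup m ==> (\<lambda>n. \<Psi>K f (n # xs @ [\<one>])) \<in> LN"
  using assemble.\<Psi>_LN1[OF assemble_K] .

lemma D_LN:
  assumes f: "mlin (Suc m) f" and xs: "xs \<in> tup m"
  shows "(\<lambda>n. D f n xs) \<in> LN" "\<kappa> (\<lambda>n. D f n xs) = \<zero>"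
proof -
  note L = \<Psi>K_LN[OF f xs]
  note R = LN_right[OF LN_id \<kappa>_closed[OF L]]
  show "(\<lambda>n. D f n xs) \<in> LN" unfolding D_def by (rule LN_minus[OF L R])
  show "\<kappa> (\<lambda>n. D f n xs) = \<zero>"
   unfolding D_def \<kappa>_minus[OF L R] \<kappa>_mult[OF \<kappa>_closed[OF L]] \<beta>_\<kappa>[OF L]
   using M.r_neg[OF \<kappa>_closed[OF L]] by (simp only: a_minus_def)
qed

lemma D_\<beta>:
  assumes f: "mlin (Suc m) f" and xs: "xs \<in> tup m" and n: "n \<in> NN"
  shows "D f n (map \<beta> xs) = D f n xs"
proof -
  have \<beta>\<beta>: "map \<beta> (map \<beta> xs @ [\<one>]) = map \<beta> (xs @ [\<one>])" using xs by (auto simp: tuples_def)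
  have "\<Psi>K f (n # map \<beta> xs @ [\<one>]) = \<Psi>K f (n # xs @ [\<one>])" if "n \<in> NN" for n
  proof -
   have H: "mlin (Suc 0 + Suc (Suc m)) (sw f)"
    using sandwich_multilinear[OF f] by simp
   show ?thesis
    unfolding \<Psi>K_def KK.lift_NN[OF H that tuples_snocI[OF xs A.one_closed]]
     KK.lift_NN[OF H that tuples_snocI[OF map_\<beta>[OF xs] A.one_closed]] \<beta>\<beta> ..
  qed
  then show ?thesis
   unfolding D_def using \<kappa>_cong[OF \<Psi>K_LN[OF f map_\<beta>[OF xs]], of "\<lambda>n. \<Psi>K f (n # xs @ [\<one>])"] n by simp
qed

text \<open>All other terms of the homotopy formula of \<open>f\<close> are cocycles, since
  \<open>\<delta> (Qc f) = Qc (\<delta> f)\<close> vanishes and coboundaries are cocycles.\<close>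

lemma d_Dc_cocycle:
  assumes f: "f \<in> cocycles (Suc m)"
  shows "Dc m f \<in> cocycles (Suc m)"
proof (rule cocyclesI)
  let ?C = "C (Suc m)"
  have fc: "f \<in> Ch (Suc m)" using f by (rule cocycles_cochains)
  note ml = cochains_multilinear[OF fc]
  note Q = Qc_cochain[OF ml]
  show D: "Dc m f \<in> Ch (Suc m)" by (rule Dc_cochain[OF ml])
  obtain h where h: "h \<in> Ch m"
   "\<And>xs. xs \<in> tup (Suc m) ==> f xs = Qc (Suc m) f xs \<oplus> Dc m f xs \<oplus> \<delta> m h xs"
   using cocycle_homotopy[OF f] by blast
  note dh = d_cochains[OF h(1)]
  have QD: "Qc (Suc m) f \<oplus>\<^bsub>?C\<^esub> Dc m f \<in> Ch (Suc m)" using add_cochain[OF Q D] by simp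
  have eq: "f = Qc (Suc m) f \<oplus>\<^bsub>?C\<^esub> Dc m f \<oplus>\<^bsub>?C\<^esub> \<delta> m h"
   using add_cochain[OF QD dh] by (intro cochains_eqI[OF fc]) (auto intro: h(2))
  fix xs assume xs: "xs \<in> tup (Suc (Suc m))"
  have "\<delta> (Suc m) (Qc (Suc m) f) xs = \<zero>"
   unfolding d_Qc[OF fc]
   using Qc_zero[OF cochains_multilinear[OF d_cochains[OF fc]] _ xs] cocycles_d[OF f map_\<alpha>] by simp
  moreover have "\<delta> (Suc m) (\<delta> m h) xs = \<zero>"
   using d_d[OF h(1)] xs by simp
  moreover have "\<delta> (Suc m) f xs = \<delta> (Suc m) (Qc (Suc m) f) xs \<oplus>
    \<delta> (Suc m) (Dc m f) xs \<oplus> \<delta> (Suc m) (\<delta> m h) xs"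
   unfolding d_add_apply[OF Q D xs, symmetric] d_add_apply[OF QD dh xs, symmetric] eq[symmetric] ..
  ultimately show "\<delta> (Suc m) (Dc m f) xs = \<zero>"
   using cocycles_d[OF f xs] cochains_closed[OF d_cochains[OF D] xs] by simp
qed

end

section \<open>Components of the residual part at the positions other than
  \<open>(0, 0)\<close>\<close>

context endo_projective
begin

lemma inj_entry:
  assumes g: "g \<in> families p" and t: "t < m\<^sup>2 - 1" and bs: "bs \<in> tuples B p" and x: "x \<in> carrier M"
  shows "entry (tgt t) (inj p g (inc (src t) x # map ib bs)) = g t bs x"
proof -
  have "inj p g (inc (src t) x # map ib bs) = \<Theta> g (inc (src t) x) (map ib bs)"
   unfolding inj_def using from_N_Cons[OF NN_closed[OF inc_NN[OF x]] map_ib[OF bs]] NN_\<nu>[OF inc_NN[OF x]] by simp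
  moreover have "entry (tgt t) (\<Theta> g (inc (src t) x) (map ib bs)) = g t bs x"
   using fun_cong[OF comp_\<Theta>[OF g map_ib[OF bs] t], of x] x by (simp add: comp_def del: map_map)
  ultimately show ?thesis by simp
qed

lemma inc_tuples:
  "x \<in> carrier M ==> bs \<in> tuples B p ==> inc j x # map ib bs \<in> tup (Suc p)"
  using NN_closed[OF inc_NN, of x j] map_ib[of bs p] by (simp del: T_fields)

text \<open>The matrix entries of the residual part of \<open>F\<close>, as cochains of
  \<open>B\<close>; on residual parts it undoes \<open>inj\<close>.\<close>

definition rho :: "nat => ((('a, 'm) matrix) list => ('a, 'm) matrix) => nat => ('m => 'm) list => 'm => 'm" where
  "rho p F t = (\<lambda>bs\<in>tuples B p. comp (src t) (tgt t) (\<lambda>n. D F n (map ib bs)))"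

lemma rho_families:
  assumes F: "F \<in> Ch (Suc p)"
  shows "rho p F \<in> families p"
  unfolding families_def rho_def
proof (intro CollectI allI impI B.restrict_cochains, subst B.Lin.multilinear_iff, intro conjI ballI allI impI)
  fix t assume t: "t < m\<^sup>2 - 1"
  note ml = cochains_multilinear[OF F]
  let ?c = "\<lambda>bs. comp (src t) (tgt t) (\<lambda>n. D F n (map ib bs))"
  let ?e = "\<lambda>x bs. entry (tgt t) (Dc p F (inc (src t) x # map ib bs))"
  have c: "?c bs \<in> carrier B" if "bs \<in> tuples B p" for bs
   unfolding comp_def by (rule ext_B[OF D_LN(1)[OF ml map_ib[OF that]] src_tgt(2)[OF t]])
  then show "?c \<in> tuples B p \<rightarrow> carrier B" by blast
  \<comment> \<open>The components are entries of \<open>Dc p F\<close> at lists with one additional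
    entry in front, so linearity at the position \<open>i\<close> is linearity of
    \<open>Dc p F\<close> at \<open>Suc i\<close>.\<close>
  have e: "?c bs x = ?e x bs" if "bs \<in> tuples B p" "x \<in> carrier M" for bs x
   using that inc_tuples[OF that(2,1)] NN_\<nu>[OF inc_NN] by (simp add: comp_def Dc_def del: T_fields)
  have Dc: "Dc p F l \<in> U" if "l \<in> tup (Suc p)" for l
   using cochains_closed[OF Dc_cochain[OF ml] that] .
  note D = Lin.multilinear_iff[THEN iffD1, OF cochains_multilinear[OF Dc_cochain[OF ml]], THEN conjunct2, rule_format]
  fix bs i assume bs: "bs \<in> tuples B p" and i: "i < p"
  have up: "bs[i := b] \<in> tuples B p" if "b \<in> carrier B" for b
   using bs that by (auto simp: tuples_def dest!: subsetD[OF set_update_subset_insert])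
  have l: "inc (src t) x # map ib (bs[i := b]) = (inc (src t) x # map ib bs)[Suc i := ib b]" for b x
   by (simp add: map_update)
  fix b assume b: "b \<in> carrier B"
  show "?c (bs[i := b \<oplus>\<^bsub>B\<^esub> b']) = ?c (bs[i := b]) \<oplus>\<^bsub>B\<^esub> ?c (bs[i := b'])" if b': "b' \<in> carrier B" for b'
  proof (rule B_eqI[OF c[OF up] B_closed(2)[OF c[OF up] c[OF up]]])
   fix x assume x: "x \<in> carrier M"
   have "Dc p F (inc (src t) x # map ib (bs[i := b \<oplus>\<^bsub>B\<^esub> b'])) =
     Dc p F (inc (src t) x # map ib (bs[i := b])) \<oplus> Dc p F (inc (src t) x # map ib (bs[i := b']))"
    unfolding l ib_simps(2)[OF b b'] using D[OF inc_tuples[OF x bs], of "Suc i"] i ib_simps(1)[OF b] ib_simps(1)[OF b'] by blast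
   then have "?e x (bs[i := b \<oplus>\<^bsub>B\<^esub> b']) = ?e x (bs[i := b]) \<oplus>\<^bsub>M\<^esub> ?e x (bs[i := b'])"
    using abelian_group_hom.hom_add[OF entry_hom[OF src_tgt(2)[OF t]] Dc[OF inc_tuples[OF x up[OF b]]] Dc[OF inc_tuples[OF x up[OF b']]]]
    by simp
   then show "?c (bs[i := b \<oplus>\<^bsub>B\<^esub> b']) x = (?c (bs[i := b]) \<oplus>\<^bsub>B\<^esub> ?c (bs[i := b'])) x"
    using e[OF up x] b b' x by (simp add: B_fields)
  qed (use b b' in auto)
  show "?c (bs[i := k \<odot>\<^bsub>B\<^esub> b]) = k \<odot>\<^bsub>B\<^esub> ?c (bs[i := b])" if k: "k \<in> carrier K" for k
  proof (rule B_eqI[OF c[OF up] B_closed(3)[OF c[OF up] k]])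
   fix x assume x: "x \<in> carrier M"
   have "Dc p F (inc (src t) x # map ib (bs[i := k \<odot>\<^bsub>B\<^esub> b])) = k \<odot> Dc p F (inc (src t) x # map ib (bs[i := b]))"
    unfolding l ib_simps(3)[OF k b] using D[OF inc_tuples[OF x bs], of "Suc i"] i ib_simps(1)[OF b] k by blast
   then have "?e x (bs[i := k \<odot>\<^bsub>B\<^esub> b]) = scalar k (?e x (bs[i := b]))"
    using src_tgt(2)[OF t] by (cases "Dc p F (inc (src t) x # map ib (bs[i := b]))") (simp add: N_fields)
   then show "?c (bs[i := k \<odot>\<^bsub>B\<^esub> b]) x = (k \<odot>\<^bsub>B\<^esub> ?c (bs[i := b])) x"
    using e[OF up x] b k x by (simp add: B_fields)
  qed (use b k in auto)
qed

text \<open>\<open>\<kappa>\<close> vanishes on the residual part, so nothing is lost by reading off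
  only the entries other than that at \<open>(0, 0)\<close>.\<close>

lemma inj_rho:
  assumes F: "F \<in> Ch (Suc p)"
  shows "inj p (rho p F) = Dc p F"
proof (rule cochains_eqI[OF inj_cochain[OF rho_families[OF F]] Dc_cochain[OF cochains_multilinear[OF F]]])
  note ml = cochains_multilinear[OF F]
  fix xs assume "xs \<in> tup (Suc p)"
  then obtain x ys where x: "xs = x # ys" "x \<in> U" "ys \<in> tup p"
   by (auto simp: in_tuples_Suc simp del: T_fields)
  have \<nu>: "\<nu> x \<in> NN" using x(2) by (intro NN_I) (simp_all del: T_fields)
  have "\<Theta> (rho p F) (\<nu> x) ys = D F (\<nu> x) ys"
  proof (rule \<Theta>_expand[OF D_LN[OF ml x(3)] \<nu> rho_families[OF F] _ x(3)])
   fix t assume "t < m\<^sup>2 - 1"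
   show "rho p F t (map bet ys) = comp (src t) (tgt t) (\<lambda>n. D F n ys)"
    unfolding rho_def map_\<beta>_bet[OF x(3)] using D_\<beta>[OF ml x(3) inc_NN] map_bet[OF x(3)] map_\<beta>_bet[OF x(3)]
    by (auto simp: comp_def fun_eq_iff simp del: map_map)
  qed
  then show "inj p (rho p F) xs = Dc p F xs"
   unfolding inj_def Dc_eq x(1) from_N_Cons[OF x(2,3)] .
qed

lemma \<Theta>_zero:
  assumes "\<And>t. t < m\<^sup>2 - 1 ==> g t (map bet xs) = \<zero>\<^bsub>B\<^esub>" "n \<in> NN"
  shows "\<Theta> g n xs = \<zero>"
proof -
  have "\<Theta> g n xs = (\<Oplus>t\<in>{..<m\<^sup>2 - 1}. \<zero>)"
   unfolding \<Theta>_def using assms entry_NN(4)[OF src_tgt(1) assms(2)]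
   by (intro M.finsum_cong') (auto simp: B_fields inc_def col_simps T_zero)
  then show ?thesis by simp
qed

lemma inj_zero:
  assumes "\<And>t bs. t < m\<^sup>2 - 1 ==> bs \<in> tuples B p ==> g t bs = \<zero>\<^bsub>B\<^esub>" "xs \<in> tup (Suc p)"
  shows "inj p g xs = \<zero>"
proof -
  obtain x ys where x: "xs = x # ys" "x \<in> U" "ys \<in> tup p"
   using assms(2) by (auto simp: in_tuples_Suc simp del: T_fields)
  have \<nu>: "\<nu> x \<in> NN" using x(2) by (intro NN_I) (simp_all del: T_fields)
  show ?thesis
   unfolding inj_def x(1) from_N_Cons[OF x(2,3)] using assms(1) map_bet[OF x(3)] by (intro \<Theta>_zero \<nu>) auto
qed

lemma inj_cong:
  assumes g: "g \<in> families p" and eq: "\<And>t. t < m\<^sup>2 - 1 ==> g t = g' t" and xs: "xs \<in> tup (Suc p)"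
  shows "inj p g xs = inj p g' xs"
proof -
  obtain x ys where x: "xs = x # ys" "x \<in> U" "ys \<in> tup p"
   using xs by (auto simp: in_tuples_Suc simp del: T_fields)
  have \<nu>: "\<nu> x \<in> NN" using x(2) by (intro NN_I) (simp_all del: T_fields)
  have "inc (tgt t) (g t (map bet ys) (entry (src t) (\<nu> x))) \<in> U" if "t < m\<^sup>2 - 1" for t
   by (rule NN_closed[OF inc_NN[OF B_D(1)[OF families_D[OF g that x(3)] entry_NN(4)[OF src_tgt(1)[OF that] \<nu>]]]])
  then show ?thesis
   unfolding inj_def x(1) from_N_Cons[OF x(2,3)] \<Theta>_def using eq by (intro M.finsum_cong') (auto simp del: T_fields)
qed

lemma families_add: "g \<in> families p ==> g' \<in> families p ==> (\<lambda>t. g t \<oplus>\<^bsub>cochain_module K B p\<^esub> g' t) \<in> families p"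
  using B.add_cochain by (auto simp: families_def)

lemma families_smult: "k \<in> carrier K ==> g \<in> families p ==> (\<lambda>t. k \<odot>\<^bsub>cochain_module K B p\<^esub> g t) \<in> families p"
  using B.smult_cochain by (auto simp: families_def)

lemma inj_add:
  assumes "g \<in> families p" "g' \<in> families p"
  shows "inj p (\<lambda>t. g t \<oplus>\<^bsub>cochain_module K B p\<^esub> g' t) = inj p g \<oplus>\<^bsub>C (Suc p)\<^esub> inj p g'" (is "?l = ?r")
proof (rule cochains_eqI[OF inj_cochain[OF families_add[OF assms]]])
  show "?r \<in> Ch (Suc p)" using add_cochain[OF inj_cochain inj_cochain] assms by simp
  fix xs assume xs: "xs \<in> tup (Suc p)"
  then obtain x ys where x: "xs = x # ys" "x \<in> U" "ys \<in> tup p"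
   by (auto simp: in_tuples_Suc simp del: T_fields)
  have \<nu>: "\<nu> x \<in> NN" using x(2) by (intro NN_I) (simp_all del: T_fields)
  note e = entry_NN(4)[OF src_tgt(1) \<nu>]
  note c = B_D(1)[OF families_D[OF assms(1) _ x(3)] e] B_D(1)[OF families_D[OF assms(2) _ x(3)] e]
  have "\<Theta> (\<lambda>t. g t \<oplus>\<^bsub>cochain_module K B p\<^esub> g' t) (\<nu> x) ys =
    (\<Oplus>t\<in>{..<m\<^sup>2 - 1}. inc (tgt t) (g t (map bet ys) (entry (src t) (\<nu> x))) \<oplus>
     inc (tgt t) (g' t (map bet ys) (entry (src t) (\<nu> x))))"
   unfolding \<Theta>_def using c e map_bet[OF x(3)] NN_closed[OF inc_NN]
   by (intro M.finsum_cong') (auto simp: B_fields inc_simps simp del: T_fields)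
  also have "\<dots> = \<Theta> g (\<nu> x) ys \<oplus> \<Theta> g' (\<nu> x) ys"
   unfolding \<Theta>_def using c NN_closed[OF inc_NN] by (intro M.finsum_addf) (auto simp del: T_fields)
  finally show "?l xs = ?r xs"
   using xs x by (simp add: inj_def from_N_Cons del: T_fields B.cochain_simps)
qed

lemma inj_smult:
  assumes k: "k \<in> carrier K" and g: "g \<in> families p"
  shows "inj p (\<lambda>t. k \<odot>\<^bsub>cochain_module K B p\<^esub> g t) = k \<odot>\<^bsub>C (Suc p)\<^esub> inj p g" (is "?l = ?r")
proof (rule cochains_eqI[OF inj_cochain[OF families_smult[OF assms]]])
  show "?r \<in> Ch (Suc p)" using smult_cochain[OF k inj_cochain[OF g]] by simp
  fix xs assume xs: "xs \<in> tup (Suc p)"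
  then obtain x ys where x: "xs = x # ys" "x \<in> U" "ys \<in> tup p"
   by (auto simp: in_tuples_Suc simp del: T_fields)
  have \<nu>: "\<nu> x \<in> NN" using x(2) by (intro NN_I) (simp_all del: T_fields)
  note e = entry_NN(4)[OF src_tgt(1) \<nu>]
  note c = B_D(1)[OF families_D[OF g _ x(3)] e]
  have h: "(\<lambda>x. k \<odot> x) \<in> lin"
   using k by (intro linear_mapsI) (auto simp: smult_r_distr smult_assoc1[symmetric] A.R.m_comm simp del: T_fields)
  have i: "inc j (scalar k y) = k \<odot> inc j y" if "y \<in> carrier M" for j y
   using k that by (simp add: inc_def col_simps A.smult_r_null B.smult_r_null)
  have "\<Theta> (\<lambda>t. k \<odot>\<^bsub>cochain_module K B p\<^esub> g t) (\<nu> x) ys =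
    (\<Oplus>t\<in>{..<m\<^sup>2 - 1}. k \<odot> inc (tgt t) (g t (map bet ys) (entry (src t) (\<nu> x))))"
   unfolding \<Theta>_def using c e k map_bet[OF x(3)] NN_closed[OF inc_NN]
   by (intro M.finsum_cong') (auto simp: B_fields i simp del: T_fields)
  also have "\<dots> = k \<odot> \<Theta> g (\<nu> x) ys"
   unfolding \<Theta>_def using c NN_closed[OF inc_NN]
   by (intro abelian_group_hom.hom_finsum[OF hom_of_linear[OF h], symmetric]) (auto simp del: T_fields)
  finally show "?l xs = ?r xs"
   using xs x by (simp add: inj_def from_N_Cons del: T_fields B.cochain_simps)
qed

lemma inj_cocycle:
  assumes "\<And>t. t < m\<^sup>2 - 1 ==> g t \<in> B.cocycles p"
  shows "inj p g \<in> cocycles (Suc p)"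
proof -
  have g: "g \<in> families p" using assms B.cocycles_cochains by (simp add: families_def)
  show ?thesis
  proof (rule cocyclesI[OF inj_cochain[OF g]])
   fix xs assume xs: "xs \<in> tup (Suc (Suc p))"
   have "inj (Suc p) (\<lambda>t. hochschild_d B p (g t)) xs = \<zero>"
    using B.cocycles_d[OF assms] by (intro inj_zero xs)
   then show "\<delta> (Suc p) (inj p g) xs = \<zero>" using d_inj[OF g xs] by simp
  qed
qed

text \<open>\<open>inj\<close> turns the differentials of the components into that of
  \<open>Dc p F\<close>, a cocycle, up to sign; \<open>inj_entry\<close> then isolates each
  component.\<close>

lemma rho_cocycle:
  assumes F: "F \<in> cocycles (Suc p)" and t: "t < m\<^sup>2 - 1"
  shows "rho p F t \<in> B.cocycles p"
proof (rule B.cocyclesI)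
  note Fc = cocycles_cochains[OF F]
  note \<rho> = rho_families[OF Fc]
  show c: "rho p F t \<in> cochains K B p" using \<rho> t by (simp add: families_def)
  have d\<rho>: "(\<lambda>t. hochschild_d B p (rho p F t)) \<in> families (Suc p)"
   using \<rho> B.d_cochains by (simp add: families_def)
  fix bs assume bs: "bs \<in> tuples B (Suc p)"
  show "hochschild_d B p (rho p F t) bs = \<zero>\<^bsub>B\<^esub>"
  proof (rule B_eqI[OF B.cochains_closed[OF B.d_cochains[OF c] bs] B_one_zero(2)])
   fix x assume x: "x \<in> carrier M"
   note l = inc_tuples[OF x bs, of "src t"]
   have "\<ominus> inj (Suc p) (\<lambda>t. hochschild_d B p (rho p F t)) (inc (src t) x # map ib bs) = \<zero>"
    unfolding d_inj[OF \<rho> l, symmetric] inj_rho[OF Fc] by (rule cocycles_d[OF d_Dc_cocycle[OF F] l])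
   then have "inj (Suc p) (\<lambda>t. hochschild_d B p (rho p F t)) (inc (src t) x # map ib bs) = \<zero>"
    using M.minus_minus[OF cochains_closed[OF inj_cochain[OF d\<rho>] l]] by simp
   then have "hochschild_d B p (rho p F t) bs x = entry (tgt t) \<zero>"
    using inj_entry[OF d\<rho> t bs x] by simp
   also have "\<dots> = \<zero>\<^bsub>M\<^esub>" using src_tgt(2)[OF t] by (simp add: T_zero N_fields)
   finally show "hochschild_d B p (rho p F t) bs x = \<zero>\<^bsub>B\<^esub> x" using x by (simp add: B_fields)
  qed
qed

lemma inj_coboundary:
  assumes g: "g \<in> families p" "\<And>t. t < m\<^sup>2 - 1 ==> g t \<in> coboundaries K B p"
  shows "inj p g \<in> bd (Suc p)"
proof (cases p)
  case 0
  have "inj p g xs = \<delta> p (\<lambda>xs\<in>tup p. \<zero>) xs" if "xs \<in> tup (Suc p)" for xs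
   using g(2) 0 inj_zero[of p g xs] that d_zero_apply[OF zero_cochain _ that] by (simp add: coboundaries_def)
  then have "inj p g = \<delta> p (\<lambda>xs\<in>tup p. \<zero>)"
   by (intro cochains_eqI[OF inj_cochain[OF g(1)] d_cochains[OF zero_cochain]])
  then show ?thesis using zero_cochain by (simp add: coboundaries_def)
next
  case (Suc q)
  have "\<forall>t. \<exists>h. t < m\<^sup>2 - 1 \<longrightarrow> h \<in> cochains K B q \<and> g t = hochschild_d B q h"
   using g(2) by (auto simp: coboundaries_def Suc)
  then obtain h where h: "\<And>t. t < m\<^sup>2 - 1 ==> h t \<in> cochains K B q \<and> g t = hochschild_d B q (h t)" by metis
  then have hf: "h \<in> families q" by (simp add: families_def)
  have eq: "inj p g xs = \<ominus> \<delta> p (inj q h) xs" if "xs \<in> tup (Suc p)" for xs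
  proof -
   have "inj p g xs = inj p (\<lambda>t. hochschild_d B q (h t)) xs"
    using h by (intro inj_cong[OF g(1) _ that]) auto
   then show ?thesis
    using d_inj[OF hf] that M.minus_minus[OF cochains_closed[OF inj_cochain]] Suc
     h B.d_cochains by (simp add: families_def)
  qed
  note dc = d_cochains[OF inj_cochain[OF hf]]
  have "inj p g = (\<ominus>\<^bsub>K\<^esub> \<one>\<^bsub>K\<^esub>) \<odot>\<^bsub>C (Suc p)\<^esub> \<delta> p (inj q h)"
   using eq dc cochains_closed[OF dc] inj_cochain[OF g(1)] smult_cochain[of "\<ominus>\<^bsub>K\<^esub> \<one>\<^bsub>K\<^esub>", OF _ dc] Suc
   by (intro cochains_eqI[OF inj_cochain[OF g(1)]]) (auto simp: smult_l_minus simp del: T_fields)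
  moreover have "\<delta> p (inj q h) \<in> bd (Suc p)"
   using inj_cochain[OF hf] Suc by (simp add: coboundaries_def)
  ultimately show ?thesis
   using Q.H.smult_closed[of "\<ominus>\<^bsub>K\<^esub> \<one>\<^bsub>K\<^esub>" "\<delta> p (inj q h)" "Suc p"] by simp
qed

text \<open>A cochain \<open>F\<close> of \<open>T\<close> with coboundary \<open>inj p g\<close>
  may be replaced by its residual part, which is \<open>inj\<close> of its components. Comparing
  entries exhibits \<open>g t\<close> as the negative of a coboundary of \<open>B\<close>; in degree
  0 it is zero.\<close>

lemma inj_coboundaryD:
  assumes g: "g \<in> families p" and c: "inj p g \<in> bd (Suc p)" and t: "t < m\<^sup>2 - 1"
  shows "g t \<in> coboundaries K B p"
proof -
  have gt: "g t \<in> cochains K B p" using g t by (simp add: families_def)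
  obtain F where F: "F \<in> Ch p" "\<delta> p F = from_N p (\<Theta> g)"
   using c by (auto simp: coboundaries_def inj_def)
  note fixed = \<Theta>_LN[OF g] \<kappa>_\<Theta>[OF g]
  have \<beta>: "\<Theta> g n (map \<beta> xs) = \<Theta> g n xs" if "xs \<in> tup p" for n xs
   unfolding \<Theta>_def map_bet_\<beta>[OF that] ..
  show ?thesis
  proof (cases p)
   case 0
   have "g t bs = \<zero>\<^bsub>B\<^esub>" if bs: "bs \<in> tuples B p" for bs
   proof (rule B_eqI[OF B.cochains_closed[OF gt bs] B_one_zero(2)])
    fix x assume x: "x \<in> carrier M"
    have "inj p g (inc (src t) x # map ib bs) = \<zero>"
     using from_N_coboundary_0[OF fixed[unfolded 0] \<beta>[unfolded 0] F[unfolded 0] inc_tuples[OF x bs, unfolded 0]] F(2)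
     by (simp add: 0 inj_def)
    then show "g t bs x = \<zero>\<^bsub>B\<^esub> x"
     using inj_entry[OF g t bs x] x src_tgt(2)[OF t] by (simp add: T_zero N_fields B_fields)
   qed
   then have "g t = (\<lambda>xs\<in>tuples B p. \<zero>\<^bsub>B\<^esub>)"
    by (intro B.cochains_eqI[OF gt B.zero_cochain]) simp
   then show ?thesis using B.zero_coboundary by simp
  next
   case (Suc q)
   note Fq = F(1)[unfolded Suc]
   note \<rho> = rho_families[OF Fq]
   have d\<rho>: "(\<lambda>t. hochschild_d B q (rho q F t)) \<in> families p"
    using \<rho> B.d_cochains Suc by (simp add: families_def)
   have rt: "rho q F t \<in> cochains K B q" using \<rho> t by (simp add: families_def)
   have dr: "hochschild_d B q (rho q F t) \<in> coboundaries K B p" using rt by (simp add: coboundaries_def Suc)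
   have "g t bs = \<ominus>\<^bsub>B\<^esub> hochschild_d B q (rho q F t) bs" if bs: "bs \<in> tuples B p" for bs
   proof (rule B_eqI[OF B.cochains_closed[OF gt bs]])
    have db: "hochschild_d B q (rho q F t) bs \<in> carrier B" using families_D[OF d\<rho> t map_ib[OF bs]] by (simp del: map_map)
    then show "\<ominus>\<^bsub>B\<^esub> hochschild_d B q (rho q F t) bs \<in> carrier B" by simp
    fix x assume x: "x \<in> carrier M"
    note l = inc_tuples[OF x bs, of "src t"]
    have "inj p g (inc (src t) x # map ib bs) = \<delta> p (inj q (rho q F)) (inc (src t) x # map ib bs)"
     unfolding inj_rho[OF Fq] unfolding inj_def F(2)[symmetric] using from_N_coboundary[OF fixed[unfolded Suc] \<beta>[unfolded Suc] F[unfolded Suc] l[unfolded Suc]]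
     by (simp add: Suc)
    also have "\<dots> = \<ominus> inj p (\<lambda>t. hochschild_d B q (rho q F t)) (inc (src t) x # map ib bs)"
     using d_inj[OF \<rho> l[unfolded Suc]] by (simp add: Suc)
    finally have "g t bs x = \<ominus>\<^bsub>M\<^esub> hochschild_d B q (rho q F t) bs x"
     using inj_entry[OF g t bs x] inj_entry[OF d\<rho> t bs x]
      abelian_group_hom.hom_a_inv[OF entry_hom[OF src_tgt(2)[OF t]] cochains_closed[OF inj_cochain[OF d\<rho>] l]] by simp
    also have "\<dots> = (\<ominus>\<^bsub>B\<^esub> hochschild_d B q (rho q F t) bs) x"
    proof -
     have "(\<ominus>\<^bsub>B\<^esub> hochschild_d B q (rho q F t) bs) x \<oplus>\<^bsub>M\<^esub> hochschild_d B q (rho q F t) bs x = \<zero>\<^bsub>M\<^esub>"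
      using fun_cong[OF B.M.l_neg[OF db], of x] x by (simp add: B_fields)
     then show ?thesis
      using L.M.minus_equality B_D(1)[OF db x] B_D(1)[OF B.M.a_inv_closed[OF db] x] by metis
    qed
    finally show "g t bs x = (\<ominus>\<^bsub>B\<^esub> hochschild_d B q (rho q F t) bs) x" .
   qed
   then have "g t = (\<ominus>\<^bsub>K\<^esub> \<one>\<^bsub>K\<^esub>) \<odot>\<^bsub>cochain_module K B p\<^esub> hochschild_d B q (rho q F t)"
    using B.cochains_closed[OF B.d_cochains[OF rt]] B.smult_cochain[of "\<ominus>\<^bsub>K\<^esub> \<one>\<^bsub>K\<^esub>", OF _ B.d_cochains[OF rt]] Suc
    by (intro B.cochains_eqI[OF gt]) (auto simp: B.smult_l_minus)
   then show ?thesis using B.Q.H.smult_closed[of "\<ominus>\<^bsub>K\<^esub> \<one>\<^bsub>K\<^esub>" "hochschild_d B q (rho q F t)" p] dr by simp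
  qed
qed

lemma res_inj:
  assumes "g \<in> families p"
  shows "res (Suc p) (inj p g) = \<zero>\<^bsub>cochain_module K A (Suc p)\<^esub>"
proof -
  have "fst (inj p g (map diag as)) = \<zero>\<^bsub>A\<^esub>" if as: "as \<in> tuples A (Suc p)" for as
  proof -
   obtain x ys where x: "map diag as = x # ys" "x \<in> U" "ys \<in> tup p"
    using map_diag[OF as] by (auto simp: in_tuples_Suc simp del: T_fields)
   have "\<nu> x \<in> NN" using x(2) by (intro NN_I) (simp_all del: T_fields)
   then have "inj p g (map diag as) \<in> NN"
    unfolding x(1) inj_def from_N_Cons[OF x(2,3)] by (rule LN_D(1)[OF \<Theta>_LN[OF assms x(3)]])
   then show ?thesis by (auto simp: NN_iff)
  qed
  then show ?thesis
   using A.zero_cochain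
   by (intro A.cochains_eqI[OF res_cochain[OF inj_cochain[OF assms]]]) (auto simp: res_def)
qed

end

section \<open>The exact sequence in cohomology\<close>

locale cochain_map = S: hochschild K S + T: hochschild K T
  for K :: "'k ring" and S :: "('k, 's) module" and T :: "('k, 't) module" +
  fixes h :: "nat => ('s list => 's) => 't list => 't"
  assumes h_linear: "h n \<in> linear_maps K (cochain_module K S n) (cochain_module K T n)"
   and d_h: "f \<in> cochains K S n ==> hochschild_d T n (h n f) = h (Suc n) (hochschild_d S n f)"
begin

lemma h_cochain: "f \<in> cochains K S n ==> h n f \<in> cochains K T n"
  using linear_mapsD(1)[OF h_linear] S.cochain_simps(1) T.cochain_simps(1) by metis

lemma h_hom: "abelian_group_hom (cochain_module K S n) (cochain_module K T n) (h n)"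
  by (rule linear_maps_hom[OF h_linear]) unfold_locales

lemma h_zero: "h n \<zero>\<^bsub>cochain_module K S n\<^esub> = \<zero>\<^bsub>cochain_module K T n\<^esub>"
  by (rule abelian_group_hom.hom_zero[OF h_hom])

lemma h_cocycle: "f \<in> S.cocycles n ==> h n f \<in> T.cocycles n"
  unfolding S.cocycles_def T.cocycles_def using h_cochain d_h h_zero
  by (auto simp del: S.cochain_simps T.cochain_simps)

lemma h_coboundary: "h n ` coboundaries K S n \<subseteq> coboundaries K T n"
proof (cases n)
  case 0
  then show ?thesis using h_zero[of 0] by (simp add: coboundaries_def)
next
  case (Suc p)
  then show ?thesis using h_cochain d_h[symmetric] by (auto simp: coboundaries_def)
qed

lemma h_cocycle_linear: "h n \<in> linear_maps K (cocycle_module K S n) (cocycle_module K T n)"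
  using h_cocycle linear_mapsD(2,3)[OF h_linear] S.cocycles_cochains
  by (intro linear_mapsI) (simp_all del: S.cochain_simps(2-4) T.cochain_simps(2-4))

definition induced :: "nat => ('s list => 's) set => ('t list => 't) set" where
  "induced n = coset_map (h n) (cocycle_module K T n) (coboundaries K T n)"

lemma induced_cl: "f \<in> S.cocycles n ==> induced n (S.Q.cl n f) = T.Q.cl n (h n f)"
  unfolding induced_def
  by (intro coset_map_cl[OF S.Q.module_quotient_axioms T.Q.module_quotient_axioms h_cocycle_linear h_coboundary]) simp

lemma induced_linear: "induced n \<in> linear_maps K (HH K S n) (HH K T n)"
  unfolding induced_def HH_def
  by (intro coset_map_linear[OF S.Q.module_quotient_axioms T.Q.module_quotient_axioms h_cocycle_linear h_coboundary])

end

context hochschild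
begin

lemma cl_coboundary:
  assumes "f \<in> cocycles n" "b \<in> bd n"
  shows "Q.cl n (f \<oplus>\<^bsub>C n\<^esub> b) = Q.cl n f"
proof -
  have b: "b \<in> cocycles n" using assms(2) coboundaries_cocycles by blast
  have z: "Q.cl n b = Q.cl n \<zero>\<^bsub>Z n\<^esub>"
   using Q.cl_eq_zero_iff[of b n] b assms(2) Q.cl_zero by simp
  have "Q.cl n (f \<oplus>\<^bsub>Z n\<^esub> b) = Q.cl n (f \<oplus>\<^bsub>Z n\<^esub> \<zero>\<^bsub>Z n\<^esub>)"
   using Q.cl_add[of f n b] Q.cl_add[of f n "\<zero>\<^bsub>Z n\<^esub>"] assms(1) b z Z.zero_closed[of n]
   by (simp del: cochain_simps)
  also have "f \<oplus>\<^bsub>Z n\<^esub> \<zero>\<^bsub>Z n\<^esub> = f"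
   using Z.M.r_zero[of f n] assms(1) by simp
  finally show ?thesis by (simp only: cocycle_simps)
qed

lemma cl_eqD:
  assumes "f \<in> cocycles n" "g \<in> cocycles n" "Q.cl n f = Q.cl n g"
  obtains b where "b \<in> bd n" "f = g \<oplus>\<^bsub>C n\<^esub> b"
proof
  let ?Z = "Z n"
  show "f \<ominus>\<^bsub>?Z\<^esub> g \<in> bd n"
   using Q.cl_eq_iff[of f n g] assms by simp
  have fg: "f \<in> carrier ?Z" "g \<in> carrier ?Z" using assms by simp_all
  have "g \<oplus>\<^bsub>?Z\<^esub> (f \<ominus>\<^bsub>?Z\<^esub> g) = f"
   using fg by (simp only: Z.M.minus_eq) (simp only: Z.M.a_comm[of f] Z.M.a_inv_closed Z.M.r_neg2)
  then show "f = g \<oplus>\<^bsub>C n\<^esub> (f \<ominus>\<^bsub>?Z\<^esub> g)" by simp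
qed

lemma unit_cocycle: "(\<lambda>xs\<in>tup 0. \<one>) \<in> cocycles 0"
proof (rule cocyclesI)
  show "(\<lambda>xs\<in>tup 0. \<one>) \<in> Ch 0" by (intro restrict_cochains) simp
  show "\<delta> 0 (\<lambda>xs\<in>tup 0. \<one>) xs = \<zero>" if "xs \<in> tup (Suc 0)" for xs
   using that by (auto simp: hochschild_d_def in_tuples_Suc alt_sign_def M.r_neg)
qed

end

context endo_projective
begin

sublocale R: cochain_map K T A res
  by unfold_locales (use res_linear d_res in auto)

sublocale S: cochain_map K A T sec
  by unfold_locales (use sec_linear d_sec in auto)

lemma R_induced_S: 
  assumes "z \<in> carrier (HH K A n)"
  shows "R.induced n (S.induced n z) = z" "S.induced n z \<in> carrier (HH K T n)"
proof -
  obtain g where g: "g \<in> A.cocycles n" "z = A.Q.cl n g" using assms by (auto simp: A.carrier_HH)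
  show "R.induced n (S.induced n z) = z"
   using R.induced_cl[OF S.h_cocycle[OF g(1)]] S.induced_cl[OF g(1)] res_sec[OF A.cocycles_cochains[OF g(1)]]
   by (simp add: g(2))
  show "S.induced n z \<in> carrier (HH K T n)" using linear_mapsD(1)[OF S.induced_linear assms] .
qed

lemma induced_algebra_morphism: "HH_algebra_morphism K T A R.induced"
  unfolding HH_algebra_morphism_def
proof (intro conjI allI ballI)
  show "R.induced n \<in> linear_maps K (HH K T n) (HH K A n)" for n by (rule R.induced_linear)
  have "res 0 (\<lambda>xs\<in>tup 0. \<one>) = (\<lambda>as\<in>tuples A 0. \<one>\<^bsub>A\<^esub>)"
   using map_diag[of _ 0] by (auto simp: res_def fun_eq_iff T_one)
  then show "R.induced 0 (HH_one K T) = HH_one K A"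
   using R.induced_cl[OF unit_cocycle] by (simp add: HH_one_def Q.cl_def A.Q.cl_def)
  fix p q x y assume "x \<in> carrier (HH K T p)" "y \<in> carrier (HH K T q)"
  then obtain f g where f: "f \<in> cocycles p" "x = Q.cl p f" and g: "g \<in> cocycles q" "y = Q.cl q g"
   by (auto simp: carrier_HH)
  show "R.induced (p + q) (HH_cup K T p q x y) = HH_cup K A p q (R.induced p x) (R.induced q y)"
   unfolding f(2) g(2) HH_cup_cl[OF f(1) g(1)] R.induced_cl[OF f(1)] R.induced_cl[OF g(1)]
    R.induced_cl[OF cup_cocycles[OF f(1) g(1)]] A.HH_cup_cl[OF R.h_cocycle[OF f(1)] R.h_cocycle[OF g(1)]]
    res_cup[OF cocycles_cochains[OF f(1)] cocycles_cochains[OF g(1)]] ..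
qed

text \<open>In degree 0 the source is the zero module. In positive degree each class is represented
  by a choice, and \<open>incl_eq\<close> allows any other representatives.\<close>

definition incl :: "nat => (nat => (('m => 'm) list => 'm => 'm) set) =>
   ((('a, 'm) matrix) list => ('a, 'm) matrix) set" where
  "incl n X = (case n of 0 => \<zero>\<^bsub>HH K T 0\<^esub> | Suc p => Q.cl (Suc p) (inj p (\<lambda>t. SOME g. g \<in> X t)))"

definition XX :: "nat => ('k, nat => (('m => 'm) list => 'm => 'm) set) module" where
  "XX n = module_power (m\<^sup>2 - 1) (degree_shift (HH K B) n)"

text \<open>The only element of \<open>zero_module\<close> is \<open>undefined\<close>, so in degree
  0 the power consists of one constant family.\<close>

lemma XX_simps:
  "carrier (XX (Suc p)) = {..<m\<^sup>2 - 1} \<rightarrow>\<^sub>E carrier (HH K B p)"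
  "carrier (XX 0) = {\<lambda>t\<in>{..<m\<^sup>2 - 1}. undefined}"
  "t < m\<^sup>2 - 1 ==> (X \<oplus>\<^bsub>XX (Suc p)\<^esub> Y) t = X t \<oplus>\<^bsub>HH K B p\<^esub> Y t"
  "t < m\<^sup>2 - 1 ==> (k \<odot>\<^bsub>XX (Suc p)\<^esub> X) t = k \<odot>\<^bsub>HH K B p\<^esub> X t"
  "X \<oplus>\<^bsub>XX 0\<^esub> Y = (\<lambda>t\<in>{..<m\<^sup>2 - 1}. undefined)"
  "k \<odot>\<^bsub>XX 0\<^esub> X = (\<lambda>t\<in>{..<m\<^sup>2 - 1}. undefined)"
  by (auto simp: XX_def module_power_def degree_shift_def zero_module_def PiE_eq_singleton
    intro!: arg_cong2[where f = PiE] simp flip: PiE_singleton)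

definition representatives :: "nat => (nat => (('m => 'm) list => 'm => 'm) set) => (nat => ('m => 'm) list => 'm => 'm) => bool" where
  "representatives p X g \<longleftrightarrow> (\<forall>t<m\<^sup>2 - 1. g t \<in> B.cocycles p \<and> B.Q.cl p (g t) = X t)"

lemma representatives_families: "representatives p X g ==> g \<in> families p"
  by (simp add: representatives_def families_def B.cocycles_cochains)

lemma representatives_carrier:
  "representatives p X g ==> X \<in> extensional {..<m\<^sup>2 - 1} ==> X \<in> carrier (XX (Suc p))"
  unfolding XX_simps(1) B.carrier_HH PiE_iff representatives_def by (metis image_eqI lessThan_iff)

lemma representatives_choice: "X \<in> carrier (XX (Suc p)) ==> representatives p X (\<lambda>t. SOME g. g \<in> X t)"
  unfolding representatives_def
proof (intro allI impI)
  fix t assume "X \<in> carrier (XX (Suc p))" "t < m\<^sup>2 - 1"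
  then have "X t \<in> carrier (quotient_module (cocycle_module K B p) (coboundaries K B p))"
   by (auto simp: XX_simps HH_def)
  from B.Q.quotient_rep[OF this] show "(SOME g. g \<in> X t) \<in> B.cocycles p \<and> B.Q.cl p (SOME g. g \<in> X t) = X t"
   by simp
qed

lemma representatives_differ:
  assumes g: "representatives p X g" and g': "representatives p X g'"
  obtains b where "b \<in> families p" "\<And>t. t < m\<^sup>2 - 1 ==> b t \<in> coboundaries K B p"
   "\<And>t. t < m\<^sup>2 - 1 ==> g t = g' t \<oplus>\<^bsub>cochain_module K B p\<^esub> b t"
proof -
  have "\<exists>b. t < m\<^sup>2 - 1 \<longrightarrow> b \<in> coboundaries K B p \<and> g t = g' t \<oplus>\<^bsub>cochain_module K B p\<^esub> b" for t
   using g g' B.cl_eqD[of "g t" p "g' t"] unfolding representatives_def by metis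
  then obtain b where b: "\<And>t. t < m\<^sup>2 - 1 ==> b t \<in> coboundaries K B p \<and> g t = g' t \<oplus>\<^bsub>cochain_module K B p\<^esub> b t"
   by metis
  then have "b \<in> families p"
   using B.coboundaries_cocycles[of p] B.cocycles_cochains by (auto simp: families_def)
  then show ?thesis using b that by blast
qed

lemma inj_representatives: "representatives p X g ==> inj p g \<in> cocycles (Suc p)"
  by (rule inj_cocycle) (simp add: representatives_def)

text \<open>Two choices of representatives differ by a family of coboundaries, which
  \<open>inj\<close> sends to a coboundary.\<close>

lemma incl_eq:
  assumes X: "X \<in> carrier (XX (Suc p))" and g: "representatives p X g"
  shows "incl (Suc p) X = Q.cl (Suc p) (inj p g)"
proof -
  let ?g = "\<lambda>t. SOME g. g \<in> X t"
  note r = representatives_choice[OF X]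
  obtain b where b: "b \<in> families p" "\<And>t. t < m\<^sup>2 - 1 ==> b t \<in> coboundaries K B p"
   "\<And>t. t < m\<^sup>2 - 1 ==> ?g t = g t \<oplus>\<^bsub>cochain_module K B p\<^esub> b t"
   using representatives_differ[OF r g] by blast
  have gb: "(\<lambda>t. g t \<oplus>\<^bsub>cochain_module K B p\<^esub> b t) \<in> families p"
   by (rule families_add[OF representatives_families[OF g] b(1)])
  have "inj p ?g = inj p (\<lambda>t. g t \<oplus>\<^bsub>cochain_module K B p\<^esub> b t)"
   using b(3) by (intro cochains_eqI[OF inj_cochain inj_cochain] inj_cong[OF representatives_families[OF r]])
    (use representatives_families[OF r] gb in auto)
  also have "\<dots> = inj p g \<oplus>\<^bsub>C (Suc p)\<^esub> inj p b"
   by (rule inj_add[OF representatives_families[OF g] b(1)])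
  finally show ?thesis
   using cl_coboundary[OF inj_representatives[OF g] inj_coboundary[OF b(1,2)]] by (simp add: incl_def)
qed

lemma incl_linear: "incl n \<in> linear_maps K (XX n) (HH K T n)"
proof (cases n)
  case 0
  have z: "\<zero>\<^bsub>Z 0\<^esub> \<in> cocycles 0" using Z.zero_closed[of 0] by simp
  have e: "\<zero>\<^bsub>HH K T 0\<^esub> = Q.cl 0 \<zero>\<^bsub>Z 0\<^esub>" by (simp only: HH_def Q.cl_zero)
  show ?thesis
   unfolding 0
  proof (rule linear_mapsI)
   show "incl 0 X \<in> carrier (HH K T 0)" for X using z by (simp only: incl_def e carrier_HH nat.case) blast
   show "incl 0 (X \<oplus>\<^bsub>XX 0\<^esub> Y) = incl 0 X \<oplus>\<^bsub>HH K T 0\<^esub> incl 0 Y" for X Y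
    using Q.cl_add[of "\<zero>\<^bsub>Z 0\<^esub>" 0 "\<zero>\<^bsub>Z 0\<^esub>"] Z.zero_closed[of 0] Z.M.r_zero[OF Z.zero_closed, of 0]
    unfolding incl_def nat.case e unfolding HH_def by (simp del: cochain_simps cocycle_simps)
   show "incl 0 (k \<odot>\<^bsub>XX 0\<^esub> X) = k \<odot>\<^bsub>HH K T 0\<^esub> incl 0 X" if "k \<in> carrier K" for k X
    using Q.cl_smult[of k "\<zero>\<^bsub>Z 0\<^esub>" 0] Z.zero_closed[of 0] Z.smult_r_null[OF that, of 0] that
    unfolding incl_def nat.case e unfolding HH_def by (simp del: cochain_simps cocycle_simps)
  qed
next
  case (Suc p)
  show ?thesis
   unfolding Suc
  proof (rule linear_mapsI)
   fix X assume X: "X \<in> carrier (XX (Suc p))"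
   let ?g = "\<lambda>X t. SOME g. g \<in> X t"
   note g = representatives_choice[OF X]
   note Ig = inj_representatives[OF g]
   show "incl (Suc p) X \<in> carrier (HH K T (Suc p))" using Ig by (simp add: incl_def carrier_HH)
   show "incl (Suc p) (X \<oplus>\<^bsub>XX (Suc p)\<^esub> Y) = incl (Suc p) X \<oplus>\<^bsub>HH K T (Suc p)\<^esub> incl (Suc p) Y"
    if Y: "Y \<in> carrier (XX (Suc p))" for Y
   proof -
    note h = representatives_choice[OF Y]
    have s: "representatives p (X \<oplus>\<^bsub>XX (Suc p)\<^esub> Y) (\<lambda>t. ?g X t \<oplus>\<^bsub>cochain_module K B p\<^esub> ?g Y t)"
     unfolding representatives_def
    proof (intro allI impI)
     fix t assume t: "t < m\<^sup>2 - 1"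
     note gt = g[unfolded representatives_def, rule_format, OF t] note ht = h[unfolded representatives_def, rule_format, OF t]
     show "?g X t \<oplus>\<^bsub>cochain_module K B p\<^esub> ?g Y t \<in> B.cocycles p \<and>
       B.Q.cl p (?g X t \<oplus>\<^bsub>cochain_module K B p\<^esub> ?g Y t) = (X \<oplus>\<^bsub>XX (Suc p)\<^esub> Y) t"
      using B.Q.cl_add[of "?g X t" p "?g Y t"] B.Z.M.a_closed[of "?g X t" p "?g Y t"] gt ht t
      by (simp add: XX_simps HH_def del: B.cochain_simps)
    qed
    have XY: "X \<oplus>\<^bsub>XX (Suc p)\<^esub> Y \<in> carrier (XX (Suc p))"
     using s by (rule representatives_carrier) (simp add: XX_def module_power_def)
    show ?thesis
     unfolding incl_eq[OF XY s] incl_eq[OF X g] incl_eq[OF Y h]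
      inj_add[OF representatives_families[OF g] representatives_families[OF h]] HH_def
     using Q.cl_add[of "inj p (?g X)" "Suc p" "inj p (?g Y)"] Ig inj_representatives[OF h]
     by (simp del: cochain_simps)
   qed
   show "incl (Suc p) (k \<odot>\<^bsub>XX (Suc p)\<^esub> X) = k \<odot>\<^bsub>HH K T (Suc p)\<^esub> incl (Suc p) X" if k: "k \<in> carrier K" for k
   proof -
    have s: "representatives p (k \<odot>\<^bsub>XX (Suc p)\<^esub> X) (\<lambda>t. k \<odot>\<^bsub>cochain_module K B p\<^esub> ?g X t)"
     unfolding representatives_def
    proof (intro allI impI)
     fix t assume t: "t < m\<^sup>2 - 1"
     note gt = g[unfolded representatives_def, rule_format, OF t]
     show "k \<odot>\<^bsub>cochain_module K B p\<^esub> ?g X t \<in> B.cocycles p \<and>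
       B.Q.cl p (k \<odot>\<^bsub>cochain_module K B p\<^esub> ?g X t) = (k \<odot>\<^bsub>XX (Suc p)\<^esub> X) t"
      using B.Q.cl_smult[OF k, of "?g X t" p] B.Z.smult_closed[OF k, of "?g X t" p] gt t
      by (simp add: XX_simps HH_def del: B.cochain_simps)
    qed
    have kX: "k \<odot>\<^bsub>XX (Suc p)\<^esub> X \<in> carrier (XX (Suc p))"
     using s by (rule representatives_carrier) (simp add: XX_def module_power_def)
    show ?thesis
     unfolding incl_eq[OF kX s] incl_eq[OF X g] inj_smult[OF k representatives_families[OF g]] HH_def
     using Q.cl_smult[OF k, of "inj p (?g X)" "Suc p"] Ig by (simp del: cochain_simps)
   qed
  qed
qed

lemma incl_inj: "inj_on (incl n) (carrier (XX n))"
proof (cases n)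
  case 0
  then show ?thesis by (simp add: XX_simps)
next
  case (Suc p)
  show ?thesis
   unfolding Suc
  proof (rule inj_onI)
   fix X Y assume X: "X \<in> carrier (XX (Suc p))" and Y: "Y \<in> carrier (XX (Suc p))" and eq: "incl (Suc p) X = incl (Suc p) Y"
   let ?C = "cochain_module K B p" and ?D = "C (Suc p)"
   define g where "g = (\<lambda>t. SOME g. g \<in> X t)"
   define h where "h = (\<lambda>t. SOME g. g \<in> Y t)"
   have g: "representatives p X g" and h: "representatives p Y h"
    using representatives_choice X Y by (simp_all add: g_def h_def)
   \<comment> \<open>The difference of the families is formed with the scalar -1, because
     \<open>inj\<close> is known to respect sums and scalar multiples.\<close>
   define d where "d = (\<lambda>t. g t \<oplus>\<^bsub>?C\<^esub> (\<ominus>\<^bsub>K\<^esub> \<one>\<^bsub>K\<^esub>) \<odot>\<^bsub>?C\<^esub> h t)"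
   have kk: "\<ominus>\<^bsub>K\<^esub> \<one>\<^bsub>K\<^esub> \<in> carrier K" by simp
   note gf = representatives_families[OF g] and hf = representatives_families[OF h]
   have d: "d \<in> families p" unfolding d_def by (intro families_add families_smult gf hf kk)
   have minus: "f \<oplus>\<^bsub>C (Suc p)\<^esub> (\<ominus>\<^bsub>K\<^esub> \<one>\<^bsub>K\<^esub>) \<odot>\<^bsub>?D\<^esub> f' = f \<ominus>\<^bsub>Z (Suc p)\<^esub> f'"
    if "f \<in> cocycles (Suc p)" "f' \<in> cocycles (Suc p)" for f f'
    using Z.smult_l_minus[of "\<one>\<^bsub>K\<^esub>" f' "Suc p"] Z.smult_one[of f' "Suc p"] that by (simp del: cochain_simps add: Z.M.minus_eq)
   have "Q.cl (Suc p) (inj p g) = Q.cl (Suc p) (inj p h)" using eq incl_eq[OF X g] incl_eq[OF Y h] by simp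
   then have "inj p g \<ominus>\<^bsub>Z (Suc p)\<^esub> inj p h \<in> bd (Suc p)"
    using Q.cl_eq_iff[of "inj p g" "Suc p" "inj p h"] inj_representatives[OF g] inj_representatives[OF h] by simp
   then have "inj p d \<in> bd (Suc p)"
    unfolding d_def inj_add[OF gf families_smult[OF kk hf]] inj_smult[OF kk hf]
     minus[OF inj_representatives[OF g] inj_representatives[OF h]] .
   from inj_coboundaryD[OF d this] have db: "d t \<in> coboundaries K B p" if "t < m\<^sup>2 - 1" for t using that .
   show "X = Y"
   proof (rule PiE_ext[OF X[unfolded XX_simps(1)] Y[unfolded XX_simps(1)]])
    fix t assume "t \<in> {..<m\<^sup>2 - 1}"
    then have t: "t < m\<^sup>2 - 1" by simp
    note gt = g[unfolded representatives_def, rule_format, OF t] note ht = h[unfolded representatives_def, rule_format, OF t]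
    have "g t \<ominus>\<^bsub>cocycle_module K B p\<^esub> h t = d t"
     using B.Z.smult_l_minus[of "\<one>\<^bsub>K\<^esub>" "h t" p] B.Z.smult_one[of "h t" p] gt ht
     by (simp del: B.cochain_simps add: B.Z.M.minus_eq d_def)
    then show "X t = Y t"
     using B.Q.cl_eq_iff[of "g t" p "h t"] gt ht db[OF t] by simp
   qed
  qed
qed

text \<open>If the restriction of \<open>F\<close> to \<open>A\<close> is a coboundary, so is
  \<open>Qc F\<close>, the section applied to that restriction. The homotopy formula then reduces
  \<open>F\<close> modulo coboundaries to its residual part, which is in the image.\<close>

lemma incl_kernel: "incl n ` carrier (XX n) = a_kernel (HH K T n) (HH K A n) (R.induced n)"
proof (rule Set.set_eqI)
  fix y
  have ker: "y \<in> a_kernel (HH K T n) (HH K A n) (R.induced n) \<longleftrightarrow>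
    y \<in> carrier (HH K T n) \<and> R.induced n y = \<zero>\<^bsub>HH K A n\<^esub>"
   by (auto simp: a_kernel_def kernel_def)
  have cob: "f \<in> coboundaries K A n" if "f \<in> A.cocycles n" "A.Q.cl n f = \<zero>\<^bsub>HH K A n\<^esub>" for f
   using A.Q.cl_eq_zero_iff[of f n] that by (simp add: HH_def)
  show "y \<in> incl n ` carrier (XX n) \<longleftrightarrow> y \<in> a_kernel (HH K T n) (HH K A n) (R.induced n)"
  proof (cases n)
   case 0
   have e: "\<zero>\<^bsub>HH K T 0\<^esub> = Q.cl 0 \<zero>\<^bsub>Z 0\<^esub>" by (simp only: HH_def Q.cl_zero)
   have z: "\<zero>\<^bsub>Z 0\<^esub> \<in> cocycles 0" using Z.zero_closed[of 0] by simp
   \<comment> \<open>In degree 0 a cocycle equals its \<open>Qc\<close>, and the only coboundary is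
     zero; so a cocycle with trivial restriction vanishes.\<close>
   have "y = \<zero>\<^bsub>HH K T 0\<^esub>" if y: "y \<in> carrier (HH K T 0)" "R.induced 0 y = \<zero>\<^bsub>HH K A 0\<^esub>"
   proof -
    obtain F where F: "F \<in> cocycles 0" "y = Q.cl 0 F" using y by (auto simp: carrier_HH)
    note Fc = cocycles_cochains[OF F(1)]
    have "res 0 F \<in> coboundaries K A 0"
     using y(2) cob[OF R.h_cocycle[of F n]] F 0 R.induced_cl[OF F(1)] by simp
    then have "res 0 F = \<zero>\<^bsub>cochain_module K A 0\<^esub>" by (simp add: coboundaries_def)
    then have "Qc 0 F = \<zero>\<^bsub>C 0\<^esub>"
     using sec_res[OF Fc] S.h_zero[of 0] by simp
    moreover have "F = Qc 0 F"
     using cocycle_homotopy_0[OF F(1)] by (intro cochains_eqI[OF Fc Qc_cochain[OF cochains_multilinear[OF Fc]]]) simp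
    ultimately show ?thesis using F(2) e by simp
   qed
   moreover have "R.induced 0 \<zero>\<^bsub>HH K T 0\<^esub> = \<zero>\<^bsub>HH K A 0\<^esub>"
    unfolding e using R.induced_cl[OF z] R.h_zero[of 0] A.Q.cl_zero[of 0] by (simp add: HH_def)
   moreover have "\<zero>\<^bsub>HH K T 0\<^esub> \<in> carrier (HH K T 0)" using z by (simp only: e carrier_HH) blast
   ultimately show ?thesis unfolding ker unfolding 0 by (auto simp: XX_simps incl_def)
  next
   case (Suc p)
   have "R.induced (Suc p) (incl (Suc p) X) = \<zero>\<^bsub>HH K A (Suc p)\<^esub>" if X: "X \<in> carrier (XX (Suc p))" for X
   proof -
    note g = representatives_choice[OF X]
    show ?thesis
     unfolding incl_eq[OF X g] R.induced_cl[OF inj_representatives[OF g]] res_inj[OF representatives_families[OF g]]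
     using A.Q.cl_zero[of "Suc p"] by (simp add: HH_def)
   qed
   moreover have "y \<in> incl (Suc p) ` carrier (XX (Suc p))"
    if y: "y \<in> carrier (HH K T (Suc p))" "R.induced (Suc p) y = \<zero>\<^bsub>HH K A (Suc p)\<^esub>"
   proof -
    let ?D = "C (Suc p)"
    obtain F where F: "F \<in> cocycles (Suc p)" "y = Q.cl (Suc p) F" using y by (auto simp: carrier_HH)
    note Fc = cocycles_cochains[OF F(1)]
    have "res (Suc p) F \<in> coboundaries K A (Suc p)"
     using y(2) cob[OF R.h_cocycle[of F n]] F Suc R.induced_cl[OF F(1)] by simp
    then have Qb: "Qc (Suc p) F \<in> bd (Suc p)"
     using S.h_coboundary[of "Suc p"] sec_res[OF Fc] by force
    obtain k where k: "k \<in> Ch p"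
     "\<And>xs. xs \<in> tup (Suc p) ==> F xs = Qc (Suc p) F xs \<oplus> Dc p F xs \<oplus> \<delta> p k xs"
     using cocycle_homotopy[OF F(1)] by blast
    have kb: "\<delta> p k \<in> bd (Suc p)" using k(1) by (simp add: coboundaries_def)
    have \<rho>c: "inj p (rho p F) \<in> cocycles (Suc p)" by (intro inj_cocycle rho_cocycle F(1))
    note Qcc = Qc_cochain[OF cochains_multilinear[OF Fc]]
    have s: "inj p (rho p F) \<oplus>\<^bsub>?D\<^esub> Qc (Suc p) F \<in> cocycles (Suc p)"
     using Z.M.a_closed[of "inj p (rho p F)" "Suc p" "Qc (Suc p) F"] \<rho>c Qb coboundaries_cocycles[of "Suc p"]
     by (auto simp del: cochain_simps)
    have "F = inj p (rho p F) \<oplus>\<^bsub>?D\<^esub> Qc (Suc p) F \<oplus>\<^bsub>?D\<^esub> \<delta> p k"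
    proof (rule cochains_eqI[OF Fc])
     show "inj p (rho p F) \<oplus>\<^bsub>?D\<^esub> Qc (Suc p) F \<oplus>\<^bsub>?D\<^esub> \<delta> p k \<in> Ch (Suc p)"
      using add_cochain[OF cocycles_cochains[OF s] d_cochains[OF k(1)]] by simp
     fix xs assume xs: "xs \<in> tup (Suc p)"
     show "F xs = (inj p (rho p F) \<oplus>\<^bsub>?D\<^esub> Qc (Suc p) F \<oplus>\<^bsub>?D\<^esub> \<delta> p k) xs"
      unfolding k(2)[OF xs] inj_rho[OF Fc] using xs cochains_closed[OF Qcc xs]
       cochains_closed[OF Dc_cochain[OF cochains_multilinear[OF Fc]] xs]
      by (simp add: M.a_comm del: T_fields)
    qed
    then have y': "y = Q.cl (Suc p) (inj p (rho p F))"
     unfolding F(2) using cl_coboundary[OF s kb] cl_coboundary[OF \<rho>c Qb] by metis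
    let ?X = "\<lambda>t\<in>{..<m\<^sup>2 - 1}. B.Q.cl p (rho p F t)"
    have X: "?X \<in> carrier (XX (Suc p))"
     unfolding XX_simps(1) B.carrier_HH using rho_cocycle[OF F(1)] by auto
    have "representatives p ?X (rho p F)" using rho_cocycle[OF F(1)] by (simp add: representatives_def)
    then have "y = incl (Suc p) ?X" using incl_eq[OF X] y' by simp
    then show ?thesis using X by blast
   qed
   moreover have "incl (Suc p) X \<in> carrier (HH K T (Suc p))" if "X \<in> carrier (XX (Suc p))" for X
    using linear_mapsD(1)[OF incl_linear that] .
   ultimately show ?thesis unfolding ker unfolding Suc by blast
  qed
qed

theorem split_exact: "graded_split_short_exact K XX (HH K T) (HH K A) incl R.induced"
  unfolding graded_split_short_exact_def
proof (intro allI conjI)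
  fix n
  show "incl n \<in> linear_maps K (XX n) (HH K T n)" by (rule incl_linear)
  show "R.induced n \<in> linear_maps K (HH K T n) (HH K A n)" by (rule R.induced_linear)
  show "inj_on (incl n) (carrier (XX n))" by (rule incl_inj)
  show "incl n ` carrier (XX n) = a_kernel (HH K T n) (HH K A n) (R.induced n)" by (rule incl_kernel)
  show "R.induced n ` carrier (HH K T n) = carrier (HH K A n)"
   using linear_mapsD(1)[OF R.induced_linear] R_induced_S by (metis (no_types, lifting) image_eqI image_subsetI subsetI subset_antisym)
  show "\<exists>s\<in>linear_maps K (HH K A n) (HH K T n). \<forall>z\<in>carrier (HH K A n). R.induced n (s z) = z"
   using S.induced_linear R_induced_S by blast
qed

end

theorem mainTheorem7:
  fixes K :: "'k ring"
    and A :: "('k, 'a) module"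
    and M :: "('a, 'm) module"
    and m :: nat
  defines "B \<equiv> opposite_algebra (endomorphism_algebra A M)"
  defines "T \<equiv> triangular_algebra A (bimodule_power m (endo_bimodule M)) B"
  assumes "cring K"
    and "assoc_algebra K A"
    and "projective_module K A"
    and "projective_module A M"
    and "finitely_generated_module A M \<or> semisimple_cring K"
    and "m \<ge> 1"
  shows "\<exists>i r.
    graded_split_short_exact K
      (\<lambda>n. module_power (m\<^sup>2 - 1) (degree_shift (HH K B) n)) (HH K T) (HH K A) i r \<and>
    HH_algebra_morphism K T A r"
proof -
  \<comment> \<open>The splitting of \<open>M\<close> off a free module provides the dual basis:
    coordinates through \<open>u\<close>, basis elements as images of unit vectors under
    \<open>v\<close>.\<close>
  obtain I :: "'m set" and u v where uv: "u \<in> linear_maps A M (free_module A I)"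
    "v \<in> linear_maps A (free_module A I) M" "\<And>x. x \<in> carrier M \<Longrightarrow> v (u x) = x"
    using assms(6) by (auto simp: projective_module_def)
  interpret E: endo_projective K A M m B "bimodule_power m (endo_bimodule M)" T I u v
  proof (intro endo_projective.intro endo_triangular.intro endo_triangular_axioms.intro
      endo_projective_axioms.intro hochschild.intro)
    show "left_module A M" using assms(6) by (simp add: projective_module_def)
  qed (use assms(3-8) uv in \<open>auto simp: assms(1,2)\<close>)
  show ?thesis using E.split_exact E.induced_algebra_morphism unfolding E.XX_def[abs_def] by auto
qed

end
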